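(* Let $\Omega\subset\mathbb{R}^N$ be open and bounded, and let $A:\Omega\times\mathbb{R}\times\mathbb{R}^N\to\mathbb{R}^N$, $(x,u,\xi)\mapsto A(x,u,\xi)$, be a (time-independent) Caratheodory vector field for which there are constants $\Lambda,C>0$ and nonnegative $\tilde b,\tilde c\in L^1(\Omega)$ such that for a.e. $x\in\Omega$, all $u,u_1,u_2\in\mathbb{R}$, all $\xi,\eta\in\mathbb{R}^N$ and all $i\in\{1,\dots,N\}$: $$|A_i(x,u,\xi)|\leq\Lambda\Big(\sum_{k=1}^N|\xi_k|^{p_k}+\tilde b(x)\Big)^{\frac{p_i-1}{p_i}},$$ $$|A_i(x,u_1,\xi)-A_i(x,u_2,\xi)|\leq C|u_1-u_2|\Big(\tilde c(x)+\sum_{k=1}^N|\xi_k|^{p_k}\Big)^{\frac{p_i-1}{p_i}},$$ $$\big(A(x,u,\xi)-A(x,u,\eta)\big)\cdot(\xi-\eta)\geq0.$$ Suppose also that $A(x,0,0)=0$. Suppose that $u$ solves the Cauchy-Dirichlet problem $$\partial_t(|u|^{\alpha-1}u)-\nabla\cdot A(x,u,\nabla u)=f\ \text{ in }\Omega_T,\qquad u(x,0)=u_0(x),\ x\in\Omega,\qquad u=g\ \text{ on }\partial\Omega\times(0,T),$$ where $u_0\in L^{\alpha+1}(\Omega)$, $f\in L^{\frac{\alpha+1}{\alpha}}(\Omega)$ and $g\in L^{\bf p}(0,T;W^{1,{\bf p}}(\Omega))$ are nonnegative. Then $u$ is nonnegative.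
   Context: Parameters: $N\ge1$, $T>0$, $\alpha>0$, ${\bf p}=(p_1,\dots,p_N)$ with all $p_j>1$. $\Omega_T:=\Omega\times(0,T)$; $\nabla,\partial_j$ are weak spatial derivatives; $|u|^{\alpha-1}u:=0$ when $u=0$. The right-hand side $f$ is independent of time. Inequalities between functions hold a.e. Caratheodory: $x\mapsto A(x,u,\xi)$ is measurable for every $(u,\xi)$ and $(u,\xi)\mapsto A(x,u,\xi)$ is continuous for a.e. $x\in\Omega$. Spaces: $W^{1,{\bf p}}(\Omega):=\{v\in W^{1,1}(\Omega): \partial_i v\in L^{p_i}(\Omega),\ i=1,\dots,N\}$. $\overline W^{1,{\bf p}}_{\rm o}(\Omega)$ is the closure of $C^\infty_{\rm o}(\Omega)$ (smooth compactly supported functions) in $W^{1,{\bf p}}(\Omega)$ with respect to the norm $\|u\|_{L^1(\Omega)}+\sum_{j=1}^N\|\partial_j u\|_{L^{p_j}(\Omega)}$. $L^{\bf p}(0,T;W^{1,{\bf p}}(\Omega)):=\{v\in L^1(0,T;W^{1,1}(\Omega)): \partial_i v\in L^{p_i}(\Omega_T)\}$. $L^{\bf p}(0,T;\overline W^{1,{\bf p}}_{\rm o}(\Omega))$ is the space of (equivalence classes of) measurable functions $u:(0,T)\to\overline W^{1,{\bf p}}_{\rm o}(\Omega)$ with $u\in L^1(0,T;L^1(\Omega))$ and $\partial_k u\in L^{p_k}(0,T;L^{p_k}(\Omega))$ for all $k$; its elements are identified with functions on $\Omega_T$. A solution of the Cauchy-Dirichlet problem $\partial_t(|u|^{\alpha-1}u)-\nabla\cdot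 A(x,u,\nabla u)=f$ in $\Omega_T$, $u(x,0)=u_0(x)$ for $x\in\Omega$, $u=g$ on $\partial\Omega\times(0,T)$, is a function $u\in L^{\bf p}(0,T;W^{1,{\bf p}}(\Omega))\cap C([0,T];L^{\alpha+1}(\Omega))$ such that (1) $\iint_{\Omega_T}A(x,u,\nabla u)\cdot\nabla\varphi-|u|^{\alpha-1}u\,\partial_t\varphi\,dx\,dt=\iint_{\Omega_T}f\varphi\,dx\,dt$ for all $\varphi\in C^\infty_{\rm o}(\Omega_T)$; (2) $u(t)\to u_0$ in $L^{\alpha+1}(\Omega)$ as $t\to0$; (3) $u\in g+L^{\bf p}(0,T;\overline W^{1,{\bf p}}_{\rm o}(\Omega))$. *)

theory Defs
  imports "HOL-Analysis.Analysis"
begin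

text \<open>
  Functions on a measurable set \<open>U\<close> are represented by total functions; only their values on \<open>U\<close>,
  up to Lebesgue null sets, matter. The space-time point \<open>(x, t)\<close> has type \<open>(real^'n) \<times> real\<close>.
\<close>

section \<open>Test functions and weak derivatives\<close>

definition dir_deriv :: "'a::euclidean_space \<Rightarrow> ('a \<Rightarrow> real) \<Rightarrow> 'a \<Rightarrow> real" where
  "dir_deriv b \<phi> x = frechet_derivative \<phi> (at x) b"

primrec C_order :: "nat \<Rightarrow> ('a::euclidean_space \<Rightarrow> real) \<Rightarrow> bool" where
  "C_order 0 \<phi> \<longleftrightarrow> continuous_on UNIV \<phi>"
| "C_order (Suc k) \<phi> \<longleftrightarrow>
     (\<forall>x. \<phi> differentiable (at x)) \<and> (\<forall>b\<in>Basis. C_order k (dir_deriv b \<phi>))"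

definition smooth :: "('a::euclidean_space \<Rightarrow> real) \<Rightarrow> bool" where
  "smooth \<phi> \<longleftrightarrow> (\<forall>k. C_order k \<phi>)"

text \<open>\<open>C\<^sub>o\<^sup>\<infinity>(U)\<close>, its elements being extended by zero outside \<open>U\<close>.\<close>

definition test_fun :: "'a::euclidean_space set \<Rightarrow> ('a \<Rightarrow> real) set" where
  "test_fun U = {\<phi>. smooth \<phi> \<and> compact (closure {x. \<phi> x \<noteq> 0}) \<and> closure {x. \<phi> x \<noteq> 0} \<subseteq> U}"

definition locally_integrable :: "'a::euclidean_space set \<Rightarrow> ('a \<Rightarrow> real) \<Rightarrow> bool" where
  "locally_integrable U f \<longleftrightarrow> (\<forall>K. compact K \<and> K \<subseteq> U \<longrightarrow> f absolutely_integrable_on K)"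

definition has_weak_deriv ::
  "'a::euclidean_space set \<Rightarrow> 'a \<Rightarrow> ('a \<Rightarrow> real) \<Rightarrow> ('a \<Rightarrow> real) \<Rightarrow> bool" where
  "has_weak_deriv U b f h \<longleftrightarrow>
     locally_integrable U f \<and> locally_integrable U h \<and>
     (\<forall>\<phi>\<in>test_fun U.
        (\<integral>x. f x * dir_deriv b \<phi> x \<partial>lebesgue_on U) = - (\<integral>x. h x * \<phi> x \<partial>lebesgue_on U))"

text \<open>For open \<open>U\<close> the weak derivative is unique up to null sets; it is unspecified if none exists.\<close>

definition weak_deriv :: "'a::euclidean_space set \<Rightarrow> 'a \<Rightarrow> ('a \<Rightarrow> real) \<Rightarrow> 'a \<Rightarrow> real" where
  "weak_deriv U b f = (SOME h. has_weak_deriv U b f h)"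

section \<open>Lebesgue and anisotropic Sobolev spaces\<close>

definition Lsp :: "real \<Rightarrow> 'a::euclidean_space set \<Rightarrow> ('a \<Rightarrow> real) set" where
  "Lsp q U = {f \<in> borel_measurable (lebesgue_on U). integrable (lebesgue_on U) (\<lambda>x. \<bar>f x\<bar> powr q)}"

definition Lnorm :: "real \<Rightarrow> 'a::euclidean_space set \<Rightarrow> ('a \<Rightarrow> real) \<Rightarrow> real" where
  "Lnorm q U f = (\<integral>x. \<bar>f x\<bar> powr q \<partial>lebesgue_on U) powr (1 / q)"

abbreviation wpartial :: "(real^'n) set \<Rightarrow> 'n \<Rightarrow> (real^'n \<Rightarrow> real) \<Rightarrow> real^'n \<Rightarrow> real" where
  "wpartial \<Omega> i \<equiv> weak_deriv \<Omega> (axis i 1)"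

definition W11 :: "(real^'n) set \<Rightarrow> (real^'n \<Rightarrow> real) set" where
  "W11 \<Omega> = {v \<in> Lsp 1 \<Omega>. \<forall>i. \<exists>h\<in>Lsp 1 \<Omega>. has_weak_deriv \<Omega> (axis i 1) v h}"

definition W11_norm :: "(real^'n) set \<Rightarrow> (real^'n \<Rightarrow> real) \<Rightarrow> real" where
  "W11_norm \<Omega> v = Lnorm 1 \<Omega> v + (\<Sum>i\<in>UNIV. Lnorm 1 \<Omega> (wpartial \<Omega> i v))"

definition W1p :: "('n \<Rightarrow> real) \<Rightarrow> (real^'n) set \<Rightarrow> (real^'n \<Rightarrow> real) set" where
  "W1p p \<Omega> = {v \<in> W11 \<Omega>. \<forall>i. wpartial \<Omega> i v \<in> Lsp (p i) \<Omega>}"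

definition W1p_norm :: "('n \<Rightarrow> real) \<Rightarrow> (real^'n) set \<Rightarrow> (real^'n \<Rightarrow> real) \<Rightarrow> real" where
  "W1p_norm p \<Omega> v = Lnorm 1 \<Omega> v + (\<Sum>j\<in>UNIV. Lnorm (p j) \<Omega> (wpartial \<Omega> j v))"

definition W1p_o :: "('n \<Rightarrow> real) \<Rightarrow> (real^'n) set \<Rightarrow> (real^'n \<Rightarrow> real) set" where
  "W1p_o p \<Omega> = {v \<in> W1p p \<Omega>. \<forall>\<epsilon>>0. \<exists>\<phi>\<in>test_fun \<Omega>. W1p_norm p \<Omega> (\<lambda>x. v x - \<phi> x) < \<epsilon>}"

section \<open>Spaces of functions of time with values in a function space\<close>

text \<open>
  A function space is given by its set \<open>X\<close> of representatives and its seminorm \<open>N\<close>.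
  Measurability of \<open>v : (0,T) \<rightarrow> X\<close> is strong (Bochner) measurability: \<open>v\<close> is a.e. the limit in \<open>X\<close>
  of simple functions. (All spaces \<open>X\<close> used below are separable, so that this agrees
  with Borel measurability.)
\<close>

definition bochner_measurable ::
  "real \<Rightarrow> ('a \<Rightarrow> real) set \<Rightarrow> (('a \<Rightarrow> real) \<Rightarrow> real) \<Rightarrow> (real \<Rightarrow> 'a \<Rightarrow> real) \<Rightarrow> bool" where
  "bochner_measurable T X N v \<longleftrightarrow>
     (AE t in lebesgue_on {0<..<T}. v t \<in> X) \<and>
     (\<exists>s :: nat \<Rightarrow> real \<Rightarrow> 'a \<Rightarrow> real.
        (\<forall>k. simple_function (lebesgue_on {0<..<T}) (s k) \<and> (\<forall>t\<in>{0<..<T}. s k t \<in> X)) \<and>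
        (AE t in lebesgue_on {0<..<T}. (\<lambda>k. N (\<lambda>x. s k t x - v t x)) \<longlonglongrightarrow> 0))"

definition bochner_L ::
  "real \<Rightarrow> real \<Rightarrow> ('a \<Rightarrow> real) set \<Rightarrow> (('a \<Rightarrow> real) \<Rightarrow> real) \<Rightarrow> (real \<Rightarrow> 'a \<Rightarrow> real) set" where
  "bochner_L q T X N = {v. bochner_measurable T X N v \<and>
     integrable (lebesgue_on {0<..<T}) (\<lambda>t. N (v t) powr q)}"

definition cont_in_time ::
  "real \<Rightarrow> ('a \<Rightarrow> real) set \<Rightarrow> (('a \<Rightarrow> real) \<Rightarrow> real) \<Rightarrow> (real \<Rightarrow> 'a \<Rightarrow> real) set" where
  "cont_in_time T X N = {v. \<forall>t\<in>{0..T}. v t \<in> X \<and>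
     ((\<lambda>s. N (\<lambda>x. v s x - v t x)) \<longlongrightarrow> 0) (at t within {0..T})}"

definition slice :: "('a \<times> real \<Rightarrow> real) \<Rightarrow> real \<Rightarrow> 'a \<Rightarrow> real" where
  "slice v t = (\<lambda>x. v (x, t))"

definition cyl :: "(real^'n) set \<Rightarrow> real \<Rightarrow> ((real^'n) \<times> real) set" where
  "cyl \<Omega> T = \<Omega> \<times> {0<..<T}"

text \<open>
  The Bochner-type spaces below are identified with spaces of (jointly measurable) functions on the
  space-time cylinder.
\<close>

definition LpW :: "('n \<Rightarrow> real) \<Rightarrow> (real^'n) set \<Rightarrow> real \<Rightarrow> ((real^'n) \<times> real \<Rightarrow> real) set" where
  "LpW p \<Omega> T = {v \<in> borel_measurable (lebesgue_on (cyl \<Omega> T)).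
     slice v \<in> bochner_L 1 T (W11 \<Omega>) (W11_norm \<Omega>) \<and>
     (\<forall>i. \<exists>h\<in>Lsp (p i) (cyl \<Omega> T). has_weak_deriv (cyl \<Omega> T) (axis i 1, 0) v h)}"

definition LpW_o :: "('n \<Rightarrow> real) \<Rightarrow> (real^'n) set \<Rightarrow> real \<Rightarrow> ((real^'n) \<times> real \<Rightarrow> real) set" where
  "LpW_o p \<Omega> T = {v \<in> borel_measurable (lebesgue_on (cyl \<Omega> T)).
     bochner_measurable T (W1p_o p \<Omega>) (W1p_norm p \<Omega>) (slice v) \<and>
     slice v \<in> bochner_L 1 T (Lsp 1 \<Omega>) (Lnorm 1 \<Omega>) \<and>
     (\<forall>k. (\<lambda>t. wpartial \<Omega> k (slice v t)) \<in> bochner_L (p k) T (Lsp (p k) \<Omega>) (Lnorm (p k) \<Omega>))}"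

definition weak_grad_x ::
  "(real^'n) set \<Rightarrow> real \<Rightarrow> ((real^'n) \<times> real \<Rightarrow> real) \<Rightarrow> (real^'n) \<times> real \<Rightarrow> real^'n" where
  "weak_grad_x \<Omega> T v z = (\<chi> i. weak_deriv (cyl \<Omega> T) (axis i 1, 0) v z)"

definition grad_x :: "((real^'n) \<times> real \<Rightarrow> real) \<Rightarrow> (real^'n) \<times> real \<Rightarrow> real^'n" where
  "grad_x \<phi> z = (\<chi> i. dir_deriv (axis i 1, 0) \<phi> z)"

section \<open>The doubly nonlinear Cauchy-Dirichlet problem\<close>

definition caratheodory ::
  "(real^'n) set \<Rightarrow> (real^'n \<Rightarrow> real \<Rightarrow> real^'n \<Rightarrow> real^'n) \<Rightarrow> bool" where
  "caratheodory \<Omega> A \<longleftrightarrow>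
     (\<forall>u \<xi>. (\<lambda>x. A x u \<xi>) \<in> borel_measurable (lebesgue_on \<Omega>)) \<and>
     (AE x in lebesgue_on \<Omega>. continuous_on UNIV (\<lambda>(u, \<xi>). A x u \<xi>))"

text \<open>\<open>|r|\<^sup>\<alpha>\<^sup>-\<^sup>1 r\<close>, which is \<open>0\<close> for \<open>r = 0\<close> whatever \<open>\<alpha>\<close>.\<close>

definition signed_powr :: "real \<Rightarrow> real \<Rightarrow> real" where
  "signed_powr \<alpha> r = \<bar>r\<bar> powr (\<alpha> - 1) * r"

text \<open>
  Membership in \<open>C([0,T]; L\<^sup>\<alpha>\<^sup>+\<^sup>1(\<Omega>))\<close> is imposed on the slices at all \<open>t \<in> [0,T]\<close>,
  i.e. \<open>u\<close> is the representative that is continuous in time.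
\<close>

definition CD_solution ::
  "('n \<Rightarrow> real) \<Rightarrow> real \<Rightarrow> (real^'n) set \<Rightarrow> real \<Rightarrow> (real^'n \<Rightarrow> real \<Rightarrow> real^'n \<Rightarrow> real^'n) \<Rightarrow>
   (real^'n \<Rightarrow> real) \<Rightarrow> (real^'n \<Rightarrow> real) \<Rightarrow> ((real^'n) \<times> real \<Rightarrow> real) \<Rightarrow>
   ((real^'n) \<times> real \<Rightarrow> real) \<Rightarrow> bool" where
  "CD_solution p \<alpha> \<Omega> T A f u\<^sub>0 g u \<longleftrightarrow>
     u \<in> LpW p \<Omega> T \<and>
     slice u \<in> cont_in_time T (Lsp (\<alpha> + 1) \<Omega>) (Lnorm (\<alpha> + 1) \<Omega>) \<and>
     (\<forall>\<phi>\<in>test_fun (cyl \<Omega> T).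
        (\<integral>z. A (fst z) (u z) (weak_grad_x \<Omega> T u z) \<bullet> grad_x \<phi> z
              - signed_powr \<alpha> (u z) * dir_deriv (0, 1) \<phi> z \<partial>lebesgue_on (cyl \<Omega> T))
        = (\<integral>z. f (fst z) * \<phi> z \<partial>lebesgue_on (cyl \<Omega> T))) \<and>
     ((\<lambda>t. Lnorm (\<alpha> + 1) \<Omega> (\<lambda>x. slice u t x - u\<^sub>0 x)) \<longlongrightarrow> 0) (at_right 0) \<and>
     (\<lambda>z. u z - g z) \<in> LpW_o p \<Omega> T"

end

theory Submission
  imports Defs "HOL-Probability.Probability_Measure" "HOL-Real_Asymp.Real_Asymp"
begin

text \<open>
  The equation is tested at each time with \<open>\<Theta> = H(u(t))\<close>, where \<open>H\<close> is a smooth approximation of the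
  indicator function of \<open>(-\<infinity>, 0)\<close> with the opposite sign. In terms of \<open>w = -|u|\<^sup>\<alpha>\<^sup>-\<^sup>1 u\<close> one has
  \<open>\<Theta> = -\<Phi>'(w)\<close> for the convex function \<open>\<Phi>(w) = w exp(-d/w)\<close>, \<open>w > 0\<close>, extended by \<open>0\<close>, so that convexity
  turns the increments of the time derivative term into increments of \<open>\<integral> \<Phi>(w(t)) dx\<close> and no time derivative
  of \<open>u\<close> is needed. Testing with \<open>\<Theta>\<close> is justified by the test functions \<open>H(\<phi> + g\<^sub>\<epsilon>)\<close>, where
  \<open>\<phi>\<close> approximates \<open>u(t) - g(t)\<close> and \<open>g\<^sub>\<epsilon> \<ge> 0\<close> is a mollification of \<open>g(t)\<close>: since \<open>H\<close> vanishes
  on \<open>[0, \<infinity>)\<close>, their support is contained in that of \<open>\<phi>\<close>.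

  As \<open>A(x, 0, 0) = 0\<close>, monotonicity and the Lipschitz condition bound \<open>A(x, u, \<nabla>u) \<bullet> \<nabla>\<Theta>\<close> from below by
  \<open>-C |u| H'(u) \<Sum>\<^sub>i c(x)\<^bsup>(p\<^sub>i-1)/p\<^sub>i\<^esup> |\<partial>\<^sub>i u|\<close>; here \<open>|u| H'(u)\<close> is bounded and tends to \<open>0\<close> pointwise
  as \<open>d \<rightarrow> 0\<close>, so the integral of the negative part of \<open>|u|\<^sup>\<alpha>\<^sup>-\<^sup>1 u\<close> does not grow from its initial value \<open>0\<close>.
\<close>

section \<open>Calculus of smooth functions\<close>

text \<open>Two demands fix the truncation. The equation admits only C^\<infinity> test functions,
  while the time derivative falls on a power of \<open>u\<close> with an arbitrary exponent \<alpha>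
  > 0; so \<Theta> has to be a monotone function of \<open>w\<close> and yet smooth as a function of
  \<open>u\<close>. Writing y = d (-r)^(-\<alpha>), one has H(r) = -(1 + y) exp(-y) for r < 0, and
  the exponential is flat enough at 0 to absorb the singularity of the power for every \<alpha>.
  Moreover |r| H'(r) = \<alpha> y^2 exp(-y) depends on d only through y. Its bound is therefore
  uniform in d, and the Lipschitz error disappears by dominated convergence, with no Gronwall
  argument.

  The obstacle in time is that \<Theta>, frozen at time t, is paired with the flux at all times in
  (t - h, t]. Averaging over t and the continuity of translations in Lebesgue spaces remove this
  mismatch. Convexity is applied at the later endpoint only; this gives a one-sided bound on
  increments, in the direction that is wanted.\<close>

lemma dir_deriv_eq: "(\<phi> has_derivative D) (at x) \<Longrightarrow> dir_deriv b \<phi> x = D b"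
  unfolding dir_deriv_def using frechet_derivative_at by metis

lemma differentiable_has_dir_deriv:
  "\<phi> differentiable (at x) \<Longrightarrow> (\<phi> has_derivative (\<lambda>h. dir_deriv h \<phi> x)) (at x)"
  unfolding frechet_derivative_works dir_deriv_def by simp

lemma dir_deriv_sum_Basis:
  fixes \<phi> :: "'a::euclidean_space \<Rightarrow> real"
  assumes "\<phi> differentiable (at x)"
  shows "dir_deriv h \<phi> x = (\<Sum>b\<in>Basis. (h \<bullet> b) * dir_deriv b \<phi> x)"
proof -
  have "linear (frechet_derivative \<phi> (at x))"
    using assms by (rule linear_frechet_derivative)
  then have "frechet_derivative \<phi> (at x) (\<Sum>b\<in>Basis. (h \<bullet> b) *\<^sub>R b)
      = (\<Sum>b\<in>Basis. (h \<bullet> b) *\<^sub>R frechet_derivative \<phi> (at x) b)"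
    by (simp add: linear_sum linear_scale)
  then show ?thesis by (simp add: dir_deriv_def euclidean_representation)
qed

lemma C_order_imp_continuous: "C_order k \<phi> \<Longrightarrow> continuous_on UNIV \<phi>"
  by (cases k) (auto simp: continuous_at_imp_continuous_on differentiable_imp_continuous_within)

text \<open>Only the base case has content: \<open>C_order\<close> asks for continuity at the last
  order alone, and at lower orders continuity comes from differentiability.\<close>

lemma C_order_SucD: "C_order (Suc k) \<phi> \<Longrightarrow> C_order k \<phi>"
proof (induction k arbitrary: \<phi>)
  case 0
  then show ?case using C_order_imp_continuous by fastforce
next
  case (Suc k)
  then show ?case by auto
qed

lemma dir_deriv_const [simp]: "dir_deriv b (\<lambda>x. c) = (\<lambda>x. 0)"
  using dir_deriv_eq[OF has_derivative_const] by blast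

lemma C_order_const [simp]: "C_order k (\<lambda>x. c)"
  by (induction k arbitrary: c) auto

lemma dir_deriv_add:
  "f differentiable (at x) \<Longrightarrow> g differentiable (at x) \<Longrightarrow>
    dir_deriv b (\<lambda>x. f x + g x) x = dir_deriv b f x + dir_deriv b g x"
  by (rule dir_deriv_eq[OF has_derivative_add[OF differentiable_has_dir_deriv differentiable_has_dir_deriv]])

lemma dir_deriv_mult:
  "f differentiable (at x) \<Longrightarrow> g differentiable (at x) \<Longrightarrow>
    dir_deriv b (\<lambda>x. f x * g x) x = f x * dir_deriv b g x + dir_deriv b f x * g x"
  by (rule dir_deriv_eq[OF has_derivative_mult[OF differentiable_has_dir_deriv differentiable_has_dir_deriv]])

lemma C_order_add: "C_order k f \<Longrightarrow> C_order k g \<Longrightarrow> C_order k (\<lambda>x. f x + g x)"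
proof (induction k arbitrary: f g)
  case 0
  then show ?case by (auto intro: continuous_intros)
next
  case (Suc k)
  then have "dir_deriv b (\<lambda>x. f x + g x) = (\<lambda>x. dir_deriv b f x + dir_deriv b g x)" for b
    by (auto simp: dir_deriv_add)
  with Suc show ?case by auto
qed

lemma C_order_mult: "C_order k f \<Longrightarrow> C_order k g \<Longrightarrow> C_order k (\<lambda>x. f x * g x)"
proof (induction k arbitrary: f g)
  case 0
  then show ?case by (auto intro: continuous_intros)
next
  case (Suc k)
  then have "dir_deriv b (\<lambda>x. f x * g x) = (\<lambda>x. f x * dir_deriv b g x + dir_deriv b f x * g x)" for b
    by (auto simp: dir_deriv_mult)
  with Suc show ?case
    using C_order_SucD[OF Suc.prems(1)] C_order_SucD[OF Suc.prems(2)]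
    by (auto intro!: C_order_add)
qed

lemma C_order_prod: "finite I \<Longrightarrow> (\<And>i. i \<in> I \<Longrightarrow> C_order k (f i)) \<Longrightarrow> C_order k (\<lambda>x. \<Prod>i\<in>I. f i x)"
  by (induction rule: finite_induct) (auto intro: C_order_mult)

text \<open>The free factor \<open>r\<close> makes one rule cover translations (r = 1), reflections
  (r = -1) and directions annihilated by a projection (r = 0).\<close>

lemma dir_deriv_affine:
  fixes \<phi> :: "'b::euclidean_space \<Rightarrow> real" and L :: "'a::euclidean_space \<Rightarrow> 'b"
  assumes "bounded_linear L" "\<phi> differentiable (at (L x + a))" "L b = r *\<^sub>R b'"
  shows "((\<lambda>x. \<phi> (L x + a)) has_derivative (\<lambda>h. dir_deriv (L h) \<phi> (L x + a))) (at x)" (is ?A)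
    and "dir_deriv b (\<lambda>x. \<phi> (L x + a)) x = r * dir_deriv b' \<phi> (L x + a)" (is ?B)
proof -
  have "((\<lambda>x. L x + a) has_derivative L) (at x)"
    using bounded_linear_imp_has_derivative[OF assms(1)]
    by (auto intro!: derivative_eq_intros)
  from has_derivative_compose[OF this differentiable_has_dir_deriv[OF assms(2)]]
  show A: ?A .
  have "linear (frechet_derivative \<phi> (at (L x + a)))"
    using assms(2) by (rule linear_frechet_derivative)
  with A assms(3) show ?B
    by (subst dir_deriv_eq[OF A]) (simp add: dir_deriv_def linear_scale)
qed

text \<open>\<open>C_order\<close> inspects basis directions only, so the induction closes when
  \<open>L\<close> sends each basis vector to a multiple of a basis vector. Translations,
  reflections and coordinate projections are of this kind.\<close>

lemma C_order_affine:
  fixes \<phi> :: "'b::euclidean_space \<Rightarrow> real" and L :: "'a::euclidean_space \<Rightarrow> 'b"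
  assumes "bounded_linear L" and "\<And>b. b \<in> Basis \<Longrightarrow> \<exists>r. \<exists>b'\<in>Basis. L b = r *\<^sub>R b'"
  shows "C_order k \<phi> \<Longrightarrow> C_order k (\<lambda>x. \<phi> (L x + a))"
proof (induction k arbitrary: \<phi>)
  case 0
  have "continuous_on UNIV (\<lambda>x. L x + a)"
    using assms(1) by (intro continuous_intros linear_continuous_on)
  with 0 show ?case
    by (auto intro: continuous_on_compose2)
next
  case (Suc k)
  show ?case unfolding C_order.simps
  proof (intro conjI allI ballI)
    fix x
    show "(\<lambda>x. \<phi> (L x + a)) differentiable (at x)"
      \<comment> \<open>The direction 0 makes the third premise trivial, since
        \<open>L 0 = 0\<close>.\<close>
      using dir_deriv_affine(1)[OF assms(1), of \<phi> x a 0 0 0] Suc.prems assms(1)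
      by (auto simp: differentiable_def linear_simps)
  next
    fix b :: 'a assume "b \<in> Basis"
    with assms(2) obtain r b' where b': "b' \<in> Basis" "L b = r *\<^sub>R b'" by blast
    then have "dir_deriv b (\<lambda>x. \<phi> (L x + a)) = (\<lambda>x. r * dir_deriv b' \<phi> (L x + a))"
      using Suc.prems assms(1) by (auto simp: dir_deriv_affine(2)[where r=r and b'=b'])
    with Suc b' show "C_order k (dir_deriv b (\<lambda>x. \<phi> (L x + a)))"
      by (auto intro!: C_order_mult)
  qed
qed

lemma dir_deriv_compose:
  fixes f :: "'a::euclidean_space \<Rightarrow> real" and F :: "real \<Rightarrow> real"
  assumes "f differentiable (at x)" "F differentiable (at (f x))"
  shows "((\<lambda>x. F (f x)) has_derivative (\<lambda>h. dir_deriv h f x * dir_deriv 1 F (f x))) (at x)" (is ?A)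
    and "dir_deriv b (\<lambda>x. F (f x)) x = dir_deriv 1 F (f x) * dir_deriv b f x" (is ?B)
proof -
  have lin: "linear (frechet_derivative F (at (f x)))"
    using assms(2) by (rule linear_frechet_derivative)
  have eq: "dir_deriv r F (f x) = r * dir_deriv 1 F (f x)" for r
    using linear_scale[OF lin, of r 1] by (simp add: dir_deriv_def)
  show A: ?A
    using has_derivative_compose[OF differentiable_has_dir_deriv[OF assms(1)] differentiable_has_dir_deriv[OF assms(2)]]
    by (subst (asm) eq)
  show ?B by (subst dir_deriv_eq[OF A]) simp
qed

lemma C_order_compose:
  fixes f :: "'a::euclidean_space \<Rightarrow> real" and F :: "real \<Rightarrow> real"
  shows "C_order k F \<Longrightarrow> C_order k f \<Longrightarrow> C_order k (\<lambda>x. F (f x))"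
proof (induction k arbitrary: F)
  case 0
  then show ?case by (auto intro: continuous_on_compose2)
next
  case (Suc k)
  have "dir_deriv b (\<lambda>x. F (f x)) = (\<lambda>x. dir_deriv 1 F (f x) * dir_deriv b f x)" for b
    using Suc.prems by (auto simp: dir_deriv_compose(2))
  moreover have "(\<lambda>x. F (f x)) differentiable (at x)" for x
    using dir_deriv_compose(1)[of f x F] Suc.prems by (auto simp: differentiable_def)
  ultimately show ?case
    using Suc C_order_SucD[OF Suc.prems(2)] by (auto intro!: C_order_mult)
qed

lemma smooth_intros:
  "smooth (\<lambda>x. c)"
  "smooth f \<Longrightarrow> smooth g \<Longrightarrow> smooth (\<lambda>x. f x + g x)"
  "smooth f \<Longrightarrow> smooth g \<Longrightarrow> smooth (\<lambda>x. f x * g x)"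
  "smooth F \<Longrightarrow> smooth f \<Longrightarrow> smooth (\<lambda>x. F (f x))"
  by (auto simp: smooth_def C_order_add C_order_mult C_order_compose)

lemma smooth_diff: "smooth f \<Longrightarrow> smooth g \<Longrightarrow> smooth (\<lambda>x. f x - g x)"
  using smooth_intros(2)[OF _ smooth_intros(3)[OF smooth_intros(1)[of "-1"]], of f g] by simp

lemma smooth_affine:
  fixes \<phi> :: "'b::euclidean_space \<Rightarrow> real" and L :: "'a::euclidean_space \<Rightarrow> 'b"
  assumes "smooth \<phi>" "bounded_linear L" "\<And>b. b \<in> Basis \<Longrightarrow> \<exists>r. \<exists>b'\<in>Basis. L b = r *\<^sub>R b'"
  shows "smooth (\<lambda>x. \<phi> (L x + a))"
  using assms(1) C_order_affine[OF assms(2,3)] unfolding smooth_def by auto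

lemma smooth_imp_differentiable: "smooth \<phi> \<Longrightarrow> \<phi> differentiable (at x)"
  by (drule smooth_def[THEN iffD1, rule_format, of _ "Suc 0"]) simp

lemma smooth_dir_deriv: "smooth \<phi> \<Longrightarrow> b \<in> Basis \<Longrightarrow> smooth (dir_deriv b \<phi>)"
  unfolding smooth_def by (metis C_order.simps(2))

lemma smooth_imp_continuous: "smooth \<phi> \<Longrightarrow> continuous_on UNIV \<phi>"
  by (drule smooth_def[THEN iffD1, rule_format, of _ "0"]) simp

lemma smooth_fst: "smooth \<phi> \<Longrightarrow> smooth (\<lambda>z. \<phi> (fst z))" for \<phi> :: "'a::euclidean_space \<Rightarrow> real"
proof -
  assume "smooth \<phi>"
  then have "smooth (\<lambda>z::'a\<times>'b. \<phi> (fst z + 0))"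
  proof (rule smooth_affine)
    fix b :: "'a \<times> 'b" assume b: "b \<in> Basis"
    obtain b0 :: 'a where b0: "b0 \<in> Basis" using nonempty_Basis by blast
    \<comment> \<open>A basis vector of the second factor projects to 0, which is written as 0 times
      some basis vector.\<close>
    have "fst b \<in> Basis \<or> fst b = 0 *\<^sub>R b0" using b unfolding Basis_prod_def by auto
    then show "\<exists>r. \<exists>b'\<in>Basis. fst b = r *\<^sub>R b'"
      using b0 scaleR_one[of "fst b"] by metis
  qed (rule bounded_linear_fst)
  then show ?thesis by simp
qed

lemma smooth_snd: "smooth \<phi> \<Longrightarrow> smooth (\<lambda>z. \<phi> (snd z))" for \<phi> :: "'b::euclidean_space \<Rightarrow> real"
proof -
  assume "smooth \<phi>"
  then have "smooth (\<lambda>z::'a\<times>'b. \<phi> (snd z + 0))"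
  proof (rule smooth_affine)
    fix b :: "'a \<times> 'b" assume b: "b \<in> Basis"
    obtain b0 :: 'b where b0: "b0 \<in> Basis" using nonempty_Basis by blast
    have "snd b \<in> Basis \<or> snd b = 0 *\<^sub>R b0" using b unfolding Basis_prod_def by auto
    then show "\<exists>r. \<exists>b'\<in>Basis. snd b = r *\<^sub>R b'"
      using b0 scaleR_one[of "snd b"] by metis
  qed (rule bounded_linear_snd)
  then show ?thesis by simp
qed

lemma smooth_inner: "smooth \<phi> \<Longrightarrow> smooth (\<lambda>x. \<phi> (r * (x \<bullet> b) + a))" if "b \<in> Basis" for \<phi> :: "real \<Rightarrow> real"
  and b :: "'a::euclidean_space"
proof -
  assume "smooth \<phi>"
  then show ?thesis
    by (rule smooth_affine[where L="\<lambda>x. r * (x \<bullet> b)"])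
      (auto intro: bounded_linear_intros bounded_linear_mult_right[THEN bounded_linear_compose] bounded_linear_inner_left)
qed

section \<open>Cut-off functions\<close>

text \<open>Up to linear combinations, this family is closed under differentiation.\<close>

definition eflat :: "real \<Rightarrow> real \<Rightarrow> real \<Rightarrow> real \<Rightarrow> real" where
  "eflat a d \<beta> s = (if s > 0 then s powr (-\<beta>) * exp (- (d * s powr (-a))) else 0)"

lemma eflat_tendsto_0:
  fixes a d \<beta> :: real
  assumes "a > 0" "d > 0"
  shows "((\<lambda>s. s powr (-\<beta>) * exp (- (d * s powr (-a)))) \<longlongrightarrow> 0) (at_right 0)"
  using assms by real_asymp

text \<open>Differentiation only raises the exponent \<beta>, which is why a negative power is built
  into the family. At 0 the right difference quotient is the same expression with \<beta> + 1, and
  the exponential beats every power.\<close>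

lemma has_field_derivative_eflat:
  assumes a: "a > 0" and d: "d > 0"
  shows "(eflat a d \<beta> has_field_derivative
    (a * d * eflat a d (\<beta> + a + 1) s - \<beta> * eflat a d (\<beta> + 1) s)) (at s)"
proof (cases s "0::real" rule: linorder_cases)
  case less
  have "((\<lambda>s. 0) has_field_derivative 0) (at s)" by simp
  moreover have "eventually (\<lambda>t. t < 0) (nhds s)"
    using less eventually_nhds_in_open[of "{..<0}" s] by auto
  then have "eventually (\<lambda>t. 0 = eflat a d \<beta> t) (nhds s)"
    by eventually_elim (simp add: eflat_def)
  ultimately have "(eflat a d \<beta> has_field_derivative 0) (at s)"
    by (subst DERIV_cong_ev[OF refl, of _ "\<lambda>s. 0"]) (auto elim: eventually_mono)
  then show ?thesis using less by (simp add: eflat_def)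
next
  case greater
  have "((\<lambda>s. s powr (-\<beta>) * exp (- (d * s powr (-a)))) has_field_derivative
    (a * d * eflat a d (\<beta> + a + 1) s - \<beta> * eflat a d (\<beta> + 1) s)) (at s)"
    using greater
    by (auto intro!: derivative_eq_intros simp: eflat_def algebra_simps powr_diff powr_minus powr_add divide_simps)
  moreover have "eventually (\<lambda>t. t > 0) (nhds s)"
    using greater eventually_nhds_in_open[of "{0<..}" s] by auto
  then have "eventually (\<lambda>t. s powr 0 = 1 \<and> t powr (-\<beta>) * exp (- (d * t powr (-a))) = eflat a d \<beta> t) (nhds s)"
    by eventually_elim (use greater in \<open>simp add: eflat_def\<close>)
  ultimately show ?thesis
    by (subst DERIV_cong_ev[OF refl, of _ "\<lambda>s. s powr (-\<beta>) * exp (- (d * s powr (-a)))"])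
       (auto elim: eventually_mono)
next
  case equal
  have R: "((\<lambda>t. eflat a d \<beta> t / t) \<longlongrightarrow> 0) (at_right 0)"
  proof (rule Lim_transform_eventually[OF eflat_tendsto_0[OF a d, of "\<beta> + 1"]])
    show "eventually (\<lambda>t. t powr - (\<beta> + 1) * exp (- (d * t powr - a)) = eflat a d \<beta> t / t) (at_right 0)"
      using eventually_at_right_less[of "0::real"]
      by eventually_elim (simp add: eflat_def powr_diff powr_minus powr_add divide_simps)
  qed
  have L: "((\<lambda>t. eflat a d \<beta> t / t) \<longlongrightarrow> 0) (at_left 0)"
  proof (rule Lim_transform_eventually[OF tendsto_const])
    show "eventually (\<lambda>t. 0 = eflat a d \<beta> t / t) (at_left 0)"
      by (auto simp: eflat_def eventually_at_left_field intro: exI[of _ "-1"])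
  qed
  from L R have "((\<lambda>t. eflat a d \<beta> t / t) \<longlongrightarrow> 0) (at 0)"
    by (simp add: filterlim_at_split)
  then show ?thesis
    using equal by (simp add: DERIV_def eflat_def)
qed

lemma dir_deriv_real: "(f has_field_derivative D) (at x) \<Longrightarrow> dir_deriv h f x = D * h"
  by (rule dir_deriv_eq) (simp add: has_field_derivative_def)

lemma field_derivative_imp_differentiable:
  "(f has_field_derivative D) (at x) \<Longrightarrow> f differentiable (at x)" for f :: "real \<Rightarrow> real"
  by (auto simp: differentiable_def has_field_derivative_def)

lemma C_order_SucI_real:
  fixes f :: "real \<Rightarrow> real"
  assumes "\<And>x. (f has_field_derivative f' x) (at x)" "C_order k f'"
  shows "C_order (Suc k) f"
proof -
  have "dir_deriv 1 f = f'" using dir_deriv_real[OF assms(1), of 1] by (intro ext) simp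
  then show ?thesis using assms field_derivative_imp_differentiable[OF assms(1)] by auto
qed

text \<open>The induction has to run over all \<beta> at once, because each derivative shifts the
  exponent.\<close>

lemma smooth_eflat:
  assumes "a > 0" "d > 0"
  shows "smooth (eflat a d \<beta>)"
proof -
  have "C_order k (eflat a d \<beta>)" for k
  proof (induction k arbitrary: \<beta>)
    case 0
    show ?case using has_field_derivative_eflat[OF assms]
      by (auto intro!: continuous_at_imp_continuous_on DERIV_isCont)
  next
    case (Suc k)
    have "C_order k (\<lambda>s. a * d * eflat a d (\<beta> + a + 1) s + (-\<beta>) * eflat a d (\<beta> + 1) s)"
      by (intro C_order_add C_order_mult C_order_const Suc)
    then show ?case
      by (intro C_order_SucI_real[OF has_field_derivative_eflat[OF assms]]) simp
  qed
  then show ?thesis by (simp add: smooth_def)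
qed

text \<open>This is the classical flat function exp(-1/s) for s > 0, extended by 0.\<close>

definition cutoff :: "real \<Rightarrow> real" where "cutoff = eflat 1 1 0"

lemma smooth_cutoff: "smooth cutoff"
  by (simp add: cutoff_def smooth_eflat)

lemma cutoff_bounds: "0 \<le> cutoff s" "cutoff s \<le> 1" and cutoff_pos_iff: "0 < cutoff s \<longleftrightarrow> 0 < s"
  and cutoff_eq_0_iff: "cutoff s = 0 \<longleftrightarrow> s \<le> 0"
  by (auto simp: cutoff_def eflat_def)

lemma cutoff_tendsto: "(\<lambda>k. cutoff (real k * s)) \<longlonglongrightarrow> (if s > 0 then 1 else 0)"
proof (cases "s > 0")
  case True
  then have "(\<lambda>k. exp (- ((real k * s) powr (-1)))) \<longlonglongrightarrow> 1"
    by real_asymp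
  moreover have "eventually (\<lambda>k. exp (- ((real k * s) powr (-1))) = cutoff (real k * s)) sequentially"
    using eventually_gt_at_top[of 0]
    by eventually_elim (use True in \<open>simp add: cutoff_def eflat_def\<close>)
  ultimately have "(\<lambda>k. cutoff (real k * s)) \<longlonglongrightarrow> 1" by (rule Lim_transform_eventually)
  with True show ?thesis by simp
next
  case False
  then have "cutoff (real k * s) = 0" for k
    by (simp add: cutoff_eq_0_iff mult_nonneg_nonpos)
  with False show ?thesis by simp
qed

text \<open>For k > 0 the bump is positive exactly on the open box. The factor \<open>k\<close>
  steepens its walls, so that these test functions converge pointwise to the indicator function of
  the box.\<close>

definition box_bump :: "'a::euclidean_space \<Rightarrow> 'a \<Rightarrow> nat \<Rightarrow> 'a \<Rightarrow> real" where
  "box_bump a c k x = (\<Prod>b\<in>Basis. cutoff (real k * ((x - a) \<bullet> b)) * cutoff (real k * ((c - x) \<bullet> b)))"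

lemma smooth_box_bump: "smooth (box_bump a c k)"
proof -
  have "C_order j (\<lambda>x. cutoff (real k * (x \<bullet> b) + (- real k * (a \<bullet> b)))
       * cutoff ((- real k) * (x \<bullet> b) + (real k * (c \<bullet> b))))" if "b \<in> Basis" for b j
    using smooth_inner[OF that smooth_cutoff] unfolding smooth_def by (intro C_order_mult) blast+
  then have "C_order j (\<lambda>x. \<Prod>b\<in>Basis. cutoff (real k * (x \<bullet> b) + (- real k * (a \<bullet> b)))
       * cutoff ((- real k) * (x \<bullet> b) + (real k * (c \<bullet> b))))" for j
    by (intro C_order_prod) auto
  moreover have "(\<lambda>x. \<Prod>b\<in>Basis. cutoff (real k * (x \<bullet> b) + (- real k * (a \<bullet> b)))
       * cutoff ((- real k) * (x \<bullet> b) + (real k * (c \<bullet> b)))) = box_bump a c k"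
    by (rule ext) (simp add: box_bump_def algebra_simps)
  ultimately show ?thesis by (simp add: smooth_def)
qed

lemma box_bump_bounds: "0 \<le> box_bump a c k x" "box_bump a c k x \<le> 1"
  unfolding box_bump_def
  by (auto intro!: prod_nonneg prod_le_1 mult_nonneg_nonneg mult_le_one simp: cutoff_bounds)

lemma box_bump_eq_0: "x \<notin> box a c \<Longrightarrow> box_bump a c k x = 0"
  unfolding box_bump_def mem_box
  by (auto simp: cutoff_eq_0_iff inner_diff_left not_less intro!: mult_nonneg_nonpos)

lemma box_bump_pos: "x \<in> box a c \<Longrightarrow> k > 0 \<Longrightarrow> box_bump a c k x > 0"
  unfolding box_bump_def mem_box
  by (auto intro!: prod_pos mult_pos_pos simp: cutoff_pos_iff inner_diff_left)

lemma box_bump_tendsto: "(\<lambda>k. box_bump a c k x) \<longlonglongrightarrow> indicator (box a c) x"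
proof (cases "x \<in> box a c")
  case True
  have "(\<lambda>k. box_bump a c k x) \<longlonglongrightarrow> (\<Prod>b\<in>(Basis::'a set). (1::real) * 1)"
    unfolding box_bump_def
  proof (intro tendsto_prod tendsto_mult)
    fix b :: 'a assume "b \<in> Basis"
    with True have "(x - a) \<bullet> b > 0" "(c - x) \<bullet> b > 0"
      by (auto simp: mem_box inner_diff_left)
    then show "(\<lambda>k. cutoff (real k * ((x - a) \<bullet> b))) \<longlonglongrightarrow> 1"
      "(\<lambda>k. cutoff (real k * ((c - x) \<bullet> b))) \<longlonglongrightarrow> 1"
      using cutoff_tendsto by (metis (full_types))+
  qed
  with True show ?thesis by simp
qed (simp add: box_bump_eq_0)

section \<open>Test functions: support, bounds, integrability\<close>

lemma test_funI:
  assumes "smooth \<phi>" "compact K" "K \<subseteq> U" "\<And>x. x \<notin> K \<Longrightarrow> \<phi> x = 0"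
  shows "\<phi> \<in> test_fun U"
proof -
  have "closure {x. \<phi> x \<noteq> 0} \<subseteq> K"
    using assms(2,4) by (intro closure_minimal) (auto intro: compact_imp_closed)
  with assms show ?thesis
    by (auto simp: test_fun_def intro: compact_closure[THEN iffD2] bounded_subset[OF compact_imp_bounded]
          closure_subset[THEN subset_trans])
qed

lemma test_fun_imp_smooth: "\<phi> \<in> test_fun U \<Longrightarrow> smooth \<phi>"
  by (simp add: test_fun_def)

lemma test_fun_support:
  assumes "\<phi> \<in> test_fun U"
  shows "\<exists>K. compact K \<and> K \<subseteq> U \<and> (\<forall>x. x \<notin> K \<longrightarrow> \<phi> x = 0)"
proof (intro exI conjI allI impI)
  show "\<phi> x = 0" if "x \<notin> closure {x. \<phi> x \<noteq> 0}" for x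
    using that closure_subset[of "{x. \<phi> x \<noteq> 0}"] by blast
qed (use assms in \<open>auto simp: test_fun_def\<close>)

lemma test_fun_mono: "U \<subseteq> V \<Longrightarrow> test_fun U \<subseteq> test_fun V"
  by (auto simp: test_fun_def)

lemma test_fun_box_bump: "cbox a c \<subseteq> U \<Longrightarrow> box_bump a c k \<in> test_fun U"
  using box_subset_cbox[of a c]
  by (intro test_funI[of _ "cbox a c"]) (auto simp: smooth_box_bump intro!: box_bump_eq_0)

lemma dir_deriv_zero_outside:
  assumes "\<And>x. x \<notin> K \<Longrightarrow> \<phi> x = 0" "closed K" "x \<notin> K"
  shows "dir_deriv b \<phi> x = 0"
proof -
  have "((\<lambda>x. 0) has_derivative (\<lambda>h. 0)) (at x)" by simp
  then have "(\<phi> has_derivative (\<lambda>h. 0)) (at x)"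
    by (rule has_derivative_transform_within_open[of _ _ _ _ "-K"]) (use assms in auto)
  then show ?thesis by (rule dir_deriv_eq)
qed

lemma test_fun_dir_deriv:
  assumes "\<phi> \<in> test_fun U" "b \<in> Basis"
  shows "dir_deriv b \<phi> \<in> test_fun U"
proof -
  obtain K where K: "compact K" "K \<subseteq> U" "\<And>x. x \<notin> K \<Longrightarrow> \<phi> x = 0"
    using test_fun_support[OF assms(1)] by blast
  show ?thesis
    by (rule test_funI[OF smooth_dir_deriv[OF test_fun_imp_smooth[OF assms(1)] assms(2)] K(1,2)])
       (rule dir_deriv_zero_outside[OF K(3) compact_imp_closed[OF K(1)]])
qed

lemma test_fun_measurable [measurable]: "\<phi> \<in> test_fun U \<Longrightarrow> \<phi> \<in> borel_measurable borel"
  by (auto intro!: borel_measurable_continuous_onI smooth_imp_continuous intro: test_fun_imp_smooth)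

lemma test_fun_bounded:
  assumes "\<phi> \<in> test_fun U"
  shows "\<exists>B>0. \<forall>x. \<bar>\<phi> x\<bar> \<le> B"
proof -
  obtain K where K: "compact K" "\<And>x. x \<notin> K \<Longrightarrow> \<phi> x = 0"
    using test_fun_support[OF assms] by blast
  have "bounded (\<phi> ` K)"
    using K(1) test_fun_imp_smooth[OF assms] by (intro compact_imp_bounded compact_continuous_image
        continuous_on_subset[OF smooth_imp_continuous]) auto
  then obtain B where "B > 0" "\<And>x. x \<in> K \<Longrightarrow> \<bar>\<phi> x\<bar> \<le> B"
    unfolding bounded_pos by force
  moreover from this K(2) have "\<bar>\<phi> x\<bar> \<le> B" for x by (cases "x \<in> K") auto
  ultimately show ?thesis by blast
qed

lemma test_fun_powr_integrable:
  fixes \<phi> :: "'a::euclidean_space \<Rightarrow> real"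
  assumes \<phi>: "\<phi> \<in> test_fun U" and r: "r > 0"
  shows "integrable lborel (\<lambda>x. \<bar>\<phi> x\<bar> powr r)"
proof -
  obtain B where B: "B > 0" "\<And>x. \<bar>\<phi> x\<bar> \<le> B" using test_fun_bounded[OF \<phi>] by blast
  obtain K where K: "compact K" "\<And>x. x \<notin> K \<Longrightarrow> \<phi> x = 0" using test_fun_support[OF \<phi>] by blast
  have [measurable]: "\<phi> \<in> borel_measurable borel" using \<phi> by (rule test_fun_measurable)
  have "integrable lborel (\<lambda>x. B powr r * indicator K x)"
    using emeasure_bounded_finite[OF compact_imp_bounded[OF K(1)]] compact_imp_closed[OF K(1)] by auto
  then show ?thesis
  proof (rule Bochner_Integration.integrable_bound)
    show "AE x in lborel. norm (\<bar>\<phi> x\<bar> powr r) \<le> norm (B powr r * indicator K x)"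
    proof (rule AE_I2)
      fix x show "norm (\<bar>\<phi> x\<bar> powr r) \<le> norm (B powr r * indicator K x)"
        using K(2)[of x] B(2)[of x] r by (cases "x \<in> K") (auto intro: powr_mono2)
    qed
  qed simp
qed

lemma test_fun_integrable:
  assumes "\<phi> \<in> test_fun U" shows "integrable lborel \<phi>"
proof -
  have "integrable lborel (\<lambda>x. \<bar>\<phi> x\<bar>)" using test_fun_powr_integrable[OF assms, of 1] by simp
  then show ?thesis using test_fun_measurable[OF assms] by (subst (asm) integrable_abs_iff) auto
qed

text \<open>A box bump divided by its integral. The centre is left free: kernels for mollification
  sit at 0, smooth steps on the time axis use other centres.\<close>

lemma mollifier_exists:
  fixes a :: "'a::euclidean_space"
  assumes "e > 0"
  obtains \<rho> where "smooth \<rho>" "\<And>x. \<rho> x \<ge> 0" "integrable lborel \<rho>" "(\<integral>x. \<rho> x \<partial>lborel) = 1"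
    "\<And>x. x \<notin> cball a e \<Longrightarrow> \<rho> x = 0"
proof -
  obtain c d where "cbox c d \<subseteq> ball a e" and lt: "\<forall>i\<in>Basis. c \<bullet> i < d \<bullet> i"
    by (rule open_contains_cbox[of "ball a e" a]) (use assms in auto)
  then have cd: "cbox c d \<subseteq> cball a e" using ball_subset_cball by blast
  let ?f = "box_bump c d 1"
  have tf: "?f \<in> test_fun UNIV" by (rule test_fun_box_bump) simp
  let ?I = "\<integral>x. ?f x \<partial>lborel"
  have int: "integrable lborel ?f" using tf by (rule test_fun_integrable)
  \<comment> \<open>A vanishing integral would make the set where the bump is positive, a box of
    positive volume, a null set.\<close>
  have "?I \<noteq> 0"
  proof
    assume "?I = 0"
    then have "AE x in lborel. ?f x = 0"
      using integral_nonneg_eq_0_iff_AE[OF int AE_I2[OF box_bump_bounds(1)]] by blast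
    then have "AE x in lborel. x \<notin> box c d"
    proof eventually_elim
      case (elim x)
      then show ?case using box_bump_pos[of x c d 1] by linarith
    qed
    then have "emeasure lborel (box c d) = 0"
      by (subst (asm) AE_iff_measurable[OF _ refl]) auto
    moreover have "(\<Prod>b\<in>Basis. (d - c) \<bullet> b) > 0"
      using lt by (auto intro!: prod_pos simp: inner_diff_left)
    ultimately show False
      using lt by (subst (asm) emeasure_lborel_box) (auto simp: inner_diff_left intro: less_imp_le)
  qed
  moreover have "?I \<ge> 0" by (simp add: box_bump_bounds)
  ultimately have pos: "?I > 0" by simp
  show thesis
  proof (rule that[of "\<lambda>x. inverse ?I * ?f x"])
    show "smooth (\<lambda>x. inverse ?I * ?f x)"
      using smooth_intros(3)[OF smooth_intros(1) smooth_box_bump] .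
    show "inverse ?I * ?f x \<ge> 0" for x
      using less_imp_le[OF positive_imp_inverse_positive[OF pos]]
      by (intro mult_nonneg_nonneg box_bump_bounds)
    show "integrable lborel (\<lambda>x. inverse ?I * ?f x)" using int by simp
    show "(\<integral>x. inverse ?I * ?f x \<partial>lborel) = 1" using pos by simp
    show "inverse ?I * ?f x = 0" if "x \<notin> cball a e" for x
      using that cd box_subset_cbox[of c d] by (auto intro!: box_bump_eq_0)
  qed
qed

section \<open>Borel representatives\<close>

lemma dir_deriv_mvt:
  fixes \<phi> :: "'a::euclidean_space \<Rightarrow> real"
  assumes "\<And>x. \<phi> differentiable (at x)"
  shows "\<exists>\<tau>\<in>{0..1}. \<phi> (x + h) - \<phi> x = dir_deriv h \<phi> (x + \<tau> *\<^sub>R h)"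
proof -
  have "((\<lambda>\<tau>. \<phi> (x + \<tau> *\<^sub>R h)) has_derivative (\<lambda>r. dir_deriv (r *\<^sub>R h) \<phi> (x + \<tau> *\<^sub>R h))) (at \<tau> within {0..1})" for \<tau> :: real
  proof -
    have "((\<lambda>\<tau>. x + \<tau> *\<^sub>R h) has_derivative (\<lambda>r. r *\<^sub>R h)) (at \<tau> within {0..1})"
      by (auto intro!: derivative_eq_intros)
    from has_derivative_compose[OF this differentiable_has_dir_deriv[OF assms]] show ?thesis .
  qed
  from mvt_very_simple[OF zero_le_one this] show ?thesis by simp
qed

lemma integral_lborel_translation:
  fixes f :: "'a::euclidean_space \<Rightarrow> real"
  assumes [measurable]: "f \<in> borel_measurable borel"
  shows "(\<integral>x. f (y + x) \<partial>lborel) = (\<integral>x. f x \<partial>lborel)"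
    and "integrable lborel (\<lambda>x. f (y + x)) \<longleftrightarrow> integrable lborel f"
proof -
  have "(\<integral>x. f (y + x) \<partial>lborel) = integral\<^sup>L (distr lborel borel ((+) y)) f"
    by (subst integral_distr) auto
  then show "(\<integral>x. f (y + x) \<partial>lborel) = (\<integral>x. f x \<partial>lborel)"
    by (simp add: lborel_distr_plus)
  have "integrable (distr lborel borel ((+) y)) f \<longleftrightarrow> integrable lborel (\<lambda>x. f (y + x))"
    by (subst integrable_distr_eq) auto
  then show "integrable lborel (\<lambda>x. f (y + x)) \<longleftrightarrow> integrable lborel f"
    by (simp add: lborel_distr_plus)
qed

text \<open>Difference quotients have integral 0 by translation invariance, and dominated
  convergence passes to the derivative. The mean value theorem bounds the quotients by the supremum
  of the derivative.\<close>

lemma integral_dir_deriv_eq_0: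
  fixes \<phi> :: "'a::euclidean_space \<Rightarrow> real"
  assumes \<phi>: "\<phi> \<in> test_fun UNIV" and b: "b \<in> Basis"
  shows "(\<integral>x. dir_deriv b \<phi> x \<partial>lborel) = 0"
proof -
  have [measurable]: "\<phi> \<in> borel_measurable borel" "dir_deriv b \<phi> \<in> borel_measurable borel"
    using \<phi> test_fun_dir_deriv[OF \<phi> b] by (auto intro: test_fun_measurable)
  have diff: "\<phi> differentiable (at x)" for x
    using \<phi> by (intro smooth_imp_differentiable test_fun_imp_smooth)
  obtain K where K: "compact K" "\<And>x. x \<notin> K \<Longrightarrow> \<phi> x = 0"
    using test_fun_support[OF \<phi>] by blast
  obtain B where B: "B > 0" "\<And>x. \<bar>dir_deriv b \<phi> x\<bar> \<le> B"
    using test_fun_bounded[OF test_fun_dir_deriv[OF \<phi> b]] by blast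
  \<comment> \<open>The unit neighbourhood of \<open>K\<close> contains the supports of all
    difference quotients with step at most 1.\<close>
  define K' where "K' = {x + y | x y. x \<in> K \<and> y \<in> cball (0::'a) 1}"
  have K': "compact K'" unfolding K'_def using K(1) by (intro compact_sums) auto
  have K'_borel [measurable]: "K' \<in> sets borel" using borel_closed[OF compact_imp_closed[OF K']] by simp
  define s where "s n = inverse (real (Suc n))" for n
  have s: "0 < s n" "s n \<le> 1" for n unfolding s_def by (auto simp: field_simps)
  have s0: "s \<longlonglongrightarrow> 0" unfolding s_def by (rule LIMSEQ_inverse_real_of_nat)
  let ?q = "\<lambda>n x. (\<phi> (s n *\<^sub>R b + x) - \<phi> x) / s n"
  have q0: "(\<integral>x. ?q n x \<partial>lborel) = 0" for n
    using test_fun_integrable[OF \<phi>] integral_lborel_translation[of \<phi> "s n *\<^sub>R b"]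
    by simp
  have "(\<lambda>n. \<integral>x. ?q n x \<partial>lborel) \<longlonglongrightarrow> (\<integral>x. dir_deriv b \<phi> x \<partial>lborel)"
  proof (rule integral_dominated_convergence[where w="\<lambda>x. B * indicator K' x"])
    show "integrable lborel (\<lambda>x. B * indicator K' x)"
      using emeasure_bounded_finite[OF compact_imp_bounded[OF K']] by auto
    show "AE x in lborel. (\<lambda>n. ?q n x) \<longlonglongrightarrow> dir_deriv b \<phi> x"
    proof (rule AE_I2)
      fix x
      have "((\<lambda>r. x + r *\<^sub>R b) has_derivative (\<lambda>r. r *\<^sub>R b)) (at (0::real))"
        by (auto intro!: derivative_eq_intros)
      from has_derivative_compose[OF this, of \<phi> "\<lambda>h. dir_deriv h \<phi> x"]
      have "((\<lambda>r. \<phi> (x + r *\<^sub>R b)) has_derivative (\<lambda>r. dir_deriv (r *\<^sub>R b) \<phi> x)) (at (0::real))"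
        using differentiable_has_dir_deriv[OF diff[of x]] by simp
      moreover have "dir_deriv (r *\<^sub>R b) \<phi> x = dir_deriv b \<phi> x * r" for r
        using linear_scale[OF linear_frechet_derivative[OF diff[of x]], of r b]
        by (simp add: dir_deriv_def)
      ultimately have "((\<lambda>r. \<phi> (x + r *\<^sub>R b)) has_field_derivative dir_deriv b \<phi> x) (at 0)"
        by (simp add: has_field_derivative_def fun_eq_iff)
      then have "((\<lambda>h. (\<phi> (x + h *\<^sub>R b) - \<phi> x) / h) \<longlongrightarrow> dir_deriv b \<phi> x) (at 0)"
        by (simp add: DERIV_def)
      moreover have "filterlim s (at 0) sequentially"
        using s0 s(1) by (auto simp: filterlim_at less_imp_neq[symmetric])
      ultimately show "(\<lambda>n. ?q n x) \<longlonglongrightarrow> dir_deriv b \<phi> x"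
        by (auto dest: filterlim_compose simp: add.commute)
    qed
    show "AE x in lborel. norm (?q n x) \<le> B * indicator K' x" for n
    proof (rule AE_I2)
      fix x
      show "norm (?q n x) \<le> B * indicator K' x"
      proof (cases "x \<in> K'")
        case True
        obtain \<tau> where "\<phi> (x + s n *\<^sub>R b) - \<phi> x = dir_deriv (s n *\<^sub>R b) \<phi> (x + \<tau> *\<^sub>R s n *\<^sub>R b)"
          using dir_deriv_mvt[of \<phi> x "s n *\<^sub>R b"] diff by blast
        also have "\<dots> = s n * dir_deriv b \<phi> (x + \<tau> *\<^sub>R s n *\<^sub>R b)"
          using linear_scale[OF linear_frechet_derivative[OF diff]]
          by (simp add: dir_deriv_def)
        finally have "?q n x = dir_deriv b \<phi> (x + \<tau> *\<^sub>R s n *\<^sub>R b)"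
          using s(1)[of n] by (simp add: add.commute)
        with B(2) True show ?thesis by simp
      next
        case False
        have "x \<notin> K"
        proof
          assume "x \<in> K"
          then have "x + 0 \<in> K'" unfolding K'_def mem_Collect_eq
            by (intro exI[of _ x] exI[of _ "0::'a"]) simp
          with False show False by simp
        qed
        moreover have "s n *\<^sub>R b + x \<notin> K"
        proof
          assume "s n *\<^sub>R b + x \<in> K"
          moreover have "x = (s n *\<^sub>R b + x) + (- s n *\<^sub>R b)" "norm (- s n *\<^sub>R b) \<le> 1"
            using s[of n] b by auto
          ultimately have "x \<in> K'" unfolding K'_def mem_Collect_eq
            by (metis mem_cball_0)
          with False show False by simp
        qed
        ultimately show ?thesis using K(2) False by simp
      qed
    qed
  qed auto
  then show ?thesis unfolding q0 by (simp add: LIMSEQ_const_iff)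
qed

text \<open>
  \<open>brep U f f'\<close>: the function \<open>f'\<close> is Borel measurable on the whole space, vanishes outside \<open>U\<close> and
  agrees with \<open>f\<close> a.e. on \<open>U\<close>. Integrals over \<open>lebesgue_on U\<close> thereby become integrals over \<open>lborel\<close>,
  where products of measures are available.
\<close>

definition brep :: "'a::euclidean_space set \<Rightarrow> ('a \<Rightarrow> real) \<Rightarrow> ('a \<Rightarrow> real) \<Rightarrow> bool" where
  "brep U f f' \<longleftrightarrow> f' \<in> borel_measurable borel \<and> (\<forall>x. x \<notin> U \<longrightarrow> f' x = 0) \<and>
     (AE x in lborel. x \<in> U \<longrightarrow> f x = f' x)"

lemma AE_lebesgue_on_iff:
  "U \<in> sets borel \<Longrightarrow> (AE x in lebesgue_on U. P x) \<longleftrightarrow> (AE x in lborel. x \<in> U \<longrightarrow> P x)"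
  by (subst AE_restrict_space_iff) (auto simp: AE_completion_iff)

lemma brep_exists:
  assumes U: "U \<in> sets borel" and f: "f \<in> borel_measurable (lebesgue_on U)"
  shows "\<exists>f'. brep U f f'"
proof -
  have "(\<lambda>x. indicator U x * f x) \<in> borel_measurable lebesgue"
    using f U by (subst (asm) borel_measurable_restrict_space_iff) auto
  from completion_ex_borel_measurable_real[OF this] obtain g where
    g[measurable]: "g \<in> borel_measurable borel" and ae: "AE x in lborel. indicator U x * f x = g x"
    by auto
  have "brep U f (\<lambda>x. indicator U x * g x)"
    unfolding brep_def
  proof (intro conjI)
    show "AE x in lborel. x \<in> U \<longrightarrow> f x = indicator U x * g x"
      using ae by eventually_elim auto
  qed (use U in auto)
  then show ?thesis by blast
qed

lemma brep_measurable: "brep U f f' \<Longrightarrow> f' \<in> borel_measurable borel"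
  and brep_outside: "brep U f f' \<Longrightarrow> x \<notin> U \<Longrightarrow> f' x = 0"
  and brep_AE: "brep U f f' \<Longrightarrow> AE x in lborel. x \<in> U \<longrightarrow> f x = f' x"
  by (auto simp: brep_def)

lemma brep_AE_lebesgue:
  assumes "U \<in> sets borel" "brep U f f'"
  shows "AE x in lebesgue. indicator U x * f x = f' x"
  using brep_AE[OF assms(2)] brep_outside[OF assms(2)]
  by (subst AE_completion_iff) (auto elim!: eventually_mono split: split_indicator)

lemma brep_measurable_lebesgue_on:
  assumes U: "U \<in> sets borel" and f: "brep U f f'"
  shows "f \<in> borel_measurable (lebesgue_on U)"
proof -
  have "f' \<in> borel_measurable lebesgue"
    using brep_measurable[OF f] by (simp add: measurable_completion)
  moreover have "AE x in lebesgue. f' x = indicator U x * f x"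
    using brep_AE_lebesgue[OF U f] by (auto elim: eventually_mono)
  ultimately have "(\<lambda>x. indicator U x * f x) \<in> borel_measurable lebesgue"
    by (rule borel_measurable_AE)
  with U show ?thesis
    by (subst borel_measurable_restrict_space_iff) auto
qed

lemma brep_integrable_iff:
  assumes U: "U \<in> sets borel" and f: "brep U f f'"
  shows "integrable (lebesgue_on U) f \<longleftrightarrow> integrable lborel f'"
    and "integral\<^sup>L (lebesgue_on U) f = integral\<^sup>L lborel f'"
proof -
  have f'[measurable]: "f' \<in> borel_measurable borel" using f by (rule brep_measurable)
  have f'l: "f' \<in> borel_measurable lebesgue" by (simp add: measurable_completion)
  have m: "(\<lambda>x. indicator U x * f x) \<in> borel_measurable lebesgue"
    using brep_measurable_lebesgue_on[OF U f] U by (subst (asm) borel_measurable_restrict_space_iff) auto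
  have "integrable (lebesgue_on U) f \<longleftrightarrow> integrable lebesgue (\<lambda>x. indicator U x * f x)"
    using U by (subst integrable_restrict_space) auto
  also have "\<dots> \<longleftrightarrow> integrable lebesgue f'"
    by (rule integrable_cong_AE[OF m f'l brep_AE_lebesgue[OF U f]])
  also have "\<dots> \<longleftrightarrow> integrable lborel f'" by (simp add: integrable_completion)
  finally show "integrable (lebesgue_on U) f \<longleftrightarrow> integrable lborel f'" .
  have "integral\<^sup>L (lebesgue_on U) f = integral\<^sup>L lebesgue (\<lambda>x. indicator U x * f x)"
    using U by (subst integral_restrict_space) auto
  also have "\<dots> = integral\<^sup>L lebesgue f'"
    by (rule integral_cong_AE[OF m f'l brep_AE_lebesgue[OF U f]])
  also have "\<dots> = integral\<^sup>L lborel f'" by (simp add: integral_completion)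
  finally show "integral\<^sup>L (lebesgue_on U) f = integral\<^sup>L lborel f'" .
qed

text \<open>The normalisation \<open>F 0 0 = 0\<close> is what preserves vanishing outside
  \<open>U\<close>.\<close>

lemma brep_comp2:
  assumes f: "brep U f f'" and g: "brep U g g'"
    and [measurable]: "(\<lambda>p. F (fst p) (snd p)) \<in> borel_measurable borel" and F0: "F 0 0 = 0"
  shows "brep U (\<lambda>x. F (f x) (g x)) (\<lambda>x. F (f' x) (g' x))"
proof -
  have [measurable]: "f' \<in> borel_measurable borel" "g' \<in> borel_measurable borel"
    using f g brep_measurable by auto
  have "(\<lambda>x. (\<lambda>p. F (fst p) (snd p)) (f' x, g' x)) \<in> borel_measurable borel"
    by measurable
  moreover have "AE x in lborel. x \<in> U \<longrightarrow> F (f x) (g x) = F (f' x) (g' x)"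
    using brep_AE[OF f] brep_AE[OF g] by eventually_elim auto
  ultimately show ?thesis
    using brep_outside[OF f] brep_outside[OF g] F0 by (simp add: brep_def)
qed

lemma brep_comp:
  assumes f: "brep U f f'" and [measurable]: "F \<in> borel_measurable borel" and F0: "F 0 = 0"
  shows "brep U (\<lambda>x. F (f x)) (\<lambda>x. F (f' x))"
proof -
  have "(\<lambda>p::real \<times> real. F (fst p)) \<in> borel_measurable borel"
    unfolding borel_prod[symmetric] by measurable
  from brep_comp2[OF f f this] F0 show ?thesis by simp
qed

lemma brep_add: "brep U f f' \<Longrightarrow> brep U g g' \<Longrightarrow> brep U (\<lambda>x. f x + g x) (\<lambda>x. f' x + g' x)"
  by (rule brep_comp2[where F="\<lambda>x y. x + y"]) (auto intro!: borel_measurable_continuous_onI continuous_intros)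

lemma brep_diff: "brep U f f' \<Longrightarrow> brep U g g' \<Longrightarrow> brep U (\<lambda>x. f x - g x) (\<lambda>x. f' x - g' x)"
  by (rule brep_comp2[where F="\<lambda>x y. x - y"]) (auto intro!: borel_measurable_continuous_onI continuous_intros)

lemma brep_sum: "finite I \<Longrightarrow> (\<And>i. i \<in> I \<Longrightarrow> brep U (f i) (f' i)) \<Longrightarrow>
    brep U (\<lambda>x. \<Sum>i\<in>I. f i x) (\<lambda>x. \<Sum>i\<in>I. f' i x)"
proof (induction rule: finite_induct)
  case empty
  then show ?case by (simp add: brep_def)
next
  case (insert i I)
  then show ?case by (simp add: brep_add)
qed

lemma brep_mult_borel:
  assumes f: "brep U f f'" and [measurable]: "\<phi> \<in> borel_measurable borel"
  shows "brep U (\<lambda>x. f x * \<phi> x) (\<lambda>x. f' x * \<phi> x)"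
proof -
  have [measurable]: "f' \<in> borel_measurable borel" using f by (rule brep_measurable)
  show ?thesis
    using f unfolding brep_def by (auto elim: eventually_mono)
qed

lemma brep_unique: "brep U f f' \<Longrightarrow> brep U f f'' \<Longrightarrow> AE x in lborel. f' x = f'' x"
  using brep_AE[of U f f'] brep_AE[of U f f''] brep_outside[of U f f'] brep_outside[of U f f'']
  by (auto elim!: eventually_elim2)

lemma brep_nonneg:
  assumes f: "brep U f f'" and nn: "AE x in lborel. x \<in> U \<longrightarrow> f x \<ge> 0"
  shows "AE x in lborel. f' x \<ge> 0"
  using brep_AE[OF f] nn
proof eventually_elim
  case (elim x)
  then show ?case using brep_outside[OF f, of x] by (cases "x \<in> U") auto
qed

lemma brep_Lsp_iff:
  assumes U: "U \<in> sets borel" and f: "brep U f f'"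
  shows "f \<in> Lsp q U \<longleftrightarrow> integrable lborel (\<lambda>x. \<bar>f' x\<bar> powr q)"
  using brep_integrable_iff(1)[OF U brep_comp[OF f, of "\<lambda>x. \<bar>x\<bar> powr q"]] brep_measurable_lebesgue_on[OF U f]
  by (simp add: Lsp_def)

section \<open>Uniqueness of weak derivatives\<close>

definition rat_points :: "'a::euclidean_space set" where
  "rat_points = {a. \<forall>i\<in>Basis. a \<bullet> i \<in> \<rat>}"

lemma countable_rat_points: "countable (rat_points :: 'a::euclidean_space set)"
proof -
  have "(rat_points :: 'a set) \<subseteq> (\<lambda>f. \<Sum>i\<in>Basis. f i *\<^sub>R i) ` (Basis \<rightarrow>\<^sub>E \<rat>)"
  proof
    fix a :: 'a assume "a \<in> rat_points"
    then show "a \<in> (\<lambda>f. \<Sum>i\<in>Basis. f i *\<^sub>R i) ` (Basis \<rightarrow>\<^sub>E \<rat>)"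
      by (intro image_eqI[of _ _ "restrict (\<lambda>i. a \<bullet> i) Basis"])
         (auto simp: rat_points_def euclidean_representation)
  qed
  moreover have "countable ((\<lambda>f. \<Sum>i\<in>Basis. f i *\<^sub>R i) ` (Basis \<rightarrow>\<^sub>E \<rat>) :: 'a set)"
    by (intro countable_image countable_PiE) (auto simp: countable_rat)
  ultimately show ?thesis by (rule countable_subset)
qed

text \<open>A countable base of the topology that is stable under intersections: the latter for the
  uniqueness of measures, the former so that exceptional null sets can be united.\<close>

definition rat_boxes :: "'a::euclidean_space set set" where
  "rat_boxes = {box a c | a c. a \<in> rat_points \<and> c \<in> rat_points}"

lemma countable_rat_boxes: "countable (rat_boxes :: 'a::euclidean_space set set)"
proof -
  have *: "(rat_boxes :: 'a set set) = (\<lambda>(a, c). box a c) ` (rat_points \<times> rat_points)"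
    by (auto simp: rat_boxes_def)
  show ?thesis
    unfolding * by (intro countable_image countable_SIGMA countable_rat_points)
qed

lemma rat_boxes_basis: "topological_basis (rat_boxes :: 'a::euclidean_space set set)"
proof (rule topological_basisI)
  fix O' :: "'a set" and x assume "open O'" "x \<in> O'"
  then obtain e where e: "e > 0" "ball x e \<subseteq> O'" by (auto simp: open_contains_ball)
  from rational_boxes[OF e(1)] obtain a b where
    "\<forall>i\<in>Basis. a \<bullet> i \<in> \<rat> \<and> b \<bullet> i \<in> \<rat>" "x \<in> box a b" "box a b \<subseteq> ball x e" by blast
  with e(2) show "\<exists>B'\<in>rat_boxes. x \<in> B' \<and> B' \<subseteq> O'"
    unfolding rat_boxes_def rat_points_def by blast
qed (auto simp: rat_boxes_def)

text \<open>The measures with densities w^+ and w^- agree on an intersection-stable generator of the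
  Borel sets, hence everywhere, and densities are unique up to null sets.\<close>

lemma AE_eq_0_if_rat_boxes:
  fixes w :: "'a::euclidean_space \<Rightarrow> real"
  assumes w: "integrable lborel w"
    and 0: "\<And>a c. a \<in> rat_points \<Longrightarrow> c \<in> rat_points \<Longrightarrow> (\<integral>x. w x * indicator (box a c) x \<partial>lborel) = 0"
  shows "AE x in lborel. w x = 0"
proof -
  have [measurable]: "w \<in> borel_measurable borel" using w by auto
  have sets_eq: "sets borel = sigma_sets UNIV (rat_boxes :: 'a set set)"
    by (simp add: borel_eq_countable_basis[OF countable_rat_boxes rat_boxes_basis])
  define f where "f x = ennreal (max 0 (w x))" for x
  define g where "g x = ennreal (max 0 (- w x))" for x
  have [measurable]: "f \<in> borel_measurable borel" "g \<in> borel_measurable borel"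
    unfolding f_def g_def by auto
  have int: "integrable lborel (\<lambda>x. max 0 (w x))" "integrable lborel (\<lambda>x. max 0 (- w x))"
    using w by auto
  have int': "integrable lborel (\<lambda>x. max 0 (w x) * indicator X x)"
    "integrable lborel (\<lambda>x. max 0 (- w x) * indicator X x)"
    "integrable lborel (\<lambda>x. w x * indicator X x)" if [measurable]: "X \<in> sets borel" for X
    using that int w by (auto intro!: integrable_real_mult_indicator)
  have em: "emeasure (density lborel f) X = ennreal (\<integral>x. max 0 (w x) * indicator X x \<partial>lborel)"
    "emeasure (density lborel g) X = ennreal (\<integral>x. max 0 (- w x) * indicator X x \<partial>lborel)"
    if X[measurable]: "X \<in> sets borel" for X
    using int'[OF X]
    by (auto simp: emeasure_density f_def g_def nn_integral_eq_integral[symmetric] ennreal_mult ennreal_indicator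
        intro!: nn_integral_cong split: split_indicator)
  have "density lborel f = density lborel g"
  proof (rule measure_eqI_generator_eq_countable[where E="rat_boxes" and \<Omega>=UNIV and A=rat_boxes])
    show "Int_stable (rat_boxes :: 'a set set)"
    proof (rule Int_stableI)
      fix X Y :: "'a set" assume "X \<in> rat_boxes" "Y \<in> rat_boxes"
      then obtain a b c d where "X = box a b" "Y = box c d"
        "a \<in> rat_points" "b \<in> rat_points" "c \<in> rat_points" "d \<in> rat_points"
        by (auto simp: rat_boxes_def)
      then show "X \<inter> Y \<in> rat_boxes"
        unfolding rat_boxes_def mem_Collect_eq
        by (intro exI[of _ "\<Sum>i\<in>Basis. max (a\<bullet>i) (c\<bullet>i) *\<^sub>R i"] exI[of _ "\<Sum>i\<in>Basis. min (b\<bullet>i) (d\<bullet>i) *\<^sub>R i"])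
           (auto simp: box_Int_box rat_points_def max_def min_def)
    qed
    fix X :: "'a set" assume "X \<in> rat_boxes"
    then obtain a c where X: "X = box a c" "a \<in> rat_points" "c \<in> rat_points" by (auto simp: rat_boxes_def)
    have "0 = (\<integral>x. w x * indicator X x \<partial>lborel)" using 0 X by simp
    also have "\<dots> = (\<integral>x. max 0 (w x) * indicator X x - max 0 (- w x) * indicator X x \<partial>lborel)"
      by (rule Bochner_Integration.integral_cong) (auto simp: max_def split: split_indicator)
    also have "\<dots> = (\<integral>x. max 0 (w x) * indicator X x \<partial>lborel) - (\<integral>x. max 0 (- w x) * indicator X x \<partial>lborel)"
      using X by (intro Bochner_Integration.integral_diff int') auto
    finally show "emeasure (density lborel f) X = emeasure (density lborel g) X"
      using X by (simp add: em)
  next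
    show "\<Union>(rat_boxes :: 'a set set) = UNIV"
      using topological_basisE[OF rat_boxes_basis open_UNIV] by (metis UNIV_I UNIV_eq_I UnionI)
    show "emeasure (density lborel f) a \<noteq> \<infinity>" if "a \<in> rat_boxes" for a
      using that by (auto simp: em rat_boxes_def)
  qed (auto simp: sets_eq countable_rat_boxes)
  then have "AE x in lborel. f x = g x"
    by (subst (asm) sigma_finite_measure.density_unique_iff[OF sigma_finite_lborel]) auto
  then show ?thesis
    by eventually_elim (auto simp: f_def g_def max_def split: if_splits)
qed

text \<open>Countably many test functions that decide whether a locally integrable function
  vanishes. Countability later allows one exceptional set of times to serve all test
  functions.\<close>

definition rat_bumps :: "'a::euclidean_space set \<Rightarrow> ('a \<Rightarrow> real) set" where
  "rat_bumps U = {box_bump a c k | a c k. a \<in> rat_points \<and> c \<in> rat_points \<and> cbox a c \<subseteq> U}"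

lemma countable_rat_bumps: "countable (rat_bumps U)"
proof -
  have "rat_bumps U \<subseteq> (\<lambda>(a, c, k). box_bump a c k) ` (rat_points \<times> rat_points \<times> UNIV)"
    unfolding rat_bumps_def by force
  then show ?thesis by (rule countable_subset) (simp add: countable_rat_points)
qed

lemma rat_bumps_subset: "rat_bumps U \<subseteq> test_fun U"
  by (auto simp: rat_bumps_def intro: test_fun_box_bump)

text \<open>The fundamental lemma of the calculus of variations, for countably many test functions.
  Letting k tend to infinity turns bumps into indicators of boxes; the criterion on rational boxes
  is then applied inside each of the countably many boxes that cover \<open>U\<close>.\<close>

lemma AE_eq_0_if_rat_bumps:
  fixes w :: "'a::euclidean_space \<Rightarrow> real"
  assumes U: "open U" and [measurable]: "w \<in> borel_measurable borel"
    and int: "\<And>K. compact K \<Longrightarrow> K \<subseteq> U \<Longrightarrow> integrable lborel (\<lambda>x. indicator K x * w x)"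
    and 0: "\<And>\<phi>. \<phi> \<in> rat_bumps U \<Longrightarrow> (\<integral>x. w x * \<phi> x \<partial>lborel) = 0"
  shows "AE x in lborel. x \<in> U \<longrightarrow> w x = 0"
proof -
  have box0: "(\<integral>x. w x * indicator (box a c) x \<partial>lborel) = 0"
    if a: "a \<in> rat_points" "c \<in> rat_points" "cbox a c \<subseteq> U" for a c
  proof -
    have "(\<lambda>k. \<integral>x. w x * box_bump a c k x \<partial>lborel) \<longlonglongrightarrow> (\<integral>x. w x * indicator (box a c) x \<partial>lborel)"
    proof (rule integral_dominated_convergence[where w="\<lambda>x. \<bar>indicator (cbox a c) x * w x\<bar>"])
      show "integrable lborel (\<lambda>x. \<bar>indicator (cbox a c) x * w x\<bar>)"
        using int[of "cbox a c"] a by auto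
      show "AE x in lborel. (\<lambda>k. w x * box_bump a c k x) \<longlonglongrightarrow> w x * indicator (box a c) x"
        by (intro AE_I2 tendsto_mult tendsto_const box_bump_tendsto)
      show "AE x in lborel. norm (w x * box_bump a c k x) \<le> \<bar>indicator (cbox a c) x * w x\<bar>" for k
      proof (rule AE_I2)
        fix x show "norm (w x * box_bump a c k x) \<le> \<bar>indicator (cbox a c) x * w x\<bar>"
          using box_bump_bounds[of a c k x] box_bump_eq_0[of x a c k] subsetD[OF box_subset_cbox, of x a c]
          by (cases "x \<in> box a c") (auto simp: abs_mult intro: mult_left_le)
      qed
      show "(\<lambda>x. w x * box_bump a c k x) \<in> borel_measurable lborel" for k
        using test_fun_measurable[OF test_fun_box_bump[of a c UNIV k]] by auto
    qed auto
    moreover have "box_bump a c k \<in> rat_bumps U" for k using a by (auto simp: rat_bumps_def)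
    ultimately show ?thesis by (simp add: 0 LIMSEQ_const_iff)
  qed
  let ?R = "{X. \<exists>a c. X = box a c \<and> a \<in> rat_points \<and> c \<in> rat_points \<and> cbox a c \<subseteq> U}"
  have "countable ?R"
    by (rule countable_subset[OF _ countable_rat_boxes]) (auto simp: rat_boxes_def)
  moreover have "AE x in lborel. x \<in> X \<longrightarrow> w x = 0" if X0: "X \<in> ?R" for X
  proof -
    obtain a c where X: "X = box a c" "a \<in> rat_points" "c \<in> rat_points" "cbox a c \<subseteq> U"
      using X0 by blast
    have X_cbox: "X \<subseteq> cbox a c" using box_subset_cbox X by auto
    have [measurable]: "X \<in> sets borel" using X by simp
    \<comment> \<open>Cutting \<open>w\<close> off at \<open>X\<close> makes it integrable on the
      whole space, as the criterion on rational boxes requires.\<close>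
    have "integrable lborel (\<lambda>x. (indicator (cbox a c) x * w x) * indicator X x)"
      using int[of "cbox a c"] X by (intro integrable_real_mult_indicator) auto
    then have "integrable lborel (\<lambda>x. w x * indicator X x)"
      by (rule Bochner_Integration.integrable_cong[THEN iffD1, rotated -1])
         (use X_cbox in \<open>auto split: split_indicator\<close>)
    then have "AE x in lborel. w x * indicator X x = 0"
    proof (rule AE_eq_0_if_rat_boxes)
      fix a' c' :: 'a assume r: "a' \<in> rat_points" "c' \<in> rat_points"
      \<comment> \<open>The corners of the intersection of the two boxes, which is again rational,
        with closed box inside \<open>U\<close>.\<close>
      define l u where "l = (\<Sum>i\<in>Basis. max (a\<bullet>i) (a'\<bullet>i) *\<^sub>R i)" "u = (\<Sum>i\<in>Basis. min (c\<bullet>i) (c'\<bullet>i) *\<^sub>R i)"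
      have lu: "l \<in> rat_points" "u \<in> rat_points" "X \<inter> box a' c' = box l u" "cbox l u \<subseteq> U"
        using X r Int_interval[of a c a' c'] by (auto simp: l_u_def box_Int_box rat_points_def max_def min_def)
      have "(\<integral>x. w x * indicator X x * indicator (box a' c') x \<partial>lborel)
          = (\<integral>x. w x * indicator (box l u) x \<partial>lborel)"
        by (rule Bochner_Integration.integral_cong) (auto simp: lu(3)[symmetric] split: split_indicator)
      with box0[OF lu(1,2,4)] show "(\<integral>x. w x * indicator X x * indicator (box a' c') x \<partial>lborel) = 0"
        by simp
    qed
    then show ?thesis by eventually_elim auto
  qed
  ultimately have "AE x in lborel. \<forall>X\<in>?R. x \<in> X \<longrightarrow> w x = 0"
    by (simp only: AE_ball_countable) simp
  moreover have "\<exists>X\<in>?R. x \<in> X" if xU: "x \<in> U" for x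
  proof -
    obtain e where e: "e > 0" "ball x e \<subseteq> U" using U xU unfolding open_contains_ball by blast
    \<comment> \<open>Half the radius leaves room for the closure of the box inside
      \<open>U\<close>.\<close>
    then have "e / 2 > 0" by simp
    from rational_boxes[OF this] obtain a c where
      ac: "a \<in> rat_points" "c \<in> rat_points" "x \<in> box a c" "box a c \<subseteq> ball x (e/2)"
      unfolding rat_points_def by blast
    have "cbox a c = closure (box a c)" using ac(3) by (subst closure_box) auto
    also have "\<dots> \<subseteq> cball x (e/2)" using ac(4) by (intro closure_minimal) (auto simp: subset_eq)
    also have "\<dots> \<subseteq> ball x e" using e(1) by auto
    finally show ?thesis using ac e(2) by blast
  qed
  ultimately show ?thesis by (auto elim!: eventually_mono)
qed

section \<open>Local integrability and the uniqueness of weak derivatives\<close>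

lemma locally_integrable_measurable:
  assumes U: "open U" and f: "locally_integrable U f"
  shows "f \<in> borel_measurable (lebesgue_on U)"
proof -
  \<comment> \<open>Local integrability speaks about compact sets only; a countable cover of
    \<open>U\<close> by closed boxes glues the pieces together.\<close>
  obtain \<D> where \<D>: "countable \<D>" "\<D> \<subseteq> Pow U" "\<And>X. X \<in> \<D> \<Longrightarrow> \<exists>a b. X = cbox a b" "\<Union>\<D> = U"
    using open_countable_Union_open_cbox[OF U] by metis
  show ?thesis
  proof (rule measurable_piecewise_restrict[OF \<D>(1)])
    fix X assume X: "X \<in> \<D>"
    then obtain a b where ab: "X = cbox a b" using \<D> by blast
    have XU: "X \<subseteq> U" using X \<D> by auto
    show "X \<inter> space (lebesgue_on U) \<in> sets (lebesgue_on U)"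
      using U XU ab by (auto simp: sets_restrict_space intro!: image_eqI[of _ _ X])
    have "f absolutely_integrable_on X"
      using f XU ab unfolding locally_integrable_def by auto
    then have "(\<lambda>x. indicator X x *\<^sub>R f x) \<in> borel_measurable lebesgue"
      unfolding set_integrable_def by (rule borel_measurable_integrable)
    then have "f \<in> borel_measurable (lebesgue_on X)"
      using ab by (subst borel_measurable_restrict_space_iff) auto
    moreover have "restrict_space (lebesgue_on U) X = lebesgue_on X"
      using XU U ab by (subst restrict_restrict_space) (auto simp: Int_absorb1)
    ultimately show "f \<in> borel_measurable (restrict_space (lebesgue_on U) X)" by simp
  qed (use \<D> in auto)
qed

lemma brep_locally_integrable:
  assumes U: "open U" and f: "locally_integrable U f" and r: "brep U f f'"
    and K: "compact K" "K \<subseteq> U"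
  shows "integrable lborel (\<lambda>x. indicator K x * f' x)"
proof -
  have Kb: "K \<in> sets borel" using borel_closed[OF compact_imp_closed[OF K(1)]] by simp
  have "integrable lebesgue (\<lambda>x. indicator K x * f x)"
    using f K unfolding locally_integrable_def set_integrable_def by auto
  then have i: "integrable (lebesgue_on K) f"
    using Kb by (subst integrable_restrict_space) auto
  have "brep K f (\<lambda>x. indicator K x * f' x)"
    using brep_measurable[OF r] brep_AE[OF r] Kb K(2)
    unfolding brep_def by (auto elim!: eventually_mono)
  from brep_integrable_iff(1)[OF Kb this] i show ?thesis by simp
qed

lemma integrable_mult_test_fun:
  assumes w[measurable]: "w \<in> borel_measurable borel"
    and int: "\<And>K. compact K \<Longrightarrow> K \<subseteq> U \<Longrightarrow> integrable lborel (\<lambda>x. indicator K x * w x)"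
    and \<phi>: "\<phi> \<in> test_fun U"
  shows "integrable lborel (\<lambda>x. w x * \<phi> x)"
proof -
  obtain K where K: "compact K" "K \<subseteq> U" "\<And>x. x \<notin> K \<Longrightarrow> \<phi> x = 0" using test_fun_support[OF \<phi>] by blast
  obtain B where B: "B > 0" "\<And>x. \<bar>\<phi> x\<bar> \<le> B" using test_fun_bounded[OF \<phi>] by blast
  have "integrable lborel (\<lambda>x. B * (indicator K x * w x))" using int[OF K(1,2)] by simp
  then show ?thesis
  proof (rule Bochner_Integration.integrable_bound)
    show "(\<lambda>x. w x * \<phi> x) \<in> borel_measurable lborel" using test_fun_measurable[OF \<phi>] by auto
    show "AE x in lborel. norm (w x * \<phi> x) \<le> norm (B * (indicator K x * w x))"
    proof (rule AE_I2)
      fix x show "norm (w x * \<phi> x) \<le> norm (B * (indicator K x * w x))"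
        using K(3)[of x] B(2)[of x] B(1)
        by (cases "x \<in> K") (auto simp: abs_mult mult.commute intro: mult_right_mono)
    qed
  qed
qed

lemma has_weak_deriv_unique:
  fixes f :: "'a::euclidean_space \<Rightarrow> real"
  assumes U: "open U" and 1: "has_weak_deriv U b f h1" and 2: "has_weak_deriv U b f h2"
  shows "AE x in lebesgue_on U. h1 x = h2 x"
proof -
  have Ub: "U \<in> sets borel" using U by simp
  have li: "locally_integrable U h1" "locally_integrable U h2"
    using 1 2 by (auto simp: has_weak_deriv_def)
  obtain h1' h2' where r: "brep U h1 h1'" "brep U h2 h2'"
    using brep_exists[OF Ub locally_integrable_measurable[OF U li(1)]]
      brep_exists[OF Ub locally_integrable_measurable[OF U li(2)]] by blast
  have [measurable]: "h1' \<in> borel_measurable borel" "h2' \<in> borel_measurable borel"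
    using r brep_measurable by auto
  note int = brep_locally_integrable[OF U li(1) r(1)] brep_locally_integrable[OF U li(2) r(2)]
  have "AE x in lborel. x \<in> U \<longrightarrow> h1' x - h2' x = 0"
  proof (rule AE_eq_0_if_rat_bumps[OF U])
    fix K assume "compact K" "K \<subseteq> U"
    then show "integrable lborel (\<lambda>x. indicator K x * (h1' x - h2' x))"
      using int by (auto simp: right_diff_distrib)
  next
    fix \<phi> :: "'a \<Rightarrow> real" assume "\<phi> \<in> rat_bumps U"
    then have \<phi>: "\<phi> \<in> test_fun U" using rat_bumps_subset by auto
    note [measurable] = test_fun_measurable[OF \<phi>]
    have "(\<integral>x. h1 x * \<phi> x \<partial>lebesgue_on U) = (\<integral>x. h2 x * \<phi> x \<partial>lebesgue_on U)"
      using 1 2 \<phi> by (auto simp: has_weak_deriv_def)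
    then have "(\<integral>x. h1' x * \<phi> x \<partial>lborel) = (\<integral>x. h2' x * \<phi> x \<partial>lborel)"
      using brep_integrable_iff(2)[OF Ub brep_mult_borel[OF r(1), of \<phi>]]
        brep_integrable_iff(2)[OF Ub brep_mult_borel[OF r(2), of \<phi>]] by simp
    then show "(\<integral>x. (h1' x - h2' x) * \<phi> x \<partial>lborel) = 0"
      using integrable_mult_test_fun[OF _ int(1) \<phi>] integrable_mult_test_fun[OF _ int(2) \<phi>]
      by (simp add: left_diff_distrib)
  qed auto
  with brep_AE[OF r(1)] brep_AE[OF r(2)] show ?thesis
    unfolding AE_lebesgue_on_iff[OF Ub] by eventually_elim auto
qed

lemma has_weak_deriv_weak_deriv: "has_weak_deriv U b f h \<Longrightarrow> has_weak_deriv U b f (weak_deriv U b f)"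
  unfolding weak_deriv_def by (rule someI[of "has_weak_deriv U b f"])

lemma weak_deriv_AE_eq:
  "open U \<Longrightarrow> has_weak_deriv U b f h \<Longrightarrow> AE x in lebesgue_on U. weak_deriv U b f x = h x"
  by (rule has_weak_deriv_unique[OF _ has_weak_deriv_weak_deriv])

section \<open>Iterated integrals\<close>

lemma AE_lborel_swap:
  fixes P :: "'a::euclidean_space \<times> 'b::euclidean_space \<Rightarrow> bool"
  assumes "AE z in lborel. P z"
  shows "AE y in lborel. AE x in lborel. P (x, y)"
proof -
  \<comment> \<open>The set where \<open>P\<close> fails may be non-measurable. A Borel null set
    containing it can be treated by exchanging the order of the quantifiers.\<close>
  obtain N where N: "N \<in> sets (lborel :: ('a \<times> 'b) measure)" "emeasure lborel N = 0" "{z. \<not> P z} \<subseteq> N"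
    using assms unfolding eventually_ae_filter by (auto simp: null_sets_def)
  have "AE z in (lborel :: ('a \<times> 'b) measure). z \<notin> N"
    using N by (intro AE_not_in) auto
  then have "AE x in (lborel :: 'a measure). AE y in (lborel :: 'b measure). (x, y) \<notin> N"
    unfolding lborel_prod[symmetric] by (rule lborel_pair.AE_pair)
  moreover have "{z \<in> space (lborel \<Otimes>\<^sub>M lborel :: ('a \<times> 'b) measure). (fst z, snd z) \<notin> N} \<in> sets (lborel \<Otimes>\<^sub>M lborel)"
    using N(1) unfolding lborel_prod by simp
  ultimately have "AE y in (lborel :: 'b measure). AE x in (lborel :: 'a measure). (x, y) \<notin> N"
    using lborel_pair.AE_commute[of "\<lambda>x y. (x, y) \<notin> N"] by simp
  then show ?thesis
    by eventually_elim (use N(3) in \<open>auto elim!: eventually_mono\<close>)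
qed

text \<open>In contrast to the passage from the product to sections, this direction relies on
  measurability: null sections alone do not make a set null.\<close>

lemma AE_lborel_prodI:
  fixes P :: "'a::euclidean_space \<times> 'b::euclidean_space \<Rightarrow> bool"
  assumes m: "{z. P z} \<in> sets borel" and ae: "AE y in lborel. AE x in lborel. P (x, y)"
  shows "AE z in lborel. P z"
proof -
  have m': "{z \<in> space (lborel \<Otimes>\<^sub>M lborel :: ('a \<times> 'b) measure). P (fst z, snd z)} \<in> sets (lborel \<Otimes>\<^sub>M lborel)"
    using m unfolding lborel_prod by simp
  then have "AE x in (lborel :: 'a measure). AE y in (lborel :: 'b measure). P (x, y)"
    using ae lborel_pair.AE_commute[of "\<lambda>x y. P (x, y)"] by simp
  then have "AE z in lborel \<Otimes>\<^sub>M lborel. P (fst z, snd z)"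
    using lborel_pair.AE_pair_iff[of "\<lambda>x y. P (x, y)", OF m'] by blast
  then show ?thesis unfolding lborel_prod by simp
qed

lemma integrable_lborel_swap:
  fixes f :: "'a::euclidean_space \<times> 'b::euclidean_space \<Rightarrow> real"
  shows "integrable lborel (\<lambda>(y, x). f (x, y)) \<longleftrightarrow> integrable lborel f"
  using lborel_pair.integrable_product_swap_iff[of f] by (simp add: lborel_prod)

text \<open>The first coordinate is integrated first: at space-time points this is integration over
  space at a fixed time.\<close>

lemma lborel_fubini:
  fixes f :: "'a::euclidean_space \<times> 'b::euclidean_space \<Rightarrow> real"
  assumes f: "integrable lborel f"
  shows "AE y in lborel. integrable lborel (\<lambda>x. f (x, y))"
    and "integrable lborel (\<lambda>y. \<integral>x. f (x, y) \<partial>lborel)"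
    and "(\<integral>y. \<integral>x. f (x, y) \<partial>lborel \<partial>lborel) = (\<integral>z. f z \<partial>lborel)"
proof -
  have i: "integrable (lborel \<Otimes>\<^sub>M lborel) (\<lambda>(y, x). f (x, y))"
    using f integrable_lborel_swap[of f] by (simp add: lborel_prod)
  show "AE y in lborel. integrable lborel (\<lambda>x. f (x, y))"
    using lborel_pair.AE_integrable_fst'[OF i] by simp
  show "integrable lborel (\<lambda>y. \<integral>x. f (x, y) \<partial>lborel)"
    using lborel_pair.integrable_fst'[OF i] by simp
  have "integral\<^sup>L (lborel \<Otimes>\<^sub>M lborel) (\<lambda>(y, x). f (x, y)) = integral\<^sup>L (lborel \<Otimes>\<^sub>M lborel) f"
    using f by (intro lborel_pair.integral_product_swap) (auto simp: lborel_prod)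
  then show "(\<integral>y. \<integral>x. f (x, y) \<partial>lborel \<partial>lborel) = (\<integral>z. f z \<partial>lborel)"
    using lborel_pair.integral_fst'[OF i] by (simp add: lborel_prod)
qed

lemma lborel_fubini_integrable:
  fixes f :: "'a::euclidean_space \<times> 'b::euclidean_space \<Rightarrow> real"
  assumes [measurable]: "f \<in> borel_measurable borel"
    and "AE y in lborel. integrable lborel (\<lambda>x. f (x, y))"
    and "integrable lborel (\<lambda>y. \<integral>x. \<bar>f (x, y)\<bar> \<partial>lborel)"
  shows "integrable lborel f"
proof -
  have "(\<lambda>z. f (snd z, fst z)) \<in> borel_measurable (borel \<Otimes>\<^sub>M borel)"
    using assms(1) by measurable
  then have "(\<lambda>(y, x). f (x, y)) \<in> borel_measurable (lborel \<Otimes>\<^sub>M lborel)"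
    by (simp add: case_prod_beta' borel_prod lborel_prod)
  then have "integrable (lborel \<Otimes>\<^sub>M lborel) (\<lambda>(y, x). f (x, y))"
    using assms(2,3) by (intro lborel_pair.Fubini_integrable) auto
  then show ?thesis using integrable_lborel_swap[of f] by (simp add: lborel_prod)
qed

lemma borel_measurable_slice:
  fixes f :: "'a::euclidean_space \<times> 'b::euclidean_space \<Rightarrow> real"
  assumes [measurable]: "f \<in> borel_measurable borel"
  shows "(\<lambda>x. f (x, y)) \<in> borel_measurable borel"
  using assms by measurable

lemma borel_measurable_lborel_integral:
  fixes f :: "'a::euclidean_space \<times> 'b::euclidean_space \<Rightarrow> real"
  assumes "f \<in> borel_measurable borel"
  shows "(\<lambda>y. \<integral>x. f (x, y) \<partial>lborel) \<in> borel_measurable borel"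
proof -
  have "(\<lambda>z. f (snd z, fst z)) \<in> borel_measurable (borel \<Otimes>\<^sub>M borel)"
    using assms by measurable
  then have "case_prod (\<lambda>y x. f (x, y)) \<in> borel_measurable (borel \<Otimes>\<^sub>M lborel)"
    by (simp add: case_prod_beta')
  then show ?thesis by (rule lborel.borel_measurable_lebesgue_integral)
qed

section \<open>Integration by parts and product test functions\<close>

lemma has_weak_deriv_test_fun:
  fixes \<phi> :: "'a::euclidean_space \<Rightarrow> real"
  assumes U: "open U" and \<phi>: "\<phi> \<in> test_fun UNIV" and b: "b \<in> Basis"
  shows "has_weak_deriv U b \<phi> (dir_deriv b \<phi>)"
proof -
  have Ub: "U \<in> sets borel" using U by simp
  have li: "locally_integrable U \<psi>" if "\<psi> \<in> test_fun UNIV" for \<psi> :: "'a \<Rightarrow> real"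
  proof -
    have "integrable lebesgue \<psi>"
      using test_fun_integrable[OF that] test_fun_measurable[OF that] by (simp add: integrable_completion)
    then show ?thesis unfolding locally_integrable_def
      by (auto simp: set_integrable_def mult.commute intro!: integrable_real_mult_indicator
          dest!: borel_closed[OF compact_imp_closed])
  qed
  have "(\<integral>x. \<phi> x * dir_deriv b \<psi> x \<partial>lebesgue_on U) = - (\<integral>x. dir_deriv b \<phi> x * \<psi> x \<partial>lebesgue_on U)"
    if \<psi>: "\<psi> \<in> test_fun U" for \<psi>
  proof -
    obtain K where K: "compact K" "K \<subseteq> U" "\<And>x. x \<notin> K \<Longrightarrow> \<psi> x = 0" using test_fun_support[OF \<psi>] by blast
    have d: "dir_deriv b \<phi> \<in> test_fun UNIV" "dir_deriv b \<psi> \<in> test_fun U"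
      using \<phi> \<psi> b by (auto intro: test_fun_dir_deriv)
    have s: "smooth \<phi>" "smooth \<psi>" using \<phi> \<psi> by (auto intro: test_fun_imp_smooth)
    note [measurable] = test_fun_measurable[OF \<phi>] test_fun_measurable[OF \<psi>]
      test_fun_measurable[OF d(1)] test_fun_measurable[OF d(2)]
    have z: "\<psi> x = 0" "dir_deriv b \<psi> x = 0" if "x \<notin> U" for x
      using that K dir_deriv_zero_outside[where K=K and \<phi>=\<psi> and x=x and b=b, OF K(3) compact_imp_closed[OF K(1)]] by auto
    \<comment> \<open>The product is supported where \<psi> is, so \<phi> may reach across the
      boundary of \<open>U\<close>. That the derivative of the product has integral 0 is the
      integration by parts.\<close>
    have prod: "(\<lambda>x. \<phi> x * \<psi> x) \<in> test_fun UNIV"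
      using K smooth_intros(3)[OF s] by (intro test_funI[of _ K]) auto
    have prodi: "integrable lborel (\<lambda>x. f x * g x)" if "f \<in> test_fun UNIV" "g \<in> test_fun U" for f g :: "'a \<Rightarrow> real"
    proof -
      have "integrable lborel (\<lambda>x. indicator K x * f x)" if "compact K" for K
        using test_fun_integrable[OF \<open>f \<in> test_fun UNIV\<close>] borel_closed[OF compact_imp_closed[OF that]]
        by (subst mult.commute) (auto intro!: integrable_real_mult_indicator)
      then show ?thesis
        by (intro integrable_mult_test_fun[OF test_fun_measurable[OF that(1)] _ that(2)])
    qed
    have "0 = (\<integral>x. dir_deriv b (\<lambda>x. \<phi> x * \<psi> x) x \<partial>lborel)"
      using integral_dir_deriv_eq_0[OF prod b] by simp
    also have "\<dots> = (\<integral>x. \<phi> x * dir_deriv b \<psi> x + dir_deriv b \<phi> x * \<psi> x \<partial>lborel)"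
      using s by (intro Bochner_Integration.integral_cong) (auto simp: dir_deriv_mult smooth_imp_differentiable)
    also have "\<dots> = (\<integral>x. \<phi> x * dir_deriv b \<psi> x \<partial>lborel) + (\<integral>x. dir_deriv b \<phi> x * \<psi> x \<partial>lborel)"
      using \<phi> \<psi> d by (intro Bochner_Integration.integral_add prodi)
    finally have eq: "(\<integral>x. \<phi> x * dir_deriv b \<psi> x \<partial>lborel) = - (\<integral>x. dir_deriv b \<phi> x * \<psi> x \<partial>lborel)" by simp
    have "brep U (\<lambda>x. \<phi> x * dir_deriv b \<psi> x) (\<lambda>x. \<phi> x * dir_deriv b \<psi> x)"
      "brep U (\<lambda>x. dir_deriv b \<phi> x * \<psi> x) (\<lambda>x. dir_deriv b \<phi> x * \<psi> x)"
      using z unfolding brep_def by auto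
    with eq show ?thesis using brep_integrable_iff(2)[OF Ub] by metis
  qed
  with li[OF \<phi>] li[OF test_fun_dir_deriv[OF \<phi> b]] show ?thesis
    by (simp add: has_weak_deriv_def)
qed

lemma test_fun_product:
  assumes \<psi>: "\<psi> \<in> test_fun U" and \<eta>: "\<eta> \<in> test_fun V"
  shows "(\<lambda>z. \<psi> (fst z) * \<eta> (snd z)) \<in> test_fun (U \<times> V)"
proof -
  obtain K where K: "compact K" "K \<subseteq> U" "\<And>x. x \<notin> K \<Longrightarrow> \<psi> x = 0" using test_fun_support[OF \<psi>] by blast
  obtain L where L: "compact L" "L \<subseteq> V" "\<And>x. x \<notin> L \<Longrightarrow> \<eta> x = 0" using test_fun_support[OF \<eta>] by blast
  show ?thesis
  proof (rule test_funI[of _ "K \<times> L"])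
    show "smooth (\<lambda>z. \<psi> (fst z) * \<eta> (snd z))"
      by (intro smooth_intros(3) smooth_fst[OF test_fun_imp_smooth[OF \<psi>]] smooth_snd[OF test_fun_imp_smooth[OF \<eta>]])
    show "\<psi> (fst z) * \<eta> (snd z) = 0" if "z \<notin> K \<times> L" for z
      using that K(3)[of "fst z"] L(3)[of "snd z"] by (cases z) auto
    show "compact (K \<times> L)" "K \<times> L \<subseteq> U \<times> V" using K L by (auto intro: compact_Times)
  qed
qed

lemma dir_deriv_product:
  fixes \<psi> :: "'a::euclidean_space \<Rightarrow> real" and \<eta> :: "'b::euclidean_space \<Rightarrow> real"
  assumes "smooth \<psi>" "smooth \<eta>"
  shows "dir_deriv (b, c) (\<lambda>z. \<psi> (fst z) * \<eta> (snd z)) z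
    = dir_deriv b \<psi> (fst z) * \<eta> (snd z) + \<psi> (fst z) * dir_deriv c \<eta> (snd z)"
proof -
  have 1: "dir_deriv (b, c) (\<lambda>z. \<psi> (fst z)) z = dir_deriv b \<psi> (fst z)"
    using dir_deriv_eq[OF has_derivative_compose[OF bounded_linear_imp_has_derivative[OF bounded_linear_fst, of "at z"]
        differentiable_has_dir_deriv[OF smooth_imp_differentiable[OF assms(1)]]], of "(b, c)"]
    by simp
  have 2: "dir_deriv (b, c) (\<lambda>z. \<eta> (snd z)) z = dir_deriv c \<eta> (snd z)"
    using dir_deriv_eq[OF has_derivative_compose[OF bounded_linear_imp_has_derivative[OF bounded_linear_snd, of "at z"]
        differentiable_has_dir_deriv[OF smooth_imp_differentiable[OF assms(2)]]], of "(b, c)"]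
    by simp
  show ?thesis
    using smooth_fst[OF assms(1)] smooth_snd[OF assms(2)]
    by (subst dir_deriv_mult) (auto intro: smooth_imp_differentiable simp: 1 2 algebra_simps)
qed

section \<open>Lebesgue spaces\<close>

text \<open>A crude substitute for the Minkowski inequality, valid for every q > 0. The constant is
  harmless because only convergence to 0 is at stake later.\<close>

lemma powr_abs_add_le:
  fixes a b q :: real
  assumes "q > 0"
  shows "\<bar>a + b\<bar> powr q \<le> 2 powr q * (\<bar>a\<bar> powr q + \<bar>b\<bar> powr q)"
proof -
  have "\<bar>a + b\<bar> powr q \<le> (2 * max \<bar>a\<bar> \<bar>b\<bar>) powr q"
    using assms by (intro powr_mono2) auto
  also have "\<dots> = 2 powr q * (max \<bar>a\<bar> \<bar>b\<bar> powr q)" by (simp add: powr_mult)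
  also have "max \<bar>a\<bar> \<bar>b\<bar> powr q \<le> \<bar>a\<bar> powr q + \<bar>b\<bar> powr q" by (auto simp: max_def)
  finally show ?thesis by simp
qed

lemma integrable_powr_abs_add:
  fixes f g :: "'a \<Rightarrow> real"
  assumes q: "q > 0" and [measurable]: "f \<in> borel_measurable M" "g \<in> borel_measurable M"
    and f: "integrable M (\<lambda>x. \<bar>f x\<bar> powr q)" and g: "integrable M (\<lambda>x. \<bar>g x\<bar> powr q)"
  shows "integrable M (\<lambda>x. \<bar>f x + g x\<bar> powr q)"
    and "(\<integral>x. \<bar>f x + g x\<bar> powr q \<partial>M) \<le> 2 powr q * ((\<integral>x. \<bar>f x\<bar> powr q \<partial>M) + (\<integral>x. \<bar>g x\<bar> powr q \<partial>M))"
proof -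
  have i: "integrable M (\<lambda>x. 2 powr q * (\<bar>f x\<bar> powr q + \<bar>g x\<bar> powr q))" using f g by simp
  then show i': "integrable M (\<lambda>x. \<bar>f x + g x\<bar> powr q)"
    by (rule Bochner_Integration.integrable_bound) (auto intro: powr_abs_add_le[OF q])
  have "(\<integral>x. \<bar>f x + g x\<bar> powr q \<partial>M) \<le> (\<integral>x. 2 powr q * (\<bar>f x\<bar> powr q + \<bar>g x\<bar> powr q) \<partial>M)"
    by (intro integral_mono i i' powr_abs_add_le[OF q])
  then show "(\<integral>x. \<bar>f x + g x\<bar> powr q \<partial>M) \<le> 2 powr q * ((\<integral>x. \<bar>f x\<bar> powr q \<partial>M) + (\<integral>x. \<bar>g x\<bar> powr q \<partial>M))"
    using f g by simp
qed

lemma integrable_powr_abs_diff: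
  fixes f g :: "'a \<Rightarrow> real"
  assumes q: "q > 0" and [measurable]: "f \<in> borel_measurable M" "g \<in> borel_measurable M"
    and f: "integrable M (\<lambda>x. \<bar>f x\<bar> powr q)" and g: "integrable M (\<lambda>x. \<bar>g x\<bar> powr q)"
  shows "integrable M (\<lambda>x. \<bar>f x - g x\<bar> powr q)"
    and "(\<integral>x. \<bar>f x - g x\<bar> powr q \<partial>M) \<le> 2 powr q * ((\<integral>x. \<bar>f x\<bar> powr q \<partial>M) + (\<integral>x. \<bar>g x\<bar> powr q \<partial>M))"
  using integrable_powr_abs_add[OF q assms(2), of "\<lambda>x. - g x"] assms(3-) by auto

text \<open>Young's inequality with a free parameter stands in for Hoelder's inequality: multiplying
  one factor by \<open>e\<close> and dividing the other by it shifts weight between the two terms.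
  The divisors coming from the exponents exceed 1 and are dropped.\<close>

lemma Young_integral:
  fixes a d :: "'a \<Rightarrow> real"
  assumes p: "p > 1" and [measurable]: "a \<in> borel_measurable M" "d \<in> borel_measurable M"
    and a: "integrable M (\<lambda>x. \<bar>a x\<bar> powr (p / (p - 1)))" and d: "integrable M (\<lambda>x. \<bar>d x\<bar> powr p)"
  shows "integrable M (\<lambda>x. a x * d x)"
    and "e > 0 \<Longrightarrow> \<bar>\<integral>x. a x * d x \<partial>M\<bar> \<le> e powr (p / (p - 1)) * (\<integral>x. \<bar>a x\<bar> powr (p / (p - 1)) \<partial>M)
        + e powr (-p) * (\<integral>x. \<bar>d x\<bar> powr p \<partial>M)"
proof -
  define q where "q = p / (p - 1)"
  have q: "q > 1" using p by (simp add: q_def field_simps)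
  have pq: "1 / q + 1 / p = 1" using p by (simp add: q_def field_simps)
  have Y: "\<bar>a x * d x\<bar> \<le> e powr q * \<bar>a x\<bar> powr q + e powr (-p) * \<bar>d x\<bar> powr p" if e: "e > 0" for e x
  proof -
    have "\<bar>a x * d x\<bar> = (e * \<bar>a x\<bar>) * (\<bar>d x\<bar> / e)" using e by (simp add: abs_mult)
    also have "\<dots> \<le> (e * \<bar>a x\<bar>) powr q / q + (\<bar>d x\<bar> / e) powr p / p"
      using e by (intro Youngs_inequality[OF q p pq]) auto
    also have "\<dots> \<le> (e * \<bar>a x\<bar>) powr q + (\<bar>d x\<bar> / e) powr p"
    proof -
      have "y / r \<le> y" if "y \<ge> 0" "r > 1" for y r :: real
        using that mult_left_mono[of 1 r y] by (simp add: divide_le_eq)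
      then show ?thesis using p q by (intro add_mono) auto
    qed
    also have "\<dots> = e powr q * \<bar>a x\<bar> powr q + e powr (-p) * \<bar>d x\<bar> powr p"
      using e by (simp add: powr_mult powr_divide powr_minus divide_simps)
    finally show ?thesis .
  qed
  have i: "integrable M (\<lambda>x. e powr q * \<bar>a x\<bar> powr q + e powr (-p) * \<bar>d x\<bar> powr p)" for e
    using a d by (auto simp: q_def)
  show int: "integrable M (\<lambda>x. a x * d x)"
    by (rule Bochner_Integration.integrable_bound[OF i[of 1]])
       (use Y[of 1] in \<open>auto intro!: order_trans[OF _ abs_ge_self]\<close>)
  show "\<bar>\<integral>x. a x * d x \<partial>M\<bar> \<le> e powr (p / (p - 1)) * (\<integral>x. \<bar>a x\<bar> powr (p / (p - 1)) \<partial>M)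
        + e powr (-p) * (\<integral>x. \<bar>d x\<bar> powr p \<partial>M)" if e: "e > 0"
  proof -
    have "\<bar>\<integral>x. a x * d x \<partial>M\<bar> \<le> (\<integral>x. \<bar>a x * d x\<bar> \<partial>M)" by (rule integral_abs_bound)
    also have "\<dots> \<le> (\<integral>x. e powr q * \<bar>a x\<bar> powr q + e powr (-p) * \<bar>d x\<bar> powr p \<partial>M)"
      using int by (intro integral_mono i Y[OF e]) auto
    also have "\<dots> = e powr q * (\<integral>x. \<bar>a x\<bar> powr q \<partial>M) + e powr (-p) * (\<integral>x. \<bar>d x\<bar> powr p \<partial>M)"
      using a d by (simp add: q_def)
    finally show ?thesis by (simp add: q_def)
  qed
qed

text \<open>The parameter \<open>e\<close> is fixed first, so small that the term with
  \<open>a\<close> stays below half the tolerance; the remaining term then tends to 0.\<close>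

lemma tendsto_Lp_pairing_0:
  fixes a :: "'a \<Rightarrow> real" and d :: "'i \<Rightarrow> 'a \<Rightarrow> real"
  assumes p: "p > 1" and [measurable]: "a \<in> borel_measurable M" "\<And>i. d i \<in> borel_measurable M"
    and a: "integrable M (\<lambda>x. \<bar>a x\<bar> powr (p / (p - 1)))"
    and d: "eventually (\<lambda>i. integrable M (\<lambda>x. \<bar>d i x\<bar> powr p)) F"
    and lim: "((\<lambda>i. \<integral>x. \<bar>d i x\<bar> powr p \<partial>M) \<longlongrightarrow> 0) F"
  shows "((\<lambda>i. \<integral>x. a x * d i x \<partial>M) \<longlongrightarrow> 0) F"
proof (rule tendstoI)
  fix \<eta> :: real assume \<eta>: "\<eta> > 0"
  define q where "q = p / (p - 1)"
  have q: "q > 1" using p by (simp add: q_def field_simps)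
  define I where "I = (\<integral>x. \<bar>a x\<bar> powr q \<partial>M)"
  have I: "I \<ge> 0" by (simp add: I_def)
  \<comment> \<open>Solves \<open>e powr q * (I + 1) = \<eta> / 2\<close>; the added 1 keeps the
    denominator positive.\<close>
  define e where "e = (\<eta> / (2 * (I + 1))) powr (1 / q)"
  have e: "e > 0" using \<eta> I by (simp add: e_def)
  have "e powr q = \<eta> / (2 * (I + 1))" using \<eta> I q by (simp add: e_def powr_powr)
  then have "e powr q * I + e powr q = \<eta> / 2" using I by (simp add: field_simps)
  moreover have "e powr q > 0" using e by simp
  ultimately have 1: "e powr q * I < \<eta> / 2" by linarith
  have "eventually (\<lambda>i. (\<integral>x. \<bar>d i x\<bar> powr p \<partial>M) < \<eta> / 2 / e powr (-p)) F"
    using order_tendstoD(2)[OF lim, of "\<eta> / 2 / e powr (-p)"] \<eta> e by simp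
  with d show "eventually (\<lambda>i. dist (\<integral>x. a x * d i x \<partial>M) 0 < \<eta>) F"
  proof eventually_elim
    case (elim i)
    have "e powr (-p) * (\<integral>x. \<bar>d i x\<bar> powr p \<partial>M) < \<eta> / 2"
      using elim(2) e by (simp add: field_simps)
    with 1 Young_integral(2)[OF p assms(2,3) a elim(1) e] show ?case
      by (simp add: I_def q_def)
  qed
qed

text \<open>A measurable function is an a.e. limit of continuous ones, but without any control in
  size. Clamping the values and cutting off outside a ball restores a dominating function, for
  \<open>f\<close> and for its approximants alike.\<close>

lemma continuous_compact_support_Lp_dense:
  fixes f :: "'a::euclidean_space \<Rightarrow> real"
  assumes q: "q > 0" and f[measurable]: "f \<in> borel_measurable borel"
    and fi: "integrable lborel (\<lambda>x. \<bar>f x\<bar> powr q)" and \<eta>: "\<eta> > 0"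
  shows "\<exists>g R. continuous_on UNIV g \<and> (\<forall>x. x \<notin> cball 0 R \<longrightarrow> g x = 0) \<and>
    integrable lborel (\<lambda>x. \<bar>f x - g x\<bar> powr q) \<and> (\<integral>x. \<bar>f x - g x\<bar> powr q \<partial>lborel) < \<eta>"
proof -
  have "f \<in> borel_measurable lebesgue" by (simp add: measurable_completion)
  then have "f measurable_on UNIV" by (intro lebesgue_measurable_imp_measurable_on_real) auto
  then obtain N g where N: "negligible N" and g: "\<And>n. continuous_on UNIV (g n)"
    and lim: "\<And>x. x \<notin> N \<Longrightarrow> (\<lambda>n. g n x) \<longlonglongrightarrow> f x"
    unfolding measurable_on_def by auto
  have "AE x in lebesgue. x \<notin> N" using N by (simp add: negligible_iff_null_sets AE_not_in)
  then have aeN: "AE x in lborel. x \<notin> N" by (simp add: AE_completion_iff)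
  have gb[measurable]: "g n \<in> borel_measurable borel" for n
    using g by (rule borel_measurable_continuous_onI)
  \<comment> \<open>Continuous cut-off: 1 on the ball of radius \<open>M\<close>, 0 outside radius M
    + 1.\<close>
  define ct where "ct M x = max 0 (min 1 (M + 1 - norm x))" for M :: real and x :: 'a
  have ct: "0 \<le> ct M x" "ct M x \<le> 1" for M x by (auto simp: ct_def)
  have ct0: "ct M x = 0" if "x \<notin> cball 0 (M + 1)" for M x using that by (simp add: ct_def)
  have ctc: "continuous_on UNIV (ct M)" for M unfolding ct_def by (intro continuous_intros)
  then have [measurable]: "ct M \<in> borel_measurable borel" for M by (rule borel_measurable_continuous_onI)
  define cl where "cl M r = max (-M) (min M r)" for M r :: real
  define fM where "fM M x = cl M (f x) * ct M x" for M x
  define gM where "gM M n x = cl M (g n x) * ct M x" for M n x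
  have [measurable]: "fM M \<in> borel_measurable borel" "gM M n \<in> borel_measurable borel" for M n
    unfolding fM_def gM_def cl_def by auto
  have l1: "(\<lambda>m. \<integral>x. \<bar>f x - fM (real m) x\<bar> powr q \<partial>lborel) \<longlonglongrightarrow> (\<integral>x. 0 \<partial>(lborel :: 'a measure))"
  proof (rule integral_dominated_convergence[where w="\<lambda>x. \<bar>f x\<bar> powr q"])
    show "AE x in lborel. (\<lambda>m. \<bar>f x - fM (real m) x\<bar> powr q) \<longlonglongrightarrow> 0"
    proof (rule AE_I2)
      fix x
      have "eventually (\<lambda>m. real m > \<bar>f x\<bar> + norm x) sequentially"
        using filterlim_real_sequentially by (auto simp: filterlim_at_top_dense)
      then have "eventually (\<lambda>m. 0 = \<bar>f x - fM (real m) x\<bar> powr q) sequentially"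
      proof eventually_elim
        case (elim m)
        then have "\<bar>f x\<bar> \<le> real m" "norm x \<le> real m"
          using norm_ge_zero[of x] abs_ge_zero[of "f x"] by linarith+
        then have "cl (real m) (f x) = f x" "ct (real m) x = 1"
          by (auto simp: cl_def ct_def max_def min_def)
        then show ?case by (simp add: fM_def)
      qed
      then show "(\<lambda>m. \<bar>f x - fM (real m) x\<bar> powr q) \<longlonglongrightarrow> 0"
        by (rule Lim_transform_eventually[OF tendsto_const])
    qed
    show "AE x in lborel. norm (\<bar>f x - fM (real m) x\<bar> powr q) \<le> \<bar>f x\<bar> powr q" for m
    proof (rule AE_I2)
      fix x
      define c where "c = cl (real m) (f x)"
      define y where "y = ct (real m) x"
      have y: "0 \<le> y" "y \<le> 1" using ct by (auto simp: y_def)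
      have c: "0 \<le> c \<and> c \<le> f x \<or> f x \<le> c \<and> c \<le> 0" by (auto simp: c_def cl_def max_def min_def)
      \<comment> \<open>The clamped and cut-off value lies between 0 and \<open>f x\<close>, so
        subtracting it does not increase the modulus.\<close>
      have "\<bar>f x - c * y\<bar> \<le> \<bar>f x\<bar>"
      proof (cases "0 \<le> c \<and> c \<le> f x")
        case True
        then have "0 \<le> c * y" "c * y \<le> c" using y by (auto intro: mult_left_le)
        with True show ?thesis by linarith
      next
        case False
        with c have "f x \<le> c" "c \<le> 0" by auto
        moreover have "c * y \<le> 0" using y \<open>c \<le> 0\<close> by (simp add: mult_nonpos_nonneg)
        moreover have "(-c) * y \<le> -c" using y \<open>c \<le> 0\<close> by (intro mult_left_le) auto
        ultimately show ?thesis by simp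
      qed
      then show "norm (\<bar>f x - fM (real m) x\<bar> powr q) \<le> \<bar>f x\<bar> powr q"
        using q by (auto simp: fM_def c_def y_def intro!: powr_mono2)
    qed
  qed (use fi in auto)
  \<comment> \<open>Two errors of size \<epsilon>, multiplied by the constant 2^q of the
    quasi-triangle inequality, add up to \<eta>.\<close>
  define \<epsilon> where "\<epsilon> = \<eta> / (2 * 2 powr q)"
  have \<epsilon>: "\<epsilon> > 0" using \<eta> by (simp add: \<epsilon>_def)
  obtain m where m: "(\<integral>x. \<bar>f x - fM (real m) x\<bar> powr q \<partial>lborel) < \<epsilon>"
    using order_tendstoD(2)[OF l1, of \<epsilon>] \<epsilon> by (auto simp: eventually_sequentially)
  define M where "M = real m"
  have M: "M \<ge> 0" by (simp add: M_def)
  have clb: "\<bar>cl M r\<bar> \<le> M" for r using M by (auto simp: cl_def max_def min_def)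
  have bnd: "\<bar>fM M x\<bar> \<le> M * indicator (cball 0 (M + 1)) x" "\<bar>gM M n x\<bar> \<le> M * indicator (cball 0 (M + 1)) x" for x n
    using ct[where M=M and x=x] ct0[where M=M and x=x] M mult_mono[OF clb[of "f x"] ct(2)[where M=M and x=x]] mult_mono[OF clb[of "g n x"] ct(2)[where M=M and x=x]]
    by (auto simp: fM_def gM_def abs_mult split: split_indicator)
  have bi: "integrable lborel (\<lambda>x. (c * indicator (cball (0::'a) (M + 1)) x) powr q)" for c
  proof -
    have "(\<lambda>x. (c * indicator (cball (0::'a) (M + 1)) x) powr q) = (\<lambda>x. c powr q * indicator (cball 0 (M + 1)) x)"
      using q by (auto split: split_indicator)
    then show ?thesis using emeasure_bounded_finite[of "cball (0::'a) (M+1)"] by simp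
  qed
  have l2: "(\<lambda>n. \<integral>x. \<bar>fM M x - gM M n x\<bar> powr q \<partial>lborel) \<longlonglongrightarrow> (\<integral>x. 0 \<partial>(lborel :: 'a measure))"
  proof (rule integral_dominated_convergence[where w="\<lambda>x. (2 * M * indicator (cball 0 (M + 1)) x) powr q"])
    show "AE x in lborel. (\<lambda>n. \<bar>fM M x - gM M n x\<bar> powr q) \<longlonglongrightarrow> 0"
      using aeN
    proof eventually_elim
      case (elim x)
      have "(\<lambda>n. \<bar>fM M x - gM M n x\<bar>) \<longlonglongrightarrow> \<bar>fM M x - fM M x\<bar>"
        unfolding fM_def gM_def cl_def by (intro tendsto_intros lim elim)
      then have "(\<lambda>n. \<bar>fM M x - gM M n x\<bar>) \<longlonglongrightarrow> 0" by simp
      then have "(\<lambda>n. \<bar>fM M x - gM M n x\<bar> powr q) \<longlonglongrightarrow> 0 powr q"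
        using q by (intro tendsto_powr') auto
      then show ?case by simp
    qed
    show "AE x in lborel. norm (\<bar>fM M x - gM M n x\<bar> powr q) \<le> (2 * M * indicator (cball 0 (M + 1)) x) powr q" for n
    proof (rule AE_I2)
      fix x
      have "\<bar>fM M x - gM M n x\<bar> \<le> 2 * M * indicator (cball 0 (M + 1)) x"
        using bnd(1)[of x] bnd(2)[of n x] by linarith
      then show "norm (\<bar>fM M x - gM M n x\<bar> powr q) \<le> (2 * M * indicator (cball 0 (M + 1)) x) powr q"
        using q by (auto intro!: powr_mono2)
    qed
  qed (use bi in auto)
  obtain n where n: "(\<integral>x. \<bar>fM M x - gM M n x\<bar> powr q \<partial>lborel) < \<epsilon>"
    using order_tendstoD(2)[OF l2, of \<epsilon>] \<epsilon> by (auto simp: eventually_sequentially)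
  have fMi: "integrable lborel (\<lambda>x. \<bar>fM M x\<bar> powr q)"
    by (rule Bochner_Integration.integrable_bound[OF bi[of M]]) (use bnd(1) q in \<open>auto intro!: powr_mono2\<close>)
  have gMi: "integrable lborel (\<lambda>x. \<bar>gM M n x\<bar> powr q)"
    by (rule Bochner_Integration.integrable_bound[OF bi[of M]]) (use bnd(2) q in \<open>auto intro!: powr_mono2\<close>)
  have i1: "integrable lborel (\<lambda>x. \<bar>f x - fM M x\<bar> powr q)" by (rule integrable_powr_abs_diff(1)[OF q]) (use fi fMi in auto)
  have i2: "integrable lborel (\<lambda>x. \<bar>fM M x - gM M n x\<bar> powr q)" by (rule integrable_powr_abs_diff(1)[OF q]) (use gMi fMi in auto)
  have "(\<integral>x. \<bar>(f x - fM M x) + (fM M x - gM M n x)\<bar> powr q \<partial>lborel) \<le>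
      2 powr q * ((\<integral>x. \<bar>f x - fM M x\<bar> powr q \<partial>lborel) + (\<integral>x. \<bar>fM M x - gM M n x\<bar> powr q \<partial>lborel))"
    by (rule integrable_powr_abs_add(2)[OF q _ _ i1 i2]) auto
  also have "\<dots> < 2 powr q * (\<epsilon> + \<epsilon>)"
    using m n by (intro mult_strict_left_mono) (auto simp: M_def)
  also have "\<dots> = \<eta>" by (simp add: \<epsilon>_def)
  finally have "(\<integral>x. \<bar>f x - gM M n x\<bar> powr q \<partial>lborel) < \<eta>" by simp
  moreover have "integrable lborel (\<lambda>x. \<bar>f x - gM M n x\<bar> powr q)"
    by (rule integrable_powr_abs_diff(1)[OF q]) (use gMi fi in auto)
  moreover have "continuous_on UNIV (gM M n)"
    unfolding gM_def cl_def by (intro continuous_intros g ctc)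
  moreover have "\<forall>x. x \<notin> cball 0 (M + 1) \<longrightarrow> gM M n x = 0" using ct0 by (auto simp: gM_def)
  ultimately show ?thesis by blast
qed

text \<open>For a continuous function of compact support this is dominated convergence. In general
  such a function \<open>g\<close> is inserted twice; the errors f - g before and after the shift
  have the same size by translation invariance.\<close>

lemma Lp_translation_continuous:
  fixes f :: "'a::euclidean_space \<Rightarrow> real"
  assumes q: "q > 0" and f[measurable]: "f \<in> borel_measurable borel"
    and fi: "integrable lborel (\<lambda>x. \<bar>f x\<bar> powr q)"
  shows "((\<lambda>h. \<integral>x. \<bar>f (h + x) - f x\<bar> powr q \<partial>lborel) \<longlongrightarrow> 0) (at 0)"
proof (rule tendstoI)
  fix \<eta> :: real assume \<eta>: "\<eta> > 0"
  define c where "c = (2::real) powr q"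
  have c: "c > 0" by (simp add: c_def)
  \<comment> \<open>Two uses of the quasi-triangle inequality lead to
    \<open>c * (\<epsilon> + c * (\<epsilon> + \<epsilon>))\<close>; the surplus in the denominator
    makes the final estimate strict.\<close>
  define \<epsilon> where "\<epsilon> = \<eta> / (2 * (c * (c * 2)) + c)"
  have den: "2 * (c * (c * 2)) + c > 0" using c by (simp add: add_pos_pos)
  have \<epsilon>: "\<epsilon> > 0" using \<eta> den by (simp add: \<epsilon>_def)
  obtain g R where g: "continuous_on UNIV g" "\<And>x. x \<notin> cball 0 R \<Longrightarrow> g x = 0"
    "integrable lborel (\<lambda>x. \<bar>f x - g x\<bar> powr q)" "(\<integral>x. \<bar>f x - g x\<bar> powr q \<partial>lborel) < \<epsilon>"
    using continuous_compact_support_Lp_dense[OF q f fi \<epsilon>] by blast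
  have [measurable]: "g \<in> borel_measurable borel" using g(1) by (rule borel_measurable_continuous_onI)
  have "bounded (g ` cball 0 R)"
    by (intro compact_imp_bounded compact_continuous_image continuous_on_subset[OF g(1)]) auto
  then obtain B where B: "B > 0" "\<And>x. x \<in> cball 0 R \<Longrightarrow> \<bar>g x\<bar> \<le> B" unfolding bounded_pos by force
  have gB: "\<bar>g x\<bar> \<le> B" for x using B g(2)[of x] by (cases "x \<in> cball 0 R") auto
  have wi: "integrable lborel (\<lambda>x. (2 * B) powr q * indicator (cball (0::'a) (R + 1)) x)"
    using emeasure_bounded_finite[of "cball (0::'a) (R+1)"] by simp
  have gbd: "\<bar>g (h + x) - g x\<bar> powr q \<le> (2 * B) powr q * indicator (cball 0 (R + 1)) x" if h: "norm h \<le> 1" for h x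
  proof (cases "x \<in> cball 0 (R + 1)")
    case True
    then show ?thesis using gB[of "h + x"] gB[of x] q by (auto intro!: powr_mono2)
  next
    case False
    then have "norm x > R + 1" by simp
    moreover from this h have "norm (h + x) > R" using norm_triangle_ineq2[of x "-h"] by (simp add: add.commute)
    ultimately show ?thesis using g(2)[of x] g(2)[of "h + x"] q False by simp
  qed
  have gi: "integrable lborel (\<lambda>x. \<bar>g (h + x) - g x\<bar> powr q)" if "norm h \<le> 1" for h
    by (rule Bochner_Integration.integrable_bound[OF wi]) (use gbd[OF that] in auto)
  have "((\<lambda>h. \<integral>x. \<bar>g (h + x) - g x\<bar> powr q \<partial>lborel) \<longlongrightarrow> (\<integral>x. 0 \<partial>(lborel::'a measure))) (at 0)"
  proof (subst tendsto_at_iff_sequentially, intro allI impI)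
    fix X :: "nat \<Rightarrow> 'a" assume X: "\<forall>i. X i \<in> UNIV - {0}" "X \<longlonglongrightarrow> 0"
    have "eventually (\<lambda>i. dist (X i) 0 < 1) sequentially" using X(2) by (rule tendstoD) simp
    \<comment> \<open>Dropping the first \<open>k\<close> terms keeps all shifts of length at most
      1, so that one ball contains every support.\<close>
    then obtain k where k: "\<And>i. i \<ge> k \<Longrightarrow> norm (X i) \<le> 1"
      by (auto simp: eventually_sequentially intro: less_imp_le)
    have "(\<lambda>i. \<integral>x. \<bar>g (X (i + k) + x) - g x\<bar> powr q \<partial>lborel) \<longlonglongrightarrow> (\<integral>x. 0 \<partial>(lborel::'a measure))"
    proof (rule integral_dominated_convergence[OF _ _ wi])
      show "AE x in lborel. (\<lambda>i. \<bar>g (X (i + k) + x) - g x\<bar> powr q) \<longlonglongrightarrow> 0"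
      proof (rule AE_I2)
        fix x
        have "(\<lambda>i. X (i + k) + x) \<longlonglongrightarrow> 0 + x" using X(2) by (intro tendsto_intros LIMSEQ_ignore_initial_segment)
        then have "(\<lambda>i. g (X (i + k) + x)) \<longlonglongrightarrow> g (0 + x)"
          using g(1) by (intro continuous_on_tendsto_compose[of UNIV g]) auto
        then have "(\<lambda>i. \<bar>g (X (i + k) + x) - g x\<bar>) \<longlonglongrightarrow> \<bar>g (0 + x) - g x\<bar>" by (intro tendsto_intros)
        then have "(\<lambda>i. \<bar>g (X (i + k) + x) - g x\<bar> powr q) \<longlonglongrightarrow> 0 powr q"
          using q by (intro tendsto_powr') auto
        then show "(\<lambda>i. \<bar>g (X (i + k) + x) - g x\<bar> powr q) \<longlonglongrightarrow> 0" by simp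
      qed
    qed (use gbd k in auto)
    then show "((\<lambda>h. \<integral>x. \<bar>g (h + x) - g x\<bar> powr q \<partial>lborel) \<circ> X) \<longlonglongrightarrow> (\<integral>x. 0 \<partial>(lborel::'a measure))"
      by (simp add: o_def LIMSEQ_offset[of _ k])
  qed
  then have gl: "((\<lambda>h. \<integral>x. \<bar>g (h + x) - g x\<bar> powr q \<partial>lborel) \<longlongrightarrow> 0) (at 0)" by simp
  have "eventually (\<lambda>h. (\<integral>x. \<bar>g (h + x) - g x\<bar> powr q \<partial>lborel) < \<epsilon>) (at 0)"
    using order_tendstoD(2)[OF gl \<epsilon>] .
  moreover have "eventually (\<lambda>h::'a. norm h \<le> 1) (at 0)"
    unfolding eventually_at by (intro exI[of _ 1]) (auto simp: dist_norm)
  ultimately show "eventually (\<lambda>h. dist (\<integral>x. \<bar>f (h + x) - f x\<bar> powr q \<partial>lborel) 0 < \<eta>) (at 0)"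
  proof eventually_elim
    case (elim h)
    let ?a = "\<lambda>x. f (h + x) - g (h + x)" and ?b = "\<lambda>x. g (h + x) - g x" and ?c = "\<lambda>x. g x - f x"
    have ai: "integrable lborel (\<lambda>x. \<bar>?a x\<bar> powr q)"
      using integral_lborel_translation(2)[of "\<lambda>x. \<bar>f x - g x\<bar> powr q" h] g(3) by simp
    have aI: "(\<integral>x. \<bar>?a x\<bar> powr q \<partial>lborel) < \<epsilon>"
      using integral_lborel_translation(1)[of "\<lambda>x. \<bar>f x - g x\<bar> powr q" h] g(4) by simp
    have bi: "integrable lborel (\<lambda>x. \<bar>?b x\<bar> powr q)" using gi elim by simp
    have ci: "integrable lborel (\<lambda>x. \<bar>?c x\<bar> powr q)" "(\<integral>x. \<bar>?c x\<bar> powr q \<partial>lborel) < \<epsilon>"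
      using g(3,4) by (simp_all add: abs_minus_commute)
    have bci: "integrable lborel (\<lambda>x. \<bar>?b x + ?c x\<bar> powr q)"
      by (rule integrable_powr_abs_add(1)[OF q]) (use bi ci in auto)
    have "(\<integral>x. \<bar>?b x + ?c x\<bar> powr q \<partial>lborel) \<le> c * ((\<integral>x. \<bar>?b x\<bar> powr q \<partial>lborel) + (\<integral>x. \<bar>?c x\<bar> powr q \<partial>lborel))"
      unfolding c_def by (rule integrable_powr_abs_add(2)[OF q]) (use bi ci in auto)
    also have "\<dots> \<le> c * (\<epsilon> + \<epsilon>)" using elim(1) ci(2) c by (intro mult_left_mono) auto
    finally have bc: "(\<integral>x. \<bar>?b x + ?c x\<bar> powr q \<partial>lborel) \<le> c * (\<epsilon> + \<epsilon>)" .
    have "(\<integral>x. \<bar>?a x + (?b x + ?c x)\<bar> powr q \<partial>lborel) \<le> c * ((\<integral>x. \<bar>?a x\<bar> powr q \<partial>lborel) + (\<integral>x. \<bar>?b x + ?c x\<bar> powr q \<partial>lborel))"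
      unfolding c_def by (rule integrable_powr_abs_add(2)[OF q _ _ ai bci]) auto
    also have "\<dots> \<le> c * (\<epsilon> + c * (\<epsilon> + \<epsilon>))" using aI bc c by (intro mult_left_mono add_mono) auto
    also have "\<dots> < \<epsilon> * (2 * (c * (c * 2)) + c)"
      using c \<epsilon> by (simp add: algebra_simps)
    also have "\<dots> = \<eta>" using den by (simp add: \<epsilon>_def)
    finally show ?case by simp
  qed
qed

section \<open>Mollification\<close>

lemma convex_on_powr_abs:
  fixes q :: real
  assumes q: "q \<ge> 1"
  shows "convex_on UNIV (\<lambda>x. \<bar>x\<bar> powr q)"
proof (rule convex_onI)
  fix t x y :: real assume t: "0 < t" "t < 1"
  have pos: "((1 - t) * a + t * b) powr q \<le> (1 - t) * a powr q + t * b powr q" if "a \<ge> 0" "b \<ge> 0" for a b :: real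
  proof (cases "a = 0 \<or> b = 0")
    case False
    with that have "a > 0" "b > 0" by auto
    then show ?thesis
      using convex_onD[OF powr_convex[OF q], of t a b] t by auto
  next
    case True
    \<comment> \<open>If an argument is 0, convexity reduces to s^q \<le> s for s in (0, 1).\<close>
    have le: "s powr q \<le> s" if "0 < s" "s < 1" for s :: real
      using that powr_mono'[of 1 q s] q by simp
    have "(s * c) powr q \<le> s * c powr q" if "0 < s" "s < 1" "c \<ge> 0" for s c :: real
      using that le[of s] by (simp add: powr_mult mult_right_mono)
    then show ?thesis using True t that by fastforce
  qed
  have "\<bar>(1 - t) *\<^sub>R x + t *\<^sub>R y\<bar> \<le> (1 - t) * \<bar>x\<bar> + t * \<bar>y\<bar>"
    using t abs_triangle_ineq[of "(1-t)*x" "t*y"] by (simp add: abs_mult)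
  then have "\<bar>(1 - t) *\<^sub>R x + t *\<^sub>R y\<bar> powr q \<le> ((1 - t) * \<bar>x\<bar> + t * \<bar>y\<bar>) powr q"
    using q by (intro powr_mono2) auto
  also have "\<dots> \<le> (1 - t) * \<bar>x\<bar> powr q + t * \<bar>y\<bar> powr q" by (rule pos) auto
  finally show "\<bar>(1 - t) *\<^sub>R x + t *\<^sub>R y\<bar> powr q \<le> (1 - t) * \<bar>x\<bar> powr q + t * \<bar>y\<bar> powr q" .
qed simp

lemma dir_deriv_abs_le:
  fixes \<phi> :: "'a::euclidean_space \<Rightarrow> real"
  assumes "\<phi> differentiable (at x)"
  shows "\<bar>dir_deriv h \<phi> x\<bar> \<le> norm h * (\<Sum>b\<in>Basis. \<bar>dir_deriv b \<phi> x\<bar>)"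
proof -
  have "\<bar>dir_deriv h \<phi> x\<bar> \<le> (\<Sum>b\<in>Basis. \<bar>(h \<bullet> b) * dir_deriv b \<phi> x\<bar>)"
    unfolding dir_deriv_sum_Basis[OF assms, of h] by (rule sum_abs)
  also have "\<dots> \<le> (\<Sum>b\<in>Basis. norm h * \<bar>dir_deriv b \<phi> x\<bar>)"
    by (intro sum_mono) (auto simp: abs_mult intro!: mult_right_mono Basis_le_norm)
  finally show ?thesis by (simp add: sum_distrib_left)
qed

lemma test_fun_Lipschitz:
  fixes \<phi> :: "'a::euclidean_space \<Rightarrow> real"
  assumes \<phi>: "\<phi> \<in> test_fun U"
  shows "\<exists>L\<ge>0. \<forall>x h. \<bar>\<phi> (x + h) - \<phi> x\<bar> \<le> L * norm h"
proof -
  have d: "\<phi> differentiable (at x)" for x using \<phi> by (intro smooth_imp_differentiable test_fun_imp_smooth)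
  have "\<forall>b\<in>Basis. \<exists>B. \<forall>x. \<bar>dir_deriv b \<phi> x\<bar> \<le> B"
    using test_fun_bounded[OF test_fun_dir_deriv[OF \<phi>]] by blast
  then obtain B where B: "\<And>b x. b \<in> Basis \<Longrightarrow> \<bar>dir_deriv b \<phi> x\<bar> \<le> B b" by metis
  have B0: "B b \<ge> 0" if "b \<in> Basis" for b using B[OF that, of 0] by linarith
  have "\<bar>\<phi> (x + h) - \<phi> x\<bar> \<le> (\<Sum>b\<in>Basis. B b) * norm h" for x h
  proof -
    obtain \<tau> where "\<phi> (x + h) - \<phi> x = dir_deriv h \<phi> (x + \<tau> *\<^sub>R h)" using dir_deriv_mvt[OF d] by blast
    then have "\<bar>\<phi> (x + h) - \<phi> x\<bar> \<le> norm h * (\<Sum>b\<in>Basis. \<bar>dir_deriv b \<phi> (x + \<tau> *\<^sub>R h)\<bar>)"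
      using dir_deriv_abs_le[OF d] by simp
    also have "\<dots> \<le> norm h * (\<Sum>b\<in>Basis. B b)" by (intro mult_left_mono sum_mono B) auto
    finally show ?thesis by (simp add: mult.commute)
  qed
  moreover have "(\<Sum>b\<in>Basis. B b) \<ge> 0" using B0 by (intro sum_nonneg)
  ultimately show ?thesis by blast
qed

text \<open>A Taylor bound of second order that is uniform in \<open>x\<close>. The uniformity is
  what permits differentiating a mollification when \<open>g\<close> is merely integrable.\<close>

lemma test_fun_remainder:
  fixes \<phi> :: "'a::euclidean_space \<Rightarrow> real"
  assumes \<phi>: "\<phi> \<in> test_fun U"
  shows "\<exists>C\<ge>0. \<forall>x h. \<bar>\<phi> (x + h) - \<phi> x - (\<Sum>b\<in>Basis. (h \<bullet> b) * dir_deriv b \<phi> x)\<bar> \<le> C * (norm h)\<^sup>2"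
proof -
  have d: "\<phi> differentiable (at x)" for x using \<phi> by (intro smooth_imp_differentiable test_fun_imp_smooth)
  have "\<forall>b\<in>Basis. \<exists>L\<ge>0. \<forall>x h. \<bar>dir_deriv b \<phi> (x + h) - dir_deriv b \<phi> x\<bar> \<le> L * norm h"
    using test_fun_Lipschitz[OF test_fun_dir_deriv[OF \<phi>]] by blast
  then obtain L where L: "\<And>b. b \<in> Basis \<Longrightarrow> L b \<ge> 0"
    "\<And>b x h. b \<in> Basis \<Longrightarrow> \<bar>dir_deriv b \<phi> (x + h) - dir_deriv b \<phi> x\<bar> \<le> L b * norm h" by metis
  have "\<bar>\<phi> (x + h) - \<phi> x - (\<Sum>b\<in>Basis. (h \<bullet> b) * dir_deriv b \<phi> x)\<bar> \<le> (\<Sum>b\<in>Basis. L b) * (norm h)\<^sup>2" for x h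
  proof -
    obtain \<tau> where \<tau>: "\<tau> \<in> {0..1}" "\<phi> (x + h) - \<phi> x = dir_deriv h \<phi> (x + \<tau> *\<^sub>R h)" using dir_deriv_mvt[OF d] by blast
    have "\<phi> (x + h) - \<phi> x - (\<Sum>b\<in>Basis. (h \<bullet> b) * dir_deriv b \<phi> x)
        = (\<Sum>b\<in>Basis. (h \<bullet> b) * (dir_deriv b \<phi> (x + \<tau> *\<^sub>R h) - dir_deriv b \<phi> x))"
      unfolding \<tau>(2) dir_deriv_sum_Basis[OF d, of h] by (simp add: sum_subtractf right_diff_distrib)
    also have "\<bar>\<dots>\<bar> \<le> (\<Sum>b\<in>Basis. \<bar>(h \<bullet> b) * (dir_deriv b \<phi> (x + \<tau> *\<^sub>R h) - dir_deriv b \<phi> x)\<bar>)"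
      by (rule sum_abs)
    also have "\<dots> \<le> (\<Sum>b\<in>Basis. norm h * (L b * norm h))"
    proof (intro sum_mono)
      fix b :: 'a assume b: "b \<in> Basis"
      have "\<bar>dir_deriv b \<phi> (x + \<tau> *\<^sub>R h) - dir_deriv b \<phi> x\<bar> \<le> L b * norm (\<tau> *\<^sub>R h)" by (rule L(2)[OF b])
      also have "\<dots> \<le> L b * norm h" using \<tau>(1) L(1)[OF b] by (auto intro!: mult_left_mono mult_left_le_one_le)
      finally show "\<bar>(h \<bullet> b) * (dir_deriv b \<phi> (x + \<tau> *\<^sub>R h) - dir_deriv b \<phi> x)\<bar> \<le> norm h * (L b * norm h)"
        using Basis_le_norm[OF b, of h] by (simp add: abs_mult mult_mono)
    qed
    also have "\<dots> = (\<Sum>b\<in>Basis. L b) * (norm h)\<^sup>2"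
      unfolding sum_distrib_right by (intro sum.cong) (auto simp: power2_eq_square)
    finally show ?thesis .
  qed
  moreover have "(\<Sum>b\<in>Basis. L b) \<ge> 0" using L(1) by (intro sum_nonneg)
  ultimately show ?thesis by blast
qed

text \<open>The kernel is reflected: this avoids reflecting the Lebesgue measure later.\<close>

definition mollify :: "('a::euclidean_space \<Rightarrow> real) \<Rightarrow> ('a \<Rightarrow> real) \<Rightarrow> 'a \<Rightarrow> real" where
  "mollify \<rho> g x = (\<integral>y. \<rho> (y - x) * g y \<partial>lborel)"

lemma integrable_kernel:
  fixes g :: "'a::euclidean_space \<Rightarrow> real"
  assumes \<rho>: "\<rho> \<in> test_fun UNIV" and g: "integrable lborel g"
  shows "integrable lborel (\<lambda>y. \<rho> (y - x) * g y)"
proof -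
  obtain B where B: "\<And>x. \<bar>\<rho> x\<bar> \<le> B" using test_fun_bounded[OF \<rho>] by blast
  have [measurable]: "\<rho> \<in> borel_measurable borel" by (rule test_fun_measurable[OF \<rho>])
  have [measurable]: "g \<in> borel_measurable borel" using g by auto
  have i: "integrable lborel (\<lambda>y. B * g y)" using g by simp
  show ?thesis
    by (rule Bochner_Integration.integrable_bound[OF i])
       (use B in \<open>auto simp: abs_mult intro!: mult_right_mono order_trans[OF B abs_ge_self]\<close>)
qed

text \<open>The quadratic remainder of the kernel gives an error of at most a constant times the L^1
  norm of \<open>g\<close> and |h|^2. The minus sign arises because \<open>x\<close> enters the
  kernel as y - x.\<close>

lemma mollify_has_derivative:
  fixes g :: "'a::euclidean_space \<Rightarrow> real"
  assumes \<rho>: "\<rho> \<in> test_fun UNIV" and g: "integrable lborel g"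
  shows "(mollify \<rho> g has_derivative (\<lambda>h. \<Sum>b\<in>Basis. (h \<bullet> b) * (- mollify (dir_deriv b \<rho>) g x))) (at x)"
proof -
  obtain C where C: "C \<ge> 0"
    "\<And>x h. \<bar>\<rho> (x + h) - \<rho> x - (\<Sum>b\<in>Basis. (h \<bullet> b) * dir_deriv b \<rho> x)\<bar> \<le> C * (norm h)\<^sup>2"
    using test_fun_remainder[OF \<rho>] by blast
  define D where "D h = (\<Sum>b\<in>Basis. (h \<bullet> b) * (- mollify (dir_deriv b \<rho>) g x))" for h
  define G where "G = (\<integral>y. \<bar>g y\<bar> \<partial>lborel)"
  note int = integrable_kernel[OF \<rho> g] integrable_kernel[OF test_fun_dir_deriv[OF \<rho>] g]
  have est: "\<bar>mollify \<rho> g (x + h) - mollify \<rho> g x - D h\<bar> \<le> C * G * (norm h)\<^sup>2" for h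
  proof -
    define S where "S y = (\<Sum>b\<in>Basis. (-h \<bullet> b) * (dir_deriv b \<rho> (y - x) * g y))" for y
    define R where "R y = \<rho> (y - (x + h)) * g y - \<rho> (y - x) * g y - S y" for y
    have si: "integrable lborel S"
      unfolding S_def[abs_def] using int(2) by (intro Bochner_Integration.integrable_sum) auto
    have Ri: "integrable lborel R"
      unfolding R_def[abs_def] by (intro Bochner_Integration.integrable_diff int(1) si)
    have "D h = (\<integral>y. S y \<partial>lborel)"
      unfolding D_def mollify_def S_def using int(2) by (subst Bochner_Integration.integral_sum) auto
    then have "mollify \<rho> g (x + h) - mollify \<rho> g x - D h = (\<integral>y. R y \<partial>lborel)"
      unfolding mollify_def R_def using int(1)[of x] int(1)[of "x + h"] si by simp
    also have "\<bar>\<integral>y. R y \<partial>lborel\<bar> \<le> (\<integral>y. \<bar>R y\<bar> \<partial>lborel)"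
      by (rule integral_abs_bound)
    also have "(\<integral>y. \<bar>R y\<bar> \<partial>lborel) \<le> (\<integral>y. C * (norm h)\<^sup>2 * \<bar>g y\<bar> \<partial>lborel)"
    proof (rule integral_mono[OF integrable_abs[OF Ri]])
      show "integrable lborel (\<lambda>y. C * (norm h)\<^sup>2 * \<bar>g y\<bar>)" using g by simp
      fix y
      define s where "s = (\<Sum>b\<in>Basis. (-h \<bullet> b) * dir_deriv b \<rho> (y - x))"
      have "S y = s * g y" unfolding s_def S_def sum_distrib_right by (simp only: mult.assoc)
      then have "R y = (\<rho> ((y - x) + (-h)) - \<rho> (y - x) - s) * g y"
        by (simp only: left_diff_distrib R_def) (simp add: diff_diff_eq)
      moreover have "\<bar>\<rho> ((y - x) + (-h)) - \<rho> (y - x) - s\<bar> \<le> C * (norm h)\<^sup>2"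
        using C(2)[of "y - x" "-h"] unfolding s_def by simp
      ultimately show "\<bar>R y\<bar> \<le> C * (norm h)\<^sup>2 * \<bar>g y\<bar>"
        by (simp only: abs_mult) (intro mult_right_mono, auto)
    qed
    finally show ?thesis by (simp add: G_def mult_ac)
  qed
  have "bounded_linear D" unfolding D_def
    by (intro bounded_linear_sum bounded_linear_mult_left[THEN bounded_linear_compose] bounded_linear_inner_left)
  moreover have "((\<lambda>h. norm (mollify \<rho> g (x + h) - mollify \<rho> g x - D h) / norm h) \<longlongrightarrow> 0) (at 0)"
  proof (rule tendsto_sandwich[of "\<lambda>_. 0" _ _ "\<lambda>h. C * G * norm h"])
    show "eventually (\<lambda>h. norm (mollify \<rho> g (x + h) - mollify \<rho> g x - D h) / norm h \<le> C * G * norm h) (at 0)"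
      unfolding eventually_at
    proof (intro exI[of _ 1] conjI ballI impI)
      fix h :: 'a assume "h \<noteq> 0 \<and> dist h 0 < 1"
      then show "norm (mollify \<rho> g (x + h) - mollify \<rho> g x - D h) / norm h \<le> C * G * norm h"
        using est[of h] by (simp add: divide_le_eq power2_eq_square mult.assoc)
    qed simp
    show "((\<lambda>h::'a. C * G * norm h) \<longlongrightarrow> 0) (at 0)"
      using tendsto_mult[OF tendsto_const tendsto_norm[OF tendsto_ident_at], of "C * G" "0::'a" UNIV] by simp
  qed auto
  ultimately have "(mollify \<rho> g has_derivative D) (at x)" by (simp add: has_derivative_at)
  then show ?thesis by (simp add: D_def[abs_def])
qed

lemma dir_deriv_mollify:
  fixes g :: "'a::euclidean_space \<Rightarrow> real"
  assumes \<rho>: "\<rho> \<in> test_fun UNIV" and g: "integrable lborel g" and b: "b \<in> Basis"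
  shows "dir_deriv b (mollify \<rho> g) x = - mollify (dir_deriv b \<rho>) g x"
proof -
  have "dir_deriv b (mollify \<rho> g) x = (\<Sum>c\<in>Basis. (b \<bullet> c) * (- mollify (dir_deriv c \<rho>) g x))"
    by (rule dir_deriv_eq[OF mollify_has_derivative[OF \<rho> g]])
  also have "\<dots> = (\<Sum>c\<in>Basis. if c = b then - mollify (dir_deriv c \<rho>) g x else 0)"
    using b by (intro sum.cong) (auto simp: inner_Basis)
  finally show ?thesis using b by simp
qed

text \<open>All derivatives fall on the kernel, so each step of the induction replaces \<rho> by
  another test function.\<close>

lemma smooth_mollify:
  fixes g :: "'a::euclidean_space \<Rightarrow> real"
  assumes \<rho>: "\<rho> \<in> test_fun UNIV" and g: "integrable lborel g"
  shows "smooth (mollify \<rho> g)"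
proof -
  have d: "mollify \<rho> g differentiable (at x)" if "\<rho> \<in> test_fun UNIV" for \<rho> :: "'a \<Rightarrow> real" and x
    using mollify_has_derivative[OF that g] by (auto simp: differentiable_def)
  have "C_order k (mollify \<rho> g)" if "\<rho> \<in> test_fun UNIV" for k \<rho>
    using that
  proof (induction k arbitrary: \<rho>)
    case 0
    then show ?case
      using d by (auto intro!: continuous_at_imp_continuous_on differentiable_imp_continuous_within)
  next
    case (Suc k)
    have "C_order k (dir_deriv b (mollify \<rho> g))" if b: "b \<in> Basis" for b
    proof -
      have "dir_deriv b (mollify \<rho> g) = (\<lambda>x. (-1) * mollify (dir_deriv b \<rho>) g x)"
        using dir_deriv_mollify[OF Suc.prems g b] by auto
      moreover have "C_order k (\<lambda>x. (-1) * mollify (dir_deriv b \<rho>) g x)"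
        by (intro C_order_mult C_order_const Suc.IH test_fun_dir_deriv[OF Suc.prems b])
      ultimately show ?thesis by (simp only:)
    qed
    then show ?case using d[OF Suc.prems] by simp
  qed
  then show ?thesis using \<rho> by (simp add: smooth_def)
qed

lemma mollify_nonneg: "(\<And>x. \<rho> x \<ge> 0) \<Longrightarrow> (AE x in lborel. g x \<ge> 0) \<Longrightarrow> mollify \<rho> g x \<ge> 0"
  unfolding mollify_def by (intro integral_nonneg_AE) (auto elim!: eventually_mono)

text \<open>For fixed \<open>x\<close> the translated kernel is itself an admissible test function
  in \<open>U\<close>, provided that the ball of radius \<open>e\<close> around \<open>x\<close>
  stays in \<open>U\<close>. Only at such points does the weak derivative pass under the
  mollification.\<close>

lemma dir_deriv_mollify_local:
  fixes g d :: "'a::euclidean_space \<Rightarrow> real"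
  assumes \<rho>: "\<rho> \<in> test_fun UNIV" and g: "integrable lborel g" and b: "b \<in> Basis"
    and wd: "\<And>\<phi>. \<phi> \<in> test_fun U \<Longrightarrow> (\<integral>y. g y * dir_deriv b \<phi> y \<partial>lborel) = - (\<integral>y. d y * \<phi> y \<partial>lborel)"
    and supp: "\<And>z. z \<notin> cball 0 e \<Longrightarrow> \<rho> z = 0" and x: "cball x e \<subseteq> U"
  shows "dir_deriv b (mollify \<rho> g) x = mollify \<rho> d x"
proof -
  let ?\<phi> = "\<lambda>y. \<rho> (y + (-x))"
  have s: "smooth \<rho>" using \<rho> by (rule test_fun_imp_smooth)
  have L: "bounded_linear (\<lambda>y::'a. y)" by (rule bounded_linear_ident)
  have sm: "smooth ?\<phi>"
    by (rule smooth_affine[OF s L]) (metis scaleR_one)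
  have "?\<phi> \<in> test_fun U"
  proof (rule test_funI[OF sm _ x])
    show "\<rho> (y + (-x)) = 0" if "y \<notin> cball x e" for y
      using that by (intro supp) (auto simp: dist_norm norm_minus_commute)
  qed simp
  moreover have "dir_deriv b ?\<phi> y = dir_deriv b \<rho> (y - x)" for y
    using dir_deriv_affine(2)[OF L smooth_imp_differentiable[OF s], where x=y and a="-x" and b=b and r=1 and b'=b]
    by simp
  ultimately have "(\<integral>y. g y * dir_deriv b \<rho> (y - x) \<partial>lborel) = - (\<integral>y. d y * \<rho> (y - x) \<partial>lborel)"
    using wd[of ?\<phi>] by simp
  then show ?thesis
    unfolding dir_deriv_mollify[OF \<rho> g b] by (simp add: mollify_def mult.commute)
qed

text \<open>Mollification averages the translates of \<open>h\<close> against the probability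
  density \<rho>. Jensen's inequality bounds the q-th power of the error by the averaged q-th
  powers, and Fubini's theorem reduces these to translation errors over the support of
  \<rho>.\<close>

lemma mollify_Lp_estimate:
  fixes h :: "'a::euclidean_space \<Rightarrow> real"
  assumes q: "q \<ge> 1" and h: "integrable lborel h" and hq: "integrable lborel (\<lambda>x. \<bar>h x\<bar> powr q)"
    and \<rho>: "\<rho> \<in> test_fun UNIV" "\<And>x. \<rho> x \<ge> 0" "(\<integral>x. \<rho> x \<partial>lborel) = 1"
    and small: "\<And>z. \<rho> z \<noteq> 0 \<Longrightarrow> (\<integral>x. \<bar>h (z + x) - h x\<bar> powr q \<partial>lborel) \<le> \<eta>"
  shows "integrable lborel (\<lambda>x. \<bar>mollify \<rho> h x - h x\<bar> powr q)"
    and "(\<integral>x. \<bar>mollify \<rho> h x - h x\<bar> powr q \<partial>lborel) \<le> \<eta>"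
proof -
  have q0: "q > 0" using q by simp
  have [measurable]: "\<rho> \<in> borel_measurable borel" by (rule test_fun_measurable[OF \<rho>(1)])
  have [measurable]: "h \<in> borel_measurable borel" using h by auto
  have [measurable]: "mollify \<rho> h \<in> borel_measurable borel"
    using smooth_mollify[OF \<rho>(1) h] by (intro borel_measurable_continuous_onI smooth_imp_continuous)
  have \<rho>i: "integrable lborel \<rho>" by (rule test_fun_integrable[OF \<rho>(1)])
  define \<omega> where "\<omega> z = (\<integral>x. \<bar>h (z + x) - h x\<bar> powr q \<partial>lborel)" for z
  \<comment> \<open>The first component is the space point, the second the shift.\<close>
  define F where "F p = \<rho> (snd p) * \<bar>h (snd p + fst p) - h (fst p)\<bar> powr q" for p :: "'a \<times> 'a"
  have Fm: "F \<in> borel_measurable borel"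
    unfolding F_def borel_prod[symmetric] by measurable
  have Fnn: "F p \<ge> 0" for p using \<rho>(2) by (simp add: F_def)
  have di: "integrable lborel (\<lambda>x. \<bar>h (z + x) - h x\<bar> powr q)" for z
    using hq integral_lborel_translation(2)[of "\<lambda>x. \<bar>h x\<bar> powr q" z]
    by (intro integrable_powr_abs_diff(1)[OF q0]) auto
  have Fx: "(\<integral>x. F (x, z) \<partial>lborel) = \<rho> z * \<omega> z" for z by (simp add: F_def \<omega>_def)
  have \<omega>0: "\<omega> z \<ge> 0" for z by (simp add: \<omega>_def)
  have \<rho>\<omega>: "\<rho> z * \<omega> z \<le> \<eta> * \<rho> z" for z
    using small[of z] \<rho>(2)[of z] by (cases "\<rho> z = 0") (auto simp: \<omega>_def mult.commute intro: mult_right_mono)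
  have "(\<lambda>z. \<rho> z * \<omega> z) \<in> borel_measurable borel"
    using borel_measurable_lborel_integral[OF Fm] by (simp add: Fx)
  then have \<rho>\<omega>m: "(\<lambda>z. \<rho> z * \<omega> z) \<in> borel_measurable lborel" by simp
  have \<rho>\<omega>i: "integrable lborel (\<lambda>z. \<rho> z * \<omega> z)"
  proof (rule Bochner_Integration.integrable_bound[of lborel "\<lambda>z. \<eta> * \<rho> z", rotated 2, OF AE_I2])
    show "integrable lborel (\<lambda>z. \<eta> * \<rho> z)" using \<rho>i by simp
    show "norm (\<rho> z * \<omega> z) \<le> norm (\<eta> * \<rho> z)" for z
      using \<rho>\<omega>[of z] \<rho>(2)[of z] \<omega>0[of z] by simp
  qed (fact \<rho>\<omega>m)
  have Fi: "integrable lborel F"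
  proof (rule lborel_fubini_integrable[OF Fm])
    show "AE z in lborel. integrable lborel (\<lambda>x. F (x, z))" using di by (auto simp: F_def)
    show "integrable lborel (\<lambda>z. \<integral>x. \<bar>F (x, z)\<bar> \<partial>lborel)" using \<rho>\<omega>i Fnn by (simp add: Fx)
  qed
  have Fi': "integrable lborel (\<lambda>(z, x). F (x, z))" using Fi integrable_lborel_swap[of F] by simp
  define J where "J x = (\<integral>z. F (x, z) \<partial>lborel)" for x
  have J1: "AE x in lborel. integrable lborel (\<lambda>z. F (x, z))" and J2: "integrable lborel J"
    using lborel_fubini(1,2)[OF Fi'] by (auto simp: J_def[abs_def])
  have "(\<integral>x. J x \<partial>lborel) = (\<integral>z. \<integral>x. F (x, z) \<partial>lborel \<partial>lborel)"
    unfolding J_def using Fi by (subst lborel_pair.Fubini_integral[of "\<lambda>x z. F (x, z)"]) (auto simp: lborel_prod)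
  also have "\<dots> = (\<integral>z. \<rho> z * \<omega> z \<partial>lborel)" by (simp add: Fx)
  also have "\<dots> \<le> (\<integral>z. \<eta> * \<rho> z \<partial>lborel)" by (intro integral_mono \<rho>\<omega>i \<rho>\<omega>) (use \<rho>i in simp)
  also have "\<dots> = \<eta>" using \<rho>(3) by simp
  finally have J\<eta>: "(\<integral>x. J x \<partial>lborel) \<le> \<eta>" .
  have pt: "AE x in lborel. \<bar>mollify \<rho> h x - h x\<bar> powr q \<le> J x"
    using J1
  proof eventually_elim
    case (elim x)
    define P where "P = density lborel (\<lambda>z. ennreal (\<rho> z))"
    have "emeasure P (space P) = (\<integral>\<^sup>+z. ennreal (\<rho> z) \<partial>lborel)" by (simp add: P_def emeasure_density)
    also have "\<dots> = 1" using \<rho> \<rho>i by (simp add: nn_integral_eq_integral)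
    finally interpret P: prob_space P by (rule prob_spaceI)
    have Pint: "integral\<^sup>L P f = (\<integral>z. \<rho> z * f z \<partial>lborel)" and Pi: "integrable P f \<longleftrightarrow> integrable lborel (\<lambda>z. \<rho> z * f z)"
      if [measurable]: "f \<in> borel_measurable borel" for f :: "'a \<Rightarrow> real"
      using \<rho>(2) by (auto simp: P_def integral_density integrable_density)
    have k1: "integrable lborel (\<lambda>z. \<rho> z * h (x + z))"
      using integral_lborel_translation(2)[of "\<lambda>z. \<rho> z * h (x + z)" "-x"] integrable_kernel[OF \<rho>(1) h, of x]
      by simp
    have k2: "mollify \<rho> h x = (\<integral>z. \<rho> z * h (x + z) \<partial>lborel)"
      using integral_lborel_translation(1)[of "\<lambda>z. \<rho> z * h (x + z)" "-x"] by (simp add: mollify_def)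
    have "integrable lborel (\<lambda>z. \<rho> z * h (x + z) - \<rho> z * h x)"
      using k1 \<rho>i by (intro Bochner_Integration.integrable_diff) auto
    then have X: "integrable P (\<lambda>z. h (x + z) - h x)"
      by (subst Pi) (auto simp: right_diff_distrib)
    have Xe: "P.expectation (\<lambda>z. h (x + z) - h x) = mollify \<rho> h x - h x"
      using k1 \<rho>i \<rho>(3) by (subst Pint) (auto simp: right_diff_distrib k2)
    have Y: "integrable P (\<lambda>z. \<bar>h (x + z) - h x\<bar> powr q)"
      using elim by (subst Pi) (auto simp: F_def add.commute)
    have "\<bar>P.expectation (\<lambda>z. h (x + z) - h x)\<bar> powr q \<le> P.expectation (\<lambda>z. \<bar>h (x + z) - h x\<bar> powr q)"
      by (rule P.jensens_inequality[OF X _ _ Y convex_on_powr_abs[OF q]]) auto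
    also have "\<dots> = J x" by (subst Pint) (auto simp: J_def F_def add.commute)
    finally show ?case unfolding Xe .
  qed
  show i: "integrable lborel (\<lambda>x. \<bar>mollify \<rho> h x - h x\<bar> powr q)"
    by (rule Bochner_Integration.integrable_bound[OF J2])
       (use pt in \<open>auto elim!: eventually_mono intro: order_trans[OF _ abs_ge_self]\<close>)
  have "(\<integral>x. \<bar>mollify \<rho> h x - h x\<bar> powr q \<partial>lborel) \<le> (\<integral>x. J x \<partial>lborel)"
    by (rule integral_mono_AE[OF i J2 pt])
  with J\<eta> show "(\<integral>x. \<bar>mollify \<rho> h x - h x\<bar> powr q \<partial>lborel) \<le> \<eta>" by simp
qed

text \<open>The radius depends on \<open>h\<close> but not on the kernel, so that a single kernel
  can serve a function and all its weak derivatives.\<close>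

lemma mollify_Lp_tendsto:
  fixes h :: "'a::euclidean_space \<Rightarrow> real"
  assumes q: "q \<ge> 1" and h: "integrable lborel h" and hq: "integrable lborel (\<lambda>x. \<bar>h x\<bar> powr q)"
    and \<eta>: "\<eta> > 0"
  shows "\<exists>e0>0. \<forall>\<rho>. \<rho> \<in> test_fun UNIV \<longrightarrow> (\<forall>x. \<rho> x \<ge> 0) \<longrightarrow> (\<integral>x. \<rho> x \<partial>lborel) = 1 \<longrightarrow>
     (\<forall>z. z \<notin> cball 0 e0 \<longrightarrow> \<rho> z = 0) \<longrightarrow>
     integrable lborel (\<lambda>x. \<bar>mollify \<rho> h x - h x\<bar> powr q) \<and>
     (\<integral>x. \<bar>mollify \<rho> h x - h x\<bar> powr q \<partial>lborel) \<le> \<eta>"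
proof -
  have [measurable]: "h \<in> borel_measurable borel" using h by auto
  have "eventually (\<lambda>z. (\<integral>x. \<bar>h (z + x) - h x\<bar> powr q \<partial>lborel) < \<eta>) (at 0)"
    using order_tendstoD(2)[OF Lp_translation_continuous[of q h] \<eta>] q hq by simp
  then obtain d where d: "d > 0" "\<And>z. z \<noteq> 0 \<Longrightarrow> norm z < d \<Longrightarrow> (\<integral>x. \<bar>h (z + x) - h x\<bar> powr q \<partial>lborel) < \<eta>"
    unfolding eventually_at by (auto simp: dist_norm)
  have s: "(\<integral>x. \<bar>h (z + x) - h x\<bar> powr q \<partial>lborel) \<le> \<eta>" if "norm z < d" for z
    using d(2)[of z] that \<eta> q by (cases "z = 0") (auto intro: less_imp_le)
  show ?thesis
  proof (intro exI[of _ "d / 2"] conjI allI impI)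
    fix \<rho> :: "'a \<Rightarrow> real" assume a: "\<rho> \<in> test_fun UNIV" "\<forall>x. \<rho> x \<ge> 0" "(\<integral>x. \<rho> x \<partial>lborel) = 1" "\<forall>z. z \<notin> cball 0 (d / 2) \<longrightarrow> \<rho> z = 0"
    have sm: "(\<integral>x. \<bar>h (z + x) - h x\<bar> powr q \<partial>lborel) \<le> \<eta>" if "\<rho> z \<noteq> 0" for z
      using a(4) that d(1) by (intro s) (force simp: dist_norm)
    show "integrable lborel (\<lambda>x. \<bar>mollify \<rho> h x - h x\<bar> powr q)"
      "(\<integral>x. \<bar>mollify \<rho> h x - h x\<bar> powr q \<partial>lborel) \<le> \<eta>"
      using mollify_Lp_estimate[OF q h hq a(1) _ a(3) sm] a(2) by auto
  qed (use d(1) in simp)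
qed

section \<open>The truncation function\<close>

text \<open>
  \<open>testH\<close> is the function \<open>H\<close> and \<open>entr\<close> the function \<open>\<Phi>\<close> of the introduction; \<open>testH'\<close> and \<open>entr'\<close>
  are their derivatives.
\<close>

definition testH :: "real \<Rightarrow> real \<Rightarrow> real \<Rightarrow> real" where
  "testH \<alpha> d r = - (eflat \<alpha> d 0 (- r) + d * eflat \<alpha> d \<alpha> (- r))"

definition testH' :: "real \<Rightarrow> real \<Rightarrow> real \<Rightarrow> real" where
  "testH' \<alpha> d r = \<alpha> * d\<^sup>2 * eflat \<alpha> d (2 * \<alpha> + 1) (- r)"

definition entr :: "real \<Rightarrow> real \<Rightarrow> real" where
  "entr d w = (if w > 0 then w * exp (- (d / w)) else 0)"

definition entr' :: "real \<Rightarrow> real \<Rightarrow> real" where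
  "entr' d w = (if w > 0 then (1 + d / w) * exp (- (d / w)) else 0)"

lemma smooth_testH: "\<alpha> > 0 \<Longrightarrow> d > 0 \<Longrightarrow> smooth (testH \<alpha> d)"
proof -
  assume a: "\<alpha> > 0" "d > 0"
  have L: "bounded_linear (\<lambda>r::real. - r)" by (intro bounded_linear_minus bounded_linear_ident)
  have "smooth (\<lambda>r. eflat \<alpha> d \<beta> (- r + 0))" for \<beta>
    by (rule smooth_affine[OF smooth_eflat[OF a] L]) (auto intro: exI[of _ "-1"])
  then have "smooth (\<lambda>r. (-1) * (eflat \<alpha> d 0 (- r) + d * eflat \<alpha> d \<alpha> (- r)))"
    by (intro smooth_intros(1,2) smooth_intros(3)[of "\<lambda>_. -1"] smooth_intros(3)[of "\<lambda>_. d"]) simp_all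
  then show ?thesis by (simp add: testH_def[abs_def])
qed

text \<open>The two contributions with exponent \<alpha> + 1 cancel, just as the derivative of (1 +
  y) exp(-y) is -y exp(-y). This leaves a single nonnegative term.\<close>

lemma testH_has_derivative:
  assumes a: "\<alpha> > 0" "d > 0"
  shows "(testH \<alpha> d has_field_derivative testH' \<alpha> d r) (at r)"
proof -
  have "((\<lambda>r. eflat \<alpha> d \<beta> (- r)) has_field_derivative
      (\<alpha> * d * eflat \<alpha> d (\<beta> + \<alpha> + 1) (-r) - \<beta> * eflat \<alpha> d (\<beta> + 1) (-r)) * (-1)) (at r)" for \<beta>
    by (rule DERIV_chain2[OF has_field_derivative_eflat[OF a]]) (auto intro!: derivative_eq_intros)
  from DERIV_minus[OF DERIV_add[OF this[of 0] DERIV_cmult[OF this[of \<alpha>], of d]]]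
  show ?thesis
    by (simp add: testH_def[abs_def] testH'_def algebra_simps power2_eq_square)
qed

lemma dir_deriv_testH: "\<alpha> > 0 \<Longrightarrow> d > 0 \<Longrightarrow> dir_deriv 1 (testH \<alpha> d) r = testH' \<alpha> d r"
  using dir_deriv_real[OF testH_has_derivative, of \<alpha> d 1 r] by simp

lemma testH_nonneg_arg: "r \<ge> 0 \<Longrightarrow> testH \<alpha> d r = 0" "r \<ge> 0 \<Longrightarrow> testH' \<alpha> d r = 0"
  by (auto simp: testH_def testH'_def eflat_def)

lemma testH'_nonneg: "\<alpha> > 0 \<Longrightarrow> testH' \<alpha> d r \<ge> 0"
  by (simp add: testH'_def eflat_def)

lemma signed_powr_neg: "r < 0 \<Longrightarrow> - signed_powr \<alpha> r = (- r) powr \<alpha>"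
  by (simp add: signed_powr_def powr_diff)

lemma signed_powr_nonneg: "r \<ge> 0 \<Longrightarrow> signed_powr \<alpha> r \<ge> 0"
  by (simp add: signed_powr_def)

text \<open>For r < 0 both sides equal -(1 + y) exp(-y) with y = d (-r)^(-\<alpha>); otherwise both
  vanish.\<close>

lemma testH_eq_entr': "testH \<alpha> d r = - entr' d (- signed_powr \<alpha> r)"
proof (cases "r < 0")
  case True
  then show ?thesis
    by (simp add: signed_powr_neg entr'_def testH_def eflat_def powr_minus divide_simps algebra_simps)
next
  case False
  then show ?thesis using signed_powr_nonneg[of r \<alpha>] by (simp add: entr'_def testH_nonneg_arg)
qed

lemma entr'_bounds: "d \<ge> 0 \<Longrightarrow> 0 \<le> entr' d w" "d \<ge> 0 \<Longrightarrow> entr' d w \<le> 1"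
proof -
  have "(1 + x) * exp (- x) \<le> exp x * exp (- x)" for x :: real
    by (intro mult_right_mono) auto
  then have "(1 + x) * exp (- x) \<le> 1" for x :: real by (simp add: exp_minus)
  then show "0 \<le> entr' d w" "entr' d w \<le> 1" if "d \<ge> 0"
    using that by (auto simp: entr'_def)
qed

lemma testH_bounds: "d \<ge> 0 \<Longrightarrow> testH \<alpha> d r \<le> 0" "d \<ge> 0 \<Longrightarrow> \<bar>testH \<alpha> d r\<bar> \<le> 1"
  using entr'_bounds[of d "- signed_powr \<alpha> r"] by (auto simp: testH_eq_entr')

text \<open>With a = d/w and b = d/w', both arguments being positive, the supporting line inequality
  is 1 + (a - b) \<le> exp(a - b) multiplied by w' exp(-a), since a w = b w' = d.\<close>

lemma entr_convex:
  assumes d: "d \<ge> 0"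
  shows "entr d w - entr d w' \<le> entr' d w * (w - w')"
proof (cases "w > 0")
  case False
  then show ?thesis by (simp add: entr_def entr'_def)
next
  case w: True
  show ?thesis
  proof (cases "w' > 0")
    case False
    have "w * exp (- (d / w)) \<le> ((1 + d / w) * exp (- (d / w))) * (w - w')"
    proof -
      have "exp (- (d / w)) * w \<le> ((1 + d / w) * exp (- (d / w))) * (w - w')"
        using w False d by (intro mult_mono) (auto simp: algebra_simps)
      then show ?thesis by (simp add: mult.commute)
    qed
    with w False show ?thesis by (simp add: entr_def entr'_def)
  next
    case w': True
    define a where "a = d / w"
    define b where "b = d / w'"
    have aw: "a * w = d" "b * w' = d" using w w' by (auto simp: a_def b_def)
    have "1 + (a - b) \<le> exp (a - b)" by simp
    then have "w' * (1 + (a - b)) \<le> w' * exp (a - b)" using w' by (intro mult_left_mono) auto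
    then have "w - w' * exp (a - b) \<le> (1 + a) * (w - w')" using aw by (simp add: algebra_simps)
    then have "exp (- a) * (w - w' * exp (a - b)) \<le> exp (- a) * ((1 + a) * (w - w'))"
      by (intro mult_left_mono) auto
    moreover have "exp (- a) * exp (a - b) = exp (- b)" by (simp add: exp_add[symmetric])
    then have "exp (- a) * (w - w' * exp (a - b)) = w * exp (- a) - w' * exp (- b)"
      by (simp add: right_diff_distrib mult.assoc mult.left_commute[of _ w'])
    moreover have "exp (- a) * ((1 + a) * (w - w')) = ((1 + a) * exp (- a)) * (w - w')"
      by (simp only: mult_ac)
    ultimately have "w * exp (- a) - w' * exp (- b) \<le> ((1 + a) * exp (- a)) * (w - w')" by simp
    then show ?thesis using w w' by (simp only: entr_def entr'_def a_def b_def if_True)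
  qed
qed

lemma entr_nonneg: "0 \<le> entr d w" by (simp add: entr_def)

lemma entr_le: "d \<ge> 0 \<Longrightarrow> entr d w \<le> max 0 w"
  by (auto simp: entr_def max_def)

lemma entr_Lipschitz:
  assumes d: "d \<ge> 0"
  shows "\<bar>entr d w - entr d w'\<bar> \<le> \<bar>w - w'\<bar>"
proof -
  have "entr d w - entr d w' \<le> \<bar>w - w'\<bar>" for w w'
  proof -
    have "entr' d w * (w - w') \<le> \<bar>entr' d w * (w - w')\<bar>" by simp
    also have "\<dots> \<le> 1 * \<bar>w - w'\<bar>"
      unfolding abs_mult using entr'_bounds[OF d, of w] by (intro mult_right_mono) auto
    finally show ?thesis using entr_convex[OF d, of w w'] by simp
  qed
  from this[of w w'] this[of w' w] show ?thesis by (simp add: abs_minus_commute)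
qed

lemma entr_tendsto: "(\<lambda>n. entr (inverse (real (Suc n))) w) \<longlonglongrightarrow> max 0 w"
proof (cases "w > 0")
  case True
  have "(\<lambda>n. w * exp (- (inverse (real (Suc n)) / w))) \<longlonglongrightarrow> w * exp (- (0 / w))"
    using True by (intro tendsto_intros LIMSEQ_inverse_real_of_nat) auto
  with True show ?thesis by (simp add: entr_def)
qed (simp add: entr_def)

text \<open>With y = d (-r)^(-\<alpha>) the product is \<alpha> y^2 exp(-y). It never exceeds 2
  \<alpha>, whatever \<open>d\<close> is, and for fixed \<open>r\<close> the cruder bound \<alpha>
  y^2 tends to 0 with \<open>d\<close>.\<close>

lemma abs_mult_testH':
  assumes a: "\<alpha> > 0" "d > 0"
  shows "\<bar>r\<bar> * testH' \<alpha> d r \<le> 2 * \<alpha>"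
    and "r < 0 \<Longrightarrow> \<bar>r\<bar> * testH' \<alpha> d r \<le> \<alpha> * (d * (- r) powr (-\<alpha>))\<^sup>2"
proof -
  have eq: "\<bar>r\<bar> * testH' \<alpha> d r = \<alpha> * ((d * (- r) powr (-\<alpha>))\<^sup>2 * exp (- (d * (- r) powr (-\<alpha>))))" if "r < 0" for r
  proof -
    define X where "X = (- r) powr (- (2 * \<alpha> + 1))"
    define E where "E = exp (- (d * (- r) powr (-\<alpha>)))"
    have "X * (- r) = (- r) powr (- (2 * \<alpha> + 1)) * (- r) powr 1" using that by (simp add: X_def)
    also have "\<dots> = (- r) powr (- (2 * \<alpha> + 1) + 1)" by (simp only: powr_add)
    also have "- (2 * \<alpha> + 1) + 1 = - \<alpha> + - \<alpha>" by simp
    also have "(- r) powr (- \<alpha> + - \<alpha>) = ((- r) powr (-\<alpha>))\<^sup>2" by (simp only: powr_add power2_eq_square)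
    finally have X: "X * (- r) = ((- r) powr (-\<alpha>))\<^sup>2" .
    have "\<bar>r\<bar> * testH' \<alpha> d r = (- r) * (\<alpha> * d\<^sup>2 * (X * E))"
      using that by (simp add: testH'_def eflat_def X_def E_def)
    also have "\<dots> = \<alpha> * (d\<^sup>2 * (X * (- r)) * E)" by (simp only: mult_ac)
    also have "\<dots> = \<alpha> * ((d * (- r) powr (-\<alpha>))\<^sup>2 * E)" by (simp only: X power_mult_distrib)
    finally show ?thesis by (simp only: E_def)
  qed
  have b2: "y\<^sup>2 * exp (- y) \<le> 2" if "y \<ge> 0" for y :: real
  proof -
    have "y\<^sup>2 \<le> 2 * exp y" using exp_lower_Taylor_quadratic[OF that] that by simp
    then show ?thesis by (simp add: exp_minus divide_simps)
  qed
  show "\<bar>r\<bar> * testH' \<alpha> d r \<le> 2 * \<alpha>"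
  proof (cases "r < 0")
    case True
    show ?thesis unfolding eq[OF True]
      using b2[of "d * (- r) powr (-\<alpha>)"] a by (simp add: mult.commute)
  next
    case False
    then show ?thesis using a by (simp add: testH_nonneg_arg)
  qed
  show "\<bar>r\<bar> * testH' \<alpha> d r \<le> \<alpha> * (d * (- r) powr (-\<alpha>))\<^sup>2" if "r < 0"
    unfolding eq[OF that] using a by (intro mult_left_mono mult_left_le) auto
qed

lemma abs_mult_testH'_tendsto:
  assumes a: "\<alpha> > 0"
  shows "(\<lambda>n. \<bar>r\<bar> * testH' \<alpha> (inverse (real (Suc n))) r) \<longlonglongrightarrow> 0"
proof (cases "r < 0")
  case True
  show ?thesis
  proof (rule tendsto_sandwich[of "\<lambda>_. 0" _ _ "\<lambda>n. \<alpha> * (inverse (real (Suc n)) * (- r) powr (-\<alpha>))\<^sup>2"])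
    have "(\<lambda>n. \<alpha> * (inverse (real (Suc n)) * (- r) powr (-\<alpha>))\<^sup>2) \<longlonglongrightarrow> \<alpha> * (0 * (- r) powr (-\<alpha>))\<^sup>2"
      by (intro tendsto_intros LIMSEQ_inverse_real_of_nat)
    then show "(\<lambda>n. \<alpha> * (inverse (real (Suc n)) * (- r) powr (-\<alpha>))\<^sup>2) \<longlonglongrightarrow> 0" by simp
  qed (use abs_mult_testH'(2)[OF a _ True] testH'_nonneg[OF a] in auto)
qed (simp add: testH_nonneg_arg)

text \<open>Far from 0 the bound on |r| H'(r) suffices, near 0 continuity. This bound may depend on
  \<open>d\<close>; it serves only to justify the test function.\<close>

lemma testH'_bounded:
  assumes a: "\<alpha> > 0" "d > 0"
  shows "\<exists>M. \<forall>r. \<bar>testH' \<alpha> d r\<bar> \<le> M"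
proof -
  have cont: "continuous_on UNIV (testH' \<alpha> d)"
  proof -
    have "dir_deriv 1 (testH \<alpha> d) = testH' \<alpha> d" using dir_deriv_testH[OF a] by auto
    then show ?thesis
      using smooth_imp_continuous[OF smooth_dir_deriv[OF smooth_testH[OF a], of 1]] by simp
  qed
  have "bounded (testH' \<alpha> d ` {-1..0})"
    by (intro compact_imp_bounded compact_continuous_image continuous_on_subset[OF cont]) auto
  then obtain B where B: "\<And>r. r \<in> {-1..0} \<Longrightarrow> \<bar>testH' \<alpha> d r\<bar> \<le> B" unfolding bounded_pos by force
  have "\<bar>testH' \<alpha> d r\<bar> \<le> max B (2 * \<alpha>)" for r
  proof (cases "r < -1")
    case True
    have "1 * testH' \<alpha> d r \<le> \<bar>r\<bar> * testH' \<alpha> d r"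
      using True testH'_nonneg[OF a(1)] by (intro mult_right_mono) auto
    then show ?thesis using abs_mult_testH'(1)[OF a, of r] testH'_nonneg[OF a(1), of d r] by simp
  next
    case False
    then show ?thesis using B[of r] testH_nonneg_arg(2)[of r \<alpha> d] a by (cases "r \<le> 0") (auto simp: max_def)
  qed
  then show ?thesis by blast
qed

section \<open>Increments of a continuous function from its weak derivative\<close>

lemma integral_mult_mollifier_approx:
  fixes \<beta> \<rho> :: "real \<Rightarrow> real"
  assumes \<rho>: "\<And>x. \<rho> x \<ge> 0" "integrable lborel \<rho>" "(\<integral>x. \<rho> x \<partial>lborel) = 1"
    and i: "integrable lborel (\<lambda>x. \<beta> x * \<rho> x)"
    and c: "\<And>x. \<rho> x \<noteq> 0 \<Longrightarrow> \<bar>\<beta> x - y\<bar> \<le> e"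
  shows "\<bar>(\<integral>x. \<beta> x * \<rho> x \<partial>lborel) - y\<bar> \<le> e"
proof -
  have "(\<integral>x. \<beta> x * \<rho> x \<partial>lborel) - y = (\<integral>x. \<beta> x * \<rho> x - y * \<rho> x \<partial>lborel)"
    using i \<rho> by simp
  also have "\<bar>\<integral>x. \<beta> x * \<rho> x - y * \<rho> x \<partial>lborel\<bar> \<le> (\<integral>x. \<bar>\<beta> x * \<rho> x - y * \<rho> x\<bar> \<partial>lborel)"
    by (rule integral_abs_bound)
  also have "(\<integral>x. \<bar>\<beta> x * \<rho> x - y * \<rho> x\<bar> \<partial>lborel) \<le> (\<integral>x. e * \<rho> x \<partial>lborel)"
  proof (rule integral_mono)
    show "integrable lborel (\<lambda>x. \<bar>\<beta> x * \<rho> x - y * \<rho> x\<bar>)"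
      using i \<rho>(2) by (intro integrable_abs Bochner_Integration.integrable_diff) auto
    show "\<bar>\<beta> x * \<rho> x - y * \<rho> x\<bar> \<le> e * \<rho> x" for x
      using c[of x] \<rho>(1)[of x]
      by (cases "\<rho> x = 0") (auto simp: left_diff_distrib[symmetric] abs_mult intro: mult_right_mono)
  qed (use \<rho>(2) in simp)
  finally show ?thesis using \<rho>(3) by simp
qed

text \<open>\<open>P\<close> is the distribution function of a mollifier centred at s + e.\<close>

lemma smooth_step_exists:
  fixes s e :: real
  assumes e: "e > 0"
  obtains P \<rho> where "\<And>x. (P has_field_derivative \<rho> x) (at x)" "smooth \<rho>" "\<And>x. \<rho> x \<ge> 0"
    "integrable lborel \<rho>" "(\<integral>x. \<rho> x \<partial>lborel) = 1" "\<And>x. x \<notin> {s..s + 2 * e} \<Longrightarrow> \<rho> x = 0"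
    "\<And>x. x \<le> s \<Longrightarrow> P x = 0" "\<And>x. x \<ge> s + 2 * e \<Longrightarrow> P x = 1" "\<And>x. 0 \<le> P x \<and> P x \<le> 1"
proof -
  obtain \<rho> :: "real \<Rightarrow> real" where \<rho>: "smooth \<rho>" "\<And>x. \<rho> x \<ge> 0" "integrable lborel \<rho>" "(\<integral>x. \<rho> x \<partial>lborel) = 1"
    "\<And>x. x \<notin> cball (s + e) e \<Longrightarrow> \<rho> x = 0"
    by (rule mollifier_exists[OF e, of "s + e"]) blast
  have supp: "\<rho> x = 0" if "x \<notin> {s..s + 2 * e}" for x
    using that by (intro \<rho>(5)) (auto simp: cball_def dist_real_def abs_real_def split: if_splits)
  have [measurable]: "\<rho> \<in> borel_measurable borel" using \<rho>(3) by auto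
  define P where "P x = (\<integral>y. \<rho> y * indicator {..x} y \<partial>lborel)" for x
  have Pi: "integrable lborel (\<lambda>y. \<rho> y * indicator S y)" if "S \<in> sets borel" for S
    using \<rho>(3) that by (intro integrable_real_mult_indicator) auto
  have D: "(P has_field_derivative \<rho> x) (at x)" for x
  proof -
    \<comment> \<open>Integrating from a point to the left of both \<open>x\<close> and the support
      of \<rho> reproduces \<open>P\<close> near \<open>x\<close>, so the fundamental theorem of
      calculus applies.\<close>
    define a where "a = min x s - 1"
    define b where "b = max x s + 1"
    have ab: "a < x" "x < b" "a < s" by (auto simp: a_def b_def)
    have c: "continuous_on {a..b} \<rho>" using smooth_imp_continuous[OF \<rho>(1)] by (rule continuous_on_subset) simp
    have "((\<lambda>u. integral {a..u} \<rho>) has_real_derivative \<rho> x) (at x within {a..b})"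
      using integral_has_real_derivative[OF c] ab by auto
    then have D: "((\<lambda>u. integral {a..u} \<rho>) has_real_derivative \<rho> x) (at x)"
      using ab by (simp add: at_within_Icc_at)
    have eq: "P u = integral {a..u} \<rho>" if "u > a" for u
    proof -
      have i: "set_integrable lborel {a..u} \<rho>" using Pi[of "{a..u}"] by (simp add: set_integrable_def mult.commute)
      have "P u = (\<integral>y. \<rho> y * indicator {a..u} y \<partial>lborel)"
        unfolding P_def using ab supp by (intro Bochner_Integration.integral_cong) (auto split: split_indicator)
      also have "\<dots> = (LINT y:{a..u}|lborel. \<rho> y)" by (simp add: set_lebesgue_integral_def mult.commute)
      also have "\<dots> = integral {a..u} \<rho>" by (rule set_borel_integral_eq_integral(2)[OF i])
      finally show ?thesis .
    qed
    have "eventually (\<lambda>u. u > a) (nhds x)"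
      using ab(1) eventually_nhds_in_open[of "{a<..}" x] by auto
    then have "eventually (\<lambda>u. integral {a..u} \<rho> = P u) (nhds x)"
      by eventually_elim (simp add: eq)
    with D show ?thesis by (subst (asm) DERIV_cong_ev[OF refl]) auto
  qed
  have P0: "P x = 0" if "x \<le> s" for x
  proof -
    \<comment> \<open>The support condition says nothing at the point \<open>s\<close> itself, which
      is a null set.\<close>
    have "AE y in lborel. \<rho> y * indicator {..x} y = 0"
      using AE_lborel_singleton[of s] by eventually_elim (use supp that in \<open>auto split: split_indicator\<close>)
    then show ?thesis unfolding P_def by (simp add: integral_eq_zero_AE)
  qed
  have P1: "P x = 1" if "x \<ge> s + 2 * e" for x
  proof -
    have "P x = (\<integral>y. \<rho> y \<partial>lborel)" unfolding P_def
      using supp that by (intro Bochner_Integration.integral_cong) (auto split: split_indicator)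
    with \<rho>(4) show ?thesis by simp
  qed
  have Pb: "0 \<le> P x \<and> P x \<le> 1" for x
  proof -
    have "P x \<le> (\<integral>y. \<rho> y \<partial>lborel)" unfolding P_def
      using \<rho>(2) by (intro integral_mono Pi \<rho>(3)) (auto split: split_indicator)
    moreover have "P x \<ge> 0" unfolding P_def using \<rho>(2) by simp
    ultimately show ?thesis using \<rho>(4) by simp
  qed
  show thesis by (rule that[OF D \<rho>(1-4) supp P0 P1 Pb])
qed

text \<open>The test functions rise from 0 to 1 just after \<open>s\<close> and fall back just after
  \<open>t\<close>. Their derivatives concentrate at the two points, where continuity of \<beta> is
  used, and they converge to the indicator of the interval.\<close>

lemma weak_derivative_increment:
  fixes \<beta> k :: "real \<Rightarrow> real"
  assumes \<beta>: "integrable lborel \<beta>" and k: "integrable lborel k"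
    and cont: "continuous_on {0<..<T} \<beta>"
    and wd: "\<And>\<eta>. \<eta> \<in> test_fun {0<..<T} \<Longrightarrow> (\<integral>x. \<beta> x * dir_deriv 1 \<eta> x \<partial>lborel) = - (\<integral>x. k x * \<eta> x \<partial>lborel)"
    and st: "0 < s" "s < t" "t < T"
  shows "\<beta> t - \<beta> s = (\<integral>x. k x * indicator {s<..t} x \<partial>lborel)"
proof -
  have [measurable]: "\<beta> \<in> borel_measurable borel" "k \<in> borel_measurable borel" using \<beta> k by auto
  \<comment> \<open>Small enough for the two ramps of width 2 e to be disjoint and to remain inside
    (0, T).\<close>
  define e where "e n = min (t - s) (T - t) / 4 * inverse (real (Suc n))" for n
  have e: "e n > 0" "t + 2 * e n < T" "s + 2 * e n < t" for n
  proof -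
    have m: "min (t - s) (T - t) > 0" using st by simp
    then show "e n > 0" by (simp add: e_def)
    have "inverse (real (Suc n)) \<le> 1" by (simp add: inverse_le_1_iff)
    then have "e n \<le> min (t - s) (T - t) / 4" unfolding e_def using m by (intro mult_left_le) auto
    then show "t + 2 * e n < T" "s + 2 * e n < t" using m by auto
  qed
  have e0: "e \<longlonglongrightarrow> 0"
    unfolding e_def using tendsto_mult[OF tendsto_const LIMSEQ_inverse_real_of_nat] by fastforce
  have ex: "\<exists>P \<rho>. (\<forall>x. (P has_field_derivative \<rho> x) (at x)) \<and> smooth \<rho> \<and> (\<forall>x. \<rho> x \<ge> 0) \<and>
    integrable lborel \<rho> \<and> (\<integral>x. \<rho> x \<partial>lborel) = 1 \<and> (\<forall>x. x \<notin> {c..c + 2 * e n} \<longrightarrow> \<rho> x = 0) \<and>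
    (\<forall>x. x \<le> c \<longrightarrow> P x = 0) \<and> (\<forall>x. x \<ge> c + 2 * e n \<longrightarrow> P x = 1) \<and> (\<forall>x. 0 \<le> P x \<and> P x \<le> 1)" for c n
    by (rule smooth_step_exists[OF e(1)[of n], of c]) blast
  define Q where "Q c n P \<rho> \<longleftrightarrow> (\<forall>x. (P has_field_derivative \<rho> x) (at x)) \<and> smooth \<rho> \<and> (\<forall>x. \<rho> x \<ge> 0) \<and>
    integrable lborel \<rho> \<and> (\<integral>x. \<rho> x \<partial>lborel) = 1 \<and> (\<forall>x. x \<notin> {c..c + 2 * e n} \<longrightarrow> \<rho> x = 0) \<and>
    (\<forall>x. x \<le> c \<longrightarrow> P x = 0) \<and> (\<forall>x. x \<ge> c + 2 * e n \<longrightarrow> P x = 1) \<and> (\<forall>x. 0 \<le> P x \<and> P x \<le> 1)"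
    for c n and P \<rho> :: "real \<Rightarrow> real"
  have "\<forall>c n. \<exists>P \<rho>. Q c n P \<rho>" using ex unfolding Q_def by blast
  then obtain P \<rho> where PQ: "\<And>c n. Q c n (P c n) (\<rho> c n)" by metis
  have PD: "(P c n has_field_derivative \<rho> c n x) (at x)" and \<rho>s: "smooth (\<rho> c n)" and \<rho>0: "\<rho> c n x \<ge> 0"
    and \<rho>i: "integrable lborel (\<rho> c n)" and \<rho>1: "(\<integral>x. \<rho> c n x \<partial>lborel) = 1"
    and \<rho>supp: "x \<notin> {c..c + 2 * e n} \<Longrightarrow> \<rho> c n x = 0" and P0: "x \<le> c \<Longrightarrow> P c n x = 0"
    and P1: "x \<ge> c + 2 * e n \<Longrightarrow> P c n x = 1" and Pb: "0 \<le> P c n x" "P c n x \<le> 1" for c n x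
    using PQ[of c n] unfolding Q_def by blast+
  have \<rho>test: "\<rho> c n \<in> test_fun UNIV" for c n
    by (rule test_funI[OF \<rho>s, of "{c..c + 2 * e n}"]) (auto intro: \<rho>supp)
  define \<eta> where "\<eta> n x = P s n x - P t n x" for n x
  have \<eta>D: "(\<eta> n has_field_derivative (\<rho> s n x - \<rho> t n x)) (at x)" for n x
    unfolding \<eta>_def[abs_def] by (intro DERIV_diff PD)
  have \<eta>test: "\<eta> n \<in> test_fun {0<..<T}" for n
  proof (rule test_funI[of _ "{s..t + 2 * e n}"])
    have "C_order j (\<lambda>x. \<rho> s n x - \<rho> t n x)" for j
      using smooth_diff[OF \<rho>s \<rho>s] by (simp add: smooth_def)
    then have "C_order (Suc j) (\<eta> n)" for j by (rule C_order_SucI_real[OF \<eta>D])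
    then show "smooth (\<eta> n)" using C_order_SucD unfolding smooth_def by blast
    show "{s..t + 2 * e n} \<subseteq> {0<..<T}" using st e(2)[of n] by auto
    show "\<eta> n x = 0" if "x \<notin> {s..t + 2 * e n}" for x
      using that st P0[of x s n] P0[of x t n] P1[of s n x] P1[of t n x] e(1)[of n]
      by (cases "x < s") (auto simp: \<eta>_def)
  qed auto
  have \<eta>dd: "dir_deriv 1 (\<eta> n) x = \<rho> s n x - \<rho> t n x" for n x
    using dir_deriv_real[OF \<eta>D, of 1] by simp
  have \<beta>\<rho>i: "integrable lborel (\<lambda>x. \<beta> x * \<rho> c n x)" for c n
  proof (rule integrable_mult_test_fun[OF _ _ \<rho>test])
    show "integrable lborel (\<lambda>x. indicator K x * \<beta> x)" if "compact K" for K
      using \<beta> borel_closed[OF compact_imp_closed[OF that]]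
      by (subst mult.commute) (auto intro!: integrable_real_mult_indicator)
  qed simp
  have lim\<beta>: "(\<lambda>n. \<integral>x. \<beta> x * \<rho> c n x \<partial>lborel) \<longlonglongrightarrow> \<beta> c" if c: "0 < c" "c < T" for c
  proof (rule LIMSEQ_I)
    fix r :: real assume r: "r > 0"
    have "isCont \<beta> c" using cont c by (simp add: continuous_on_eq_continuous_at)
    then obtain d where d: "d > 0" "\<And>x. \<bar>x - c\<bar> < d \<Longrightarrow> \<bar>\<beta> x - \<beta> c\<bar> < r / 2"
      using r unfolding continuous_at_eps_delta
      by (metis half_gt_zero dist_real_def)
    have "eventually (\<lambda>n. \<bar>e n - 0\<bar> < d / 2) sequentially"
      using tendstoD[OF e0, of "d / 2"] d by (simp add: dist_real_def)
    then obtain n0 where n0: "\<And>n. n \<ge> n0 \<Longrightarrow> \<bar>e n\<bar> < d / 2" by (auto simp: eventually_sequentially)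
    show "\<exists>no. \<forall>n\<ge>no. norm ((\<integral>x. \<beta> x * \<rho> c n x \<partial>lborel) - \<beta> c) < r"
    proof (intro exI[of _ n0] allI impI)
      fix n assume n: "n \<ge> n0"
      have "\<bar>(\<integral>x. \<beta> x * \<rho> c n x \<partial>lborel) - \<beta> c\<bar> \<le> r / 2"
      proof (rule integral_mult_mollifier_approx[OF \<rho>0 \<rho>i \<rho>1 \<beta>\<rho>i])
        fix x assume "\<rho> c n x \<noteq> 0"
        then have "x \<in> {c..c + 2 * e n}" using \<rho>supp by blast
        then show "\<bar>\<beta> x - \<beta> c\<bar> \<le> r / 2"
          using n0[OF n] by (intro less_imp_le[OF d(2)]) auto
      qed
      then show "norm ((\<integral>x. \<beta> x * \<rho> c n x \<partial>lborel) - \<beta> c) < r" using r by simp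
    qed
  qed
  have "(\<lambda>n. (\<integral>x. \<beta> x * \<rho> s n x \<partial>lborel) - (\<integral>x. \<beta> x * \<rho> t n x \<partial>lborel)) \<longlonglongrightarrow> \<beta> s - \<beta> t"
    using st by (intro tendsto_diff lim\<beta>) auto
  moreover have "(\<integral>x. \<beta> x * \<rho> s n x \<partial>lborel) - (\<integral>x. \<beta> x * \<rho> t n x \<partial>lborel) = - (\<integral>x. k x * \<eta> n x \<partial>lborel)" for n
    using wd[OF \<eta>test[of n]] \<beta>\<rho>i by (simp add: \<eta>dd right_diff_distrib)
  ultimately have l1: "(\<lambda>n. - (\<integral>x. k x * \<eta> n x \<partial>lborel)) \<longlonglongrightarrow> \<beta> s - \<beta> t" by simp
  have "(\<lambda>n. \<integral>x. k x * \<eta> n x \<partial>lborel) \<longlonglongrightarrow> (\<integral>x. k x * indicator {s<..t} x \<partial>lborel)"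
  proof (rule integral_dominated_convergence[where w="\<lambda>x. \<bar>k x\<bar>"])
    have [measurable]: "\<eta> n \<in> borel_measurable borel" for n by (rule test_fun_measurable[OF \<eta>test])
    show "(\<lambda>x. k x * \<eta> n x) \<in> borel_measurable lborel" for n by simp
    show "AE x in lborel. norm (k x * \<eta> n x) \<le> \<bar>k x\<bar>" for n
    proof (rule AE_I2)
      fix x
      have "\<bar>\<eta> n x\<bar> \<le> 1" using Pb[of s n x] Pb[of t n x] by (auto simp: \<eta>_def)
      then show "norm (k x * \<eta> n x) \<le> \<bar>k x\<bar>" by (auto simp: abs_mult intro: mult_left_le)
    qed
    show "AE x in lborel. (\<lambda>n. k x * \<eta> n x) \<longlonglongrightarrow> k x * indicator {s<..t} x"
    proof (rule AE_I2)
      fix x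
      have lP: "(\<lambda>n. P c n x) \<longlonglongrightarrow> (if x \<le> c then 0 else 1)" for c
      proof (cases "x \<le> c")
        case False
        have "eventually (\<lambda>n. \<bar>e n - 0\<bar> < (x - c) / 2) sequentially"
          using tendstoD[OF e0, of "(x - c) / 2"] False by (simp add: dist_real_def)
        then have "eventually (\<lambda>n. 1 = P c n x) sequentially"
          by eventually_elim (subst P1, auto)
        then show ?thesis using False by (auto intro: Lim_transform_eventually)
      qed (simp add: P0)
      have "(\<lambda>n. k x * \<eta> n x) \<longlonglongrightarrow> k x * ((if x \<le> s then 0 else 1) - (if x \<le> t then 0 else 1))"
        unfolding \<eta>_def by (intro tendsto_intros lP)
      then show "(\<lambda>n. k x * \<eta> n x) \<longlonglongrightarrow> k x * indicator {s<..t} x"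
        using st by (cases "x \<le> s"; cases "x \<le> t") auto
    qed
  qed (use k in auto)
  then have "(\<lambda>n. - (\<integral>x. k x * \<eta> n x \<partial>lborel)) \<longlonglongrightarrow> - (\<integral>x. k x * indicator {s<..t} x \<partial>lborel)"
    by (rule tendsto_minus)
  with l1 have "\<beta> s - \<beta> t = - (\<integral>x. k x * indicator {s<..t} x \<partial>lborel)" by (rule LIMSEQ_unique)
  then show ?thesis by simp
qed

section \<open>Truncation of Sobolev functions\<close>

lemma axis_1_Basis: "axis i (1::real) \<in> Basis"
  by (auto simp: Basis_vec_def)

text \<open>Follows from |f| \<le> 1 + |f|^q and the finite measure of \<open>U\<close>.\<close>

lemma integrable_if_Lp_bounded_support:
  fixes f :: "'a::euclidean_space \<Rightarrow> real"
  assumes q: "q \<ge> 1" and U: "bounded U" "U \<in> sets borel" and [measurable]: "f \<in> borel_measurable borel"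
    and i: "integrable lborel (\<lambda>x. \<bar>f x\<bar> powr q)" and z: "\<And>x. x \<notin> U \<Longrightarrow> f x = 0"
  shows "integrable lborel f"
proof -
  have "integrable lborel (\<lambda>x. indicator U x + \<bar>f x\<bar> powr q)"
    using emeasure_bounded_finite[OF U(1)] U(2) i by simp
  then show ?thesis
  proof (rule Bochner_Integration.integrable_bound)
    show "AE x in lborel. norm (f x) \<le> norm (indicator U x + \<bar>f x\<bar> powr q)"
    proof (rule AE_I2)
      fix x
      have "\<bar>f x\<bar> \<le> 1 + \<bar>f x\<bar> powr q"
      proof (cases "\<bar>f x\<bar> \<le> 1")
        case True then show ?thesis using powr_ge_zero[of "\<bar>f x\<bar>" q] by linarith
      next
        case False then show ?thesis using powr_mono[OF q, of "\<bar>f x\<bar>"] by simp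
      qed
      then show "norm (f x) \<le> norm (indicator U x + \<bar>f x\<bar> powr q)"
        using z[of x] by (cases "x \<in> U") auto
    qed
  qed simp
qed

text \<open>One kernel approximates \<open>g\<close> in L^1 and every weak derivative in its own
  Lebesgue space. The derivative formula is restricted to \<open>K\<close>, because after extension
  by 0 the function \<open>g\<close> need not be weakly differentiable across the boundary.\<close>

lemma mollifier_Sobolev:
  fixes \<Omega> :: "(real^'n) set" and p :: "'n \<Rightarrow> real" and g :: "real^'n \<Rightarrow> real"
  assumes \<Omega>: "open \<Omega>" "bounded \<Omega>" and p: "\<And>i. p i > 1"
    and g: "integrable lborel g"
    and dgm: "\<And>i. dg i \<in> borel_measurable borel" and dg: "\<And>i. integrable lborel (\<lambda>x. \<bar>dg i x\<bar> powr p i)"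
    and dg0: "\<And>i x. x \<notin> \<Omega> \<Longrightarrow> dg i x = 0"
    and wd: "\<And>i \<phi>. \<phi> \<in> test_fun \<Omega> \<Longrightarrow>
        (\<integral>x. g x * dir_deriv (axis i 1) \<phi> x \<partial>lborel) = - (\<integral>x. dg i x * \<phi> x \<partial>lborel)"
    and K: "compact K" "K \<subseteq> \<Omega>" and \<eta>: "\<eta> > 0"
  shows "\<exists>\<rho>. \<rho> \<in> test_fun UNIV \<and> (\<forall>x. \<rho> x \<ge> 0) \<and>
     integrable lborel (\<lambda>x. \<bar>mollify \<rho> g x - g x\<bar>) \<and> (\<integral>x. \<bar>mollify \<rho> g x - g x\<bar> \<partial>lborel) \<le> \<eta> \<and>
     (\<forall>i. integrable lborel (\<lambda>x. \<bar>mollify \<rho> (dg i) x - dg i x\<bar> powr p i) \<and>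
       (\<integral>x. \<bar>mollify \<rho> (dg i) x - dg i x\<bar> powr p i \<partial>lborel) \<le> \<eta>) \<and>
     (\<forall>x\<in>K. \<forall>i. dir_deriv (axis i 1) (mollify \<rho> g) x = mollify \<rho> (dg i) x)"
proof -
  obtain e1 where e1: "e1 > 0" "(\<Union>x\<in>K. cball x e1) \<subseteq> \<Omega>"
    by (rule compact_subset_open_imp_cball_epsilon_subset[OF K(1) \<Omega>(1) K(2)])
  have \<Omega>b: "\<Omega> \<in> sets borel" using \<Omega> by simp
  have dgi: "integrable lborel (dg i)" for i
    by (rule integrable_if_Lp_bounded_support[OF _ \<Omega>(2) \<Omega>b dgm dg dg0]) (use p[of i] in auto)
  define good where "good e q h \<longleftrightarrow> (\<forall>\<rho>. \<rho> \<in> test_fun UNIV \<longrightarrow> (\<forall>x. \<rho> x \<ge> 0) \<longrightarrow> (\<integral>x. \<rho> x \<partial>lborel) = 1 \<longrightarrow>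
     (\<forall>z. z \<notin> cball 0 e \<longrightarrow> \<rho> z = 0) \<longrightarrow>
     integrable lborel (\<lambda>x. \<bar>mollify \<rho> h x - h x\<bar> powr q) \<and>
     (\<integral>x. \<bar>mollify \<rho> h x - h x\<bar> powr q \<partial>lborel) \<le> \<eta>)" for e q and h :: "real^'n \<Rightarrow> real"
  have ex: "\<exists>e>0. good e q h" if "q \<ge> 1" "integrable lborel h" "integrable lborel (\<lambda>x. \<bar>h x\<bar> powr q)" for q h
    using mollify_Lp_tendsto[OF that \<eta>] unfolding good_def .
  have "\<exists>e>0. good e 1 g" using g by (intro ex) auto
  then obtain e2 where e2: "e2 > 0" "good e2 1 g" by blast
  have "\<forall>i. \<exists>e>0. good e (p i) (dg i)" using ex[OF _ dgi dg] p by (auto intro: less_imp_le)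
  then obtain e3 where e3: "\<And>i. e3 i > 0" "\<And>i. good (e3 i) (p i) (dg i)" by metis
  \<comment> \<open>The least of finitely many admissible radii, which also keeps balls around
    points of \<open>K\<close> inside the domain.\<close>
  define e where "e = Min (insert e1 (insert e2 (range e3)))"
  have e: "e > 0" "e \<le> e1" "e \<le> e2" "e \<le> e3 i" for i
  proof -
    show "e > 0" unfolding e_def using e1(1) e2(1) e3(1) by auto
  qed (unfold e_def, (rule Min_le; simp)+)
  obtain \<rho> :: "real^'n \<Rightarrow> real" where \<rho>: "smooth \<rho>" "\<And>x. \<rho> x \<ge> 0" "integrable lborel \<rho>" "(\<integral>x. \<rho> x \<partial>lborel) = 1"
    "\<And>x. x \<notin> cball 0 e \<Longrightarrow> \<rho> x = 0"
    by (rule mollifier_exists[OF e(1), of "0::real^'n"]) blast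
  have \<rho>t: "\<rho> \<in> test_fun UNIV" by (rule test_funI[OF \<rho>(1), of "cball 0 e"]) (auto intro: \<rho>(5))
  have supp: "\<forall>z. z \<notin> cball 0 r \<longrightarrow> \<rho> z = 0" if "e \<le> r" for r
    using \<rho>(5) that by auto
  have 1: "integrable lborel (\<lambda>x. \<bar>mollify \<rho> g x - g x\<bar>) \<and> (\<integral>x. \<bar>mollify \<rho> g x - g x\<bar> \<partial>lborel) \<le> \<eta>"
    using e2(2) \<rho>t \<rho>(2,4) supp[OF e(3)] unfolding good_def by simp
  have 2: "integrable lborel (\<lambda>x. \<bar>mollify \<rho> (dg i) x - dg i x\<bar> powr p i) \<and>
       (\<integral>x. \<bar>mollify \<rho> (dg i) x - dg i x\<bar> powr p i \<partial>lborel) \<le> \<eta>" for i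
    using e3(2)[of i] \<rho>t \<rho>(2,4) supp[OF e(4)] unfolding good_def by blast
  have 3: "dir_deriv (axis i 1) (mollify \<rho> g) x = mollify \<rho> (dg i) x" if "x \<in> K" for x i
  proof (rule dir_deriv_mollify_local[OF \<rho>t g axis_1_Basis wd])
    show "cball x e1 \<subseteq> \<Omega>" using e1(2) that by auto
    show "\<rho> z = 0" if "z \<notin> cball 0 e1" for z using supp[OF e(2)] that by blast
  qed
  show ?thesis using \<rho>t \<rho>(2) 1 2 3 by blast
qed

text \<open>No chain rule for weak derivatives of H(v) is presupposed. The classical chain rule is
  applied to the smooth approximants, and the expected gradient appears in the limit.\<close>

lemma truncation_approx:
  fixes \<Omega> :: "(real^'n) set" and p :: "'n \<Rightarrow> real" and v g :: "real^'n \<Rightarrow> real"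
  assumes \<Omega>: "open \<Omega>" "bounded \<Omega>" and p: "\<And>i. p i > 1"
    and H: "smooth H" "\<And>r. r \<ge> 0 \<Longrightarrow> H r = 0" "\<And>r. r \<ge> 0 \<Longrightarrow> dir_deriv 1 H r = 0"
      "\<And>r. \<bar>H r\<bar> \<le> 1" "\<And>r. \<bar>dir_deriv 1 H r\<bar> \<le> M"
    and v: "integrable lborel v" and g: "integrable lborel g"
    and dvm: "\<And>i. dv i \<in> borel_measurable borel" and dv: "\<And>i. integrable lborel (\<lambda>x. \<bar>dv i x\<bar> powr p i)"
    and dgm: "\<And>i. dg i \<in> borel_measurable borel" and dg: "\<And>i. integrable lborel (\<lambda>x. \<bar>dg i x\<bar> powr p i)"
    and dg0: "\<And>i x. x \<notin> \<Omega> \<Longrightarrow> dg i x = 0"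
    and g0: "AE x in lborel. g x \<ge> 0"
    and wd: "\<And>i \<phi>. \<phi> \<in> test_fun \<Omega> \<Longrightarrow>
        (\<integral>x. g x * dir_deriv (axis i 1) \<phi> x \<partial>lborel) = - (\<integral>x. dg i x * \<phi> x \<partial>lborel)"
    and \<phi>: "\<And>k. \<phi> k \<in> test_fun \<Omega>"
    and lim: "(\<lambda>k. \<integral>x. \<bar>v x - g x - \<phi> k x\<bar> \<partial>lborel) \<longlonglongrightarrow> 0"
    and dlim: "\<And>i. (\<lambda>k. \<integral>x. \<bar>dv i x - dg i x - dir_deriv (axis i 1) (\<phi> k) x\<bar> powr p i \<partial>lborel) \<longlonglongrightarrow> 0"
  shows "\<exists>\<Psi>. (\<forall>k. \<Psi> k \<in> test_fun \<Omega>) \<and> (\<forall>k x. \<bar>\<Psi> k x\<bar> \<le> 1) \<and>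
    (AE x in lborel. (\<lambda>k. \<Psi> k x) \<longlonglongrightarrow> H (v x)) \<and>
    (\<forall>i. (\<lambda>k. \<integral>x. \<bar>dir_deriv (axis i 1) (\<Psi> k) x - dir_deriv 1 H (v x) * dv i x\<bar> powr p i \<partial>lborel) \<longlonglongrightarrow> 0)"
proof -
  note [measurable] = dvm dgm
  have p0: "p i > 0" "p i \<ge> 1" for i using p[of i] by auto
  have [measurable]: "v \<in> borel_measurable borel" "g \<in> borel_measurable borel" using v g by auto
  define H' where "H' = dir_deriv 1 H"
  have H'c: "continuous_on UNIV H'" unfolding H'_def
    using H(1) by (intro smooth_imp_continuous smooth_dir_deriv) auto
  have Hc: "continuous_on UNIV H" using H(1) by (rule smooth_imp_continuous)
  have [measurable]: "H' \<in> borel_measurable borel" "H \<in> borel_measurable borel"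
    using H'c Hc by (auto intro: borel_measurable_continuous_onI)
  have M0: "M \<ge> 0" using H(5)[of 0] by linarith
  have "\<forall>k. \<exists>K. compact K \<and> K \<subseteq> \<Omega> \<and> (\<forall>x. x \<notin> K \<longrightarrow> \<phi> k x = 0)" using test_fun_support[OF \<phi>] by blast
  then obtain K where K: "\<And>k. compact (K k)" "\<And>k. K k \<subseteq> \<Omega>" "\<And>k x. x \<notin> K k \<Longrightarrow> \<phi> k x = 0" by metis
  have Kcl: "closed (K k)" for k using K(1) by (rule compact_imp_closed)
  then have [measurable]: "K k \<in> sets borel" for k by simp
  define \<eta> where "\<eta> k = inverse (real (Suc k))" for k
  have \<eta>: "\<eta> k > 0" for k by (simp add: \<eta>_def)
  have \<eta>0: "\<eta> \<longlonglongrightarrow> 0" unfolding \<eta>_def by (rule LIMSEQ_inverse_real_of_nat)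
  define mol where "mol k \<rho> \<longleftrightarrow> \<rho> \<in> test_fun UNIV \<and> (\<forall>x. \<rho> x \<ge> 0) \<and>
     integrable lborel (\<lambda>x. \<bar>mollify \<rho> g x - g x\<bar>) \<and> (\<integral>x. \<bar>mollify \<rho> g x - g x\<bar> \<partial>lborel) \<le> \<eta> k \<and>
     (\<forall>i. integrable lborel (\<lambda>x. \<bar>mollify \<rho> (dg i) x - dg i x\<bar> powr p i) \<and>
       (\<integral>x. \<bar>mollify \<rho> (dg i) x - dg i x\<bar> powr p i \<partial>lborel) \<le> \<eta> k) \<and>
     (\<forall>x\<in>K k. \<forall>i. dir_deriv (axis i 1) (mollify \<rho> g) x = mollify \<rho> (dg i) x)" for k \<rho>
  have "\<forall>k. \<exists>\<rho>. mol k \<rho>"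
    unfolding mol_def using mollifier_Sobolev[OF \<Omega> p g dgm dg dg0 wd K(1,2) \<eta>] by blast
  from choice[OF this] obtain \<rho> where mol: "\<And>k. mol k (\<rho> k)" by blast
  have \<rho>1: "\<rho> k \<in> test_fun UNIV" for k using mol[of k] by (simp add: mol_def)
  have \<rho>2: "\<rho> k x \<ge> 0" for k x using mol[of k] by (simp add: mol_def)
  have \<rho>3: "integrable lborel (\<lambda>x. \<bar>mollify (\<rho> k) g x - g x\<bar>)" "(\<integral>x. \<bar>mollify (\<rho> k) g x - g x\<bar> \<partial>lborel) \<le> \<eta> k" for k
    using mol[of k] unfolding mol_def by blast+
  have \<rho>5: "integrable lborel (\<lambda>x. \<bar>mollify (\<rho> k) (dg i) x - dg i x\<bar> powr p i)"
     "(\<integral>x. \<bar>mollify (\<rho> k) (dg i) x - dg i x\<bar> powr p i \<partial>lborel) \<le> \<eta> k" for k i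
    using mol[of k] unfolding mol_def by blast+
  have \<rho>7: "dir_deriv (axis i 1) (mollify (\<rho> k) g) x = mollify (\<rho> k) (dg i) x" if "x \<in> K k" for k x i
    using mol[of k] that unfolding mol_def by blast
  note \<rho> = \<rho>1 \<rho>2 \<rho>3 \<rho>5 \<rho>7
  have dgi: "integrable lborel (dg i)" for i
    using \<Omega> by (intro integrable_if_Lp_bounded_support[OF p0(2) \<Omega>(2) _ dgm dg dg0]) auto
  have gs: "smooth (mollify (\<rho> k) g)" for k by (rule smooth_mollify[OF \<rho>(1) g])
  have [measurable]: "mollify (\<rho> k) g \<in> borel_measurable borel" "mollify (\<rho> k) (dg i) \<in> borel_measurable borel" for k i
    by (intro borel_measurable_continuous_onI smooth_imp_continuous smooth_mollify \<rho>(1) g dgi)+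
  have gn: "mollify (\<rho> k) g x \<ge> 0" for k x by (rule mollify_nonneg[OF \<rho>(2) g0])
  have \<phi>s: "smooth (\<phi> k)" for k using \<phi> by (rule test_fun_imp_smooth)
  have [measurable]: "\<phi> k \<in> borel_measurable borel" for k using \<phi> by (rule test_fun_measurable)
  have d\<phi>t: "dir_deriv (axis i 1) (\<phi> k) \<in> test_fun \<Omega>" for i k by (intro test_fun_dir_deriv \<phi> axis_1_Basis)
  have [measurable]: "dir_deriv (axis i 1) (\<phi> k) \<in> borel_measurable borel" for i k using d\<phi>t by (rule test_fun_measurable)
  define \<Psi> where "\<Psi> k x = H (\<phi> k x + mollify (\<rho> k) g x)" for k x
  \<comment> \<open>Outside \<open>K k\<close> the mollified function and its gradient are not
    controlled near the boundary, but there H vanishes on it. Replacing it there by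
    \<open>g\<close>, which is a.e. nonnegative, changes neither the truncation nor its gradient
    a.e., and the resulting \<open>q\<close> and \<open>dq\<close> converge to \<open>v\<close> and
    \<open>dv\<close>.\<close>
  define q where "q k x = \<phi> k x + (if x \<in> K k then mollify (\<rho> k) g x else g x)" for k x
  define dq where "dq i k x = dir_deriv (axis i 1) (\<phi> k) x + (if x \<in> K k then mollify (\<rho> k) (dg i) x else dg i x)" for i k x
  have [measurable]: "q k \<in> borel_measurable borel" "dq i k \<in> borel_measurable borel" for i k
    unfolding q_def dq_def by measurable
  have \<Psi>0: "\<Psi> k x = 0" if "x \<notin> K k" for k x
    using K(3)[OF that] gn[of k x] H(2) by (simp add: \<Psi>_def)
  have \<Psi>t: "\<Psi> k \<in> test_fun \<Omega>" for k
  proof (rule test_funI[OF _ K(1,2) \<Psi>0])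
    show "smooth (\<Psi> k)" unfolding \<Psi>_def[abs_def] by (intro smooth_intros(4)[OF H(1)] smooth_intros(2) \<phi>s gs)
  qed
  have \<Psi>q: "AE x in lborel. \<Psi> k x = H (q k x)" for k
    using g0
  proof eventually_elim
    case (elim x)
    then show ?case using \<Psi>0[of x k] K(3)[of x k] H(2) by (cases "x \<in> K k") (auto simp: q_def \<Psi>_def)
  qed
  have d\<Psi>: "AE x in lborel. dir_deriv (axis i 1) (\<Psi> k) x = H' (q k x) * dq i k x" for k i
    using g0
  proof eventually_elim
    case (elim x)
    show ?case
    proof (cases "x \<in> K k")
      case True
      have "dir_deriv (axis i 1) (\<Psi> k) x = H' (\<phi> k x + mollify (\<rho> k) g x) *
          dir_deriv (axis i 1) (\<lambda>x. \<phi> k x + mollify (\<rho> k) g x) x"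
        unfolding \<Psi>_def[abs_def] H'_def
        by (rule dir_deriv_compose(2)) (intro smooth_imp_differentiable smooth_intros(2) \<phi>s gs H(1))+
      also have "dir_deriv (axis i 1) (\<lambda>x. \<phi> k x + mollify (\<rho> k) g x) x = dq i k x"
        using True \<rho>(7)[OF True, of i] smooth_imp_differentiable[OF \<phi>s] smooth_imp_differentiable[OF gs]
        by (subst dir_deriv_add) (auto simp: dq_def)
      finally show ?thesis using True by (simp add: q_def)
    next
      case False
      then show ?thesis
        using dir_deriv_zero_outside[where K="K k" and \<phi>="\<Psi> k" and x=x and b="axis i 1", OF \<Psi>0 Kcl False]
          K(3)[OF False] elim H(3) by (simp add: q_def H'_def)
    qed
  qed
  have \<phi>i: "integrable lborel (\<phi> k)" for k using \<phi> by (rule test_fun_integrable)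
  have ql: "(\<lambda>k. \<integral>x. \<bar>q k x - v x\<bar> \<partial>lborel) \<longlonglongrightarrow> 0" and qi: "\<And>k. integrable lborel (\<lambda>x. q k x - v x)"
  proof -
    have eq: "q k x - v x = - (v x - g x - \<phi> k x) + indicator (K k) x * (mollify (\<rho> k) g x - g x)" for k x
      by (simp add: q_def indicator_def)
    have i1: "integrable lborel (\<lambda>x. v x - g x - \<phi> k x)" for k using v g \<phi>i by simp
    have "integrable lborel (\<lambda>x. mollify (\<rho> k) g x - g x)" for k
      using \<rho>(3)[of k] by (subst (asm) integrable_abs_iff) auto
    then have "integrable lborel (\<lambda>x. (mollify (\<rho> k) g x - g x) * indicator (K k) x)" for k
      by (rule integrable_real_mult_indicator[rotated]) simp
    then have i2: "integrable lborel (\<lambda>x. indicator (K k) x * (mollify (\<rho> k) g x - g x))" for k by (simp add: mult.commute)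
    show qi: "integrable lborel (\<lambda>x. q k x - v x)" for k
      unfolding eq using i1 i2 by (intro Bochner_Integration.integrable_add integrable_minus) auto
    have bd: "(\<integral>x. \<bar>q k x - v x\<bar> \<partial>lborel) \<le> (\<integral>x. \<bar>v x - g x - \<phi> k x\<bar> \<partial>lborel) + \<eta> k" for k
    proof -
      have "(\<integral>x. \<bar>q k x - v x\<bar> \<partial>lborel) \<le> (\<integral>x. \<bar>v x - g x - \<phi> k x\<bar> + \<bar>mollify (\<rho> k) g x - g x\<bar> \<partial>lborel)"
      proof (rule integral_mono)
        show "\<bar>q k x - v x\<bar> \<le> \<bar>v x - g x - \<phi> k x\<bar> + \<bar>mollify (\<rho> k) g x - g x\<bar>" for x
          unfolding eq by (cases "x \<in> K k") auto
      qed (use qi i1 \<rho>(3) in auto)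
      also have "\<dots> = (\<integral>x. \<bar>v x - g x - \<phi> k x\<bar> \<partial>lborel) + (\<integral>x. \<bar>mollify (\<rho> k) g x - g x\<bar> \<partial>lborel)"
        using i1 \<rho>(3) by simp
      finally show ?thesis using \<rho>(4)[of k] by simp
    qed
    show "(\<lambda>k. \<integral>x. \<bar>q k x - v x\<bar> \<partial>lborel) \<longlonglongrightarrow> 0"
      by (rule tendsto_sandwich[of "\<lambda>_. 0" _ _ "\<lambda>k. (\<integral>x. \<bar>v x - g x - \<phi> k x\<bar> \<partial>lborel) + \<eta> k"])
         (use bd tendsto_add[OF lim \<eta>0] in auto)
  qed
  have dql: "(\<lambda>k. \<integral>x. \<bar>dq i k x - dv i x\<bar> powr p i \<partial>lborel) \<longlonglongrightarrow> 0"
    and dqi: "\<And>k. integrable lborel (\<lambda>x. \<bar>dq i k x - dv i x\<bar> powr p i)" for i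
  proof -
    let ?a = "\<lambda>k x. dv i x - dg i x - dir_deriv (axis i 1) (\<phi> k) x"
    let ?b = "\<lambda>k x. - (indicator (K k) x * (mollify (\<rho> k) (dg i) x - dg i x))"
    have eq: "dq i k x - dv i x = - (?a k x + ?b k x)" for k x
      by (simp add: dq_def indicator_def)
    have "integrable lborel (\<lambda>x. \<bar>dv i x - dg i x\<bar> powr p i)"
      by (rule integrable_powr_abs_diff(1)[OF p0(1)]) (use dv dg in auto)
    then have i1: "integrable lborel (\<lambda>x. \<bar>?a k x\<bar> powr p i)" for k
      by (rule integrable_powr_abs_diff(1)[OF p0(1) _ _ _ test_fun_powr_integrable[OF d\<phi>t p0(1)], rotated 2]) auto
    have le: "\<bar>?b k x\<bar> powr p i \<le> \<bar>mollify (\<rho> k) (dg i) x - dg i x\<bar> powr p i" for k x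
      using p0[of i] by (cases "x \<in> K k") (auto simp: abs_minus_commute)
    have i2: "integrable lborel (\<lambda>x. \<bar>?b k x\<bar> powr p i)" for k
      by (rule Bochner_Integration.integrable_bound[OF \<rho>(5)[of k i]]) (use le in auto)
    show "integrable lborel (\<lambda>x. \<bar>dq i k x - dv i x\<bar> powr p i)" for k
      unfolding eq abs_minus_cancel by (rule integrable_powr_abs_add(1)[OF p0(1) _ _ i1 i2]) auto
    have bd: "(\<integral>x. \<bar>dq i k x - dv i x\<bar> powr p i \<partial>lborel) \<le> 2 powr p i * ((\<integral>x. \<bar>?a k x\<bar> powr p i \<partial>lborel) + \<eta> k)" for k
    proof -
      have "(\<integral>x. \<bar>dq i k x - dv i x\<bar> powr p i \<partial>lborel)
          \<le> 2 powr p i * ((\<integral>x. \<bar>?a k x\<bar> powr p i \<partial>lborel) + (\<integral>x. \<bar>?b k x\<bar> powr p i \<partial>lborel))"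
        unfolding eq by (subst abs_minus_cancel, rule integrable_powr_abs_add(2)[OF p0(1) _ _ i1 i2]) auto
      also have "(\<integral>x. \<bar>?b k x\<bar> powr p i \<partial>lborel) \<le> (\<integral>x. \<bar>mollify (\<rho> k) (dg i) x - dg i x\<bar> powr p i \<partial>lborel)"
        by (rule integral_mono[OF i2 \<rho>(5) le])
      also have "\<dots> \<le> \<eta> k" by (rule \<rho>(6))
      finally show ?thesis by simp
    qed
    show "(\<lambda>k. \<integral>x. \<bar>dq i k x - dv i x\<bar> powr p i \<partial>lborel) \<longlonglongrightarrow> 0"
      by (rule tendsto_sandwich[of "\<lambda>_. 0" _ _ "\<lambda>k. 2 powr p i * ((\<integral>x. \<bar>?a k x\<bar> powr p i \<partial>lborel) + \<eta> k)"])
         (use bd tendsto_mult[OF tendsto_const tendsto_add[OF dlim[of i] \<eta>0], of "2 powr p i"] in auto)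
  qed
  \<comment> \<open>Convergence in L^1 gives pointwise convergence along a subsequence only; the
    gradient limits persist along it.\<close>
  obtain r :: "nat \<Rightarrow> nat" where r: "strict_mono r" "AE x in lborel. (\<lambda>k. q (r k) x - v x) \<longlonglongrightarrow> 0"
    using tendsto_L1_AE_subseq[of lborel "\<lambda>k x. q k x - v x"] qi ql by auto
  have qr: "AE x in lborel. (\<lambda>k. q (r k) x) \<longlonglongrightarrow> v x"
    using r(2) by eventually_elim (auto simp: LIM_zero_iff)
  show ?thesis
  proof (intro exI[of _ "\<lambda>k. \<Psi> (r k)"] conjI allI)
    show "\<Psi> (r k) \<in> test_fun \<Omega>" for k by (rule \<Psi>t)
    show "\<bar>\<Psi> (r k) x\<bar> \<le> 1" for k x by (simp add: \<Psi>_def H(4))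
    have "AE x in lborel. \<forall>k. \<Psi> (r k) x = H (q (r k) x)" using \<Psi>q by (simp add: AE_all_countable)
    with qr show "AE x in lborel. (\<lambda>k. \<Psi> (r k) x) \<longlonglongrightarrow> H (v x)"
    proof eventually_elim
      case (elim x)
      have "(\<lambda>k. H (q (r k) x)) \<longlonglongrightarrow> H (v x)"
        using Hc elim(1) by (intro continuous_on_tendsto_compose[of UNIV H]) auto
      with elim(2) show ?case by simp
    qed
    fix i
    \<comment> \<open>The gradient error is split into \<open>?A\<close>, where \<open>dq\<close> is
      not yet \<open>dv\<close>, and \<open>?B\<close>, where the argument of H' is not yet
      \<open>v\<close>. Boundedness of H' settles the first, dominated convergence the
      second.\<close>
    let ?A = "\<lambda>k x. H' (q (r k) x) * (dq i (r k) x - dv i x)"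
    let ?B = "\<lambda>k x. (H' (q (r k) x) - H' (v x)) * dv i x"
    have Hb: "\<bar>H' s\<bar> \<le> M" for s using H(5) by (simp add: H'_def)
    have Ale: "\<bar>?A k x\<bar> powr p i \<le> M powr p i * \<bar>dq i (r k) x - dv i x\<bar> powr p i" for k x
    proof -
      have "\<bar>?A k x\<bar> powr p i \<le> (M * \<bar>dq i (r k) x - dv i x\<bar>) powr p i"
        unfolding abs_mult using p0[of i] Hb by (intro powr_mono2 mult_right_mono) auto
      then show ?thesis using M0 by (simp add: powr_mult)
    qed
    have Ai: "integrable lborel (\<lambda>x. \<bar>?A k x\<bar> powr p i)" for k
      by (rule Bochner_Integration.integrable_bound[of _ "\<lambda>x. M powr p i * \<bar>dq i (r k) x - dv i x\<bar> powr p i"])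
         (use Ale dqi in auto)
    have Ble: "\<bar>?B k x\<bar> powr p i \<le> (2 * M) powr p i * \<bar>dv i x\<bar> powr p i" for k x
    proof -
      have "\<bar>H' (q (r k) x) - H' (v x)\<bar> \<le> 2 * M" using Hb[of "q (r k) x"] Hb[of "v x"] by linarith
      then have "\<bar>?B k x\<bar> powr p i \<le> (2 * M * \<bar>dv i x\<bar>) powr p i"
        unfolding abs_mult using p0[of i] by (intro powr_mono2 mult_right_mono) auto
      then show ?thesis using M0 by (simp add: powr_mult)
    qed
    have Bw: "integrable lborel (\<lambda>x. (2 * M) powr p i * \<bar>dv i x\<bar> powr p i)" using dv by simp
    have Bi: "integrable lborel (\<lambda>x. \<bar>?B k x\<bar> powr p i)" for k
      by (rule Bochner_Integration.integrable_bound[OF Bw]) (use Ble in auto)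
    have Al: "(\<lambda>k. \<integral>x. \<bar>?A k x\<bar> powr p i \<partial>lborel) \<longlonglongrightarrow> 0"
    proof (rule tendsto_sandwich[of "\<lambda>_. 0" _ _ "\<lambda>k. M powr p i * (\<integral>x. \<bar>dq i (r k) x - dv i x\<bar> powr p i \<partial>lborel)"])
      have "(\<integral>x. \<bar>?A k x\<bar> powr p i \<partial>lborel) \<le> (\<integral>x. M powr p i * \<bar>dq i (r k) x - dv i x\<bar> powr p i \<partial>lborel)" for k
        by (rule integral_mono[OF Ai _ Ale]) (use dqi in simp)
      then show "eventually (\<lambda>k. (\<integral>x. \<bar>?A k x\<bar> powr p i \<partial>lborel) \<le> M powr p i * (\<integral>x. \<bar>dq i (r k) x - dv i x\<bar> powr p i \<partial>lborel)) sequentially"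
        by simp
      show "(\<lambda>k. M powr p i * (\<integral>x. \<bar>dq i (r k) x - dv i x\<bar> powr p i \<partial>lborel)) \<longlonglongrightarrow> 0"
        using tendsto_mult[OF tendsto_const LIMSEQ_subseq_LIMSEQ[OF dql[of i] r(1)], of "M powr p i"] by (simp add: o_def)
    qed auto
    have Bl: "(\<lambda>k. \<integral>x. \<bar>?B k x\<bar> powr p i \<partial>lborel) \<longlonglongrightarrow> (\<integral>x. 0 \<partial>(lborel :: (real^'n) measure))"
    proof (rule integral_dominated_convergence[OF _ _ Bw])
      show "AE x in lborel. (\<lambda>k. \<bar>?B k x\<bar> powr p i) \<longlonglongrightarrow> 0"
        using qr
      proof eventually_elim
        case (elim x)
        have "(\<lambda>k. H' (q (r k) x)) \<longlonglongrightarrow> H' (v x)"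
          using H'c elim by (intro continuous_on_tendsto_compose[of UNIV H']) auto
        then have "(\<lambda>k. \<bar>?B k x\<bar>) \<longlonglongrightarrow> \<bar>(H' (v x) - H' (v x)) * dv i x\<bar>" by (intro tendsto_intros)
        then have "(\<lambda>k. \<bar>?B k x\<bar> powr p i) \<longlonglongrightarrow> 0 powr p i" using p0[of i] by (intro tendsto_powr') auto
        then show ?case by simp
      qed
    qed (use Ble in auto)
    have bd: "(\<integral>x. \<bar>dir_deriv (axis i 1) (\<Psi> (r k)) x - H' (v x) * dv i x\<bar> powr p i \<partial>lborel)
        \<le> 2 powr p i * ((\<integral>x. \<bar>?A k x\<bar> powr p i \<partial>lborel) + (\<integral>x. \<bar>?B k x\<bar> powr p i \<partial>lborel))" for k
    proof -
      have [measurable]: "dir_deriv (axis i 1) (\<Psi> (r k)) \<in> borel_measurable borel"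
        by (rule test_fun_measurable[OF test_fun_dir_deriv[OF \<Psi>t axis_1_Basis]])
      have "(\<integral>x. \<bar>dir_deriv (axis i 1) (\<Psi> (r k)) x - H' (v x) * dv i x\<bar> powr p i \<partial>lborel)
          = (\<integral>x. \<bar>?A k x + ?B k x\<bar> powr p i \<partial>lborel)"
      proof (rule integral_cong_AE)
        show "AE x in lborel. \<bar>dir_deriv (axis i 1) (\<Psi> (r k)) x - H' (v x) * dv i x\<bar> powr p i = \<bar>?A k x + ?B k x\<bar> powr p i"
          using d\<Psi>[of i "r k"] by eventually_elim (simp add: algebra_simps)
      qed auto
      also have "\<dots> \<le> 2 powr p i * ((\<integral>x. \<bar>?A k x\<bar> powr p i \<partial>lborel) + (\<integral>x. \<bar>?B k x\<bar> powr p i \<partial>lborel))"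
        by (rule integrable_powr_abs_add(2)[OF p0(1) _ _ Ai Bi]) auto
      finally show ?thesis .
    qed
    have "(\<lambda>k. \<integral>x. \<bar>dir_deriv (axis i 1) (\<Psi> (r k)) x - H' (v x) * dv i x\<bar> powr p i \<partial>lborel) \<longlonglongrightarrow> 0"
      by (rule tendsto_sandwich[of "\<lambda>_. 0" _ _ "\<lambda>k. 2 powr p i * ((\<integral>x. \<bar>?A k x\<bar> powr p i \<partial>lborel) + (\<integral>x. \<bar>?B k x\<bar> powr p i \<partial>lborel))"])
         (use bd tendsto_mult[OF tendsto_const tendsto_add[OF Al Bl], of "2 powr p i"] in auto)
    then show "(\<lambda>k. \<integral>x. \<bar>dir_deriv (axis i 1) (\<Psi> (r k)) x - dir_deriv 1 H (v x) * dv i x\<bar> powr p i \<partial>lborel) \<longlonglongrightarrow> 0"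
      by (simp add: H'_def)
  qed
qed

section \<open>Time slices\<close>

lemma brep_slice:
  assumes "brep (\<Omega> \<times> S) f f'"
  shows "AE t in lborel. t \<in> S \<longrightarrow> brep \<Omega> (slice f t) (slice f' t)"
proof -
  have "AE t in lborel. AE x in lborel. (x, t) \<in> \<Omega> \<times> S \<longrightarrow> f (x, t) = f' (x, t)"
    by (rule AE_lborel_swap[OF brep_AE[OF assms]])
  then show ?thesis
  proof eventually_elim
    case (elim t)
    show ?case
    proof
      assume t: "t \<in> S"
      show "brep \<Omega> (slice f t) (slice f' t)"
        unfolding brep_def slice_def
      proof (intro conjI allI impI)
        show "(\<lambda>x. f' (x, t)) \<in> borel_measurable borel"
          by (rule borel_measurable_slice[OF brep_measurable[OF assms]])
        show "f' (x, t) = 0" if "x \<notin> \<Omega>" for x using that by (intro brep_outside[OF assms]) auto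
        show "AE x in lborel. x \<in> \<Omega> \<longrightarrow> f (x, t) = f' (x, t)"
          using elim t by (auto elim: eventually_mono)
      qed
    qed
  qed
qed

section \<open>Weak derivatives of representatives, differences and slices\<close>

lemma has_weak_deriv_borel:
  assumes U: "open U" and r: "brep U f f'" "brep U h h'" and wd: "has_weak_deriv U b f h" and b: "b \<in> Basis"
    and \<phi>: "\<phi> \<in> test_fun U"
  shows "(\<integral>x. f' x * dir_deriv b \<phi> x \<partial>lborel) = - (\<integral>x. h' x * \<phi> x \<partial>lborel)"
proof -
  have Ub: "U \<in> sets borel" using U by simp
  have m: "\<phi> \<in> borel_measurable borel" "dir_deriv b \<phi> \<in> borel_measurable borel"
    using \<phi> test_fun_dir_deriv[OF \<phi> b] by (auto intro: test_fun_measurable)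
  have "(\<integral>x. f x * dir_deriv b \<phi> x \<partial>lebesgue_on U) = - (\<integral>x. h x * \<phi> x \<partial>lebesgue_on U)"
    using wd \<phi> by (auto simp: has_weak_deriv_def)
  then show ?thesis
    using brep_integrable_iff(2)[OF Ub brep_mult_borel[OF r(1) m(2)]]
      brep_integrable_iff(2)[OF Ub brep_mult_borel[OF r(2) m(1)]] by simp
qed

lemma locally_integrable_brep:
  assumes U: "open U" and r: "brep U f f'"
    and i: "\<And>K. compact K \<Longrightarrow> K \<subseteq> U \<Longrightarrow> integrable lborel (\<lambda>x. indicator K x * f' x)"
  shows "locally_integrable U f"
  unfolding locally_integrable_def
proof (intro allI impI)
  fix K assume K: "compact K \<and> K \<subseteq> U"
  have Kb: "K \<in> sets borel" using borel_closed[OF compact_imp_closed] K by auto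
  have "brep K f (\<lambda>x. indicator K x * f' x)"
    using brep_measurable[OF r] brep_AE[OF r] Kb K
    unfolding brep_def by (auto elim!: eventually_mono)
  then have "integrable (lebesgue_on K) f"
    using brep_integrable_iff(1)[OF Kb] i K by blast
  then show "f absolutely_integrable_on K"
    using Kb unfolding set_integrable_def by (subst (asm) integrable_restrict_space) auto
qed

lemma has_weak_deriv_cong:
  assumes U: "open U" and wd: "has_weak_deriv U b f h"
    and h: "AE x in lebesgue_on U. h x = k x"
  shows "has_weak_deriv U b f k"
proof -
  have Ub: "U \<in> sets borel" using U by simp
  have li: "locally_integrable U f" "locally_integrable U h" using wd by (auto simp: has_weak_deriv_def)
  obtain h' where h': "brep U h h'" using brep_exists[OF Ub locally_integrable_measurable[OF U li(2)]] by blast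
  have k': "brep U k h'"
    using h' h unfolding brep_def AE_lebesgue_on_iff[OF Ub] by (auto elim: eventually_elim2)
  have "locally_integrable U k"
    by (rule locally_integrable_brep[OF U k' brep_locally_integrable[OF U li(2) h']])
  moreover have "(\<integral>x. h x * \<phi> x \<partial>lebesgue_on U) = (\<integral>x. k x * \<phi> x \<partial>lebesgue_on U)" if "\<phi> \<in> test_fun U" for \<phi>
    using brep_integrable_iff(2)[OF Ub brep_mult_borel[OF h' test_fun_measurable[OF that]]]
      brep_integrable_iff(2)[OF Ub brep_mult_borel[OF k' test_fun_measurable[OF that]]] by simp
  ultimately show ?thesis using wd by (simp add: has_weak_deriv_def)
qed

lemma has_weak_deriv_diff:
  assumes U: "open U" and b: "b \<in> Basis" and 1: "has_weak_deriv U b f1 h1" and 2: "has_weak_deriv U b f2 h2"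
  shows "has_weak_deriv U b (\<lambda>x. f1 x - f2 x) (\<lambda>x. h1 x - h2 x)"
proof -
  have Ub: "U \<in> sets borel" using U by simp
  have li: "locally_integrable U f1" "locally_integrable U h1" "locally_integrable U f2" "locally_integrable U h2"
    using 1 2 by (auto simp: has_weak_deriv_def)
  have int: "integrable (lebesgue_on U) (\<lambda>x. f x * \<phi> x)" if f: "locally_integrable U f" and \<phi>: "\<phi> \<in> test_fun U" for f \<phi>
  proof -
    obtain f' where r: "brep U f f'" using brep_exists[OF Ub locally_integrable_measurable[OF U f]] by blast
    show ?thesis
      using brep_integrable_iff(1)[OF Ub brep_mult_borel[OF r test_fun_measurable[OF \<phi>]]]
        integrable_mult_test_fun[OF brep_measurable[OF r] brep_locally_integrable[OF U f r] \<phi>] by blast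
  qed
  have "locally_integrable U (\<lambda>x. f1 x - f2 x)" "locally_integrable U (\<lambda>x. h1 x - h2 x)"
    using li unfolding locally_integrable_def by (auto intro: set_integral_diff(1))
  moreover have "(\<integral>x. (f1 x - f2 x) * dir_deriv b \<phi> x \<partial>lebesgue_on U) = - (\<integral>x. (h1 x - h2 x) * \<phi> x \<partial>lebesgue_on U)"
    if \<phi>: "\<phi> \<in> test_fun U" for \<phi>
    using 1 2 \<phi> int[OF li(1) test_fun_dir_deriv[OF \<phi> b]] int[OF li(3) test_fun_dir_deriv[OF \<phi> b]]
      int[OF li(2) \<phi>] int[OF li(4) \<phi>]
    by (simp add: has_weak_deriv_def left_diff_distrib)
  ultimately show ?thesis by (simp add: has_weak_deriv_def)
qed

text \<open>Testing with products gives an identity for a.e. time, but with an exceptional set that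
  depends on the spatial factor. Countably many rational bumps leave one exceptional set. They
  identify the slice derivative because some weak derivative of the slice is already known to
  exist.\<close>

lemma slice_weak_deriv:
  fixes \<Omega> :: "'a::euclidean_space set"
  assumes \<Omega>: "open \<Omega>" and r: "brep (\<Omega> \<times> {0<..<T}) v v'" "brep (\<Omega> \<times> {0<..<T}) h h'"
    and h'i: "integrable lborel h'"
    and wd: "has_weak_deriv (\<Omega> \<times> {0<..<T}) (b, 0) v h" and b: "b \<in> Basis"
    and W: "AE t in lborel. t \<in> {0<..<T} \<longrightarrow> (\<exists>w. has_weak_deriv \<Omega> b (slice v t) w)"
  shows "AE t in lborel. t \<in> {0<..<T} \<longrightarrow> has_weak_deriv \<Omega> b (slice v t) (slice h' t)"
proof -
  let ?S = "{0<..<T}"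
  let ?Q = "\<Omega> \<times> ?S"
  have Q: "open ?Q" using \<Omega> by (intro open_Times) auto
  have \<Omega>b: "\<Omega> \<in> sets borel" using \<Omega> by simp
  have b0: "(b, 0::real) \<in> Basis" using b by (simp add: Basis_prod_def)
  have li: "locally_integrable ?Q v" "locally_integrable ?Q h" using wd by (auto simp: has_weak_deriv_def)
  note mb = brep_measurable[OF r(1)] brep_measurable[OF r(2)]
  have sm[measurable]: "(\<lambda>x. v' (x, t)) \<in> borel_measurable borel" "(\<lambda>x. h' (x, t)) \<in> borel_measurable borel" for t
    using mb by (auto intro: borel_measurable_slice)
  \<comment> \<open>For one fixed spatial test function the identity is an a.e. statement in
    time.\<close>
  have key: "AE t in lborel. t \<in> ?S \<longrightarrow>
      (\<integral>x. v' (x, t) * dir_deriv b \<psi> x + h' (x, t) * \<psi> x \<partial>lborel) = 0" if \<psi>: "\<psi> \<in> test_fun \<Omega>" for \<psi>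
  proof -
    have d\<psi>: "dir_deriv b \<psi> \<in> test_fun \<Omega>" by (rule test_fun_dir_deriv[OF \<psi> b])
    have [measurable]: "\<psi> \<in> borel_measurable borel" "dir_deriv b \<psi> \<in> borel_measurable borel"
      using \<psi> d\<psi> by (auto intro: test_fun_measurable)
    define G where "G z = v' z * dir_deriv b \<psi> (fst z) + h' z * \<psi> (fst z)" for z
    have Gm: "G \<in> borel_measurable borel"
      using mb unfolding G_def borel_prod[symmetric] by measurable
    define F where "F t = (\<integral>x. G (x, t) \<partial>lborel)" for t
    have Fm: "F \<in> borel_measurable borel"
      unfolding F_def by (rule borel_measurable_lborel_integral[OF Gm])
    have prodi: "integrable lborel (\<lambda>z. f z * (\<phi> (fst z) * \<eta> (snd z)))"
      if "f = v' \<or> f = h'" "\<phi> \<in> test_fun \<Omega>" "\<eta> \<in> test_fun ?S" for f \<phi> \<eta>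
      using that(1) integrable_mult_test_fun[OF mb(1) brep_locally_integrable[OF Q li(1) r(1)] test_fun_product[OF that(2,3)]]
        integrable_mult_test_fun[OF mb(2) brep_locally_integrable[OF Q li(2) r(2)] test_fun_product[OF that(2,3)]]
      by auto
    have G\<eta>: "integrable lborel (\<lambda>z. G z * \<eta> (snd z))" if \<eta>: "\<eta> \<in> test_fun ?S" for \<eta>
      using prodi[of v', OF _ d\<psi> \<eta>] prodi[of h', OF _ \<psi> \<eta>]
      by (simp add: G_def distrib_right mult.assoc)
    \<comment> \<open>The fundamental lemma, now in the time variable: the temporal factor ranges
      over rational bumps.\<close>
    have "AE t in lborel. t \<in> ?S \<longrightarrow> F t = 0"
    proof (rule AE_eq_0_if_rat_bumps[OF _ Fm])
      fix L :: "real set" assume L: "compact L" "L \<subseteq> ?S"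
      obtain K where K: "compact K" "K \<subseteq> \<Omega>" "\<And>x. x \<notin> K \<Longrightarrow> \<psi> x = 0" using test_fun_support[OF \<psi>] by blast
      obtain B1 where B1: "B1 > 0" "\<And>x. \<bar>\<psi> x\<bar> \<le> B1" using test_fun_bounded[OF \<psi>] by blast
      obtain B2 where B2: "B2 > 0" "\<And>x. \<bar>dir_deriv b \<psi> x\<bar> \<le> B2" using test_fun_bounded[OF d\<psi>] by blast
      have dz: "dir_deriv b \<psi> x = 0" if "x \<notin> K" for x
        by (rule dir_deriv_zero_outside[where K=K and \<phi>=\<psi>, OF K(3) compact_imp_closed[OF K(1)] that])
      have KL: "compact (K \<times> L)" "K \<times> L \<subseteq> ?Q" using K L by (auto intro: compact_Times)
      have "integrable lborel (\<lambda>z. B2 * \<bar>indicator (K \<times> L) z * v' z\<bar> + B1 * \<bar>indicator (K \<times> L) z * h' z\<bar>)"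
        using brep_locally_integrable[OF Q li(1) r(1) KL] brep_locally_integrable[OF Q li(2) r(2) KL] by simp
      then have "integrable lborel (\<lambda>z. indicator L (snd z) * G z)"
      proof (rule Bochner_Integration.integrable_bound)
        have [measurable]: "L \<in> sets borel" using borel_closed[OF compact_imp_closed[OF L(1)]] by simp
        have "(\<lambda>z. indicator L (snd z) :: real) \<in> borel_measurable (borel :: ('a \<times> real) measure)"
          unfolding borel_prod[symmetric] by measurable
        then show "(\<lambda>z. indicator L (snd z) * G z) \<in> borel_measurable lborel"
          using Gm by simp
        show "AE z in lborel. norm (indicator L (snd z) * G z) \<le>
            norm (B2 * \<bar>indicator (K \<times> L) z * v' z\<bar> + B1 * \<bar>indicator (K \<times> L) z * h' z\<bar>)"
        proof (rule AE_I2)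
          fix z :: "'a \<times> real"
          show "norm (indicator L (snd z) * G z) \<le>
            norm (B2 * \<bar>indicator (K \<times> L) z * v' z\<bar> + B1 * \<bar>indicator (K \<times> L) z * h' z\<bar>)"
          proof (cases "z \<in> K \<times> L")
            case True
            have "\<bar>G z\<bar> \<le> \<bar>v' z * dir_deriv b \<psi> (fst z)\<bar> + \<bar>h' z * \<psi> (fst z)\<bar>" unfolding G_def by (rule abs_triangle_ineq)
            also have "\<dots> \<le> B2 * \<bar>v' z\<bar> + B1 * \<bar>h' z\<bar>"
              using mult_right_mono[OF B2(2)[of "fst z"] abs_ge_zero[of "v' z"]]
                mult_right_mono[OF B1(2)[of "fst z"] abs_ge_zero[of "h' z"]]
              unfolding abs_mult by (intro add_mono) (simp_all only: mult.commute)
            finally show ?thesis using True B1(1) B2(1) by (cases z) auto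
          next
            case False
            then have "indicator L (snd z) * G z = 0"
              using K(3)[of "fst z"] dz[of "fst z"] by (cases z) (auto simp: G_def split: split_indicator)
            then show ?thesis by (simp only: norm_zero norm_ge_zero)
          qed
        qed
      qed
      from lborel_fubini(2)[OF this] show "integrable lborel (\<lambda>t. indicator L t * F t)"
        by (simp add: F_def)
    next
      fix \<eta> :: "real \<Rightarrow> real" assume "\<eta> \<in> rat_bumps ?S"
      then have \<eta>: "\<eta> \<in> test_fun ?S" using rat_bumps_subset by auto
      have s: "smooth \<psi>" "smooth \<eta>" using \<psi> \<eta> by (auto intro: test_fun_imp_smooth)
      have dd: "dir_deriv (b, 0) (\<lambda>z. \<psi> (fst z) * \<eta> (snd z)) z = dir_deriv b \<psi> (fst z) * \<eta> (snd z)" for z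
        unfolding dir_deriv_product[OF s]
        using linear_0[OF linear_frechet_derivative[OF smooth_imp_differentiable[OF s(2), of "snd z"]]]
        by (simp add: dir_deriv_def)
      have "(\<integral>z. v' z * (dir_deriv b \<psi> (fst z) * \<eta> (snd z)) \<partial>lborel) = - (\<integral>z. h' z * (\<psi> (fst z) * \<eta> (snd z)) \<partial>lborel)"
        using has_weak_deriv_borel[OF Q r wd b0 test_fun_product[OF \<psi> \<eta>]] by (simp add: dd)
      then have "(\<integral>z. G z * \<eta> (snd z) \<partial>lborel) = 0"
        using prodi[of v', OF _ d\<psi> \<eta>] prodi[of h', OF _ \<psi> \<eta>]
        by (simp add: G_def distrib_right mult.assoc)
      then show "(\<integral>t. F t * \<eta> t \<partial>lborel) = 0"
        using lborel_fubini(3)[OF G\<eta>[OF \<eta>]] by (simp add: F_def)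
    qed simp
    then show ?thesis by (simp add: F_def G_def)
  qed
  \<comment> \<open>From here on the exceptional set of times is independent of the test
    function.\<close>
  have "AE t in lborel. \<forall>\<psi>\<in>rat_bumps \<Omega>. t \<in> ?S \<longrightarrow>
      (\<integral>x. v' (x, t) * dir_deriv b \<psi> x + h' (x, t) * \<psi> x \<partial>lborel) = 0"
    using key rat_bumps_subset by (subst AE_ball_countable[OF countable_rat_bumps]) blast
  moreover have "AE t in lborel. integrable lborel (\<lambda>x. h' (x, t))" by (rule lborel_fubini(1)[OF h'i])
  ultimately show ?thesis
    using W brep_slice[OF r(1)]
  proof eventually_elim
    case (elim t)
    show ?case
    proof
      assume t: "t \<in> ?S"
      \<comment> \<open>With \<open>w\<close> at hand it remains to show that \<open>w\<close>
        equals the slice of \<open>h'\<close>, a question that rational bumps decide.\<close>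
      obtain w where w: "has_weak_deriv \<Omega> b (slice v t) w" using elim(3) t by blast
      have rv: "brep \<Omega> (slice v t) (slice v' t)" using elim(4) t by blast
      have liw: "locally_integrable \<Omega> w" "locally_integrable \<Omega> (slice v t)" using w by (auto simp: has_weak_deriv_def)
      obtain w' where w': "brep \<Omega> w w'" using brep_exists[OF \<Omega>b locally_integrable_measurable[OF \<Omega> liw(1)]] by blast
      have w'm[measurable]: "w' \<in> borel_measurable borel" using w' by (rule brep_measurable)
      note wi = brep_locally_integrable[OF \<Omega> liw(1) w'] brep_locally_integrable[OF \<Omega> liw(2) rv]
      have hi: "integrable lborel (\<lambda>x. indicator K x * h' (x, t))" if "compact K" for K
        using elim(2) borel_closed[OF compact_imp_closed[OF that]]
        by (subst mult.commute) (auto intro!: integrable_real_mult_indicator)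
      have "AE x in lborel. x \<in> \<Omega> \<longrightarrow> w' x - h' (x, t) = 0"
      proof (rule AE_eq_0_if_rat_bumps[OF \<Omega>])
        show "integrable lborel (\<lambda>x. indicator K x * (w' x - h' (x, t)))" if "compact K" "K \<subseteq> \<Omega>" for K
          using wi(1)[OF that] hi[OF that(1)] by (simp add: right_diff_distrib)
        fix \<psi> :: "'a \<Rightarrow> real" assume \<psi>r: "\<psi> \<in> rat_bumps \<Omega>"
        then have \<psi>: "\<psi> \<in> test_fun \<Omega>" using rat_bumps_subset by auto
        have d\<psi>: "dir_deriv b \<psi> \<in> test_fun \<Omega>" by (rule test_fun_dir_deriv[OF \<psi> b])
        have i1: "integrable lborel (\<lambda>x. v' (x, t) * dir_deriv b \<psi> x)"
          using integrable_mult_test_fun[OF brep_measurable[OF rv] wi(2) d\<psi>] by (simp add: slice_def)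
        have i2: "integrable lborel (\<lambda>x. w' x * \<psi> x)" by (rule integrable_mult_test_fun[OF w'm wi(1) \<psi>])
        have i3: "integrable lborel (\<lambda>x. h' (x, t) * \<psi> x)" by (rule integrable_mult_test_fun[OF sm(2) hi \<psi>])
        have "(\<integral>x. v' (x, t) * dir_deriv b \<psi> x \<partial>lborel) = - (\<integral>x. w' x * \<psi> x \<partial>lborel)"
          using has_weak_deriv_borel[OF \<Omega> rv w' w b \<psi>] by (simp add: slice_def)
        moreover have "(\<integral>x. v' (x, t) * dir_deriv b \<psi> x + h' (x, t) * \<psi> x \<partial>lborel) = 0"
          using elim(1) \<psi>r t by blast
        then have "(\<integral>x. v' (x, t) * dir_deriv b \<psi> x \<partial>lborel) + (\<integral>x. h' (x, t) * \<psi> x \<partial>lborel) = 0"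
          by (simp only: Bochner_Integration.integral_add[OF i1 i3])
        ultimately show "(\<integral>x. (w' x - h' (x, t)) * \<psi> x \<partial>lborel) = 0"
          using i2 i3 by (simp add: left_diff_distrib)
      qed simp
      with brep_AE[OF w'] have "AE x in lebesgue_on \<Omega>. w x = slice h' t x"
        unfolding AE_lebesgue_on_iff[OF \<Omega>b] slice_def by eventually_elim auto
      then show "has_weak_deriv \<Omega> b (slice v t) (slice h' t)"
        by (rule has_weak_deriv_cong[OF \<Omega> w])
    qed
  qed
qed

text \<open>\<open>wpartial\<close> is a choice among weak derivatives. By uniqueness it agrees a.e.
  with the explicit difference, so that the norm in \<open>W1p_o\<close> controls concrete
  integrals.\<close>

lemma W1p_o_approx:
  fixes \<Omega> :: "(real^'n) set" and p :: "'n \<Rightarrow> real"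
  assumes \<Omega>: "open \<Omega>" and p: "\<And>i. p i > 1"
    and r: "brep \<Omega> v v'" "brep \<Omega> g g'" "\<And>i. brep \<Omega> (dv i) (dv i)" "\<And>i. brep \<Omega> (dg i) (dg i)"
    and wd: "\<And>i. has_weak_deriv \<Omega> (axis i 1) v (dv i)" "\<And>i. has_weak_deriv \<Omega> (axis i 1) g (dg i)"
    and o: "(\<lambda>x. v x - g x) \<in> W1p_o p \<Omega>"
  shows "\<exists>\<phi>. (\<forall>k. \<phi> k \<in> test_fun \<Omega>) \<and> (\<lambda>k. \<integral>x. \<bar>v' x - g' x - \<phi> k x\<bar> \<partial>lborel) \<longlonglongrightarrow> 0 \<and>
    (\<forall>i. (\<lambda>k. \<integral>x. \<bar>dv i x - dg i x - dir_deriv (axis i 1) (\<phi> k) x\<bar> powr p i \<partial>lborel) \<longlonglongrightarrow> 0)"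
proof -
  have \<Omega>b: "\<Omega> \<in> sets borel" using \<Omega> by simp
  have est: "(\<integral>x. \<bar>v' x - g' x - \<phi> x\<bar> \<partial>lborel) < e \<and>
      (\<forall>i. (\<integral>x. \<bar>dv i x - dg i x - dir_deriv (axis i 1) \<phi> x\<bar> powr p i \<partial>lborel) \<le> e powr p i)"
    if \<phi>: "\<phi> \<in> test_fun \<Omega>" and n: "W1p_norm p \<Omega> (\<lambda>x. v x - g x - \<phi> x) < e" for \<phi> e
  proof -
    have \<phi>U: "\<phi> \<in> test_fun UNIV" using \<phi> test_fun_mono[of \<Omega> UNIV] by auto
    have zb: "brep \<Omega> f f" if f: "f \<in> test_fun \<Omega>" for f
    proof -
      obtain K where "K \<subseteq> \<Omega>" "\<And>x. x \<notin> K \<Longrightarrow> f x = 0" using test_fun_support[OF f] by blast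
      then show ?thesis using test_fun_measurable[OF f] by (auto simp: brep_def)
    qed
    have d\<phi>: "dir_deriv (axis i 1) \<phi> \<in> test_fun \<Omega>" for i by (rule test_fun_dir_deriv[OF \<phi> axis_1_Basis])
    let ?w = "\<lambda>x. v x - g x - \<phi> x"
    have rw: "brep \<Omega> ?w (\<lambda>x. v' x - g' x - \<phi> x)" by (intro brep_diff r zb \<phi>)
    have nn: "0 \<le> Lnorm 1 \<Omega> ?w" "0 \<le> Lnorm (p j) \<Omega> (wpartial \<Omega> j ?w)" for j by (simp_all add: Lnorm_def)
    have "Lnorm 1 \<Omega> ?w < e" using n nn(2) sum_nonneg[of UNIV "\<lambda>j. Lnorm (p j) \<Omega> (wpartial \<Omega> j ?w)"]
      by (simp add: W1p_norm_def)
    moreover have "Lnorm 1 \<Omega> ?w = (\<integral>x. \<bar>v' x - g' x - \<phi> x\<bar> \<partial>lborel)"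
      using brep_integrable_iff(2)[OF \<Omega>b brep_comp[OF rw, of abs]] by (simp add: Lnorm_def)
    ultimately have 1: "(\<integral>x. \<bar>v' x - g' x - \<phi> x\<bar> \<partial>lborel) < e" by simp
    have 2: "(\<integral>x. \<bar>dv i x - dg i x - dir_deriv (axis i 1) \<phi> x\<bar> powr p i \<partial>lborel) \<le> e powr p i" for i
    proof -
      let ?h = "\<lambda>x. dv i x - dg i x - dir_deriv (axis i 1) \<phi> x"
      have rh: "brep \<Omega> ?h ?h" by (intro brep_diff r zb d\<phi>)
      have "has_weak_deriv \<Omega> (axis i 1) ?w ?h"
        by (intro has_weak_deriv_diff[OF \<Omega> axis_1_Basis] wd has_weak_deriv_test_fun[OF \<Omega> \<phi>U axis_1_Basis])
      \<comment> \<open>The chosen weak derivative of the difference is identified here; afterwards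
        only Borel functions occur.\<close>
      then have ae: "AE x in lebesgue_on \<Omega>. wpartial \<Omega> i ?w x = ?h x" by (rule weak_deriv_AE_eq[OF \<Omega>])
      have "brep \<Omega> (wpartial \<Omega> i ?w) ?h"
        using rh ae unfolding brep_def AE_lebesgue_on_iff[OF \<Omega>b] by auto
      from brep_integrable_iff(2)[OF \<Omega>b brep_comp[OF this, of "\<lambda>y. \<bar>y\<bar> powr p i"]]
      have "Lnorm (p i) \<Omega> (wpartial \<Omega> i ?w) = (\<integral>x. \<bar>?h x\<bar> powr p i \<partial>lborel) powr (1 / p i)"
        by (simp add: Lnorm_def)
      moreover have "Lnorm (p i) \<Omega> (wpartial \<Omega> i ?w) \<le> (\<Sum>j\<in>UNIV. Lnorm (p j) \<Omega> (wpartial \<Omega> j ?w))"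
        by (rule member_le_sum) (use nn(2) in auto)
      ultimately have "(\<integral>x. \<bar>?h x\<bar> powr p i \<partial>lborel) powr (1 / p i) \<le> e"
        using n nn(1) by (simp add: W1p_norm_def)
      then have "((\<integral>x. \<bar>?h x\<bar> powr p i \<partial>lborel) powr (1 / p i)) powr p i \<le> e powr p i"
        using p[of i] by (intro powr_mono2) auto
      then show ?thesis using p[of i] by (simp add: powr_powr)
    qed
    show ?thesis using 1 2 by blast
  qed
  define e where "e k = inverse (real (Suc k))" for k
  have e: "e k > 0" for k by (simp add: e_def)
  have e0: "e \<longlonglongrightarrow> 0" unfolding e_def by (rule LIMSEQ_inverse_real_of_nat)
  have "\<forall>k. \<exists>\<phi>\<in>test_fun \<Omega>. W1p_norm p \<Omega> (\<lambda>x. v x - g x - \<phi> x) < e k"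
    using o e unfolding W1p_o_def by blast
  then obtain \<phi> where \<phi>: "\<And>k. \<phi> k \<in> test_fun \<Omega>" "\<And>k. W1p_norm p \<Omega> (\<lambda>x. v x - g x - \<phi> k x) < e k" by metis
  note b = est[OF \<phi>]
  have "(\<lambda>k. \<integral>x. \<bar>v' x - g' x - \<phi> k x\<bar> \<partial>lborel) \<longlonglongrightarrow> 0"
    by (rule tendsto_sandwich[OF _ _ tendsto_const e0]) (use b in \<open>auto intro: less_imp_le always_eventually\<close>)
  moreover have "(\<lambda>k. \<integral>x. \<bar>dv i x - dg i x - dir_deriv (axis i 1) (\<phi> k) x\<bar> powr p i \<partial>lborel) \<longlonglongrightarrow> 0" for i
  proof (rule tendsto_sandwich[of "\<lambda>_. 0" _ _ "\<lambda>k. e k powr p i"])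
    have "(\<lambda>k. e k powr p i) \<longlonglongrightarrow> 0 powr p i"
      using p[of i] e e0 by (intro tendsto_powr') (auto intro!: always_eventually less_imp_le)
    then show "(\<lambda>k. e k powr p i) \<longlonglongrightarrow> 0" by simp
  qed (use b in auto)
  ultimately show ?thesis using \<phi>(1) by blast
qed

section \<open>Superposition operators\<close>

lemma AE_lborel_fst:
  assumes "AE x in lborel. P x"
  shows "AE z in (lborel :: ('a::euclidean_space \<times> 'b::euclidean_space) measure). P (fst z)"
proof -
  obtain N where N: "N \<in> sets (lborel :: 'a measure)" "emeasure lborel N = 0" "{x. \<not> P x} \<subseteq> N"
    using assms unfolding eventually_ae_filter by (auto simp: null_sets_def)
  have [measurable]: "N \<in> sets borel" using N(1) by simp
  have "AE z in (lborel :: ('a \<times> 'b) measure). fst z \<notin> N"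
  proof (rule AE_lborel_prodI)
    have "{z \<in> space (borel \<Otimes>\<^sub>M borel). fst z \<notin> N} \<in> sets (borel \<Otimes>\<^sub>M borel :: ('a \<times> 'b) measure)" by measurable
    then show "{z :: 'a \<times> 'b. fst z \<notin> N} \<in> sets borel" unfolding borel_prod by simp
    have "AE x in lborel. x \<notin> N" using N by (intro AE_not_in) auto
    then show "AE y in (lborel :: 'b measure). AE x in lborel. fst (x, y) \<notin> N" by simp
  qed
  then show ?thesis by eventually_elim (use N(3) in auto)
qed

text \<open>For simple functions in place of \<open>v\<close> and \<open>w\<close> the superposition
  is measurable because \<open>A\<close> is measurable in \<open>x\<close>. Continuity in the
  remaining variables then passes to the limit of simple approximations.\<close>

lemma caratheodory_brep:
  fixes \<Omega> :: "(real^'n) set" and v :: "(real^'n) \<times> real \<Rightarrow> real" and w :: "(real^'n) \<times> real \<Rightarrow> real^'n"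
  assumes \<Omega>: "open \<Omega>" and S: "open S" and A: "caratheodory \<Omega> A"
    and v: "v \<in> borel_measurable borel" and w: "w \<in> borel_measurable borel"
  shows "\<exists>a. brep (\<Omega> \<times> S) (\<lambda>z. A (fst z) (v z) (w z) $ i) a"
proof -
  let ?Q = "\<Omega> \<times> S"
  have \<Omega>b: "\<Omega> \<in> sets borel" using \<Omega> by simp
  have Qb[measurable]: "?Q \<in> sets borel" using \<Omega> S by (simp add: open_Times)
  have "\<exists>B. brep \<Omega> (\<lambda>x. A x (fst c) (snd c) $ i) B" for c :: "real \<times> (real^'n)"
  proof (rule brep_exists[OF \<Omega>b])
    have "(\<lambda>x. A x (fst c) (snd c)) \<in> borel_measurable (lebesgue_on \<Omega>)" using A by (simp add: caratheodory_def)
    then show "(\<lambda>x. A x (fst c) (snd c) $ i) \<in> borel_measurable (lebesgue_on \<Omega>)"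
      by (rule measurable_compose) (intro borel_measurable_continuous_onI continuous_intros)
  qed
  then obtain B where B: "\<And>c. brep \<Omega> (\<lambda>x. A x (fst c) (snd c) $ i) (B c)" by metis
  have vw: "(\<lambda>z. (v z, w z)) \<in> borel_measurable borel" using v w by simp
  obtain s where s: "\<And>k. simple_function borel (s k)" "\<And>z. (\<lambda>k. s k z) \<longlonglongrightarrow> (v z, w z)"
    using borel_measurable_implies_sequence_metric[OF vw, of "(0,0)"] by auto
  have fin: "finite (range (s k))" for k using simple_functionD(1)[OF s(1)[of k]] by simp
  define G where "G k z = (\<Sum>c\<in>range (s k). indicator (s k -` {c}) z * B c (fst z))" for k z
  have Gm: "G k \<in> borel_measurable borel" for k
  proof -
    have [measurable]: "s k -` {c} \<in> sets borel" for c using simple_functionD(2)[OF s(1)[of k], of "{c}"] by simp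
    have "(\<lambda>z::(real^'n)\<times>real. B c (fst z)) \<in> borel_measurable borel" for c
      using brep_measurable[OF B[of c]] unfolding borel_prod[symmetric] by measurable
    then show ?thesis unfolding G_def by (intro borel_measurable_sum borel_measurable_times) auto
  qed
  have Geq: "G k z = B (s k z) (fst z)" for k z
  proof -
    have "G k z = (\<Sum>c\<in>range (s k). if c = s k z then B c (fst z) else 0)"
      unfolding G_def by (intro sum.cong) (auto split: split_indicator)
    then show ?thesis using fin by simp
  qed
  define a where "a z = indicator ?Q z * lim (\<lambda>k. G k z)" for z
  have am: "a \<in> borel_measurable borel"
    unfolding a_def using borel_measurable_lim_metric[OF Gm] by (intro borel_measurable_times) auto
  have "AE x in lborel. x \<in> \<Omega> \<longrightarrow> continuous_on UNIV (\<lambda>(u, \<xi>). A x u \<xi>)"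
    using A unfolding caratheodory_def by (simp add: AE_lebesgue_on_iff[OF \<Omega>b])
  from AE_lborel_fst[OF this]
  have cont: "AE z in (lborel :: ((real^'n) \<times> real) measure). fst z \<in> \<Omega> \<longrightarrow> continuous_on UNIV (\<lambda>(u, \<xi>). A (fst z) u \<xi>)" .
  \<comment> \<open>Every parameter value has its own exceptional null set; only the countably many
    values taken by the simple functions matter.\<close>
  have "countable (\<Union>k. range (s k))" using fin by (intro countable_UN) (auto intro: countable_finite)
  then have "AE x in lborel. \<forall>c\<in>(\<Union>k. range (s k)). x \<in> \<Omega> \<longrightarrow> A x (fst c) (snd c) $ i = B c x"
    using brep_AE[OF B] by (subst AE_ball_countable) auto
  from AE_lborel_fst[OF this]
  have eqB: "AE z in (lborel :: ((real^'n) \<times> real) measure). \<forall>c\<in>(\<Union>k. range (s k)). fst z \<in> \<Omega> \<longrightarrow> A (fst z) (fst c) (snd c) $ i = B c (fst z)" .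
  have "AE z in lborel. z \<in> ?Q \<longrightarrow> A (fst z) (v z) (w z) $ i = a z"
    using cont eqB
  proof eventually_elim
    case (elim z)
    show ?case
    proof
      assume z: "z \<in> ?Q"
      then have c: "continuous_on UNIV (\<lambda>(u, \<xi>). A (fst z) u \<xi>)" using elim(1) by auto
      have "(\<lambda>k. (\<lambda>(u, \<xi>). A (fst z) u \<xi>) (s k z)) \<longlonglongrightarrow> (\<lambda>(u, \<xi>). A (fst z) u \<xi>) (v z, w z)"
        by (rule continuous_on_tendsto_compose[OF c s(2)]) auto
      then have "(\<lambda>k. A (fst z) (fst (s k z)) (snd (s k z)) $ i) \<longlonglongrightarrow> A (fst z) (v z) (w z) $ i"
        by (auto simp: case_prod_beta intro: tendsto_vec_nth)
      moreover have "A (fst z) (fst (s k z)) (snd (s k z)) $ i = G k z" for k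
        using elim(2) z unfolding Geq by auto
      ultimately have "(\<lambda>k. G k z) \<longlonglongrightarrow> A (fst z) (v z) (w z) $ i" by simp
      then show "A (fst z) (v z) (w z) $ i = a z" using z by (simp add: a_def limI)
    qed
  qed
  then have "brep ?Q (\<lambda>z. A (fst z) (v z) (w z) $ i) a"
    using am by (auto simp: brep_def a_def)
  then show ?thesis by blast
qed

section \<open>The signed power as a continuous operator into L^1\<close>

lemma signed_powr_abs: "\<bar>signed_powr \<alpha> r\<bar> = \<bar>r\<bar> powr \<alpha>"
proof (cases "r = 0")
  case False
  have "\<bar>r\<bar> powr (\<alpha> - 1) * \<bar>r\<bar> powr 1 = \<bar>r\<bar> powr (\<alpha> - 1 + 1)" by (simp only: powr_add)
  then show ?thesis using False by (simp add: signed_powr_def abs_mult)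
qed (simp add: signed_powr_def)

lemma signed_powr_scale: "c > 0 \<Longrightarrow> signed_powr \<alpha> (c * r) = c powr \<alpha> * signed_powr \<alpha> r"
proof -
  assume c: "c > 0"
  have "c powr (\<alpha> - 1) * c powr 1 = c powr (\<alpha> - 1 + 1)" by (simp only: powr_add)
  then have "c powr (\<alpha> - 1) * c = c powr \<alpha>" using c by simp
  then show ?thesis using c by (simp add: signed_powr_def abs_mult powr_mult mult_ac)
qed

lemma continuous_signed_powr:
  assumes \<alpha>: "\<alpha> > 0"
  shows "continuous_on UNIV (signed_powr \<alpha>)"
proof -
  have "continuous_on UNIV (\<lambda>r. (max 0 r) powr \<alpha> - (max 0 (- r)) powr \<alpha>)"
    using \<alpha> by (intro continuous_intros continuous_on_powr') auto
  moreover have "(\<lambda>r. (max 0 r) powr \<alpha> - (max 0 (- r)) powr \<alpha>) = signed_powr \<alpha>"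
  proof
    fix r :: real
    show "(max 0 r) powr \<alpha> - (max 0 (- r)) powr \<alpha> = signed_powr \<alpha> r"
    proof (cases "r \<ge> 0")
      case True
      then show ?thesis using signed_powr_abs[of \<alpha> r] signed_powr_nonneg[of r \<alpha>] by simp
    next
      case False
      then show ?thesis using signed_powr_neg[of r \<alpha>] by simp
    qed
  qed
  ultimately show ?thesis by (simp only:)
qed

lemma signed_powr_measurable [measurable]: "signed_powr \<alpha> \<in> borel_measurable borel"
  unfolding signed_powr_def[abs_def] by measurable

lemma signed_powr_0 [simp]: "signed_powr \<alpha> 0 = 0"
  by (simp add: signed_powr_def)

lemma powr_less_than_one_plus:
  fixes x :: real
  assumes "x \<ge> 0" "\<alpha> > 0" "q \<ge> \<alpha>"
  shows "x powr \<alpha> \<le> 1 + x powr q"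
proof (cases "x \<le> 1")
  case True
  then have "x powr \<alpha> \<le> 1" using assms by (intro powr_le1) auto
  then show ?thesis using powr_ge_zero[of x q] by linarith
next
  case False
  then have "x powr \<alpha> \<le> x powr q" using assms(3) by (intro powr_mono) auto
  then show ?thesis by linarith
qed

text \<open>Small increments are handled by scaling to a compact set, large ones by their own power.\<close>

lemma signed_powr_modulus:
  assumes \<alpha>: "\<alpha> > 0" and \<epsilon>: "\<epsilon> > 0"
  shows "\<exists>C\<ge>0. \<forall>r s. \<bar>signed_powr \<alpha> r - signed_powr \<alpha> s\<bar> \<le> \<epsilon> * (1 + \<bar>s\<bar> powr (\<alpha> + 1)) + C * \<bar>r - s\<bar> powr (\<alpha> + 1)"
proof -
  define q where "q = \<alpha> + 1"
  have q: "q > 0" "q \<ge> \<alpha>" using \<alpha> by (auto simp: q_def)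
  \<comment> \<open>Compensates the factor 2^q in (1 + |s|)^q \<le> 2^q (1 + |s|^q).\<close>
  define \<epsilon>' where "\<epsilon>' = \<epsilon> / 2 powr q"
  have \<epsilon>': "\<epsilon>' > 0" using \<epsilon> by (simp add: \<epsilon>'_def)
  have "uniformly_continuous_on {-2..2} (signed_powr \<alpha>)"
    by (intro compact_uniformly_continuous continuous_on_subset[OF continuous_signed_powr[OF \<alpha>]]) auto
  then obtain d where d: "d > 0" "\<And>x y. x \<in> {-2..2} \<Longrightarrow> y \<in> {-2..2} \<Longrightarrow> \<bar>x - y\<bar> < d \<Longrightarrow> \<bar>signed_powr \<alpha> x - signed_powr \<alpha> y\<bar> < \<epsilon>'"
    unfolding uniformly_continuous_on_def using \<epsilon>' by (metis dist_real_def)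
  define \<eta> where "\<eta> = min d 1"
  have \<eta>: "0 < \<eta>" "\<eta> \<le> 1" "\<eta> \<le> d" using d(1) by (auto simp: \<eta>_def)
  \<comment> \<open>For a large increment \<delta> both arguments are at most (2/\<eta>) \<delta>,
    and \<delta>^\<alpha> \<le> \<delta>^q / \<eta> because \<delta> \<ge> \<eta>; the constant
    collects these factors.\<close>
  define C where "C = (2 * (2 / \<eta>) powr \<alpha>) / \<eta>"
  have C: "C \<ge> 0" using \<eta> by (simp add: C_def)
  have "\<bar>signed_powr \<alpha> r - signed_powr \<alpha> s\<bar> \<le> \<epsilon> * (1 + \<bar>s\<bar> powr q) + C * \<bar>r - s\<bar> powr q" for r s
  proof -
    define R where "R = 1 + \<bar>s\<bar>"
    have R: "R \<ge> 1" by (simp add: R_def)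
    show ?thesis
    proof (cases "\<bar>r - s\<bar> < \<eta> * R")
      case True
      have RR: "R * (y / R) = y" for y using R by simp
      have s2: "s / R \<in> {-2..2}" using R by (auto simp: R_def field_simps abs_if split: if_splits)
      have close: "\<bar>r / R - s / R\<bar> < \<eta>"
        using True R by (simp add: diff_divide_distrib[symmetric] abs_divide divide_less_eq)
      have sR: "\<bar>s / R\<bar> \<le> 1" using R by (simp add: abs_divide divide_le_eq R_def)
      have r2: "r / R \<in> {-2..2}" using close sR \<eta>(2) by (auto simp: abs_if split: if_splits)
      have "\<bar>signed_powr \<alpha> r - signed_powr \<alpha> s\<bar> = R powr \<alpha> * \<bar>signed_powr \<alpha> (r / R) - signed_powr \<alpha> (s / R)\<bar>"
        using signed_powr_scale[of R \<alpha> "r / R"] signed_powr_scale[of R \<alpha> "s / R"] R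
        by (simp add: RR right_diff_distrib[symmetric] abs_mult)
      also have "\<dots> \<le> R powr \<alpha> * \<epsilon>'"
        using d(2)[OF r2 s2] close \<eta>(3) by (intro mult_left_mono) auto
      also have "\<dots> \<le> R powr q * \<epsilon>'" using R q(2) \<epsilon>' by (intro mult_right_mono powr_mono) auto
      also have "R powr q \<le> 2 powr q * (1 + \<bar>s\<bar> powr q)"
        using powr_abs_add_le[OF q(1), of 1 "\<bar>s\<bar>"] by (simp add: R_def)
      then have "R powr q * \<epsilon>' \<le> 2 powr q * (1 + \<bar>s\<bar> powr q) * \<epsilon>'" using \<epsilon>' by (intro mult_right_mono) auto
      also have "\<dots> = \<epsilon> * (1 + \<bar>s\<bar> powr q)" by (simp add: \<epsilon>'_def)
      finally show ?thesis using C by (simp add: add_increasing2)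
    next
      case False
      define \<delta> where "\<delta> = \<bar>r - s\<bar>"
      have \<delta>: "\<delta> \<ge> \<eta> * R" "\<delta> \<ge> \<eta>" "\<delta> > 0"
      proof -
        show 1: "\<delta> \<ge> \<eta> * R" using False by (simp add: \<delta>_def)
        have "\<eta> * 1 \<le> \<eta> * R" using \<eta> R by (intro mult_left_mono) auto
        with 1 \<eta> show "\<delta> \<ge> \<eta>" "\<delta> > 0" by linarith+
      qed
      have "R \<le> \<delta> / \<eta>" using \<delta>(1) \<eta>(1) by (simp add: le_divide_eq mult.commute)
      moreover have "\<delta> \<le> \<delta> / \<eta>" using \<eta> \<delta>(3) by (simp add: le_divide_eq mult_left_le)
      ultimately have b: "\<bar>s\<bar> \<le> 2 / \<eta> * \<delta>" "\<bar>r\<bar> \<le> 2 / \<eta> * \<delta>" using \<delta>(3)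
        by (auto simp: R_def \<delta>_def)
      have "\<bar>signed_powr \<alpha> r - signed_powr \<alpha> s\<bar> \<le> \<bar>r\<bar> powr \<alpha> + \<bar>s\<bar> powr \<alpha>"
        unfolding signed_powr_abs[symmetric] by linarith
      also have "\<dots> \<le> (2 / \<eta> * \<delta>) powr \<alpha> + (2 / \<eta> * \<delta>) powr \<alpha>"
        using b \<alpha> by (intro add_mono powr_mono2) auto
      also have "\<dots> = 2 * (2 / \<eta>) powr \<alpha> * \<delta> powr \<alpha>"
      proof -
        have pm: "(2 / \<eta> * \<delta>) powr \<alpha> = (2 / \<eta>) powr \<alpha> * \<delta> powr \<alpha>"
          by (rule powr_mult)
        show ?thesis unfolding pm by simp
      qed
      also have "\<delta> powr \<alpha> \<le> \<delta> powr q / \<eta>"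
      proof -
        have "\<delta> powr \<alpha> * \<eta> \<le> \<delta> powr \<alpha> * \<delta>" using \<delta> by (intro mult_left_mono) auto
        also have "\<dots> = \<delta> powr q" using \<delta>(3) by (simp add: q_def powr_add)
        finally show ?thesis using \<eta>(1) by (simp add: le_divide_eq)
      qed
      then have "2 * (2 / \<eta>) powr \<alpha> * \<delta> powr \<alpha> \<le> 2 * (2 / \<eta>) powr \<alpha> * (\<delta> powr q / \<eta>)"
        by (intro mult_left_mono) auto
      also have "\<dots> = C * \<bar>r - s\<bar> powr q" by (simp add: C_def \<delta>_def)
      finally show ?thesis using \<epsilon> by (simp add: add_increasing)
    qed
  qed
  then show ?thesis using C unfolding q_def by blast
qed

text \<open>The pointwise modulus splits the L^1 distance into a fixed small multiple of the
  integral of 1 + |f|^(\<alpha>+1) over \<open>U\<close> and a multiple of the L^(\<alpha>+1)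
  distance, for \<alpha> below and above 1 alike. An arbitrary filter covers limits inside the time
  interval as well as the initial one.\<close>

lemma signed_powr_L1_tendsto:
  fixes f :: "'a::euclidean_space \<Rightarrow> real" and g :: "'i \<Rightarrow> 'a \<Rightarrow> real"
  assumes \<alpha>: "\<alpha> > 0" and U: "bounded U" "U \<in> sets borel"
    and fm: "f \<in> borel_measurable borel" and gm: "\<And>i. g i \<in> borel_measurable borel"
    and z: "\<And>x. x \<notin> U \<Longrightarrow> f x = 0" "\<And>i x. x \<notin> U \<Longrightarrow> g i x = 0"
    and fi: "integrable lborel (\<lambda>x. \<bar>f x\<bar> powr (\<alpha> + 1))" and gi: "\<And>i. integrable lborel (\<lambda>x. \<bar>g i x\<bar> powr (\<alpha> + 1))"
    and lim: "((\<lambda>i. \<integral>x. \<bar>g i x - f x\<bar> powr (\<alpha> + 1) \<partial>lborel) \<longlongrightarrow> 0) F"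
  shows "integrable lborel (\<lambda>x. signed_powr \<alpha> (f x))"
    and "((\<lambda>i. \<integral>x. \<bar>signed_powr \<alpha> (g i x) - signed_powr \<alpha> (f x)\<bar> \<partial>lborel) \<longlongrightarrow> 0) F"
proof -
  define q where "q = \<alpha> + 1"
  have q: "q > 0" "q \<ge> \<alpha>" using \<alpha> by (auto simp: q_def)
  note [measurable] = fm gm
  have Ui: "integrable lborel (indicator U :: 'a \<Rightarrow> real)" using emeasure_bounded_finite[OF U(1)] U(2) by simp
  have spi: "integrable lborel (\<lambda>x. signed_powr \<alpha> (h x))"
    if [measurable]: "h \<in> borel_measurable borel" and "\<And>x. x \<notin> U \<Longrightarrow> h x = 0" "integrable lborel (\<lambda>x. \<bar>h x\<bar> powr q)" for h
  proof (rule Bochner_Integration.integrable_bound)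
    show "integrable lborel (\<lambda>x. indicator U x + \<bar>h x\<bar> powr q)" using Ui that(3) by simp
    show "AE x in lborel. norm (signed_powr \<alpha> (h x)) \<le> norm (indicator U x + \<bar>h x\<bar> powr q)"
    proof (rule AE_I2)
      fix x show "norm (signed_powr \<alpha> (h x)) \<le> norm (indicator U x + \<bar>h x\<bar> powr q)"
        using powr_less_than_one_plus[OF abs_ge_zero \<alpha> q(2), of "h x"] that(2)[of x]
        by (cases "x \<in> U") (auto simp: signed_powr_abs)
    qed
  qed simp
  show fsi: "integrable lborel (\<lambda>x. signed_powr \<alpha> (f x))" using spi[OF fm z(1)] fi by (simp add: q_def)
  have gsi: "integrable lborel (\<lambda>x. signed_powr \<alpha> (g i x))" for i using spi[OF gm z(2)] gi by (simp add: q_def)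
  have di: "integrable lborel (\<lambda>x. \<bar>g i x - f x\<bar> powr q)" for i
    by (rule integrable_powr_abs_diff(1)[OF q(1)]) (use fi gi in \<open>auto simp: q_def\<close>)
  define L where "L = (\<integral>x. indicator U x + \<bar>f x\<bar> powr q \<partial>lborel)"
  have L: "L \<ge> 0" by (simp add: L_def)
  show "((\<lambda>i. \<integral>x. \<bar>signed_powr \<alpha> (g i x) - signed_powr \<alpha> (f x)\<bar> \<partial>lborel) \<longlongrightarrow> 0) F"
  proof (rule tendstoI)
    fix e :: real assume e: "e > 0"
    \<comment> \<open>Chosen so that \<open>\<epsilon> * (L + 1) = e / 2\<close>, whence the part
      that does not tend to 0 stays below half the tolerance.\<close>
    define \<epsilon> where "\<epsilon> = e / (2 * (L + 1))"
    have \<epsilon>: "\<epsilon> > 0" using e L by (simp add: \<epsilon>_def)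
    define k where "k = L + 1"
    have "k > 0" using L by (simp add: k_def)
    then have "e / (2 * k) * k = e / 2" by simp
    then have "\<epsilon> * (L + 1) = e / 2" by (simp only: \<epsilon>_def k_def)
    then have "\<epsilon> * L + \<epsilon> = e / 2" by (simp only: distrib_left mult_1_right)
    then have \<epsilon>L: "\<epsilon> * L < e / 2" using \<epsilon> by linarith
    obtain C where C: "C \<ge> 0" "\<And>r s. \<bar>signed_powr \<alpha> r - signed_powr \<alpha> s\<bar> \<le> \<epsilon> * (1 + \<bar>s\<bar> powr q) + C * \<bar>r - s\<bar> powr q"
      using signed_powr_modulus[OF \<alpha> \<epsilon>] unfolding q_def by blast
    have bd: "(\<integral>x. \<bar>signed_powr \<alpha> (g i x) - signed_powr \<alpha> (f x)\<bar> \<partial>lborel) \<le> \<epsilon> * L + C * (\<integral>x. \<bar>g i x - f x\<bar> powr q \<partial>lborel)" for i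
    proof -
      have "(\<integral>x. \<bar>signed_powr \<alpha> (g i x) - signed_powr \<alpha> (f x)\<bar> \<partial>lborel)
          \<le> (\<integral>x. \<epsilon> * (indicator U x + \<bar>f x\<bar> powr q) + C * \<bar>g i x - f x\<bar> powr q \<partial>lborel)"
      proof (rule integral_mono)
        show "integrable lborel (\<lambda>x. \<bar>signed_powr \<alpha> (g i x) - signed_powr \<alpha> (f x)\<bar>)" using fsi gsi by simp
        show "integrable lborel (\<lambda>x. \<epsilon> * (indicator U x + \<bar>f x\<bar> powr q) + C * \<bar>g i x - f x\<bar> powr q)"
          using Ui fi di by (simp add: q_def)
        show "\<bar>signed_powr \<alpha> (g i x) - signed_powr \<alpha> (f x)\<bar> \<le> \<epsilon> * (indicator U x + \<bar>f x\<bar> powr q) + C * \<bar>g i x - f x\<bar> powr q" for x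
          using C(2)[of "g i x" "f x"] z(1)[of x] z(2)[of x i] by (cases "x \<in> U") auto
      qed
      also have "\<dots> = \<epsilon> * L + C * (\<integral>x. \<bar>g i x - f x\<bar> powr q \<partial>lborel)"
        using Ui fi di by (simp add: q_def L_def)
      finally show ?thesis .
    qed
    have "((\<lambda>i. C * (\<integral>x. \<bar>g i x - f x\<bar> powr q \<partial>lborel)) \<longlongrightarrow> C * 0) F"
      using lim by (intro tendsto_intros) (simp add: q_def)
    then have "eventually (\<lambda>i. C * (\<integral>x. \<bar>g i x - f x\<bar> powr q \<partial>lborel) < e / 2) F"
      using e by (intro order_tendstoD(2)) auto
    then show "eventually (\<lambda>i. dist (\<integral>x. \<bar>signed_powr \<alpha> (g i x) - signed_powr \<alpha> (f x)\<bar> \<partial>lborel) 0 < e) F"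
    proof eventually_elim
      case (elim i)
      then show ?case using bd[of i] \<epsilon>L by simp
    qed
  qed
qed

section \<open>Time averages\<close>

lemma integral_translation_prod:
  fixes f :: "'a::euclidean_space \<times> real \<Rightarrow> real"
  assumes "f \<in> borel_measurable borel"
  shows "(\<integral>z. f (fst z, snd z - r) \<partial>lborel) = (\<integral>z. f z \<partial>lborel)"
    and "integrable lborel (\<lambda>z. f (fst z, snd z - r)) \<longleftrightarrow> integrable lborel f"
proof -
  have eq: "(\<lambda>z. f (fst z, snd z - r)) = (\<lambda>z. f ((0, -r) + z))" by (auto simp: fun_eq_iff)
  show "(\<integral>z. f (fst z, snd z - r) \<partial>lborel) = (\<integral>z. f z \<partial>lborel)"
    and "integrable lborel (\<lambda>z. f (fst z, snd z - r)) \<longleftrightarrow> integrable lborel f"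
    unfolding eq using integral_lborel_translation[OF assms, of "(0, -r)"] by auto
qed

lemma integral_real_reflect_translate:
  fixes f :: "real \<Rightarrow> real"
  shows "(\<integral>\<sigma>. f (t - \<sigma>) \<partial>lborel) = (\<integral>\<tau>. f \<tau> \<partial>lborel)"
  using lborel_integral_real_affine[of "-1" f t] by simp

text \<open>The time translation of one factor turns a time average into an average of pairings.\<close>

lemma time_average_pairing:
  fixes a G :: "'a::euclidean_space \<times> real \<Rightarrow> real"
  assumes p: "p > 1" and am[measurable]: "a \<in> borel_measurable borel" and Gm[measurable]: "G \<in> borel_measurable borel"
    and ai: "integrable lborel (\<lambda>z. \<bar>a z\<bar> powr (p / (p - 1)))" and Gi: "integrable lborel (\<lambda>z. \<bar>G z\<bar> powr p)"
    and h: "h > 0"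
  defines "D \<equiv> (\<lambda>\<sigma>. \<integral>z. a (fst z, snd z - \<sigma>) * G z \<partial>lborel)"
  defines "L \<equiv> (\<lambda>t. \<integral>x. \<integral>\<sigma>. a (x, t - \<sigma>) * G (x, t) * indicator {0..<h} \<sigma> \<partial>lborel \<partial>lborel)"
  shows "integrable lborel L"
    and "integrable lborel (\<lambda>\<sigma>. D \<sigma> * indicator {0..<h} \<sigma>)"
    and "(\<integral>t. L t \<partial>lborel) = (\<integral>\<sigma>. D \<sigma> * indicator {0..<h} \<sigma> \<partial>lborel)"
    and "(D \<longlongrightarrow> D 0) (at_right 0)"
proof -
  define q where "q = p / (p - 1)"
  have q: "q > 1" using p by (simp add: q_def field_simps)
  have qp: "q / (q - 1) = p" using p by (simp add: q_def field_simps)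
  \<comment> \<open>The arguments are ((x, t), \<sigma>). Integrating over the space-time point
    first produces \<open>D\<close>, integrating over \<sigma> and then over \<open>x\<close>
    produces \<open>L\<close>; Fubini's theorem identifies the totals.\<close>
  define F where "F w = a (fst (fst w), snd (fst w) - snd w) * G (fst w) * indicator {0..<h} (snd w)"
    for w :: "('a \<times> real) \<times> real"
  have Fm: "F \<in> borel_measurable borel"
    unfolding F_def borel_prod[symmetric] using am Gm unfolding borel_prod[symmetric] by measurable
  have sm[measurable]: "(\<lambda>z. a (fst z, snd z - \<sigma>)) \<in> borel_measurable borel" for \<sigma>
    using am unfolding borel_prod[symmetric] by measurable
  have sa: "integrable lborel (\<lambda>z. \<bar>a (fst z, snd z - \<sigma>)\<bar> powr q)"
    "(\<integral>z. \<bar>a (fst z, snd z - \<sigma>)\<bar> powr q \<partial>lborel) = (\<integral>z. \<bar>a z\<bar> powr q \<partial>lborel)" for \<sigma>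
    using integral_translation_prod[of "\<lambda>z. \<bar>a z\<bar> powr q" \<sigma>] ai by (auto simp: q_def)
  have prod_i: "integrable lborel (\<lambda>z. a (fst z, snd z - \<sigma>) * G z)" for \<sigma>
    by (rule Young_integral(1)[OF p _ _ _ Gi]) (use sa(1) in \<open>auto simp: q_def\<close>)
  have absbd: "(\<integral>z. \<bar>a (fst z, snd z - \<sigma>) * G z\<bar> \<partial>lborel) \<le> (\<integral>z. \<bar>a z\<bar> powr q \<partial>lborel) + (\<integral>z. \<bar>G z\<bar> powr p \<partial>lborel)" for \<sigma>
    using Young_integral(2)[OF p, of "\<lambda>z. \<bar>a (fst z, snd z - \<sigma>)\<bar>" lborel "\<lambda>z. \<bar>G z\<bar>" 1] sa[of \<sigma>] Gi
    by (simp add: q_def abs_mult)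
  have Fi: "integrable lborel F"
  proof (rule lborel_fubini_integrable[OF Fm])
    show "AE \<sigma> in lborel. integrable lborel (\<lambda>z. F (z, \<sigma>))" using prod_i by (simp add: F_def)
    have m: "(\<lambda>\<sigma>. \<integral>z. \<bar>F (z, \<sigma>)\<bar> \<partial>lborel) \<in> borel_measurable borel"
      using borel_measurable_lborel_integral[of "\<lambda>w. \<bar>F w\<bar>"] Fm by simp
    have i: "integrable lborel (\<lambda>\<sigma>. ((\<integral>z. \<bar>a z\<bar> powr q \<partial>lborel) + (\<integral>z. \<bar>G z\<bar> powr p \<partial>lborel)) * indicator {0..<h} \<sigma>)"
      using h by (intro integrable_mult_right integrable_real_indicator) auto
    show "integrable lborel (\<lambda>\<sigma>. \<integral>z. \<bar>F (z, \<sigma>)\<bar> \<partial>lborel)"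
    proof (rule Bochner_Integration.integrable_bound[OF i])
      show "AE \<sigma> in lborel. norm (\<integral>z. \<bar>F (z, \<sigma>)\<bar> \<partial>lborel) \<le>
          norm (((\<integral>z. \<bar>a z\<bar> powr q \<partial>lborel) + (\<integral>z. \<bar>G z\<bar> powr p \<partial>lborel)) * indicator {0..<h} \<sigma>)"
      proof (rule AE_I2)
        fix \<sigma>
        show "norm (\<integral>z. \<bar>F (z, \<sigma>)\<bar> \<partial>lborel) \<le>
          norm (((\<integral>z. \<bar>a z\<bar> powr q \<partial>lborel) + (\<integral>z. \<bar>G z\<bar> powr p \<partial>lborel)) * indicator {0..<h} \<sigma>)"
          using order_trans[OF absbd[of \<sigma>] abs_ge_self]
          by (cases "\<sigma> \<in> {0..<h}") (simp_all add: F_def)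
      qed
    qed (use m in simp)
  qed
  have FD: "(\<integral>z. F (z, \<sigma>) \<partial>lborel) = D \<sigma> * indicator {0..<h} \<sigma>" for \<sigma>
    by (simp add: F_def D_def)
  show "integrable lborel (\<lambda>\<sigma>. D \<sigma> * indicator {0..<h} \<sigma>)"
    using lborel_fubini(2)[OF Fi] by (simp add: FD)
  have Fi': "integrable lborel (\<lambda>(\<sigma>, z). F (z, \<sigma>))" using Fi integrable_lborel_swap[of F] by simp
  define \<Gamma> where "\<Gamma> z = (\<integral>\<sigma>. F (z, \<sigma>) \<partial>lborel)" for z
  have \<Gamma>i: "integrable lborel \<Gamma>" using lborel_fubini(2)[OF Fi'] by (simp add: \<Gamma>_def[abs_def])
  have "(\<integral>z. \<Gamma> z \<partial>lborel) = (\<integral>\<sigma>. \<integral>z. F (z, \<sigma>) \<partial>lborel \<partial>lborel)"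
    unfolding \<Gamma>_def using Fi by (subst lborel_pair.Fubini_integral[of "\<lambda>z \<sigma>. F (z, \<sigma>)"]) (auto simp: lborel_prod)
  then have \<Gamma>F: "(\<integral>z. \<Gamma> z \<partial>lborel) = (\<integral>\<sigma>. D \<sigma> * indicator {0..<h} \<sigma> \<partial>lborel)" by (simp add: FD)
  have LG: "L t = (\<integral>x. \<Gamma> (x, t) \<partial>lborel)" for t by (simp add: L_def \<Gamma>_def F_def)
  show "integrable lborel L" using lborel_fubini(2)[OF \<Gamma>i] by (simp add: LG[abs_def])
  show "(\<integral>t. L t \<partial>lborel) = (\<integral>\<sigma>. D \<sigma> * indicator {0..<h} \<sigma> \<partial>lborel)"
    using lborel_fubini(3)[OF \<Gamma>i] \<Gamma>F by (simp add: LG)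
  have ai': "integrable lborel (\<lambda>z. \<bar>a z\<bar> powr q)" using ai by (simp add: q_def)
  have tr: "((\<lambda>h. \<integral>z. \<bar>a (h + z) - a z\<bar> powr q \<partial>lborel) \<longlongrightarrow> 0) (at 0)"
    using q by (intro Lp_translation_continuous[OF _ am ai']) auto
  \<comment> \<open>Going back in time by \<sigma> is the space-time translation by (0, -\<sigma>),
    so continuity of translations applies as \<sigma> decreases to 0.\<close>
  have fl: "filterlim (\<lambda>\<sigma>::real. (0::'a, - \<sigma>)) (at 0) (at_right 0)"
  proof (rule filterlim_atI)
    show "((\<lambda>\<sigma>::real. (0::'a, - \<sigma>)) \<longlongrightarrow> 0) (at_right 0)"
      unfolding zero_prod_def by (intro tendsto_Pair tendsto_const) (auto intro!: tendsto_eq_intros)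
    show "eventually (\<lambda>\<sigma>::real. (0::'a, - \<sigma>) \<noteq> 0) (at_right 0)"
      using eventually_at_right_less[of "0::real"] by eventually_elim (auto simp: zero_prod_def)
  qed
  have shift: "(0, - \<sigma>) + z = (fst z, snd z - \<sigma>)" for \<sigma> and z :: "'a \<times> real" by (cases z) simp
  have lim: "((\<lambda>\<sigma>. \<integral>z. \<bar>a (fst z, snd z - \<sigma>) - a z\<bar> powr q \<partial>lborel) \<longlongrightarrow> 0) (at_right 0)"
    using filterlim_compose[OF tr fl] by (simp add: shift)
  have dm: "(\<lambda>z. a (fst z, snd z - \<sigma>) - a z) \<in> borel_measurable lborel" for \<sigma> by simp
  have di: "integrable lborel (\<lambda>z. \<bar>a (fst z, snd z - \<sigma>) - a z\<bar> powr q)" for \<sigma>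
    by (rule integrable_powr_abs_diff(1)[OF _ _ _ sa(1) ai']) (use q in auto)
  \<comment> \<open>The exponents exchange roles: the varying factor lies in L^q, and the conjugate
    exponent of \<open>q\<close> is \<open>p\<close>.\<close>
  have "((\<lambda>\<sigma>. \<integral>z. G z * (a (fst z, snd z - \<sigma>) - a z) \<partial>lborel) \<longlongrightarrow> 0) (at_right 0)"
    by (rule tendsto_Lp_pairing_0[OF q _ dm _ _ lim]) (use Gi di in \<open>auto simp: qp\<close>)
  moreover have "(\<integral>z. G z * (a (fst z, snd z - \<sigma>) - a z) \<partial>lborel) = D \<sigma> - D 0" for \<sigma>
  proof -
    have "(\<integral>z. G z * (a (fst z, snd z - \<sigma>) - a z) \<partial>lborel) = (\<integral>z. a (fst z, snd z - \<sigma>) * G z - a (fst z, snd z - 0) * G z \<partial>lborel)"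
      by (intro Bochner_Integration.integral_cong) (auto simp: algebra_simps)
    also have "\<dots> = D \<sigma> - D 0" unfolding D_def by (rule Bochner_Integration.integral_diff[OF prod_i prod_i])
    finally show ?thesis .
  qed
  ultimately show "(D \<longlongrightarrow> D 0) (at_right 0)" by (simp add: LIM_zero_iff)
qed

lemma integral_average_le:
  fixes D :: "real \<Rightarrow> real"
  assumes i: "integrable lborel (\<lambda>\<sigma>. D \<sigma> * indicator {0..<h} \<sigma>)" and h: "h > 0"
    and D: "\<And>\<sigma>. 0 < \<sigma> \<Longrightarrow> \<sigma> < h \<Longrightarrow> D \<sigma> \<ge> y"
  shows "(\<integral>\<sigma>. D \<sigma> * indicator {0..<h} \<sigma> \<partial>lborel) \<ge> y * h"
proof -
  have "y * h = (\<integral>\<sigma>. y * indicator {0..<h} \<sigma> \<partial>lborel)" using h by simp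
  also have "\<dots> \<le> (\<integral>\<sigma>. D \<sigma> * indicator {0..<h} \<sigma> \<partial>lborel)"
  proof (rule integral_mono_AE[OF _ i])
    show "AE \<sigma> in lborel. y * indicator {0..<h} \<sigma> \<le> D \<sigma> * indicator {0..<h} \<sigma>"
      using AE_lborel_singleton[of "0::real"]
    proof eventually_elim
      case (elim \<sigma>)
      then show ?case using D[of \<sigma>] by (cases "\<sigma> \<in> {0..<h}") auto
    qed
  qed (use h in \<open>intro integrable_mult_right integrable_real_indicator; auto\<close>)
  finally show ?thesis .
qed

text \<open>An integrated one-sided difference quotient estimate recovers the pointwise increment.\<close>

lemma increment_le_from_averages:
  fixes E :: "real \<Rightarrow> real"
  assumes c: "continuous_on {0<..<T} E" and t: "0 < t1" "t1 < t2" "t2 < T"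
    and D: "(D \<longlongrightarrow> y) (at_right 0)"
    and Di: "\<And>h. 0 < h \<Longrightarrow> h < t1 \<Longrightarrow> integrable lborel (\<lambda>\<sigma>. D \<sigma> * indicator {0..<h} \<sigma>)"
    and le: "\<And>h. 0 < h \<Longrightarrow> h < t1 \<Longrightarrow>
      integral {t1..t2} (\<lambda>t. E t - E (t - h)) \<le> - (\<integral>\<sigma>. D \<sigma> * indicator {0..<h} \<sigma> \<partial>lborel)"
  shows "E t2 - E t1 \<le> - y"
proof (rule field_le_epsilon)
  fix e :: real assume e: "e > 0"
  have cont: "\<exists>d>0. \<forall>s. \<bar>s - t\<bar> < d \<longrightarrow> \<bar>E s - E t\<bar> < e / 3" if "0 < t" "t < T" for t
  proof -
    have "isCont E t" using c that by (simp add: continuous_on_eq_continuous_at)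
    then show ?thesis unfolding continuous_at_eps_delta using e by (metis dist_real_def divide_pos_pos zero_less_numeral)
  qed
  obtain d1 where d1: "d1 > 0" "\<And>s. \<bar>s - t1\<bar> < d1 \<Longrightarrow> \<bar>E s - E t1\<bar> < e / 3" using cont[of t1] t by auto
  obtain d2 where d2: "d2 > 0" "\<And>s. \<bar>s - t2\<bar> < d2 \<Longrightarrow> \<bar>E s - E t2\<bar> < e / 3" using cont[of t2] t by auto
  have "eventually (\<lambda>\<sigma>. D \<sigma> > y - e / 3) (at_right 0)" using order_tendstoD(1)[OF D, of "y - e / 3"] e by simp
  then obtain d3 where d3: "d3 > 0" "\<And>\<sigma>. 0 < \<sigma> \<Longrightarrow> \<sigma> < d3 \<Longrightarrow> D \<sigma> > y - e / 3"
    unfolding eventually_at_right_field by auto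
  define h where "h = min (min d1 d2) (min d3 (min t1 (t2 - t1))) / 2"
  have h: "0 < h" "h < d1" "h < d2" "h < d3" "h < t1" "h < t2 - t1"
    using d1(1) d2(1) d3(1) t by (auto simp: h_def min_def)
  have ci: "E integrable_on {r..s}" if "0 < r" "s < T" for r s
    using that by (intro integrable_continuous_real continuous_on_subset[OF c]) auto
  \<comment> \<open>The two integrals cancel on their overlap. Only the windows of length
    \<open>h\<close> before \<open>t2\<close> and before \<open>t1\<close> remain, on which
    \<open>E\<close> is nearly constant.\<close>
  have shift: "integral {t1..t2} (\<lambda>t. E (t - h)) = integral {t1 - h..t2 - h} E"
    and shifti: "(\<lambda>t. E (t - h)) integrable_on {t1..t2}"
  proof -
    have "(E has_integral integral {t1 - h..t2 - h} E) (cbox (t1 - h) (t2 - h))"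
      using ci[of "t1 - h" "t2 - h"] h t by (simp add: integrable_integral)
    from has_integral_affinity[OF this, of 1 "-h"]
    have "((\<lambda>t. E (t - h)) has_integral integral {t1 - h..t2 - h} E) {t1..t2}" by simp
    then show "integral {t1..t2} (\<lambda>t. E (t - h)) = integral {t1 - h..t2 - h} E"
      "(\<lambda>t. E (t - h)) integrable_on {t1..t2}" by (auto simp: integral_unique)
  qed
  have split1: "integral {t1 - h..t2 - h} E + integral {t2 - h..t2} E = integral {t1 - h..t2} E"
    using h t by (intro Henstock_Kurzweil_Integration.integral_combine ci) auto
  have split2: "integral {t1 - h..t1} E + integral {t1..t2} E = integral {t1 - h..t2} E"
    using h t by (intro Henstock_Kurzweil_Integration.integral_combine ci) auto
  have "integral {t1..t2} (\<lambda>t. E t - E (t - h)) = integral {t1..t2} E - integral {t1 - h..t2 - h} E"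
    using shift shifti ci[of t1 t2] t by (simp add: integral_diff)
  also have "\<dots> = integral {t2 - h..t2} E - integral {t1 - h..t1} E" using split1 split2 by linarith
  finally have eq: "integral {t1..t2} (\<lambda>t. E t - E (t - h)) = integral {t2 - h..t2} E - integral {t1 - h..t1} E" .
  have lo: "integral {t2 - h..t2} E \<ge> h * (E t2 - e / 3)"
  proof -
    have "integral {t2 - h..t2} (\<lambda>_. E t2 - e / 3) \<le> integral {t2 - h..t2} E"
    proof (rule integral_le)
      show "E t2 - e / 3 \<le> E s" if "s \<in> {t2 - h..t2}" for s
      proof -
        have "\<bar>s - t2\<bar> < d2" using that h by auto
        from d2(2)[OF this] show ?thesis by linarith
      qed
    qed (use ci[of "t2 - h" t2] h t in auto)
    then show ?thesis using h by (simp add: mult.commute)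
  qed
  have hi: "integral {t1 - h..t1} E \<le> h * (E t1 + e / 3)"
  proof -
    have "integral {t1 - h..t1} E \<le> integral {t1 - h..t1} (\<lambda>_. E t1 + e / 3)"
    proof (rule integral_le)
      show "E s \<le> E t1 + e / 3" if "s \<in> {t1 - h..t1}" for s
      proof -
        have "\<bar>s - t1\<bar> < d1" using that h by auto
        from d1(2)[OF this] show ?thesis by linarith
      qed
    qed (use ci[of "t1 - h" t1] h t in auto)
    then show ?thesis using h by (simp add: mult.commute)
  qed
  have "(y - e / 3) * h \<le> (\<integral>\<sigma>. D \<sigma> * indicator {0..<h} \<sigma> \<partial>lborel)"
    using h d3(2) by (intro integral_average_le Di) (auto intro: less_imp_le)
  then have "h * (E t2 - e / 3) - h * (E t1 + e / 3) \<le> - ((y - e / 3) * h)"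
    using le[OF h(1) h(5)] eq lo hi by linarith
  then have "h * (E t2 - E t1) \<le> h * (- y + e)" by (simp add: algebra_simps)
  then show "E t2 - E t1 \<le> - y + e" using h(1) by simp
qed

section \<open>The energy inequality\<close>

lemma integral_prod_indicator:
  fixes \<phi> :: "'a::euclidean_space \<Rightarrow> real" and s t :: real
  assumes \<phi>: "integrable lborel \<phi>" and st: "s \<le> t"
  shows "integrable lborel (\<lambda>z. \<phi> (fst z) * indicator {s<..t} (snd z))"
    and "(\<integral>z. \<phi> (fst z) * indicator {s<..t} (snd z) \<partial>lborel) = (t - s) * (\<integral>x. \<phi> x \<partial>lborel)"
proof -
  have [measurable]: "\<phi> \<in> borel_measurable borel" using \<phi> by auto
  have m: "(\<lambda>z::'a\<times>real. \<phi> (fst z) * indicator {s<..t} (snd z)) \<in> borel_measurable borel"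
    unfolding borel_prod[symmetric] by measurable
  have I: "integrable lborel (indicator {s<..t} :: real \<Rightarrow> real)" using st by (intro integrable_real_indicator) auto
  show i: "integrable lborel (\<lambda>z. \<phi> (fst z) * indicator {s<..t} (snd z))"
  proof (rule lborel_fubini_integrable[OF m])
    show "AE y in lborel. integrable lborel (\<lambda>x. \<phi> (fst (x, y)) * indicator {s<..t} (snd (x, y)))" using \<phi> by simp
    show "integrable lborel (\<lambda>y. \<integral>x. \<bar>\<phi> (fst (x, y)) * indicator {s<..t} (snd (x, y))\<bar> \<partial>lborel)"
      using I by (simp add: abs_mult)
  qed
  show "(\<integral>z. \<phi> (fst z) * indicator {s<..t} (snd z) \<partial>lborel) = (t - s) * (\<integral>x. \<phi> x \<partial>lborel)"
    using lborel_fubini(3)[OF i] st by (simp add: mult.commute)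
qed

text \<open>\<open>u\<close> is jointly measurable, while \<open>U t\<close> represents the solution
  at every single time; they are linked for a.e. \<open>t\<close>. The approximants \<Psi> are
  chosen separately for each \<open>t\<close> and need no measurability in time, because each of
  them is used at one time only and disappears in the limit.\<close>

lemma energy_inequality:
  fixes \<Omega> :: "(real^'n) set" and p :: "'n \<Rightarrow> real" and a Du :: "'n \<Rightarrow> (real^'n) \<times> real \<Rightarrow> real"
    and u :: "(real^'n) \<times> real \<Rightarrow> real" and U :: "real \<Rightarrow> real^'n \<Rightarrow> real" and f :: "real^'n \<Rightarrow> real"
  assumes p: "\<And>i. p i > 1" and \<alpha>: "\<alpha> > 0" and d: "d > 0"
    and am: "\<And>i. a i \<in> borel_measurable borel" and ai: "\<And>i. integrable lborel (\<lambda>z. \<bar>a i z\<bar> powr (p i / (p i - 1)))"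
    and Dum: "\<And>i. Du i \<in> borel_measurable borel" and Dui: "\<And>i. integrable lborel (\<lambda>z. \<bar>Du i z\<bar> powr p i)"
    and um: "u \<in> borel_measurable borel"
    and wi: "\<And>t. t \<in> {0<..<T} \<Longrightarrow> integrable lborel (\<lambda>x. signed_powr \<alpha> (U t x))"
    and Um: "\<And>t. t \<in> {0<..<T} \<Longrightarrow> U t \<in> borel_measurable borel"
    and wc: "\<And>t. t \<in> {0<..<T} \<Longrightarrow>
      ((\<lambda>s. \<integral>x. \<bar>signed_powr \<alpha> (U s x) - signed_powr \<alpha> (U t x)\<bar> \<partial>lborel) \<longlongrightarrow> 0) (at t within {0<..<T})"
    and fi: "integrable lborel f" and f0: "AE x in lborel. f x \<ge> 0"
    and eq: "\<And>\<psi> s t. \<psi> \<in> test_fun \<Omega> \<Longrightarrow> 0 < s \<Longrightarrow> s < t \<Longrightarrow> t < T \<Longrightarrow>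
      (\<integral>x. (signed_powr \<alpha> (U t x) - signed_powr \<alpha> (U s x)) * \<psi> x \<partial>lborel) = (t - s) * (\<integral>x. f x * \<psi> x \<partial>lborel)
       - (\<Sum>i\<in>UNIV. \<integral>z. a i z * (dir_deriv (axis i 1) \<psi> (fst z) * indicator {s<..t} (snd z)) \<partial>lborel)"
    and good: "AE t in lborel. t \<in> {0<..<T} \<longrightarrow> (AE x in lborel. u (x, t) = U t x) \<and>
      (\<forall>i. integrable lborel (\<lambda>x. \<bar>Du i (x, t)\<bar> powr p i)) \<and>
      (\<exists>\<Psi>. (\<forall>k. \<Psi> k \<in> test_fun \<Omega>) \<and> (\<forall>k x. \<bar>\<Psi> k x\<bar> \<le> 1) \<and>
        (AE x in lborel. (\<lambda>k. \<Psi> k x) \<longlonglongrightarrow> testH \<alpha> d (u (x, t))) \<and>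
        (\<forall>i. (\<lambda>k. \<integral>x. \<bar>dir_deriv (axis i 1) (\<Psi> k) x - testH' \<alpha> d (u (x, t)) * Du i (x, t)\<bar> powr p i \<partial>lborel) \<longlonglongrightarrow> 0))"
    and t12: "0 < t1" "t1 < t2" "t2 < T"
  shows "(\<integral>x. entr d (- signed_powr \<alpha> (U t2 x)) \<partial>lborel) - (\<integral>x. entr d (- signed_powr \<alpha> (U t1 x)) \<partial>lborel)
    \<le> - (\<Sum>i\<in>UNIV. \<integral>z. a i z * (testH' \<alpha> d (u z) * Du i z * indicator {t1<..t2} (snd z)) \<partial>lborel)"
proof -
  note [measurable] = am Dum um
  have d0: "d \<ge> 0" using d by simp
  have p0: "p i > 0" for i using p[of i] by simp
  have H'm[measurable]: "testH' \<alpha> d \<in> borel_measurable borel"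
    unfolding testH'_def[abs_def] eflat_def[abs_def] by measurable
  have Hm[measurable]: "testH \<alpha> d \<in> borel_measurable borel"
    unfolding testH_def[abs_def] eflat_def[abs_def] by measurable
  have em[measurable]: "entr d \<in> borel_measurable borel" unfolding entr_def[abs_def] by measurable
  obtain M where M: "\<And>r. \<bar>testH' \<alpha> d r\<bar> \<le> M" using testH'_bounded[OF \<alpha> d] by blast
  have M0: "M \<ge> 0" using M[of 0] by linarith
  define w where "w t x = - signed_powr \<alpha> (U t x)" for t x
  define E where "E t = (\<integral>x. entr d (w t x) \<partial>lborel)" for t
  have wm[measurable]: "w t \<in> borel_measurable borel" if "t \<in> {0<..<T}" for t
    unfolding w_def using Um[OF that] by measurable
  have wI: "integrable lborel (w t)" if "t \<in> {0<..<T}" for t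
    unfolding w_def[abs_def] using wi[OF that] by simp
  have ei: "integrable lborel (\<lambda>x. entr d (w t x))" if "t \<in> {0<..<T}" for t
  proof (rule Bochner_Integration.integrable_bound[OF wI[OF that]])
    show "(\<lambda>x. entr d (w t x)) \<in> borel_measurable lborel" using wm[OF that] by measurable
    show "AE x in lborel. norm (entr d (w t x)) \<le> norm (w t x)"
      using entr_Lipschitz[OF d0, of _ 0] by (simp add: entr_def)
  qed
  \<comment> \<open>\<open>entr\<close> is 1-Lipschitz, so \<open>E\<close> inherits continuity from
    the signed power.\<close>
  have Ec: "continuous_on {0<..<T} E"
    unfolding continuous_on_def
  proof
    fix t assume t: "t \<in> {0<..<T}"
    have "((\<lambda>s. E s - E t) \<longlongrightarrow> 0) (at t within {0<..<T})"
    proof (rule Lim_null_comparison[OF _ wc[OF t]])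
      show "\<forall>\<^sub>F s in at t within {0<..<T}. norm (E s - E t) \<le> (\<integral>x. \<bar>signed_powr \<alpha> (U s x) - signed_powr \<alpha> (U t x)\<bar> \<partial>lborel)"
        unfolding eventually_at_filter
      proof (rule always_eventually, intro allI impI)
        fix s assume s: "s \<in> {0<..<T}"
        have "\<bar>E s - E t\<bar> = \<bar>\<integral>x. entr d (w s x) - entr d (w t x) \<partial>lborel\<bar>"
          unfolding E_def using ei[OF s] ei[OF t] by simp
        also have "\<dots> \<le> (\<integral>x. \<bar>entr d (w s x) - entr d (w t x)\<bar> \<partial>lborel)" by (rule integral_abs_bound)
        also have "\<dots> \<le> (\<integral>x. \<bar>signed_powr \<alpha> (U s x) - signed_powr \<alpha> (U t x)\<bar> \<partial>lborel)"
        proof (rule integral_mono)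
          show "\<bar>entr d (w s x) - entr d (w t x)\<bar> \<le> \<bar>signed_powr \<alpha> (U s x) - signed_powr \<alpha> (U t x)\<bar>" for x
            using entr_Lipschitz[OF d0, of "w s x" "w t x"] by (simp add: w_def abs_minus_commute)
        qed (use ei[OF s] ei[OF t] wi[OF s] wi[OF t] in auto)
        finally show "norm (E s - E t) \<le> (\<integral>x. \<bar>signed_powr \<alpha> (U s x) - signed_powr \<alpha> (U t x)\<bar> \<partial>lborel)" by simp
      qed
    qed
    then show "(E \<longlongrightarrow> E t) (at t within {0<..<T})" by (simp add: LIM_zero_iff)
  qed
  define G where "G i z = testH' \<alpha> d (u z) * Du i z * indicator {t1<..t2} (snd z)" for i z
  have Gm[measurable]: "G i \<in> borel_measurable borel" for i
  proof -
    have "(\<lambda>z::(real^'n)\<times>real. indicator {t1<..t2} (snd z) :: real) \<in> borel_measurable borel"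
      unfolding borel_prod[symmetric] by measurable
    then show ?thesis unfolding G_def by measurable
  qed
  have Gi: "integrable lborel (\<lambda>z. \<bar>G i z\<bar> powr p i)" for i
  proof (rule Bochner_Integration.integrable_bound)
    show "integrable lborel (\<lambda>z. M powr p i * \<bar>Du i z\<bar> powr p i)" using Dui by simp
    show "AE z in lborel. norm (\<bar>G i z\<bar> powr p i) \<le> norm (M powr p i * \<bar>Du i z\<bar> powr p i)"
    proof (rule AE_I2)
      fix z
      have "\<bar>G i z\<bar> \<le> M * \<bar>Du i z\<bar>"
        unfolding G_def using M[of "u z"] M0
        by (auto simp: abs_mult split: split_indicator intro: mult_right_mono)
      then have "\<bar>G i z\<bar> powr p i \<le> (M * \<bar>Du i z\<bar>) powr p i" using p0[of i] by (intro powr_mono2) auto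
      then show "norm (\<bar>G i z\<bar> powr p i) \<le> norm (M powr p i * \<bar>Du i z\<bar> powr p i)" using M0 by (simp add: powr_mult)
    qed
  qed simp
  \<comment> \<open>\<open>D\<close> pairs the flux, taken \<sigma> earlier, with the truncated
    gradient. The wanted dissipation is \<open>D\<close> at \<sigma> = 0.\<close>
  define D where "D i \<sigma> = (\<integral>z. a i (fst z, snd z - \<sigma>) * G i z \<partial>lborel)" for i \<sigma>
  define L where "L h i t = (\<integral>x. \<integral>\<sigma>. a i (x, t - \<sigma>) * G i (x, t) * indicator {0..<h} \<sigma> \<partial>lborel \<partial>lborel)" for h i t
  have tap: "integrable lborel (L h i)" "integrable lborel (\<lambda>\<sigma>. D i \<sigma> * indicator {0..<h} \<sigma>)"
    "(\<integral>t. L h i t \<partial>lborel) = (\<integral>\<sigma>. D i \<sigma> * indicator {0..<h} \<sigma> \<partial>lborel)" "(D i \<longlongrightarrow> D i 0) (at_right 0)" if "h > 0" for h i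
    using time_average_pairing[OF p am Gm ai Gi that] unfolding D_def[abs_def] L_def[abs_def] by auto
  have L0: "L h i t = 0" if "t \<notin> {t1<..t2}" for h i t using that by (simp add: L_def G_def)
  have step: "E t - E (t - h) \<le> - (\<Sum>i\<in>UNIV. L h i t)"
    if t: "t \<in> {t1<..t2}" and h: "0 < h" "h < t1"
      and ae: "AE x in lborel. u (x, t) = U t x" and Dt: "\<And>i. integrable lborel (\<lambda>x. \<bar>Du i (x, t)\<bar> powr p i)"
      and \<Psi>: "\<And>k. \<Psi> k \<in> test_fun \<Omega>" "\<And>k x. \<bar>\<Psi> k x\<bar> \<le> 1"
        "AE x in lborel. (\<lambda>k. \<Psi> k x) \<longlonglongrightarrow> testH \<alpha> d (u (x, t))"
        "\<And>i. (\<lambda>k. \<integral>x. \<bar>dir_deriv (axis i 1) (\<Psi> k) x - testH' \<alpha> d (u (x, t)) * Du i (x, t)\<bar> powr p i \<partial>lborel) \<longlonglongrightarrow> 0"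
    for t h \<Psi>
  proof -
    define s where "s = t - h"
    have st: "0 < s" "s < t" "t < T" "t - s = h" using t h t12 by (auto simp: s_def)
    have tT: "t \<in> {0<..<T}" "s \<in> {0<..<T}" using st by auto
    have [measurable]: "\<Psi> k \<in> borel_measurable borel" for k by (rule test_fun_measurable[OF \<Psi>(1)])
    have d\<Psi>: "dir_deriv (axis i 1) (\<Psi> k) \<in> test_fun \<Omega>" for i k by (rule test_fun_dir_deriv[OF \<Psi>(1) axis_1_Basis])
    have d\<Psi>m[measurable]: "dir_deriv (axis i 1) (\<Psi> k) \<in> borel_measurable borel" for i k by (rule test_fun_measurable[OF d\<Psi>])
    have sl[measurable]: "(\<lambda>x. u (x, t)) \<in> borel_measurable borel" "(\<lambda>x. Du i (x, t)) \<in> borel_measurable borel" for i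
      by (rule borel_measurable_slice; simp)+
    define g where "g i x = testH' \<alpha> d (u (x, t)) * Du i (x, t)" for i x
    have gm[measurable]: "g i \<in> borel_measurable borel" for i unfolding g_def by measurable
    have gG: "g i x = G i (x, t)" for i x using t by (simp add: g_def G_def)
    have gi: "integrable lborel (\<lambda>x. \<bar>g i x\<bar> powr p i)" for i
    proof (rule Bochner_Integration.integrable_bound)
      show "integrable lborel (\<lambda>x. M powr p i * \<bar>Du i (x, t)\<bar> powr p i)" using Dt by simp
      show "AE x in lborel. norm (\<bar>g i x\<bar> powr p i) \<le> norm (M powr p i * \<bar>Du i (x, t)\<bar> powr p i)"
      proof (rule AE_I2)
        fix x
        have "\<bar>g i x\<bar> powr p i \<le> (M * \<bar>Du i (x, t)\<bar>) powr p i"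
          unfolding g_def abs_mult using p0[of i] M by (intro powr_mono2 mult_right_mono) auto
        then show "norm (\<bar>g i x\<bar> powr p i) \<le> norm (M powr p i * \<bar>Du i (x, t)\<bar> powr p i)" using M0 by (simp add: powr_mult)
      qed
    qed simp
    let ?J = "\<lambda>z::(real^'n)\<times>real. indicator {s<..t} (snd z) :: real"
    have Jm[measurable]: "?J \<in> borel_measurable borel" unfolding borel_prod[symmetric] by measurable
    have fstm[measurable]: "(\<lambda>z::(real^'n)\<times>real. \<phi> (fst z)) \<in> borel_measurable borel" if [measurable]: "\<phi> \<in> borel_measurable borel" for \<phi> :: "real^'n \<Rightarrow> real"
      unfolding borel_prod[symmetric] by measurable
    have pw: "\<bar>\<phi> (fst z) * ?J z\<bar> powr p i = \<bar>\<phi> (fst z)\<bar> powr p i * ?J z" for \<phi> i z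
      using p0[of i] by (auto split: split_indicator)
    have gJi: "integrable lborel (\<lambda>z. \<bar>g i (fst z) * ?J z\<bar> powr p i)" for i
      unfolding pw using integral_prod_indicator(1)[OF gi] st by simp
    have agi: "integrable lborel (\<lambda>z. a i z * (g i (fst z) * ?J z))" for i
      by (rule Young_integral(1)[OF p _ _ ai gJi]) auto
    have dif: "integrable lborel (\<lambda>x. \<bar>dir_deriv (axis i 1) (\<Psi> k) x - g i x\<bar> powr p i)" for i k
      by (rule integrable_powr_abs_diff(1)[OF p0 _ _ test_fun_powr_integrable[OF d\<Psi> p0] gi]) auto
    have lim_a: "(\<lambda>k. \<integral>z. a i z * (dir_deriv (axis i 1) (\<Psi> k) (fst z) * ?J z) \<partial>lborel) \<longlonglongrightarrow>
        (\<integral>z. a i z * (g i (fst z) * ?J z) \<partial>lborel)" for i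
    proof -
      have e1: "\<bar>(dir_deriv (axis i 1) (\<Psi> k) (fst z) - g i (fst z)) * ?J z\<bar> powr p i
          = \<bar>dir_deriv (axis i 1) (\<Psi> k) (fst z) - g i (fst z)\<bar> powr p i * ?J z" for k z
        by (rule pw[of "\<lambda>x. dir_deriv (axis i 1) (\<Psi> k) x - g i x"])
      have i1: "integrable lborel (\<lambda>z. \<bar>(dir_deriv (axis i 1) (\<Psi> k) (fst z) - g i (fst z)) * ?J z\<bar> powr p i)" for k
        unfolding e1 using integral_prod_indicator(1)[OF dif] st by simp
      have "(\<integral>z. \<bar>(dir_deriv (axis i 1) (\<Psi> k) (fst z) - g i (fst z)) * ?J z\<bar> powr p i \<partial>lborel)
          = (t - s) * (\<integral>x. \<bar>dir_deriv (axis i 1) (\<Psi> k) x - g i x\<bar> powr p i \<partial>lborel)" for k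
        unfolding e1 using integral_prod_indicator(2)[OF dif] st by simp
      moreover have "(\<lambda>k. (t - s) * (\<integral>x. \<bar>dir_deriv (axis i 1) (\<Psi> k) x - g i x\<bar> powr p i \<partial>lborel)) \<longlonglongrightarrow> (t - s) * 0"
        unfolding g_def by (intro tendsto_mult tendsto_const \<Psi>(4))
      ultimately have i2: "(\<lambda>k. \<integral>z. \<bar>(dir_deriv (axis i 1) (\<Psi> k) (fst z) - g i (fst z)) * ?J z\<bar> powr p i \<partial>lborel) \<longlonglongrightarrow> 0" by simp
      have i3: "(\<lambda>k. \<integral>z. a i z * ((dir_deriv (axis i 1) (\<Psi> k) (fst z) - g i (fst z)) * ?J z) \<partial>lborel) \<longlonglongrightarrow> 0"
        by (rule tendsto_Lp_pairing_0[OF p _ _ ai _ i2]) (use i1 in auto)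
      have i4: "integrable lborel (\<lambda>z. a i z * ((dir_deriv (axis i 1) (\<Psi> k) (fst z) - g i (fst z)) * ?J z))" for k
        by (rule Young_integral(1)[OF p _ _ ai i1]) auto
      have "(\<integral>z. a i z * (dir_deriv (axis i 1) (\<Psi> k) (fst z) * ?J z) \<partial>lborel) =
         (\<integral>z. a i z * ((dir_deriv (axis i 1) (\<Psi> k) (fst z) - g i (fst z)) * ?J z) \<partial>lborel) + (\<integral>z. a i z * (g i (fst z) * ?J z) \<partial>lborel)" for k
        by (subst Bochner_Integration.integral_add[symmetric, OF i4 agi])
           (rule Bochner_Integration.integral_cong, simp_all add: algebra_simps)
      then show ?thesis using tendsto_add[OF i3 tendsto_const, of "\<integral>z. a i z * (g i (fst z) * ?J z) \<partial>lborel"] by simp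
    qed
    \<comment> \<open>Substituting \<tau> = t - \<sigma> turns (s, t] into [0, h); hence the
      opposite choice of closed endpoints.\<close>
    have aL: "(\<integral>z. a i z * (g i (fst z) * ?J z) \<partial>lborel) = L h i t" for i
    proof -
      have "(\<integral>z. a i z * (g i (fst z) * ?J z) \<partial>lborel) = (\<integral>x. \<integral>\<tau>. a i (x, \<tau>) * (g i x * indicator {s<..t} \<tau>) \<partial>lborel \<partial>lborel)"
        using lborel_pair.integral_fst'[of "\<lambda>z. a i z * (g i (fst z) * ?J z)"] agi by (simp add: lborel_prod)
      also have "\<dots> = (\<integral>x. \<integral>\<sigma>. a i (x, t - \<sigma>) * (g i x * indicator {s<..t} (t - \<sigma>)) \<partial>lborel \<partial>lborel)"
        by (subst integral_real_reflect_translate[symmetric, where t=t]) simp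
      also have "\<dots> = L h i t"
        unfolding L_def gG[symmetric] using st
        by (intro Bochner_Integration.integral_cong refl) (auto split: split_indicator)
      finally show ?thesis .
    qed
    have ae2: "AE x in lborel. (\<lambda>k. \<Psi> k x) \<longlonglongrightarrow> testH \<alpha> d (U t x)"
      using \<Psi>(3) ae by eventually_elim simp
    have conv: "(\<lambda>k. \<integral>x. y x * \<Psi> k x \<partial>lborel) \<longlonglongrightarrow> (\<integral>x. y x * testH \<alpha> d (U t x) \<partial>lborel)" if y: "integrable lborel y" for y
    proof (rule integral_dominated_convergence[where w="\<lambda>x. \<bar>y x\<bar>"])
      have [measurable]: "y \<in> borel_measurable borel" "U t \<in> borel_measurable borel" using y Um[OF tT(1)] by auto
      show "(\<lambda>x. y x * testH \<alpha> d (U t x)) \<in> borel_measurable lborel" "(\<lambda>x. y x * \<Psi> k x) \<in> borel_measurable lborel" for k by simp_all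
      show "AE x in lborel. (\<lambda>k. y x * \<Psi> k x) \<longlonglongrightarrow> y x * testH \<alpha> d (U t x)"
        using ae2 by eventually_elim (intro tendsto_intros)
      show "AE x in lborel. norm (y x * \<Psi> k x) \<le> \<bar>y x\<bar>" for k
        using \<Psi>(2) by (intro AE_I2) (auto simp: abs_mult intro!: mult_left_le)
    qed (use y in auto)
    have wd: "integrable lborel (\<lambda>x. signed_powr \<alpha> (U t x) - signed_powr \<alpha> (U s x))" using wi[OF tT(1)] wi[OF tT(2)] by simp
    have R: "(\<lambda>k. (t - s) * (\<integral>x. f x * \<Psi> k x \<partial>lborel)
        - (\<Sum>i\<in>UNIV. \<integral>z. a i z * (dir_deriv (axis i 1) (\<Psi> k) (fst z) * ?J z) \<partial>lborel)) \<longlonglongrightarrow>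
        (t - s) * (\<integral>x. f x * testH \<alpha> d (U t x) \<partial>lborel) - (\<Sum>i\<in>UNIV. L h i t)"
      using lim_a unfolding aL by (intro tendsto_diff tendsto_mult tendsto_const conv fi tendsto_sum)
    have "(\<integral>x. (signed_powr \<alpha> (U t x) - signed_powr \<alpha> (U s x)) * testH \<alpha> d (U t x) \<partial>lborel)
        = (t - s) * (\<integral>x. f x * testH \<alpha> d (U t x) \<partial>lborel) - (\<Sum>i\<in>UNIV. L h i t)"
      using conv[OF wd] R unfolding eq[OF \<Psi>(1) st(1-3)] by (rule LIMSEQ_unique)
    \<comment> \<open>The source enters with the favourable sign, since \<open>f\<close> is
      nonnegative and \<open>testH\<close> nonpositive.\<close>
    moreover have "(\<integral>x. f x * testH \<alpha> d (U t x) \<partial>lborel) \<le> 0"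
    proof -
      have "0 \<le> (\<integral>x. - (f x * testH \<alpha> d (U t x)) \<partial>lborel)"
      proof (rule integral_nonneg_AE)
        show "AE x in lborel. 0 \<le> - (f x * testH \<alpha> d (U t x))"
          using f0 by eventually_elim (use testH_bounds(1)[OF d0] in \<open>simp add: mult_nonneg_nonpos\<close>)
      qed
      then show ?thesis by simp
    qed
    then have "(t - s) * (\<integral>x. f x * testH \<alpha> d (U t x) \<partial>lborel) \<le> 0" using st by (simp add: mult_nonneg_nonpos)
    \<comment> \<open>The supporting line is taken at the later time, where the test function is
      evaluated.\<close>
    moreover have "E t - E s \<le> (\<integral>x. (signed_powr \<alpha> (U t x) - signed_powr \<alpha> (U s x)) * testH \<alpha> d (U t x) \<partial>lborel)"
    proof -
      have "E t - E s = (\<integral>x. entr d (w t x) - entr d (w s x) \<partial>lborel)" unfolding E_def using ei tT by simp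
      also have "\<dots> \<le> (\<integral>x. (signed_powr \<alpha> (U t x) - signed_powr \<alpha> (U s x)) * testH \<alpha> d (U t x) \<partial>lborel)"
      proof (rule integral_mono)
        show "integrable lborel (\<lambda>x. entr d (w t x) - entr d (w s x))" using ei tT by simp
        show "integrable lborel (\<lambda>x. (signed_powr \<alpha> (U t x) - signed_powr \<alpha> (U s x)) * testH \<alpha> d (U t x))"
        proof (rule Bochner_Integration.integrable_bound[OF wd])
          have [measurable]: "U t \<in> borel_measurable borel" "U s \<in> borel_measurable borel" using Um tT by auto
          show "(\<lambda>x. (signed_powr \<alpha> (U t x) - signed_powr \<alpha> (U s x)) * testH \<alpha> d (U t x)) \<in> borel_measurable lborel" by simp
          show "AE x in lborel. norm ((signed_powr \<alpha> (U t x) - signed_powr \<alpha> (U s x)) * testH \<alpha> d (U t x)) \<le> norm (signed_powr \<alpha> (U t x) - signed_powr \<alpha> (U s x))"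
            using testH_bounds(2)[OF d0] by (intro AE_I2) (auto simp: abs_mult intro!: mult_left_le)
        qed
        fix x
        have "entr d (w t x) - entr d (w s x) \<le> entr' d (w t x) * (w t x - w s x)" by (rule entr_convex[OF d0])
        also have "entr' d (w t x) = - testH \<alpha> d (U t x)" by (simp add: testH_eq_entr' w_def)
        finally show "entr d (w t x) - entr d (w s x) \<le> (signed_powr \<alpha> (U t x) - signed_powr \<alpha> (U s x)) * testH \<alpha> d (U t x)"
          by (simp add: w_def algebra_simps)
      qed
      finally show ?thesis .
    qed
    ultimately show ?thesis unfolding s_def by linarith
  qed
  have "E t2 - E t1 \<le> - (\<Sum>i\<in>UNIV. D i 0)"
  proof (rule increment_le_from_averages[OF Ec t12, of "\<lambda>\<sigma>. \<Sum>i\<in>UNIV. D i \<sigma>"])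
    show "((\<lambda>\<sigma>. \<Sum>i\<in>UNIV. D i \<sigma>) \<longlongrightarrow> (\<Sum>i\<in>UNIV. D i 0)) (at_right 0)"
      using tap(4)[OF zero_less_one] by (intro tendsto_sum)
    fix h :: real assume h: "0 < h" "h < t1"
    show "integrable lborel (\<lambda>\<sigma>. (\<Sum>i\<in>UNIV. D i \<sigma>) * indicator {0..<h} \<sigma>)"
      unfolding sum_distrib_right using tap(2)[OF h(1)] by (intro Bochner_Integration.integrable_sum)
    have sumL: "(\<integral>t. (\<Sum>i\<in>UNIV. L h i t) \<partial>lborel) = (\<integral>\<sigma>. (\<Sum>i\<in>UNIV. D i \<sigma>) * indicator {0..<h} \<sigma> \<partial>lborel)"
    proof -
      have "(\<integral>t. (\<Sum>i\<in>UNIV. L h i t) \<partial>lborel) = (\<Sum>i\<in>UNIV. \<integral>t. L h i t \<partial>lborel)"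
        by (rule Bochner_Integration.integral_sum) (rule tap(1)[OF h(1)])
      also have "\<dots> = (\<Sum>i\<in>UNIV. \<integral>\<sigma>. D i \<sigma> * indicator {0..<h} \<sigma> \<partial>lborel)" by (simp only: tap(3)[OF h(1)])
      also have "\<dots> = (\<integral>\<sigma>. (\<Sum>i\<in>UNIV. D i \<sigma> * indicator {0..<h} \<sigma>) \<partial>lborel)"
        by (rule Bochner_Integration.integral_sum[symmetric]) (rule tap(2)[OF h(1)])
      finally show ?thesis by (simp only: sum_distrib_right)
    qed
    have cE: "continuous_on {t1..t2} (\<lambda>t. E t - E (t - h))"
    proof (rule continuous_on_diff)
      show "continuous_on {t1..t2} E" using t12 by (intro continuous_on_subset[OF Ec]) auto
      show "continuous_on {t1..t2} (\<lambda>t. E (t - h))"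
        using t12 h by (intro continuous_on_compose2[OF Ec]) (auto intro!: continuous_intros)
    qed
    have si: "set_integrable lborel {t1..t2} (\<lambda>t. E t - E (t - h))"
      using cE by (rule borel_integrable_atLeastAtMost')
    have "integral {t1..t2} (\<lambda>t. E t - E (t - h)) = (LINT t:{t1..t2}|lborel. E t - E (t - h))"
      by (rule set_borel_integral_eq_integral(2)[OF si, symmetric])
    also have "\<dots> = (\<integral>t. indicator {t1..t2} t * (E t - E (t - h)) \<partial>lborel)" by (simp add: set_lebesgue_integral_def)
    also have "\<dots> \<le> (\<integral>t. - (\<Sum>i\<in>UNIV. L h i t) \<partial>lborel)"
    proof (rule integral_mono_AE)
      show "integrable lborel (\<lambda>t. indicator {t1..t2} t * (E t - E (t - h)))" using si by (simp add: set_integrable_def)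
      show "integrable lborel (\<lambda>t. - (\<Sum>i\<in>UNIV. L h i t))" using tap(1)[OF h(1)] by simp
      \<comment> \<open>\<open>L\<close> vanishes at \<open>t1\<close> while the left side need not;
        one point is negligible.\<close>
      show "AE t in lborel. indicator {t1..t2} t * (E t - E (t - h)) \<le> - (\<Sum>i\<in>UNIV. L h i t)"
        using good AE_lborel_singleton[of t1]
      proof eventually_elim
        case (elim t)
        show ?case
        proof (cases "t \<in> {t1<..t2}")
          case True
          then have "t \<in> {0<..<T}" using t12 by auto
          with elim(1) obtain \<Psi> where "AE x in lborel. u (x, t) = U t x" "\<And>i. integrable lborel (\<lambda>x. \<bar>Du i (x, t)\<bar> powr p i)"
            "\<And>k. \<Psi> k \<in> test_fun \<Omega>" "\<And>k x. \<bar>\<Psi> k x\<bar> \<le> 1"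
            "AE x in lborel. (\<lambda>k. \<Psi> k x) \<longlonglongrightarrow> testH \<alpha> d (u (x, t))"
            "\<And>i. (\<lambda>k. \<integral>x. \<bar>dir_deriv (axis i 1) (\<Psi> k) x - testH' \<alpha> d (u (x, t)) * Du i (x, t)\<bar> powr p i \<partial>lborel) \<longlonglongrightarrow> 0"
            by blast
          from step[OF True h this] True show ?thesis by simp
        next
          case False
          then show ?thesis using elim(2) L0[OF False] by auto
        qed
      qed
    qed
    finally show "integral {t1..t2} (\<lambda>t. E t - E (t - h)) \<le> - (\<integral>\<sigma>. (\<Sum>i\<in>UNIV. D i \<sigma>) * indicator {0..<h} \<sigma> \<partial>lborel)"
      by (simp add: sumL)
  qed
  then show ?thesis by (simp add: E_def w_def D_def G_def)
qed

section \<open>The equation in terms of Borel representatives\<close>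

text \<open>\<open>brep U h h\<close> expresses that \<open>h\<close> is Borel and vanishes outside
  \<open>U\<close>. One family \<open>dv\<close> serves as weak derivative on the cylinder and,
  slice by slice, in space.\<close>

lemma LpW_repr:
  fixes \<Omega> :: "(real^'n) set" and p :: "'n \<Rightarrow> real"
  assumes \<Omega>: "open \<Omega>" "bounded \<Omega>" and p: "\<And>i. p i > 1" and v: "v \<in> LpW p \<Omega> T"
  shows "\<exists>v' dv. brep (\<Omega> \<times> {0<..<T}) v v' \<and> (\<forall>i. brep (\<Omega> \<times> {0<..<T}) (dv i) (dv i)) \<and>
    (\<forall>i. integrable lborel (\<lambda>z. \<bar>dv i z\<bar> powr p i)) \<and>
    (\<forall>i. has_weak_deriv (\<Omega> \<times> {0<..<T}) (axis i 1, 0) v (dv i)) \<and>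
    (AE t in lborel. t \<in> {0<..<T} \<longrightarrow> brep \<Omega> (slice v t) (slice v' t) \<and> integrable lborel (slice v' t) \<and>
      (\<forall>i. has_weak_deriv \<Omega> (axis i 1) (slice v t) (slice (dv i) t) \<and> integrable lborel (\<lambda>x. \<bar>dv i (x, t)\<bar> powr p i)))"
proof -
  let ?S = "{0<..<T}" and ?Q = "\<Omega> \<times> {0<..<T}"
  have Q: "open ?Q" "bounded ?Q" using \<Omega> by (auto intro: open_Times bounded_Times)
  have Qb: "?Q \<in> sets borel" and \<Omega>b: "\<Omega> \<in> sets borel" and Sb: "?S \<in> sets borel" using Q \<Omega> by auto
  have vm: "v \<in> borel_measurable (lebesgue_on ?Q)"
    and vb: "slice v \<in> bochner_L 1 T (W11 \<Omega>) (W11_norm \<Omega>)"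
    and vh: "\<forall>i. \<exists>h\<in>Lsp (p i) ?Q. has_weak_deriv ?Q (axis i 1, 0) v h"
    using v by (auto simp: LpW_def cyl_def)
  obtain v' where v': "brep ?Q v v'" using brep_exists[OF Qb vm] by blast
  obtain h where h: "\<And>i. h i \<in> Lsp (p i) ?Q" "\<And>i. has_weak_deriv ?Q (axis i 1, 0) v (h i)" using vh by metis
  have "\<forall>i. \<exists>h'. brep ?Q (h i) h'" using h(1) by (intro allI brep_exists[OF Qb]) (auto simp: Lsp_def)
  then obtain dv where dv: "\<And>i. brep ?Q (h i) (dv i)" by metis
  have dvi: "integrable lborel (\<lambda>z. \<bar>dv i z\<bar> powr p i)" for i using brep_Lsp_iff[OF Qb dv] h(1) by blast
  have dvb: "brep ?Q (dv i) (dv i)" for i using dv[of i] by (auto simp: brep_def)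
  have wd: "has_weak_deriv ?Q (axis i 1, 0) v (dv i)" for i
  proof (rule has_weak_deriv_cong[OF Q(1) h(2)])
    show "AE x in lebesgue_on ?Q. h i x = dv i x" using brep_AE[OF dv] by (simp add: AE_lebesgue_on_iff[OF Qb])
  qed
  have dv1: "integrable lborel (dv i)" for i
    using p[of i] brep_outside[OF dv] by (intro integrable_if_Lp_bounded_support[OF _ Q(2) Qb brep_measurable[OF dv] dvi]) auto
  have W: "AE t in lborel. t \<in> ?S \<longrightarrow> slice v t \<in> W11 \<Omega>"
    using vb unfolding bochner_L_def bochner_measurable_def by (simp add: AE_lebesgue_on_iff[OF Sb])
  have sl: "AE t in lborel. \<forall>i\<in>UNIV. t \<in> ?S \<longrightarrow> has_weak_deriv \<Omega> (axis i 1) (slice v t) (slice (dv i) t)"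
  proof (subst AE_ball_countable, simp add: countable_finite, rule ballI)
    fix i
    have "AE t in lborel. t \<in> ?S \<longrightarrow> (\<exists>w. has_weak_deriv \<Omega> (axis i 1) (slice v t) w)"
      using W by eventually_elim (auto simp: W11_def)
    then show "AE t in lborel. t \<in> ?S \<longrightarrow> has_weak_deriv \<Omega> (axis i 1) (slice v t) (slice (dv i) t)"
      by (rule slice_weak_deriv[OF \<Omega>(1) v' dvb dv1 wd axis_1_Basis])
  qed
  have di: "AE t in lborel. \<forall>i\<in>UNIV. integrable lborel (\<lambda>x. \<bar>dv i (x, t)\<bar> powr p i)"
    using lborel_fubini(1)[OF dvi] by (subst AE_ball_countable) (auto simp: countable_finite)
  have "AE t in lborel. t \<in> ?S \<longrightarrow> brep \<Omega> (slice v t) (slice v' t) \<and> integrable lborel (slice v' t) \<and>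
      (\<forall>i. has_weak_deriv \<Omega> (axis i 1) (slice v t) (slice (dv i) t) \<and> integrable lborel (\<lambda>x. \<bar>dv i (x, t)\<bar> powr p i))"
    using W sl di brep_slice[OF v']
  proof eventually_elim
    case (elim t)
    show ?case
    proof
      assume t: "t \<in> ?S"
      have r: "brep \<Omega> (slice v t) (slice v' t)" using elim(4) t by blast
      have "slice v t \<in> Lsp 1 \<Omega>" using elim(1) t by (auto simp: W11_def)
      then have "integrable lborel (\<lambda>x. \<bar>slice v' t x\<bar>)" using brep_Lsp_iff[OF \<Omega>b r, of 1] by simp
      then have "integrable lborel (slice v' t)"
        using brep_measurable[OF r] by (subst (asm) integrable_abs_iff) auto
      with r elim(2,3) t show "brep \<Omega> (slice v t) (slice v' t) \<and> integrable lborel (slice v' t) \<and>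
      (\<forall>i. has_weak_deriv \<Omega> (axis i 1) (slice v t) (slice (dv i) t) \<and> integrable lborel (\<lambda>x. \<bar>dv i (x, t)\<bar> powr p i))"
        by blast
    qed
  qed
  with v' dvb dvi wd show ?thesis by blast
qed

lemma AE_cyl_fst:
  assumes \<Omega>: "\<Omega> \<in> sets borel" and P: "AE x in lebesgue_on \<Omega>. P x"
  shows "AE z in (lborel :: ('a::euclidean_space \<times> real) measure). z \<in> \<Omega> \<times> S \<longrightarrow> P (fst z)"
  using AE_lborel_fst[OF P[unfolded AE_lebesgue_on_iff[OF \<Omega>]]] by eventually_elim auto

text \<open>Raising the growth bound to the conjugate exponent p/(p-1) cancels the exponent (p-1)/p
  and leaves the integrable function \<Sum> |Du|^p + b.\<close>

lemma flux_repr: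
  fixes \<Omega> :: "(real^'n) set" and p :: "'n \<Rightarrow> real" and Du :: "'n \<Rightarrow> (real^'n) \<times> real \<Rightarrow> real"
  assumes \<Omega>: "open \<Omega>" and p: "\<And>i. p i > 1" and A: "caratheodory \<Omega> A" and \<Lambda>: "\<Lambda> > 0"
    and b: "b \<in> Lsp 1 \<Omega>" "AE x in lebesgue_on \<Omega>. b x \<ge> 0"
    and growth: "AE x in lebesgue_on \<Omega>. \<forall>v \<xi> i.
      \<bar>A x v \<xi> $ i\<bar> \<le> \<Lambda> * ((\<Sum>k\<in>UNIV. \<bar>\<xi> $ k\<bar> powr p k) + b x) powr ((p i - 1) / p i)"
    and u: "u \<in> borel_measurable borel" and Du: "\<And>i. Du i \<in> borel_measurable borel"
    and Dui: "\<And>i. integrable lborel (\<lambda>z. \<bar>Du i z\<bar> powr p i)"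
    and T: "T > 0"
  shows "\<exists>a. (\<forall>i. brep (\<Omega> \<times> {0<..<T}) (\<lambda>z. A (fst z) (u z) (\<chi> k. Du k z) $ i) (a i)) \<and>
    (\<forall>i. integrable lborel (\<lambda>z. \<bar>a i z\<bar> powr (p i / (p i - 1))))"
proof -
  let ?Q = "\<Omega> \<times> {0<..<T}"
  have \<Omega>b: "\<Omega> \<in> sets borel" using \<Omega> by simp
  have wm: "(\<lambda>z. \<chi> k. Du k z) \<in> borel_measurable borel"
    by (subst borel_measurable_euclidean_space) (auto simp: Basis_vec_def inner_axis Du)
  have "\<exists>a. brep ?Q (\<lambda>z. A (fst z) (u z) (\<chi> k. Du k z) $ i) a" for i
    by (rule caratheodory_brep[OF \<Omega> _ A u wm]) simp
  then have "\<forall>i. \<exists>a. brep ?Q (\<lambda>z. A (fst z) (u z) (\<chi> k. Du k z) $ i) a" by blast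
  from choice[OF this] obtain a where a: "\<And>i. brep ?Q (\<lambda>z. A (fst z) (u z) (\<chi> k. Du k z) $ i) (a i)" by blast
  have [measurable]: "a i \<in> borel_measurable borel" for i using a by (rule brep_measurable)
  obtain b' where b': "brep \<Omega> b b'" using brep_exists[OF \<Omega>b] b(1) by (auto simp: Lsp_def)
  have b'i: "integrable lborel b'"
    using brep_Lsp_iff[OF \<Omega>b b', of 1] b(1) brep_measurable[OF b'] by (simp add: integrable_abs_iff)
  \<comment> \<open>The bound is independent of time, so a bounded time interval must be attached to
    it. On the cylinder the indicator of (0, T] is 1.\<close>
  have bi: "integrable lborel (\<lambda>z. b' (fst z) * indicator {0<..T} (snd z))"
    using integral_prod_indicator(1)[OF b'i, of 0 T] T by simp
  have bb: "AE x in lebesgue_on \<Omega>. b x = b' x" using brep_AE[OF b'] by (simp add: AE_lebesgue_on_iff[OF \<Omega>b])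
  have "integrable lborel (\<lambda>z. \<bar>a i z\<bar> powr (p i / (p i - 1)))" for i
  proof (rule Bochner_Integration.integrable_bound)
    define q where "q = p i / (p i - 1)"
    have q: "q > 0" "(p i - 1) / p i * q = 1" using p[of i] by (auto simp: q_def)
    show "integrable lborel (\<lambda>z. \<Lambda> powr (p i / (p i - 1)) * ((\<Sum>k\<in>UNIV. \<bar>Du k z\<bar> powr p k) + b' (fst z) * indicator {0<..T} (snd z)))"
      using Dui bi by simp
    show "AE z in lborel. norm (\<bar>a i z\<bar> powr (p i / (p i - 1))) \<le> norm (\<Lambda> powr (p i / (p i - 1)) * ((\<Sum>k\<in>UNIV. \<bar>Du k z\<bar> powr p k) + b' (fst z) * indicator {0<..T} (snd z)))"
      using brep_AE[OF a[of i]] AE_cyl_fst[OF \<Omega>b growth, of "{0<..<T}"] AE_cyl_fst[OF \<Omega>b b(2), of "{0<..<T}"] AE_cyl_fst[OF \<Omega>b bb, of "{0<..<T}"]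
    proof eventually_elim
      case (elim z)
      show ?case
      proof (cases "z \<in> ?Q")
        case True
        define X where "X = (\<Sum>k\<in>UNIV. \<bar>Du k z\<bar> powr p k) + b (fst z)"
        have X: "X \<ge> 0" using elim(3) True by (auto simp: X_def intro!: add_nonneg_nonneg sum_nonneg)
        have "\<bar>A (fst z) (u z) (\<chi> k. Du k z) $ i\<bar> \<le> \<Lambda> * ((\<Sum>k\<in>UNIV. \<bar>(\<chi> k. Du k z) $ k\<bar> powr p k) + b (fst z)) powr ((p i - 1) / p i)"
          using elim(2) True by blast
        then have "\<bar>a i z\<bar> \<le> \<Lambda> * X powr ((p i - 1) / p i)" using elim(1) True by (simp add: X_def)
        then have "\<bar>a i z\<bar> powr q \<le> (\<Lambda> * X powr ((p i - 1) / p i)) powr q" using q(1) by (intro powr_mono2) auto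
        also have "\<dots> = \<Lambda> powr q * (X powr ((p i - 1) / p i)) powr q" by (rule powr_mult)
        also have "(X powr ((p i - 1) / p i)) powr q = X" using X q(2) by (simp add: powr_powr)
        finally have "\<bar>a i z\<bar> powr q \<le> \<Lambda> powr q * X" .
        moreover have "X = (\<Sum>k\<in>UNIV. \<bar>Du k z\<bar> powr p k) + b' (fst z) * indicator {0<..T} (snd z)"
          using elim(4) True by (cases z) (auto simp: X_def)
        ultimately show ?thesis by (simp add: q_def)
      next
        case False
        then show ?thesis using brep_outside[OF a[of i] False] by simp
      qed
    qed
  qed simp
  with a show ?thesis by blast
qed

text \<open>Monotonicity compares the gradient with 0, which leaves the flux at gradient 0. There
  the weight in the Lipschitz condition reduces to a power of \<open>c\<close>, so the error is only
  linear in the gradient and can be paired by Young's inequality.\<close>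

lemma flux_sign:
  fixes \<Omega> :: "(real^'n) set" and p :: "'n \<Rightarrow> real" and S :: "real set"
  assumes \<Omega>b: "\<Omega> \<in> sets borel"
    and lipschitz: "AE x in lebesgue_on \<Omega>. \<forall>v\<^sub>1 v\<^sub>2 \<xi> i.
      \<bar>A x v\<^sub>1 \<xi> $ i - A x v\<^sub>2 \<xi> $ i\<bar>
        \<le> C * \<bar>v\<^sub>1 - v\<^sub>2\<bar> * (c x + (\<Sum>k\<in>UNIV. \<bar>\<xi> $ k\<bar> powr p k)) powr ((p i - 1) / p i)"
    and monotone: "AE x in lebesgue_on \<Omega>. \<forall>v \<xi> \<eta>. (A x v \<xi> - A x v \<eta>) \<bullet> (\<xi> - \<eta>) \<ge> 0"
    and A0: "AE x in lebesgue_on \<Omega>. A x 0 0 = 0"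
    and c: "brep \<Omega> c c'"
    and a: "\<And>i. brep (\<Omega> \<times> S) (\<lambda>z. A (fst z) (u z) (\<chi> k. Du k z) $ i) (a i)"
  shows "AE z in lborel. z \<in> \<Omega> \<times> S \<longrightarrow>
     (\<Sum>i\<in>UNIV. a i z * Du i z) \<ge> - (\<bar>u z\<bar> * (C * (\<Sum>i\<in>UNIV. c' (fst z) powr ((p i - 1) / p i) * \<bar>Du i z\<bar>)))"
proof -
  have "AE z in lborel. \<forall>i\<in>UNIV. z \<in> \<Omega> \<times> S \<longrightarrow> A (fst z) (u z) (\<chi> k. Du k z) $ i = a i z"
    using brep_AE[OF a] by (subst AE_ball_countable) (auto simp: countable_finite)
  moreover have "AE x in lebesgue_on \<Omega>. c x = c' x" using brep_AE[OF c] by (simp add: AE_lebesgue_on_iff[OF \<Omega>b])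
  from AE_cyl_fst[OF \<Omega>b this, of S] have "AE z in lborel. z \<in> \<Omega> \<times> S \<longrightarrow> c (fst z) = c' (fst z)" .
  ultimately show ?thesis
    using AE_cyl_fst[OF \<Omega>b lipschitz, of S] AE_cyl_fst[OF \<Omega>b monotone, of S] AE_cyl_fst[OF \<Omega>b A0, of S]
  proof eventually_elim
    case (elim z)
    show ?case
    proof
      assume z: "z \<in> \<Omega> \<times> S"
      define x where "x = fst z"
      define \<xi> where "\<xi> = (\<chi> k. Du k z)"
      have "(A x (u z) \<xi> - A x (u z) 0) \<bullet> (\<xi> - 0) \<ge> 0" using elim(4) z unfolding x_def by blast
      then have 1: "A x (u z) \<xi> \<bullet> \<xi> \<ge> A x (u z) 0 \<bullet> \<xi>" by (simp add: inner_diff_left)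
      have 2: "A x (u z) \<xi> \<bullet> \<xi> = (\<Sum>i\<in>UNIV. a i z * Du i z)"
        using elim(1) z by (simp add: inner_vec_def x_def \<xi>_def)
      have "\<bar>A x (u z) 0 \<bullet> \<xi>\<bar> \<le> (\<Sum>i\<in>UNIV. \<bar>A x (u z) 0 $ i * Du i z\<bar>)"
        by (simp add: inner_vec_def \<xi>_def sum_abs)
      also have "\<dots> \<le> (\<Sum>i\<in>UNIV. C * \<bar>u z\<bar> * c' x powr ((p i - 1) / p i) * \<bar>Du i z\<bar>)"
      proof (rule sum_mono)
        fix i
        have "\<bar>A x (u z) 0 $ i - A x 0 0 $ i\<bar> \<le> C * \<bar>u z - 0\<bar> * (c x + (\<Sum>k\<in>UNIV. \<bar>(0::real^'n) $ k\<bar> powr p k)) powr ((p i - 1) / p i)"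
          using elim(3) z unfolding x_def by blast
        then have "\<bar>A x (u z) 0 $ i\<bar> \<le> C * \<bar>u z\<bar> * c' x powr ((p i - 1) / p i)"
          using elim(2,5) z by (simp add: x_def)
        then show "\<bar>A x (u z) 0 $ i * Du i z\<bar> \<le> C * \<bar>u z\<bar> * c' x powr ((p i - 1) / p i) * \<bar>Du i z\<bar>"
          unfolding abs_mult by (rule mult_right_mono) simp
      qed
      also have "\<dots> = \<bar>u z\<bar> * (C * (\<Sum>i\<in>UNIV. c' x powr ((p i - 1) / p i) * \<bar>Du i z\<bar>))"
        unfolding sum_distrib_left by (intro sum.cong) auto
      finally show "(\<Sum>i\<in>UNIV. a i z * Du i z) \<ge> - (\<bar>u z\<bar> * (C * (\<Sum>i\<in>UNIV. c' (fst z) powr ((p i - 1) / p i) * \<bar>Du i z\<bar>)))"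
        using 1 2 unfolding x_def by linarith
    qed
  qed
qed

section \<open>From the weak formulation to increments in time\<close>

lemma Lnorm_tendsto_imp:
  assumes U: "U \<in> sets borel" and q: "q > 0"
    and r: "eventually (\<lambda>s. brep U (g s) (g' s)) F" and f: "brep U f f'"
    and lim: "((\<lambda>s. Lnorm q U (\<lambda>x. g s x - f x)) \<longlongrightarrow> 0) F"
  shows "((\<lambda>s. \<integral>x. \<bar>g' s x - f' x\<bar> powr q \<partial>lborel) \<longlongrightarrow> 0) F"
proof -
  have "((\<lambda>s. Lnorm q U (\<lambda>x. g s x - f x) powr q) \<longlongrightarrow> 0 powr q) F"
    using q by (intro tendsto_powr'[OF lim tendsto_const]) (auto simp: Lnorm_def)
  then have "((\<lambda>s. Lnorm q U (\<lambda>x. g s x - f x) powr q) \<longlongrightarrow> 0) F" by simp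
  moreover have "eventually (\<lambda>s. Lnorm q U (\<lambda>x. g s x - f x) powr q = (\<integral>x. \<bar>g' s x - f' x\<bar> powr q \<partial>lborel)) F"
    using r
  proof eventually_elim
    case (elim s)
    have "(\<integral>x. \<bar>g s x - f x\<bar> powr q \<partial>lebesgue_on U) = (\<integral>x. \<bar>g' s x - f' x\<bar> powr q \<partial>lborel)"
      using brep_integrable_iff(2)[OF U brep_comp[OF brep_diff[OF elim f], of "\<lambda>y. \<bar>y\<bar> powr q"]] by simp
    then show ?case using q by (simp add: Lnorm_def powr_powr)
  qed
  ultimately show ?thesis by (rule Lim_transform_eventually)
qed

lemma integrable_mult_bounded:
  fixes f g :: "'a \<Rightarrow> real"
  assumes f: "integrable M f" and g: "g \<in> borel_measurable M" and b: "\<And>x. \<bar>g x\<bar> \<le> B"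
  shows "integrable M (\<lambda>x. f x * g x)"
proof (rule Bochner_Integration.integrable_bound)
  show "integrable M (\<lambda>x. B * f x)" using f by simp
  show "AE x in M. norm (f x * g x) \<le> norm (B * f x)"
  proof (rule AE_I2)
    fix x
    have "\<bar>f x\<bar> * \<bar>g x\<bar> \<le> \<bar>f x\<bar> * \<bar>B\<bar>" using order_trans[OF b[of x] abs_ge_self] by (intro mult_left_mono) auto
    then show "norm (f x * g x) \<le> norm (B * f x)" by (simp add: abs_mult mult.commute)
  qed
qed (use f g in auto)

text \<open>With product test functions the equation states that the pairing of the signed power
  with \<psi> has an integrable weak derivative in time. Its continuous version, taken from
  \<open>U\<close>, then has increments equal to integrals of this derivative.\<close>

lemma weak_increment:
  fixes \<Omega> :: "(real^'n) set" and a :: "'n \<Rightarrow> (real^'n) \<times> real \<Rightarrow> real"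
    and u :: "(real^'n) \<times> real \<Rightarrow> real" and U :: "real \<Rightarrow> real^'n \<Rightarrow> real" and f :: "real^'n \<Rightarrow> real"
  assumes ai: "\<And>i. integrable lborel (a i)"
    and um: "u \<in> borel_measurable borel" and u0: "\<And>x t. t \<notin> {0<..<T} \<Longrightarrow> u (x, t) = 0"
    and wi: "\<And>t. t \<in> {0<..<T} \<Longrightarrow> integrable lborel (\<lambda>x. signed_powr \<alpha> (U t x))"
    and wN: "\<And>t. t \<in> {0<..<T} \<Longrightarrow> (\<integral>x. \<bar>signed_powr \<alpha> (U t x)\<bar> \<partial>lborel) \<le> N"
    and wc: "\<And>t. t \<in> {0<..<T} \<Longrightarrow>
      ((\<lambda>s. \<integral>x. \<bar>signed_powr \<alpha> (U s x) - signed_powr \<alpha> (U t x)\<bar> \<partial>lborel) \<longlongrightarrow> 0) (at t within {0<..<T})"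
    and uU: "AE t in lborel. t \<in> {0<..<T} \<longrightarrow> (AE x in lborel. u (x, t) = U t x)"
    and fi: "integrable lborel f" and T: "T > 0"
    and \<psi>: "\<psi> \<in> test_fun \<Omega>"
    and WF: "\<And>\<eta>. \<eta> \<in> test_fun {0<..<T} \<Longrightarrow>
      (\<integral>z. (\<Sum>i\<in>UNIV. a i z * (dir_deriv (axis i 1) \<psi> (fst z) * \<eta> (snd z)))
         - signed_powr \<alpha> (u z) * (\<psi> (fst z) * dir_deriv 1 \<eta> (snd z)) \<partial>lborel)
      = (\<integral>z. f (fst z) * indicator {0<..<T} (snd z) * (\<psi> (fst z) * \<eta> (snd z)) \<partial>lborel)"
    and st: "0 < s" "s < t" "t < T"
  shows "(\<integral>x. (signed_powr \<alpha> (U t x) - signed_powr \<alpha> (U s x)) * \<psi> x \<partial>lborel) = (t - s) * (\<integral>x. f x * \<psi> x \<partial>lborel)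
       - (\<Sum>i\<in>UNIV. \<integral>z. a i z * (dir_deriv (axis i 1) \<psi> (fst z) * indicator {s<..t} (snd z)) \<partial>lborel)"
proof -
  let ?S = "{0<..<T}"
  note [measurable] = um
  have fstm: "(\<lambda>z::(real^'n)\<times>real. \<phi> (fst z)) \<in> borel_measurable borel" if [measurable]: "\<phi> \<in> borel_measurable borel" for \<phi> :: "real^'n \<Rightarrow> real"
    unfolding borel_prod[symmetric] by measurable
  have sndm: "(\<lambda>z::(real^'n)\<times>real. \<phi> (snd z)) \<in> borel_measurable borel" if [measurable]: "\<phi> \<in> borel_measurable borel" for \<phi> :: "real \<Rightarrow> real"
    unfolding borel_prod[symmetric] by measurable
  have d\<psi>: "dir_deriv (axis i 1) \<psi> \<in> test_fun \<Omega>" for i by (rule test_fun_dir_deriv[OF \<psi> axis_1_Basis])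
  note [measurable] = test_fun_measurable[OF \<psi>] test_fun_measurable[OF d\<psi>]
  have mb: "integrable lborel (\<lambda>z. F z * (\<phi> (fst z) * \<kappa> (snd z)))"
    if F: "integrable lborel F" and \<phi>: "\<phi> \<in> test_fun \<Omega>" and \<kappa>: "\<kappa> \<in> borel_measurable borel" "\<And>r. \<bar>\<kappa> r\<bar> \<le> B"
    for F :: "(real^'n) \<times> real \<Rightarrow> real" and \<phi> \<kappa> B
  proof -
    obtain C where C: "C > 0" "\<And>x. \<bar>\<phi> x\<bar> \<le> C" using test_fun_bounded[OF \<phi>] by blast
    have "(\<lambda>z. \<phi> (fst z) * \<kappa> (snd z)) \<in> borel_measurable (lborel :: ((real^'n) \<times> real) measure)"
      using fstm[OF test_fun_measurable[OF \<phi>]] sndm[OF \<kappa>(1)] by simp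
    then show ?thesis
    proof (rule integrable_mult_bounded[OF F])
      show "\<bar>\<phi> (fst z) * \<kappa> (snd z)\<bar> \<le> C * B" for z
        unfolding abs_mult using C \<kappa>(2) by (intro mult_mono) auto
    qed
  qed
  define P where "P t x = signed_powr \<alpha> (U t x)" for t x
  define V where "V z = signed_powr \<alpha> (u z)" for z
  have Vm[measurable]: "V \<in> borel_measurable borel" unfolding V_def by measurable
  have Vs: "(\<lambda>x. V (x, t)) \<in> borel_measurable borel" for t by (rule borel_measurable_slice[OF Vm])
  have V0: "V (x, t) = 0" if "t \<notin> ?S" for x t using u0[OF that] by (simp add: V_def)
  have PI: "integrable lborel (P t)" if "t \<in> ?S" for t unfolding P_def[abs_def] by (rule wi[OF that])
  have VP: "AE t in lborel. t \<in> ?S \<longrightarrow> (AE x in lborel. V (x, t) = P t x)"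
    using uU by eventually_elim (auto simp: V_def P_def elim: eventually_mono)
  \<comment> \<open>The uniform bound \<open>N\<close> on the slices makes the signed power
    integrable over the cylinder.\<close>
  have Vi: "integrable lborel V"
  proof (rule lborel_fubini_integrable[OF Vm])
    have ev: "AE t in lborel. integrable lborel (\<lambda>x. V (x, t)) \<and> (\<integral>x. \<bar>V (x, t)\<bar> \<partial>lborel) \<le> N * indicator ?S t"
      using VP
    proof eventually_elim
      case (elim t)
      show ?case
      proof (cases "t \<in> ?S")
        case True
        with elim have ae: "AE x in lborel. V (x, t) = P t x" by blast
        have Pm: "P t \<in> borel_measurable lborel" using PI[OF True] by auto
        have "integrable lborel (\<lambda>x. V (x, t))"
          using integrable_cong_AE[OF _ Pm ae] Vs PI[OF True] by simp
        moreover have "(\<integral>x. \<bar>V (x, t)\<bar> \<partial>lborel) = (\<integral>x. \<bar>P t x\<bar> \<partial>lborel)"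
          by (rule integral_cong_AE) (use Vs Pm ae in \<open>auto elim: eventually_mono\<close>)
        ultimately show ?thesis using wN[OF True] True by (simp add: P_def)
      next
        case False
        then show ?thesis using V0[OF False] by simp
      qed
    qed
    then show "AE t in lborel. integrable lborel (\<lambda>x. V (x, t))" by eventually_elim simp
    show "integrable lborel (\<lambda>t. \<integral>x. \<bar>V (x, t)\<bar> \<partial>lborel)"
    proof (rule Bochner_Integration.integrable_bound)
      show "integrable lborel (\<lambda>t. N * indicator ?S t)"
        using T by (intro integrable_mult_right integrable_real_indicator) auto
      show "(\<lambda>t. \<integral>x. \<bar>V (x, t)\<bar> \<partial>lborel) \<in> borel_measurable lborel"
        using borel_measurable_lborel_integral[of "\<lambda>z. \<bar>V z\<bar>"] by simp
      show "AE t in lborel. norm (\<integral>x. \<bar>V (x, t)\<bar> \<partial>lborel) \<le> norm (N * indicator ?S t)"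
        using ev by eventually_elim auto
    qed
  qed
  define B where "B t = (\<integral>x. V (x, t) * \<psi> x \<partial>lborel)" for t
  \<comment> \<open>\<open>B\<close> is what Fubini's theorem yields from \<open>u\<close>; \<beta>
    is built from \<open>U\<close>, for which continuity is known. They agree a.e., and only \<beta>
    may be evaluated at single times.\<close>
  define \<beta> where "\<beta> t = indicator ?S t * (\<integral>x. P t x * \<psi> x \<partial>lborel)" for t
  obtain C where C: "C > 0" "\<And>x. \<bar>\<psi> x\<bar> \<le> C" using test_fun_bounded[OF \<psi>] by blast
  have P\<psi>: "integrable lborel (\<lambda>x. P t x * \<psi> x)" if "t \<in> ?S" for t
    by (rule integrable_mult_bounded[OF PI[OF that] _ C(2)]) simp
  have \<beta>c: "continuous_on ?S (\<lambda>t. \<integral>x. P t x * \<psi> x \<partial>lborel)"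
    unfolding continuous_on_def
  proof
    fix t assume t: "t \<in> ?S"
    have "((\<lambda>s. (\<integral>x. P s x * \<psi> x \<partial>lborel) - (\<integral>x. P t x * \<psi> x \<partial>lborel)) \<longlongrightarrow> 0) (at t within ?S)"
    proof (rule Lim_null_comparison)
      show "((\<lambda>s. C * (\<integral>x. \<bar>signed_powr \<alpha> (U s x) - signed_powr \<alpha> (U t x)\<bar> \<partial>lborel)) \<longlongrightarrow> 0) (at t within ?S)"
        using tendsto_mult[OF tendsto_const wc[OF t], of C] by simp
      show "\<forall>\<^sub>F s in at t within ?S. norm ((\<integral>x. P s x * \<psi> x \<partial>lborel) - (\<integral>x. P t x * \<psi> x \<partial>lborel))
          \<le> C * (\<integral>x. \<bar>signed_powr \<alpha> (U s x) - signed_powr \<alpha> (U t x)\<bar> \<partial>lborel)"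
        unfolding eventually_at_filter
      proof (rule always_eventually, intro allI impI)
        fix s assume s: "s \<in> ?S"
        have "\<bar>(\<integral>x. P s x * \<psi> x \<partial>lborel) - (\<integral>x. P t x * \<psi> x \<partial>lborel)\<bar> = \<bar>\<integral>x. P s x * \<psi> x - P t x * \<psi> x \<partial>lborel\<bar>"
          using P\<psi>[OF s] P\<psi>[OF t] by simp
        also have "\<dots> \<le> (\<integral>x. \<bar>P s x * \<psi> x - P t x * \<psi> x\<bar> \<partial>lborel)" by (rule integral_abs_bound)
        also have "\<dots> \<le> (\<integral>x. C * \<bar>P s x - P t x\<bar> \<partial>lborel)"
        proof (rule integral_mono)
          show "\<bar>P s x * \<psi> x - P t x * \<psi> x\<bar> \<le> C * \<bar>P s x - P t x\<bar>" for x
            using mult_right_mono[OF C(2)[of x] abs_ge_zero[of "P s x - P t x"]]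
            unfolding left_diff_distrib[symmetric] abs_mult by (simp add: mult.commute)
        qed (use P\<psi>[OF s] P\<psi>[OF t] PI[OF s] PI[OF t] in auto)
        finally show "norm ((\<integral>x. P s x * \<psi> x \<partial>lborel) - (\<integral>x. P t x * \<psi> x \<partial>lborel))
          \<le> C * (\<integral>x. \<bar>signed_powr \<alpha> (U s x) - signed_powr \<alpha> (U t x)\<bar> \<partial>lborel)" by (simp add: P_def)
      qed
    qed
    then show "((\<lambda>t. \<integral>x. P t x * \<psi> x \<partial>lborel) \<longlongrightarrow> (\<integral>x. P t x * \<psi> x \<partial>lborel)) (at t within ?S)"
      by (simp add: LIM_zero_iff)
  qed
  have \<beta>m: "\<beta> \<in> borel_measurable borel"
    using borel_measurable_continuous_on_indicator[OF _ \<beta>c] by (simp add: \<beta>_def[abs_def])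
  have V\<psi>i: "integrable lborel (\<lambda>z. V z * \<psi> (fst z))"
    using mb[OF Vi \<psi>, of "\<lambda>_. 1" 1] by simp
  have Bi: "integrable lborel B" using lborel_fubini(2)[OF V\<psi>i] by (simp add: B_def[abs_def])
  have \<beta>B: "AE t in lborel. \<beta> t = B t"
    using VP
  proof eventually_elim
    case (elim t)
    show ?case
    proof (cases "t \<in> ?S")
      case True
      have "B t = (\<integral>x. P t x * \<psi> x \<partial>lborel)" unfolding B_def
      proof (rule integral_cong_AE)
        show "(\<lambda>x. V (x, t) * \<psi> x) \<in> borel_measurable lborel" using Vs by simp
        show "(\<lambda>x. P t x * \<psi> x) \<in> borel_measurable lborel" using P\<psi>[OF True] by auto
        show "AE x in lborel. V (x, t) * \<psi> x = P t x * \<psi> x" using elim True by (auto elim: eventually_mono)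
      qed
      with True show ?thesis by (simp add: \<beta>_def)
    next
      case False
      then show ?thesis using V0[OF False] by (simp add: \<beta>_def B_def)
    qed
  qed
  have \<beta>i: "integrable lborel \<beta>"
    using integrable_cong_AE[of \<beta> lborel B] \<beta>m Bi \<beta>B by auto
  define F where "F = (\<integral>x. f x * \<psi> x \<partial>lborel)"
  define \<theta> where "\<theta> i t = (\<integral>x. a i (x, t) * dir_deriv (axis i 1) \<psi> x \<partial>lborel)" for i t
  have a\<psi>i: "integrable lborel (\<lambda>z. a i z * dir_deriv (axis i 1) \<psi> (fst z))" for i
    using mb[OF ai d\<psi>, of "\<lambda>_. 1" 1] by simp
  have \<theta>i: "integrable lborel (\<theta> i)" for i using lborel_fubini(2)[OF a\<psi>i[of i]] by (simp add: \<theta>_def[abs_def])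
  have Si: "integrable lborel (indicator ?S :: real \<Rightarrow> real)" using T by (intro integrable_real_indicator) auto
  define k where "k t = indicator ?S t * F - (\<Sum>i\<in>UNIV. \<theta> i t)" for t
  have ki: "integrable lborel k" unfolding k_def[abs_def]
    using Si \<theta>i by (intro Bochner_Integration.integrable_diff Bochner_Integration.integrable_sum) auto
  have wd: "(\<integral>t. \<beta> t * dir_deriv 1 \<eta> t \<partial>lborel) = - (\<integral>t. k t * \<eta> t \<partial>lborel)" if \<eta>: "\<eta> \<in> test_fun ?S" for \<eta>
  proof -
    have d\<eta>: "dir_deriv 1 \<eta> \<in> test_fun ?S" by (rule test_fun_dir_deriv[OF \<eta>]) simp
    note [measurable] = test_fun_measurable[OF \<eta>] test_fun_measurable[OF d\<eta>]
    obtain C1 where C1: "\<And>x. \<bar>\<eta> x\<bar> \<le> C1" using test_fun_bounded[OF \<eta>] by blast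
    obtain C2 where C2: "\<And>x. \<bar>dir_deriv 1 \<eta> x\<bar> \<le> C2" using test_fun_bounded[OF d\<eta>] by blast
    have i1: "integrable lborel (\<lambda>z. V z * (\<psi> (fst z) * dir_deriv 1 \<eta> (snd z)))"
      by (rule mb[OF Vi \<psi> _ C2]) simp
    have i2: "integrable lborel (\<lambda>z. a i z * (dir_deriv (axis i 1) \<psi> (fst z) * \<eta> (snd z)))" for i
      by (rule mb[OF ai d\<psi> _ C1]) simp
    have "(\<integral>t. \<beta> t * dir_deriv 1 \<eta> t \<partial>lborel) = (\<integral>t. B t * dir_deriv 1 \<eta> t \<partial>lborel)"
      by (rule integral_cong_AE) (use \<beta>m Bi \<beta>B in \<open>auto elim: eventually_mono\<close>)
    also have "\<dots> = (\<integral>z. V z * (\<psi> (fst z) * dir_deriv 1 \<eta> (snd z)) \<partial>lborel)"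
      using lborel_fubini(3)[OF i1] by (simp add: B_def mult.assoc[symmetric])
    also have "\<dots> = (\<Sum>i\<in>UNIV. \<integral>z. a i z * (dir_deriv (axis i 1) \<psi> (fst z) * \<eta> (snd z)) \<partial>lborel)
        - (\<integral>z. f (fst z) * indicator ?S (snd z) * (\<psi> (fst z) * \<eta> (snd z)) \<partial>lborel)"
    proof -
      have "(\<integral>z. (\<Sum>i\<in>UNIV. a i z * (dir_deriv (axis i 1) \<psi> (fst z) * \<eta> (snd z)))
          - V z * (\<psi> (fst z) * dir_deriv 1 \<eta> (snd z)) \<partial>lborel)
        = (\<Sum>i\<in>UNIV. \<integral>z. a i z * (dir_deriv (axis i 1) \<psi> (fst z) * \<eta> (snd z)) \<partial>lborel)
          - (\<integral>z. V z * (\<psi> (fst z) * dir_deriv 1 \<eta> (snd z)) \<partial>lborel)"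
        using i1 i2 by (simp add: Bochner_Integration.integral_diff Bochner_Integration.integral_sum)
      with WF[OF \<eta>] show ?thesis by (simp add: V_def)
    qed
    also have "(\<integral>z. f (fst z) * indicator ?S (snd z) * (\<psi> (fst z) * \<eta> (snd z)) \<partial>lborel) = (\<integral>t. indicator ?S t * F * \<eta> t \<partial>lborel)"
    proof -
      have "integrable lborel (\<lambda>z::(real^'n)\<times>real. f (fst z) * indicator {0<..T} (snd z))"
        using integral_prod_indicator(1)[OF fi, of 0 T] T by simp
      then have "integrable lborel (\<lambda>z. f (fst z) * indicator {0<..T} (snd z) * (\<psi> (fst z) * \<eta> (snd z)))"
        by (rule mb[OF _ \<psi> _ C1]) simp
      \<comment> \<open>Closing the interval at \<open>T\<close> does not change the integrand,
        because \<eta> vanishes there.\<close>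
      moreover have "f (fst z) * indicator {0<..T} (snd z) * (\<psi> (fst z) * \<eta> (snd z)) = f (fst z) * indicator ?S (snd z) * (\<psi> (fst z) * \<eta> (snd z))" for z
      proof -
        obtain K where K: "K \<subseteq> ?S" "\<And>r. r \<notin> K \<Longrightarrow> \<eta> r = 0" using test_fun_support[OF \<eta>] by blast
        have "T \<notin> K" using K(1) by auto
        then have "\<eta> T = 0" by (rule K(2))
        then show ?thesis by (cases "snd z = T") (auto split: split_indicator)
      qed
      ultimately have "integrable lborel (\<lambda>z. f (fst z) * indicator ?S (snd z) * (\<psi> (fst z) * \<eta> (snd z)))" by simp
      from lborel_fubini(3)[OF this, symmetric]
      have "(\<integral>z. f (fst z) * indicator ?S (snd z) * (\<psi> (fst z) * \<eta> (snd z)) \<partial>lborel)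
          = (\<integral>t. \<integral>x. (f x * \<psi> x) * (indicator ?S t * \<eta> t) \<partial>lborel \<partial>lborel)" by (simp add: mult_ac)
      also have "\<dots> = (\<integral>t. F * (indicator ?S t * \<eta> t) \<partial>lborel)" by (simp only: integral_mult_left_zero F_def)
      finally show ?thesis by (simp add: mult_ac)
    qed
    also have "(\<Sum>i\<in>UNIV. \<integral>z. a i z * (dir_deriv (axis i 1) \<psi> (fst z) * \<eta> (snd z)) \<partial>lborel) = (\<Sum>i\<in>UNIV. \<integral>t. \<theta> i t * \<eta> t \<partial>lborel)"
    proof (rule sum.cong[OF refl])
      fix i
      show "(\<integral>z. a i z * (dir_deriv (axis i 1) \<psi> (fst z) * \<eta> (snd z)) \<partial>lborel) = (\<integral>t. \<theta> i t * \<eta> t \<partial>lborel)"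
        using lborel_fubini(3)[OF i2[of i]] by (simp add: \<theta>_def mult.assoc[symmetric])
    qed
    also have "(\<Sum>i\<in>UNIV. \<integral>t. \<theta> i t * \<eta> t \<partial>lborel) - (\<integral>t. indicator ?S t * F * \<eta> t \<partial>lborel) = - (\<integral>t. k t * \<eta> t \<partial>lborel)"
    proof -
      have j1: "integrable lborel (\<lambda>t. \<theta> i t * \<eta> t)" for i by (rule integrable_mult_bounded[OF \<theta>i _ C1]) simp
      have j2: "integrable lborel (\<lambda>t. indicator ?S t * F * \<eta> t)"
        using Si by (intro integrable_mult_bounded[OF _ _ C1]) auto
      have "(\<integral>t. k t * \<eta> t \<partial>lborel) = (\<integral>t. indicator ?S t * F * \<eta> t - (\<Sum>i\<in>UNIV. \<theta> i t * \<eta> t) \<partial>lborel)"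
        by (simp only: k_def left_diff_distrib sum_distrib_right)
      also have "\<dots> = (\<integral>t. indicator ?S t * F * \<eta> t \<partial>lborel) - (\<integral>t. (\<Sum>i\<in>UNIV. \<theta> i t * \<eta> t) \<partial>lborel)"
        by (intro Bochner_Integration.integral_diff j2 Bochner_Integration.integrable_sum j1)
      also have "(\<integral>t. (\<Sum>i\<in>UNIV. \<theta> i t * \<eta> t) \<partial>lborel) = (\<Sum>i\<in>UNIV. \<integral>t. \<theta> i t * \<eta> t \<partial>lborel)"
        by (rule Bochner_Integration.integral_sum) (rule j1)
      finally show ?thesis by simp
    qed
    finally show ?thesis .
  qed
  have "continuous_on ?S \<beta>"
    by (rule continuous_on_eq[OF \<beta>c]) (simp add: \<beta>_def)
  from weak_derivative_increment[OF \<beta>i ki this wd st]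
  have inc: "\<beta> t - \<beta> s = (\<integral>x. k x * indicator {s<..t} x \<partial>lborel)" by simp
  have tS: "t \<in> ?S" "s \<in> ?S" using st by auto
  have "(\<integral>x. (P t x - P s x) * \<psi> x \<partial>lborel) = (\<integral>x. P t x * \<psi> x - P s x * \<psi> x \<partial>lborel)" by (simp only: left_diff_distrib)
  also have "\<dots> = \<beta> t - \<beta> s" using P\<psi>[OF tS(1)] P\<psi>[OF tS(2)] tS by (simp add: \<beta>_def)
  also have "\<dots> = (\<integral>r. F * indicator {s<..t} r - (\<Sum>i\<in>UNIV. \<theta> i r * indicator {s<..t} r) \<partial>lborel)"
    unfolding inc
  proof (rule Bochner_Integration.integral_cong[OF refl])
    fix r
    show "k r * indicator {s<..t} r = F * indicator {s<..t} r - (\<Sum>i\<in>UNIV. \<theta> i r * indicator {s<..t} r)"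
      unfolding k_def left_diff_distrib sum_distrib_right using st by (auto split: split_indicator)
  qed
  also have "\<dots> = (\<integral>r. F * indicator {s<..t} r \<partial>lborel) - (\<integral>r. (\<Sum>i\<in>UNIV. \<theta> i r * indicator {s<..t} r) \<partial>lborel)"
  proof (intro Bochner_Integration.integral_diff Bochner_Integration.integrable_sum)
    show "integrable lborel (\<lambda>r. F * indicator {s<..t} r)"
      using st by (intro integrable_mult_right integrable_real_indicator) auto
    show "integrable lborel (\<lambda>r. \<theta> i r * indicator {s<..t} r)" for i
      by (intro integrable_real_mult_indicator \<theta>i) simp
  qed
  also have "(\<integral>r. F * indicator {s<..t} r \<partial>lborel) = (t - s) * F" using st by simp
  also have "(\<integral>r. (\<Sum>i\<in>UNIV. \<theta> i r * indicator {s<..t} r) \<partial>lborel) = (\<Sum>i\<in>UNIV. \<integral>r. \<theta> i r * indicator {s<..t} r \<partial>lborel)"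
    by (rule Bochner_Integration.integral_sum) (intro integrable_real_mult_indicator \<theta>i, simp)
  also have "\<dots> = (\<Sum>i\<in>UNIV. \<integral>z. a i z * (dir_deriv (axis i 1) \<psi> (fst z) * indicator {s<..t} (snd z)) \<partial>lborel)"
  proof (rule sum.cong[OF refl])
    fix i
    have "integrable lborel (\<lambda>z. a i z * (dir_deriv (axis i 1) \<psi> (fst z) * indicator {s<..t} (snd z)))"
      by (rule mb[OF ai d\<psi>, of _ 1]) (auto split: split_indicator)
    from lborel_fubini(3)[OF this]
    show "(\<integral>r. \<theta> i r * indicator {s<..t} r \<partial>lborel) = (\<integral>z. a i z * (dir_deriv (axis i 1) \<psi> (fst z) * indicator {s<..t} (snd z)) \<partial>lborel)"
      by (simp add: \<theta>_def mult.assoc[symmetric])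
  qed
  finally show ?thesis by (simp add: P_def F_def)
qed

section \<open>Nonnegativity of solutions\<close>

theorem theorem2p9:
  fixes \<Omega> :: "(real^'n) set"
    and p :: "'n \<Rightarrow> real"
    and T \<alpha> \<Lambda> C :: real
    and A :: "real^'n \<Rightarrow> real \<Rightarrow> real^'n \<Rightarrow> real^'n"
    and b c f u\<^sub>0 :: "real^'n \<Rightarrow> real"
    and g u :: "(real^'n) \<times> real \<Rightarrow> real"
  assumes "open \<Omega>" and "bounded \<Omega>"
    and "T > 0" and "\<alpha> > 0" and "\<And>j. p j > 1"
    and "caratheodory \<Omega> A"
    and "\<Lambda> > 0" and "C > 0"
    and "b \<in> Lsp 1 \<Omega>" and "AE x in lebesgue_on \<Omega>. b x \<ge> 0"
    and "c \<in> Lsp 1 \<Omega>" and "AE x in lebesgue_on \<Omega>. c x \<ge> 0"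
    and growth: "AE x in lebesgue_on \<Omega>. \<forall>v \<xi> i.
      \<bar>A x v \<xi> $ i\<bar> \<le> \<Lambda> * ((\<Sum>k\<in>UNIV. \<bar>\<xi> $ k\<bar> powr p k) + b x) powr ((p i - 1) / p i)"
    and lipschitz: "AE x in lebesgue_on \<Omega>. \<forall>v\<^sub>1 v\<^sub>2 \<xi> i.
      \<bar>A x v\<^sub>1 \<xi> $ i - A x v\<^sub>2 \<xi> $ i\<bar>
        \<le> C * \<bar>v\<^sub>1 - v\<^sub>2\<bar> * (c x + (\<Sum>k\<in>UNIV. \<bar>\<xi> $ k\<bar> powr p k)) powr ((p i - 1) / p i)"
    and monotone: "AE x in lebesgue_on \<Omega>. \<forall>v \<xi> \<eta>. (A x v \<xi> - A x v \<eta>) \<bullet> (\<xi> - \<eta>) \<ge> 0"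
    and "AE x in lebesgue_on \<Omega>. A x 0 0 = 0"
    and "u\<^sub>0 \<in> Lsp (\<alpha> + 1) \<Omega>" and "AE x in lebesgue_on \<Omega>. u\<^sub>0 x \<ge> 0"
    and "f \<in> Lsp ((\<alpha> + 1) / \<alpha>) \<Omega>" and "AE x in lebesgue_on \<Omega>. f x \<ge> 0"
    and "g \<in> LpW p \<Omega> T" and "AE z in lebesgue_on (cyl \<Omega> T). g z \<ge> 0"
    and "CD_solution p \<alpha> \<Omega> T A f u\<^sub>0 g u"
  shows "AE z in lebesgue_on (cyl \<Omega> T). u z \<ge> 0"
proof -
  let ?S = "{0<..<T}" and ?Q = "\<Omega> \<times> {0<..<T}"
  note \<Omega> = assms(1,2) and T = assms(3) and \<alpha> = assms(4) and p = assms(5)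
  define q where "q = \<alpha> + 1"
  have q: "q > 0" using \<alpha> by (simp add: q_def)
  have Q: "open ?Q" "bounded ?Q" using \<Omega> by (auto intro: open_Times bounded_Times)
  have \<Omega>b: "\<Omega> \<in> sets borel" and Qb: "?Q \<in> sets borel" and Sb: "?S \<in> sets borel" using \<Omega> Q by auto
  have cyl: "cyl \<Omega> T = ?Q" by (simp add: cyl_def)
  have uL: "u \<in> LpW p \<Omega> T"
    and uc: "slice u \<in> cont_in_time T (Lsp q \<Omega>) (Lnorm q \<Omega>)"
    and uw: "\<And>\<phi>. \<phi> \<in> test_fun ?Q \<Longrightarrow>
        (\<integral>z. A (fst z) (u z) (weak_grad_x \<Omega> T u z) \<bullet> grad_x \<phi> z
              - signed_powr \<alpha> (u z) * dir_deriv (0, 1) \<phi> z \<partial>lebesgue_on ?Q)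
        = (\<integral>z. f (fst z) * \<phi> z \<partial>lebesgue_on ?Q)"
    and ui: "((\<lambda>t. Lnorm q \<Omega> (\<lambda>x. slice u t x - u\<^sub>0 x)) \<longlongrightarrow> 0) (at_right 0)"
    and ug: "(\<lambda>z. u z - g z) \<in> LpW_o p \<Omega> T"
    using assms(23) unfolding CD_solution_def cyl q_def by blast+
  obtain u' Du where u': "brep ?Q u u'" and Dub: "\<And>i. brep ?Q (Du i) (Du i)"
    and Dui: "\<And>i. integrable lborel (\<lambda>z. \<bar>Du i z\<bar> powr p i)"
    and Duw: "\<And>i. has_weak_deriv ?Q (axis i 1, 0) u (Du i)"
    and us: "AE t in lborel. t \<in> ?S \<longrightarrow> brep \<Omega> (slice u t) (slice u' t) \<and> integrable lborel (slice u' t) \<and>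
      (\<forall>i. has_weak_deriv \<Omega> (axis i 1) (slice u t) (slice (Du i) t) \<and> integrable lborel (\<lambda>x. \<bar>Du i (x, t)\<bar> powr p i))"
    using LpW_repr[OF \<Omega> p uL] by blast
  obtain g' Dg where g': "brep ?Q g g'" and Dgb: "\<And>i. brep ?Q (Dg i) (Dg i)"
    and gs: "AE t in lborel. t \<in> ?S \<longrightarrow> brep \<Omega> (slice g t) (slice g' t) \<and> integrable lborel (slice g' t) \<and>
      (\<forall>i. has_weak_deriv \<Omega> (axis i 1) (slice g t) (slice (Dg i) t) \<and> integrable lborel (\<lambda>x. \<bar>Dg i (x, t)\<bar> powr p i))"
    using LpW_repr[OF \<Omega> p assms(21)] by blast
  have Dum: "Du i \<in> borel_measurable borel" and Dgm: "Dg i \<in> borel_measurable borel" for i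
    using brep_measurable[OF Dub] brep_measurable[OF Dgb] by auto
  have u'm: "u' \<in> borel_measurable borel" using u' by (rule brep_measurable)
  have u'0: "u' (x, t) = 0" if "t \<notin> ?S" for x t using that by (intro brep_outside[OF u']) auto
  obtain a where a: "\<And>i. brep ?Q (\<lambda>z. A (fst z) (u' z) (\<chi> k. Du k z) $ i) (a i)"
    and ai: "\<And>i. integrable lborel (\<lambda>z. \<bar>a i z\<bar> powr (p i / (p i - 1)))"
    using flux_repr[OF \<Omega>(1) p assms(6,7,9,10) growth u'm Dum Dui T] by blast
  have am: "a i \<in> borel_measurable borel" for i using a by (rule brep_measurable)
  have ai1: "integrable lborel (a i)" for i
  proof (rule integrable_if_Lp_bounded_support[OF _ Q(2) Qb am ai])
    show "1 \<le> p i / (p i - 1)" using p[of i] by (simp add: field_simps)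
    show "a i z = 0" if "z \<notin> ?Q" for z using brep_outside[OF a that] .
  qed
  \<comment> \<open>The gradient in the weak formulation is a chosen weak derivative; it equals
    \<open>Du\<close> a.e., so the flux may be computed from the Borel functions.\<close>
  have grad: "AE z in lborel. \<forall>i\<in>UNIV. z \<in> ?Q \<longrightarrow> weak_deriv ?Q (axis i 1, 0) u z = Du i z"
    using weak_deriv_AE_eq[OF Q(1) Duw] by (subst AE_ball_countable) (auto simp: countable_finite AE_lebesgue_on_iff[OF Qb])
  have aU: "brep ?Q (\<lambda>z. A (fst z) (u z) (weak_grad_x \<Omega> T u z) $ i) (a i)" for i
    unfolding brep_def
  proof (intro conjI allI impI am)
    show "a i z = 0" if "z \<notin> ?Q" for z using brep_outside[OF a that] .
    show "AE z in lborel. z \<in> ?Q \<longrightarrow> A (fst z) (u z) (weak_grad_x \<Omega> T u z) $ i = a i z"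
      using grad brep_AE[OF u'] brep_AE[OF a[of i]]
      by eventually_elim (auto simp: weak_grad_x_def cyl)
  qed
  obtain f' where f': "brep \<Omega> f f'" using brep_exists[OF \<Omega>b] assms(19) by (auto simp: Lsp_def)
  have f'm: "f' \<in> borel_measurable borel" using f' by (rule brep_measurable)
  have fi: "integrable lborel f'"
  proof (rule integrable_if_Lp_bounded_support[OF _ \<Omega>(2) \<Omega>b f'm])
    show "1 \<le> (\<alpha> + 1) / \<alpha>" using \<alpha> by (simp add: field_simps)
    show "integrable lborel (\<lambda>x. \<bar>f' x\<bar> powr ((\<alpha> + 1) / \<alpha>))" using brep_Lsp_iff[OF \<Omega>b f'] assms(19) by blast
  qed (use brep_outside[OF f'] in auto)
  have f0: "AE x in lborel. f' x \<ge> 0"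
    by (rule brep_nonneg[OF f' assms(20)[unfolded AE_lebesgue_on_iff[OF \<Omega>b]]])
  \<comment> \<open>Slices of \<open>u'\<close> represent the solution only for a.e. time, whereas
    continuity and the initial condition need every time. The default 0 outside [0, T] lets
    measurability and integrability hold for all \<open>t\<close>.\<close>
  have "\<forall>t. \<exists>V. (t \<in> {0..T} \<longrightarrow> brep \<Omega> (slice u t) V) \<and> (t \<notin> {0..T} \<longrightarrow> V = (\<lambda>x. 0))"
  proof
    fix t
    show "\<exists>V. (t \<in> {0..T} \<longrightarrow> brep \<Omega> (slice u t) V) \<and> (t \<notin> {0..T} \<longrightarrow> V = (\<lambda>x. 0))"
    proof (cases "t \<in> {0..T}")
      case True
      then have "slice u t \<in> borel_measurable (lebesgue_on \<Omega>)" using uc by (auto simp: cont_in_time_def Lsp_def)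
      with True show ?thesis using brep_exists[OF \<Omega>b] by auto
    qed auto
  qed
  from choice[OF this] obtain U where U: "\<And>t. t \<in> {0..T} \<Longrightarrow> brep \<Omega> (slice u t) (U t)" "\<And>t. t \<notin> {0..T} \<Longrightarrow> U t = (\<lambda>x. 0)"
    by blast
  have Um: "U t \<in> borel_measurable borel" for t
    using brep_measurable[OF U(1), of t] U(2)[of t] by (cases "t \<in> {0..T}") auto
  have Uz: "U t x = 0" if "x \<notin> \<Omega>" for t x
    using brep_outside[OF U(1) that] U(2)[of t] by (cases "t \<in> {0..T}") auto
  have Ui: "integrable lborel (\<lambda>x. \<bar>U t x\<bar> powr (\<alpha> + 1))" for t
  proof (cases "t \<in> {0..T}")
    case True
    then have "slice u t \<in> Lsp q \<Omega>" using uc by (auto simp: cont_in_time_def)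
    then show ?thesis using brep_Lsp_iff[OF \<Omega>b U(1)[OF True]] by (simp add: q_def)
  qed (simp add: U(2))
  \<comment> \<open>Only the integrability part is wanted; the convergence premise is trivial for
    the filter \<open>bot\<close>.\<close>
  have wi: "integrable lborel (\<lambda>x. signed_powr \<alpha> (U t x))" for t
    by (rule signed_powr_L1_tendsto(1)[where F=bot and g="\<lambda>_::unit. U t", OF \<alpha> \<Omega>(2) \<Omega>b Um Um Uz Uz Ui Ui]) simp_all
  have wc: "((\<lambda>s. \<integral>x. \<bar>signed_powr \<alpha> (U s x) - signed_powr \<alpha> (U t x)\<bar> \<partial>lborel) \<longlongrightarrow> 0) (at t within {0..T})"
    if t: "t \<in> {0..T}" for t
  proof (rule signed_powr_L1_tendsto(2)[OF \<alpha> \<Omega>(2) \<Omega>b Um[of t] Um Uz Uz Ui Ui])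
    show "((\<lambda>s. \<integral>x. \<bar>U s x - U t x\<bar> powr (\<alpha> + 1) \<partial>lborel) \<longlongrightarrow> 0) (at t within {0..T})"
      unfolding q_def[symmetric]
    proof (rule Lnorm_tendsto_imp[OF \<Omega>b q _ U(1)[OF t]])
      show "eventually (\<lambda>s. brep \<Omega> (slice u s) (U s)) (at t within {0..T})"
        unfolding eventually_at_filter by (intro always_eventually allI impI U(1))
      show "((\<lambda>s. Lnorm q \<Omega> (\<lambda>x. slice u s x - slice u t x)) \<longlongrightarrow> 0) (at t within {0..T})"
        using uc t by (auto simp: cont_in_time_def)
    qed
  qed
  have wcS: "((\<lambda>s. \<integral>x. \<bar>signed_powr \<alpha> (U s x) - signed_powr \<alpha> (U t x)\<bar> \<partial>lborel) \<longlongrightarrow> 0) (at t within ?S)"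
    if "t \<in> ?S" for t
    using that by (intro tendsto_within_subset[OF wc]) auto
  obtain U0 where U0: "brep \<Omega> u\<^sub>0 U0" using brep_exists[OF \<Omega>b] assms(17) by (auto simp: Lsp_def)
  have U0m: "U0 \<in> borel_measurable borel" using U0 by (rule brep_measurable)
  have U0z: "U0 x = 0" if "x \<notin> \<Omega>" for x using brep_outside[OF U0 that] .
  have U0i: "integrable lborel (\<lambda>x. \<bar>U0 x\<bar> powr (\<alpha> + 1))" using brep_Lsp_iff[OF \<Omega>b U0] assms(17) by blast
  have w0i: "integrable lborel (\<lambda>x. signed_powr \<alpha> (U0 x))"
    by (rule signed_powr_L1_tendsto(1)[where F=bot and g="\<lambda>_::unit. U0", OF \<alpha> \<Omega>(2) \<Omega>b U0m U0m U0z U0z U0i U0i]) simp_all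
  have w0: "((\<lambda>t. \<integral>x. \<bar>signed_powr \<alpha> (U t x) - signed_powr \<alpha> (U0 x)\<bar> \<partial>lborel) \<longlongrightarrow> 0) (at_right 0)"
  proof (rule signed_powr_L1_tendsto(2)[OF \<alpha> \<Omega>(2) \<Omega>b U0m Um U0z Uz U0i Ui])
    show "((\<lambda>s. \<integral>x. \<bar>U s x - U0 x\<bar> powr (\<alpha> + 1) \<partial>lborel) \<longlongrightarrow> 0) (at_right 0)"
      unfolding q_def[symmetric]
    proof (rule Lnorm_tendsto_imp[OF \<Omega>b q _ U0 ui])
      show "eventually (\<lambda>s. brep \<Omega> (slice u s) (U s)) (at_right 0)"
        unfolding eventually_at_right_field using T by (intro exI[of _ T]) (auto intro: U(1))
    qed
  qed
  have U0n: "AE x in lborel. U0 x \<ge> 0"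
    by (rule brep_nonneg[OF U0 assms(18)[unfolded AE_lebesgue_on_iff[OF \<Omega>b]]])
  have uU: "AE t in lborel. t \<in> ?S \<longrightarrow> (AE x in lborel. u' (x, t) = U t x)"
    using us
  proof eventually_elim
    case (elim t)
    show ?case
    proof
      assume t: "t \<in> ?S"
      have "AE x in lborel. slice u' t x = U t x"
        by (rule brep_unique[of \<Omega> "slice u t"]) (use elim t U(1)[of t] in auto)
      then show "AE x in lborel. u' (x, t) = U t x" by (simp add: slice_def)
    qed
  qed
  \<comment> \<open>A continuous function on the compact interval [0, T] is bounded.\<close>
  obtain N where N: "\<And>t. t \<in> ?S \<Longrightarrow> (\<integral>x. \<bar>signed_powr \<alpha> (U t x)\<bar> \<partial>lborel) \<le> N"
  proof -
    define n where "n t = (\<integral>x. \<bar>signed_powr \<alpha> (U t x)\<bar> \<partial>lborel)" for t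
    have "continuous_on {0..T} n"
      unfolding continuous_on_def
    proof
      fix t assume t: "t \<in> {0..T}"
      have "((\<lambda>s. n s - n t) \<longlongrightarrow> 0) (at t within {0..T})"
      proof (rule Lim_null_comparison[OF _ wc[OF t]], rule always_eventually, rule allI)
        fix s
        have "\<bar>n s - n t\<bar> = \<bar>\<integral>x. \<bar>signed_powr \<alpha> (U s x)\<bar> - \<bar>signed_powr \<alpha> (U t x)\<bar> \<partial>lborel\<bar>"
          unfolding n_def using wi[of s] wi[of t] by simp
        also have "\<dots> \<le> (\<integral>x. \<bar>\<bar>signed_powr \<alpha> (U s x)\<bar> - \<bar>signed_powr \<alpha> (U t x)\<bar>\<bar> \<partial>lborel)" by (rule integral_abs_bound)
        also have "\<dots> \<le> (\<integral>x. \<bar>signed_powr \<alpha> (U s x) - signed_powr \<alpha> (U t x)\<bar> \<partial>lborel)"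
          using wi[of s] wi[of t] by (intro integral_mono) auto
        finally show "norm (n s - n t) \<le> (\<integral>x. \<bar>signed_powr \<alpha> (U s x) - signed_powr \<alpha> (U t x)\<bar> \<partial>lborel)" by simp
      qed
      then show "(n \<longlongrightarrow> n t) (at t within {0..T})" by (simp add: LIM_zero_iff)
    qed
    then have "bounded (n ` {0..T})" by (intro compact_imp_bounded compact_continuous_image) auto
    then obtain N where "\<And>t. t \<in> {0..T} \<Longrightarrow> \<bar>n t\<bar> \<le> N" unfolding bounded_iff by force
    then show thesis by (intro that[of N]) (force simp: n_def)
  qed
  have eq: "(\<integral>x. (signed_powr \<alpha> (U t x) - signed_powr \<alpha> (U s x)) * \<psi> x \<partial>lborel) = (t - s) * (\<integral>x. f' x * \<psi> x \<partial>lborel)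
       - (\<Sum>i\<in>UNIV. \<integral>z. a i z * (dir_deriv (axis i 1) \<psi> (fst z) * indicator {s<..t} (snd z)) \<partial>lborel)"
    if \<psi>: "\<psi> \<in> test_fun \<Omega>" and st: "0 < s" "s < t" "t < T" for \<psi> s t
  proof (rule weak_increment[OF ai1 u'm u'0 wi N wcS uU fi T \<psi> _ st])
    fix \<eta> :: "real \<Rightarrow> real" assume \<eta>: "\<eta> \<in> test_fun ?S"
    \<comment> \<open>Separated variables: the directions (axis i 1, 0) and (0, 1) each
      differentiate one factor only.\<close>
    define \<phi> where "\<phi> z = \<psi> (fst z) * \<eta> (snd z)" for z
    have \<phi>: "\<phi> \<in> test_fun ?Q" unfolding \<phi>_def[abs_def] by (rule test_fun_product[OF \<psi> \<eta>])
    have sm: "smooth \<psi>" "smooth \<eta>" using \<psi> \<eta> by (auto intro: test_fun_imp_smooth)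
    have z0: "dir_deriv 0 \<psi> x = 0" "dir_deriv 0 \<eta> r = 0" for x r
      using linear_0[OF linear_frechet_derivative[OF smooth_imp_differentiable[OF sm(1)]]]
        linear_0[OF linear_frechet_derivative[OF smooth_imp_differentiable[OF sm(2)]]] by (simp_all add: dir_deriv_def)
    have d1: "dir_deriv (axis i 1, 0) \<phi> z = dir_deriv (axis i 1) \<psi> (fst z) * \<eta> (snd z)" for i z
      unfolding \<phi>_def[abs_def] dir_deriv_product[OF sm] by (simp add: z0)
    have d2: "dir_deriv (0, 1) \<phi> z = \<psi> (fst z) * dir_deriv 1 \<eta> (snd z)" for z
      unfolding \<phi>_def[abs_def] dir_deriv_product[OF sm] by (simp add: z0)
    have B: "(axis i 1 :: real^'n, 0::real) \<in> Basis" "(0 :: real^'n, 1::real) \<in> Basis" for i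
      by (auto simp: Basis_prod_def axis_1_Basis)
    have m1: "(\<lambda>z. dir_deriv (axis i 1) \<psi> (fst z) * \<eta> (snd z)) \<in> borel_measurable borel" for i
      using test_fun_measurable[OF test_fun_dir_deriv[OF \<phi> B(1)[of i]]] by (simp add: d1[abs_def])
    have m2: "(\<lambda>z. \<psi> (fst z) * dir_deriv 1 \<eta> (snd z)) \<in> borel_measurable borel"
      using test_fun_measurable[OF test_fun_dir_deriv[OF \<phi> B(2)]] by (simp add: d2[abs_def])
    have "brep ?Q (\<lambda>z. (\<Sum>i\<in>UNIV. A (fst z) (u z) (weak_grad_x \<Omega> T u z) $ i * (dir_deriv (axis i 1) \<psi> (fst z) * \<eta> (snd z)))
         - signed_powr \<alpha> (u z) * (\<psi> (fst z) * dir_deriv 1 \<eta> (snd z)))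
       (\<lambda>z. (\<Sum>i\<in>UNIV. a i z * (dir_deriv (axis i 1) \<psi> (fst z) * \<eta> (snd z)))
         - signed_powr \<alpha> (u' z) * (\<psi> (fst z) * dir_deriv 1 \<eta> (snd z)))"
      by (intro brep_diff brep_sum brep_mult_borel aU m1 m2 brep_comp[OF u']) auto
    moreover have "A (fst z) (u z) (weak_grad_x \<Omega> T u z) \<bullet> grad_x \<phi> z - signed_powr \<alpha> (u z) * dir_deriv (0, 1) \<phi> z
       = (\<Sum>i\<in>UNIV. A (fst z) (u z) (weak_grad_x \<Omega> T u z) $ i * (dir_deriv (axis i 1) \<psi> (fst z) * \<eta> (snd z)))
         - signed_powr \<alpha> (u z) * (\<psi> (fst z) * dir_deriv 1 \<eta> (snd z))" for z
      by (simp add: inner_vec_def grad_x_def d1 d2)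
    ultimately have 1: "(\<integral>z. A (fst z) (u z) (weak_grad_x \<Omega> T u z) \<bullet> grad_x \<phi> z - signed_powr \<alpha> (u z) * dir_deriv (0, 1) \<phi> z \<partial>lebesgue_on ?Q)
       = (\<integral>z. (\<Sum>i\<in>UNIV. a i z * (dir_deriv (axis i 1) \<psi> (fst z) * \<eta> (snd z)))
         - signed_powr \<alpha> (u' z) * (\<psi> (fst z) * dir_deriv 1 \<eta> (snd z)) \<partial>lborel)"
      using brep_integrable_iff(2)[OF Qb] by simp
    have Sm: "(\<lambda>z::(real^'n)\<times>real. f' (fst z) * indicator ?S (snd z)) \<in> borel_measurable borel"
      using f'm unfolding borel_prod[symmetric] by measurable
    have "AE x in lebesgue_on \<Omega>. f x = f' x" using brep_AE[OF f'] by (simp add: AE_lebesgue_on_iff[OF \<Omega>b])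
    from AE_cyl_fst[OF \<Omega>b this, of ?S]
    have "AE z in lborel. z \<in> ?Q \<longrightarrow> f (fst z) = f' (fst z) * indicator ?S (snd z)"
      by eventually_elim auto
    then have "brep ?Q (\<lambda>z. f (fst z)) (\<lambda>z. f' (fst z) * indicator ?S (snd z))"
      using Sm brep_outside[OF f'] by (auto simp: brep_def split: split_indicator)
    from brep_integrable_iff(2)[OF Qb brep_mult_borel[OF this test_fun_measurable[OF \<phi>]]]
    have "(\<integral>z. f (fst z) * \<phi> z \<partial>lebesgue_on ?Q) = (\<integral>z. f' (fst z) * indicator ?S (snd z) * (\<psi> (fst z) * \<eta> (snd z)) \<partial>lborel)"
      by (simp add: \<phi>_def)
    with 1 uw[OF \<phi>] show "(\<integral>z. (\<Sum>i\<in>UNIV. a i z * (dir_deriv (axis i 1) \<psi> (fst z) * \<eta> (snd z)))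
         - signed_powr \<alpha> (u' z) * (\<psi> (fst z) * dir_deriv 1 \<eta> (snd z)) \<partial>lborel)
      = (\<integral>z. f' (fst z) * indicator ?S (snd z) * (\<psi> (fst z) * \<eta> (snd z)) \<partial>lborel)" by simp
  qed
  have zo: "AE t in lborel. t \<in> ?S \<longrightarrow> (\<lambda>x. slice u t x - slice g t x) \<in> W1p_o p \<Omega>"
    using ug unfolding LpW_o_def bochner_measurable_def by (simp add: AE_lebesgue_on_iff[OF Sb] slice_def)
  have g0: "AE t in lborel. AE x in lborel. g' (x, t) \<ge> 0"
    by (rule AE_lborel_swap[OF brep_nonneg[OF g' assms(22)[unfolded cyl AE_lebesgue_on_iff[OF Qb]]]])
  \<comment> \<open>For a.e. time all slice facts hold simultaneously, and the truncation lemma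
    applies to the slices of \<open>u'\<close> and \<open>g'\<close>.\<close>
  have good: "AE t in lborel. t \<in> ?S \<longrightarrow> (AE x in lborel. u' (x, t) = U t x) \<and>
      (\<forall>i. integrable lborel (\<lambda>x. \<bar>Du i (x, t)\<bar> powr p i)) \<and>
      (\<exists>\<Psi>. (\<forall>k. \<Psi> k \<in> test_fun \<Omega>) \<and> (\<forall>k x. \<bar>\<Psi> k x\<bar> \<le> 1) \<and>
        (AE x in lborel. (\<lambda>k. \<Psi> k x) \<longlonglongrightarrow> testH \<alpha> d (u' (x, t))) \<and>
        (\<forall>i. (\<lambda>k. \<integral>x. \<bar>dir_deriv (axis i 1) (\<Psi> k) x - testH' \<alpha> d (u' (x, t)) * Du i (x, t)\<bar> powr p i \<partial>lborel) \<longlonglongrightarrow> 0))"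
    if d: "d > 0" for d
    using us gs zo g0 uU
  proof eventually_elim
    case (elim t)
    show ?case
    proof
      assume t: "t \<in> ?S"
      have u1: "brep \<Omega> (slice u t) (slice u' t)" "integrable lborel (slice u' t)"
        "\<And>i. has_weak_deriv \<Omega> (axis i 1) (slice u t) (slice (Du i) t)" "\<And>i. integrable lborel (\<lambda>x. \<bar>slice (Du i) t x\<bar> powr p i)"
        using elim(1) t by (auto simp: slice_def)
      have g1: "brep \<Omega> (slice g t) (slice g' t)" "integrable lborel (slice g' t)"
        "\<And>i. has_weak_deriv \<Omega> (axis i 1) (slice g t) (slice (Dg i) t)" "\<And>i. integrable lborel (\<lambda>x. \<bar>slice (Dg i) t x\<bar> powr p i)"
        using elim(2) t by (auto simp: slice_def)
      have sm: "slice (Du i) t \<in> borel_measurable borel" "slice (Dg i) t \<in> borel_measurable borel" for i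
        unfolding slice_def by (rule borel_measurable_slice[OF Dum] borel_measurable_slice[OF Dgm])+
      have s0: "slice (Du i) t x = 0" "slice (Dg i) t x = 0" if "x \<notin> \<Omega>" for i x
        unfolding slice_def using that brep_outside[OF Dub, of "(x, t)"] brep_outside[OF Dgb, of "(x, t)"] by auto
      have sb: "brep \<Omega> (slice (Du i) t) (slice (Du i) t)" "brep \<Omega> (slice (Dg i) t) (slice (Dg i) t)" for i
        using sm s0 by (auto simp: brep_def)
      obtain \<phi> where \<phi>: "\<And>k. \<phi> k \<in> test_fun \<Omega>" "(\<lambda>k. \<integral>x. \<bar>slice u' t x - slice g' t x - \<phi> k x\<bar> \<partial>lborel) \<longlonglongrightarrow> 0"
        "\<And>i. (\<lambda>k. \<integral>x. \<bar>slice (Du i) t x - slice (Dg i) t x - dir_deriv (axis i 1) (\<phi> k) x\<bar> powr p i \<partial>lborel) \<longlonglongrightarrow> 0"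
        using W1p_o_approx[where p=p, OF \<Omega>(1) p u1(1) g1(1) sb u1(3) g1(3)] elim(3) t by blast
      obtain M where M: "\<And>r. \<bar>testH' \<alpha> d r\<bar> \<le> M" using testH'_bounded[OF \<alpha> d] by blast
      have dH: "dir_deriv 1 (testH \<alpha> d) r = testH' \<alpha> d r" for r by (rule dir_deriv_testH[OF \<alpha> d])
      have wdg: "(\<integral>x. slice g' t x * dir_deriv (axis i 1) \<phi> x \<partial>lborel) = - (\<integral>x. slice (Dg i) t x * \<phi> x \<partial>lborel)"
        if "\<phi> \<in> test_fun \<Omega>" for i \<phi>
        by (rule has_weak_deriv_borel[OF \<Omega>(1) g1(1) sb(2) g1(3) axis_1_Basis that])
      have g1n: "AE x in lborel. slice g' t x \<ge> 0" using elim(4) by (simp add: slice_def)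
      have H0: "testH \<alpha> d r = 0" "dir_deriv 1 (testH \<alpha> d) r = 0" if "r \<ge> 0" for r
        using testH_nonneg_arg that by (auto simp: dH)
      have Hb: "\<bar>testH \<alpha> d r\<bar> \<le> 1" "\<bar>dir_deriv 1 (testH \<alpha> d) r\<bar> \<le> M" for r
        using testH_bounds(2)[of d \<alpha> r] d M[of r] by (auto simp: dH)
      have "\<exists>\<Psi>. (\<forall>k. \<Psi> k \<in> test_fun \<Omega>) \<and> (\<forall>k x. \<bar>\<Psi> k x\<bar> \<le> 1) \<and>
        (AE x in lborel. (\<lambda>k. \<Psi> k x) \<longlonglongrightarrow> testH \<alpha> d (slice u' t x)) \<and>
        (\<forall>i. (\<lambda>k. \<integral>x. \<bar>dir_deriv (axis i 1) (\<Psi> k) x - dir_deriv 1 (testH \<alpha> d) (slice u' t x) * slice (Du i) t x\<bar> powr p i \<partial>lborel) \<longlonglongrightarrow> 0)"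
        by (rule truncation_approx[OF \<Omega> p smooth_testH[OF \<alpha> d] H0 Hb u1(2) g1(2) sm(1) u1(4) sm(2) g1(4) s0(2) g1n wdg \<phi>])
      then show "(AE x in lborel. u' (x, t) = U t x) \<and>
      (\<forall>i. integrable lborel (\<lambda>x. \<bar>Du i (x, t)\<bar> powr p i)) \<and>
      (\<exists>\<Psi>. (\<forall>k. \<Psi> k \<in> test_fun \<Omega>) \<and> (\<forall>k x. \<bar>\<Psi> k x\<bar> \<le> 1) \<and>
        (AE x in lborel. (\<lambda>k. \<Psi> k x) \<longlonglongrightarrow> testH \<alpha> d (u' (x, t))) \<and>
        (\<forall>i. (\<lambda>k. \<integral>x. \<bar>dir_deriv (axis i 1) (\<Psi> k) x - testH' \<alpha> d (u' (x, t)) * Du i (x, t)\<bar> powr p i \<partial>lborel) \<longlonglongrightarrow> 0))"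
        using elim(5) t u1(4) by (simp add: dH slice_def)
    qed
  qed
  \<comment> \<open>Nonnegativity is arranged everywhere, not merely a.e., so that iterated powers
    of \<open>c'\<close> multiply their exponents.\<close>
  obtain c' where c': "brep \<Omega> c c'" and c'0: "\<And>x. c' x \<ge> 0"
  proof -
    obtain c1 where c1: "brep \<Omega> c c1" using brep_exists[OF \<Omega>b] assms(11) by (auto simp: Lsp_def)
    have "AE x in lborel. x \<in> \<Omega> \<longrightarrow> c x \<ge> 0" using assms(12) unfolding AE_lebesgue_on_iff[OF \<Omega>b] .
    with brep_AE[OF c1] have "AE x in lborel. x \<in> \<Omega> \<longrightarrow> c x = max 0 (c1 x)" by eventually_elim auto
    then have "brep \<Omega> c (\<lambda>x. max 0 (c1 x))"
      using brep_measurable[OF c1] brep_outside[OF c1] by (auto simp: brep_def)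
    then show thesis by (rule that) simp
  qed
  have c'm: "c' \<in> borel_measurable borel" using c' by (rule brep_measurable)
  have c'i: "integrable lborel (\<lambda>x. \<bar>c' x\<bar>)" using brep_Lsp_iff[OF \<Omega>b c', of 1] assms(11) by simp
  \<comment> \<open>The error bound without its factor |u|. It is integrable by Young's inequality
    and independent of \<open>d\<close>, hence serves as dominating function.\<close>
  define R where "R z = C * (\<Sum>i\<in>UNIV. (c' (fst z) powr ((p i - 1) / p i) * indicator {0<..T} (snd z)) * \<bar>Du i z\<bar>)" for z
  have Ri: "integrable lborel R"
    unfolding R_def[abs_def]
  proof (intro integrable_mult_right Bochner_Integration.integrable_sum)
    fix i
    have m: "(\<lambda>z::(real^'n)\<times>real. c' (fst z) powr ((p i - 1) / p i) * indicator {0<..T} (snd z)) \<in> borel_measurable borel"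
      using c'm unfolding borel_prod[symmetric] by measurable
    have "integrable lborel (\<lambda>z::(real^'n)\<times>real. \<bar>c' (fst z) powr ((p i - 1) / p i) * indicator {0<..T} (snd z)\<bar> powr (p i / (p i - 1)))"
    proof (rule Bochner_Integration.integrable_bound)
      show "integrable lborel (\<lambda>z::(real^'n)\<times>real. \<bar>c' (fst z)\<bar> * indicator {0<..T} (snd z))"
        using integral_prod_indicator(1)[OF c'i, of 0 T] T by simp
      have "\<bar>c' (fst z) powr ((p i - 1) / p i) * indicator {0<..T} (snd z)\<bar> powr (p i / (p i - 1)) = \<bar>c' (fst z)\<bar> * indicator {0<..T} (snd z)" for z :: "(real^'n)\<times>real"
        using p[of i] c'0[of "fst z"] by (auto simp: powr_powr split: split_indicator)
      then show "AE z :: (real^'n)\<times>real in lborel. norm (\<bar>c' (fst z) powr ((p i - 1) / p i) * indicator {0<..T} (snd z)\<bar> powr (p i / (p i - 1)))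
          \<le> norm (\<bar>c' (fst z)\<bar> * indicator {0<..T} (snd z))" by simp
    qed (use m in simp)
    then show "integrable lborel (\<lambda>z. (c' (fst z) powr ((p i - 1) / p i) * indicator {0<..T} (snd z)) * \<bar>Du i z\<bar>)"
      using m Dum[of i] Dui[of i] by (intro Young_integral(1)[OF p]) auto
  qed
  have R0: "R z \<ge> 0" for z using assms(8) unfolding R_def by (intro mult_nonneg_nonneg sum_nonneg) auto
  \<comment> \<open>The factor that multiplies \<open>R\<close> after testing; it carries all
    dependence on \<open>d\<close>.\<close>
  define \<kappa> where "\<kappa> d z = \<bar>u' z\<bar> * testH' \<alpha> d (u' z)" for d z
  have H'm: "testH' \<alpha> d \<in> borel_measurable borel" for d
    unfolding testH'_def[abs_def] eflat_def[abs_def] by measurable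
  have \<kappa>m: "\<kappa> d \<in> borel_measurable borel" for d unfolding \<kappa>_def using u'm H'm by measurable
  have \<kappa>b: "0 \<le> \<kappa> d z" "\<kappa> d z \<le> 2 * \<alpha>" if "d > 0" for d z
    using abs_mult_testH'(1)[OF \<alpha> that] testH'_nonneg[OF \<alpha>] by (auto simp: \<kappa>_def)
  have \<kappa>Ri: "integrable lborel (\<lambda>z. R z * \<kappa> d z)" if "d > 0" for d
    by (rule integrable_mult_bounded[OF Ri _, of _ "2 * \<alpha>"]) (use \<kappa>m \<kappa>b[OF that] in auto)
  define E where "E d t = (\<integral>x. entr d (- signed_powr \<alpha> (U t x)) \<partial>lborel)" for d t
  \<comment> \<open>Since \<open>R\<close> and \<kappa> are nonnegative, the integral may be
    extended from (t1, t2] to the whole cylinder. The bound becomes independent of the two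
    times.\<close>
  have en: "E d t2 - E d t1 \<le> (\<integral>z. R z * \<kappa> d z \<partial>lborel)" if d: "d > 0" and t12: "0 < t1" "t1 < t2" "t2 < T" for d t1 t2
  proof -
    have ei: "integrable lborel (\<lambda>z. a i z * (testH' \<alpha> d (u' z) * Du i z * indicator {t1<..t2} (snd z)))" for i
    proof -
      obtain M where M: "\<And>r. \<bar>testH' \<alpha> d r\<bar> \<le> M" using testH'_bounded[OF \<alpha> d] by blast
      have "integrable lborel (\<lambda>z. a i z * Du i z)" using am Dum ai Dui by (intro Young_integral(1)[OF p]) auto
      moreover have "(\<lambda>z::(real^'n)\<times>real. testH' \<alpha> d (u' z) * indicator {t1<..t2} (snd z)) \<in> borel_measurable borel"
      proof -
        have "(\<lambda>z::(real^'n)\<times>real. indicator {t1<..t2} (snd z) :: real) \<in> borel_measurable borel"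
          unfolding borel_prod[symmetric] by measurable
        then show ?thesis using u'm H'm by measurable
      qed
      moreover have "\<bar>testH' \<alpha> d (u' z) * indicator {t1<..t2} (snd z)\<bar> \<le> M" for z :: "(real^'n)\<times>real"
        using M[of "u' z"] by (auto split: split_indicator)
      ultimately have "integrable lborel (\<lambda>z. (a i z * Du i z) * (testH' \<alpha> d (u' z) * indicator {t1<..t2} (snd z)))"
        by (intro integrable_mult_bounded[where B=M and f="\<lambda>z. a i z * Du i z"
              and g="\<lambda>z. testH' \<alpha> d (u' z) * indicator {t1<..t2} (snd z)"]) simp_all
      then show ?thesis by (simp add: mult_ac)
    qed
    have "E d t2 - E d t1 \<le> - (\<Sum>i\<in>UNIV. \<integral>z. a i z * (testH' \<alpha> d (u' z) * Du i z * indicator {t1<..t2} (snd z)) \<partial>lborel)"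
      unfolding E_def by (rule energy_inequality[OF p \<alpha> d am ai Dum Dui u'm wi Um wcS fi f0 eq good[OF d] t12])
    also have "\<dots> = (\<integral>z. - (\<Sum>i\<in>UNIV. a i z * (testH' \<alpha> d (u' z) * Du i z * indicator {t1<..t2} (snd z))) \<partial>lborel)"
      using ei by (simp add: Bochner_Integration.integral_sum)
    also have "\<dots> \<le> (\<integral>z. R z * \<kappa> d z \<partial>lborel)"
    proof (rule integral_mono_AE)
      show "integrable lborel (\<lambda>z. - (\<Sum>i\<in>UNIV. a i z * (testH' \<alpha> d (u' z) * Du i z * indicator {t1<..t2} (snd z))))"
        using ei by (intro integrable_minus Bochner_Integration.integrable_sum)
      show "integrable lborel (\<lambda>z. R z * \<kappa> d z)" by (rule \<kappa>Ri[OF d])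
      show "AE z in lborel. - (\<Sum>i\<in>UNIV. a i z * (testH' \<alpha> d (u' z) * Du i z * indicator {t1<..t2} (snd z))) \<le> R z * \<kappa> d z"
        using flux_sign[OF \<Omega>b lipschitz monotone assms(16) c' a]
      proof eventually_elim
        case (elim z)
        show ?case
        proof (cases "z \<in> ?Q \<and> snd z \<in> {t1<..t2}")
          case True
          have Rz: "R z = C * (\<Sum>i\<in>UNIV. c' (fst z) powr ((p i - 1) / p i) * \<bar>Du i z\<bar>)"
            using True by (cases z) (auto simp: R_def)
          have "- (\<Sum>i\<in>UNIV. a i z * Du i z) \<le> \<bar>u' z\<bar> * R z" using elim True Rz by auto
          then have "testH' \<alpha> d (u' z) * - (\<Sum>i\<in>UNIV. a i z * Du i z) \<le> testH' \<alpha> d (u' z) * (\<bar>u' z\<bar> * R z)"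
            by (rule mult_left_mono[OF _ testH'_nonneg[OF \<alpha>]])
          moreover have "(\<Sum>i\<in>UNIV. a i z * (testH' \<alpha> d (u' z) * Du i z * indicator {t1<..t2} (snd z))) = testH' \<alpha> d (u' z) * (\<Sum>i\<in>UNIV. a i z * Du i z)"
            using True unfolding sum_distrib_left by (intro sum.cong) auto
          ultimately show ?thesis by (simp add: \<kappa>_def mult_ac)
        next
          case False
          have "(\<Sum>i\<in>UNIV. a i z * (testH' \<alpha> d (u' z) * Du i z * indicator {t1<..t2} (snd z))) = 0"
            using False brep_outside[OF a, of z] by (intro sum.neutral) auto
          then show ?thesis using R0[of z] \<kappa>b(1)[OF d, of z] by simp
        qed
      qed
    qed
    finally show ?thesis .
  qed
  \<comment> \<open>The left endpoint tends to 0. \<open>entr\<close> vanishes on the nonnegative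
    initial value and is 1-Lipschitz, so the entropy at a small time is at most the L^1 distance to
    the initial signed power.\<close>
  have E_le: "E d t \<le> (\<integral>z. R z * \<kappa> d z \<partial>lborel)" if d: "d > 0" and t: "t \<in> ?S" for d t
  proof (rule field_le_epsilon)
    fix e :: real assume e: "e > 0"
    have "eventually (\<lambda>s. (\<integral>x. \<bar>signed_powr \<alpha> (U s x) - signed_powr \<alpha> (U0 x)\<bar> \<partial>lborel) < e) (at_right 0)"
      using order_tendstoD(2)[OF w0 e] .
    moreover have "eventually (\<lambda>s. s < t) (at_right 0)" using t eventually_at_right_field[of "\<lambda>s. s < t" 0] by auto
    moreover have "eventually (\<lambda>s::real. 0 < s) (at_right 0)" by (rule eventually_at_right_less)
    ultimately have "eventually (\<lambda>s. (\<integral>x. \<bar>signed_powr \<alpha> (U s x) - signed_powr \<alpha> (U0 x)\<bar> \<partial>lborel) < e \<and> s < t \<and> 0 < s) (at_right 0)"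
      by eventually_elim blast
    then obtain s where s: "(\<integral>x. \<bar>signed_powr \<alpha> (U s x) - signed_powr \<alpha> (U0 x)\<bar> \<partial>lborel) < e" "s < t" "0 < s"
      using eventually_happens'[OF trivial_limit_at_right_real[of "0::real"]] by blast
    have em: "entr d \<in> borel_measurable borel" unfolding entr_def[abs_def] by measurable
    have "E d s \<le> (\<integral>x. \<bar>signed_powr \<alpha> (U s x) - signed_powr \<alpha> (U0 x)\<bar> \<partial>lborel)"
      unfolding E_def
    proof (rule integral_mono_AE)
      show "integrable lborel (\<lambda>x. entr d (- signed_powr \<alpha> (U s x)))"
      proof (rule Bochner_Integration.integrable_bound[OF wi[of s]])
        show "(\<lambda>x. entr d (- signed_powr \<alpha> (U s x))) \<in> borel_measurable lborel" using em Um by simp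
        show "AE x in lborel. norm (entr d (- signed_powr \<alpha> (U s x))) \<le> norm (signed_powr \<alpha> (U s x))"
          using entr_Lipschitz[of d _ 0] d by (intro AE_I2) (simp add: entr_def[of d 0], metis abs_minus_cancel)
      qed
      show "integrable lborel (\<lambda>x. \<bar>signed_powr \<alpha> (U s x) - signed_powr \<alpha> (U0 x)\<bar>)" using wi w0i by simp
      show "AE x in lborel. entr d (- signed_powr \<alpha> (U s x)) \<le> \<bar>signed_powr \<alpha> (U s x) - signed_powr \<alpha> (U0 x)\<bar>"
        using U0n
      proof eventually_elim
        case (elim x)
        have "entr d (- signed_powr \<alpha> (U0 x)) = 0" using signed_powr_nonneg[OF elim, of \<alpha>] by (simp add: entr_def)
        then show ?case
          using entr_Lipschitz[of d "- signed_powr \<alpha> (U s x)" "- signed_powr \<alpha> (U0 x)"] d by simp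
      qed
    qed
    with s en[OF d s(3,2)] t show "E d t \<le> (\<integral>z. R z * \<kappa> d z \<partial>lborel) + e" by auto
  qed
  define d where "d n = inverse (real (Suc n))" for n
  have d: "d n > 0" for n by (simp add: d_def)
  \<comment> \<open>The domination by 2 \<alpha> R rests on the bound for |r| H'(r) that is uniform
    in \<open>d\<close>.\<close>
  have "(\<lambda>n. \<integral>z. R z * \<kappa> (d n) z \<partial>lborel) \<longlonglongrightarrow> (\<integral>z. 0 \<partial>(lborel :: ((real^'n) \<times> real) measure))"
  proof (rule integral_dominated_convergence[where w="\<lambda>z. 2 * \<alpha> * R z"])
    show "AE z in lborel. (\<lambda>n. R z * \<kappa> (d n) z) \<longlonglongrightarrow> 0"
      unfolding \<kappa>_def d_def using tendsto_mult[OF tendsto_const abs_mult_testH'_tendsto[OF \<alpha>]] by (intro AE_I2) fastforce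
    show "AE z in lborel. norm (R z * \<kappa> (d n) z) \<le> 2 * \<alpha> * R z" for n
    proof (rule AE_I2)
      fix z
      have "R z * \<kappa> (d n) z \<le> R z * (2 * \<alpha>)" by (intro mult_left_mono R0 \<kappa>b(2)[OF d])
      then show "norm (R z * \<kappa> (d n) z) \<le> 2 * \<alpha> * R z"
        using R0[of z] \<kappa>b(1)[OF d[of n], of z] by (simp add: abs_mult mult.commute)
    qed
    show "(\<lambda>z. R z * \<kappa> (d n) z) \<in> borel_measurable lborel" for n using \<kappa>Ri[OF d[of n]] by auto
  qed (use Ri in auto)
  then have Rlim: "(\<lambda>n. \<integral>z. R z * \<kappa> (d n) z \<partial>lborel) \<longlonglongrightarrow> 0" by simp
  \<comment> \<open>As \<open>d\<close> tends to 0, the entropy tends to the integral of the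
    negative part of the signed power, which is therefore at most 0.\<close>
  have pos: "AE x in lborel. U t x \<ge> 0" if t: "t \<in> ?S" for t
  proof -
    have em: "entr d \<in> borel_measurable borel" for d unfolding entr_def[abs_def] by measurable
    have mi: "integrable lborel (\<lambda>x. max 0 (- signed_powr \<alpha> (U t x)))" using wi[of t] by (intro integrable_max) auto
    have "(\<lambda>n. E (d n) t) \<longlonglongrightarrow> (\<integral>x. max 0 (- signed_powr \<alpha> (U t x)) \<partial>lborel)"
      unfolding E_def
    proof (rule integral_dominated_convergence[OF _ _ mi])
      show "(\<lambda>x. entr (d n) (- signed_powr \<alpha> (U t x))) \<in> borel_measurable lborel" for n using em Um by simp
      show "AE x in lborel. (\<lambda>n. entr (d n) (- signed_powr \<alpha> (U t x))) \<longlonglongrightarrow> max 0 (- signed_powr \<alpha> (U t x))"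
        unfolding d_def by (intro AE_I2 entr_tendsto)
      show "AE x in lborel. norm (entr (d n) (- signed_powr \<alpha> (U t x))) \<le> max 0 (- signed_powr \<alpha> (U t x))" for n
        using entr_le[of "d n"] entr_nonneg[of "d n"] d[of n] by (intro AE_I2) (simp add: less_imp_le)
    qed (use Um in auto)
    then have "(\<integral>x. max 0 (- signed_powr \<alpha> (U t x)) \<partial>lborel) \<le> 0"
      using Rlim by (rule LIMSEQ_le) (use E_le[OF d t] in auto)
    moreover have "(\<integral>x. max 0 (- signed_powr \<alpha> (U t x)) \<partial>lborel) \<ge> 0" by simp
    ultimately have "(\<integral>x. max 0 (- signed_powr \<alpha> (U t x)) \<partial>lborel) = 0" by simp
    then have "AE x in lborel. max 0 (- signed_powr \<alpha> (U t x)) = 0"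
      by (subst (asm) integral_nonneg_eq_0_iff_AE[OF mi]) auto
    then show ?thesis
    proof eventually_elim
      case (elim x)
      show ?case
      proof (rule ccontr)
        assume "\<not> U t x \<ge> 0"
        then have "(- U t x) powr \<alpha> > 0" "- signed_powr \<alpha> (U t x) = (- U t x) powr \<alpha>" by (auto simp: signed_powr_neg)
        with elim show False by (simp add: max_def split: if_splits)
      qed
    qed
  qed
  \<comment> \<open>Back from the slices at single times to the jointly measurable representative,
    whose sign set is Borel, as required for passing to a.e. space-time point.\<close>
  have "AE t in lborel. AE x in lborel. u' (x, t) \<ge> 0"
    using uU
  proof eventually_elim
    case (elim t)
    show ?case
    proof (cases "t \<in> ?S")
      case True
      with elim have "AE x in lborel. u' (x, t) = U t x" by blast
      with pos[OF True] show ?thesis by eventually_elim simp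
    next
      case False
      then show ?thesis using u'0[OF False] by simp
    qed
  qed
  moreover have "{z. u' z \<ge> 0} \<in> sets borel"
  proof -
    have "{z \<in> space borel. u' z \<ge> 0} \<in> sets borel" using u'm by measurable
    then show ?thesis by simp
  qed
  ultimately have "AE z in lborel. u' z \<ge> 0" by (intro AE_lborel_prodI)
  with brep_AE[OF u'] show ?thesis
    unfolding cyl AE_lebesgue_on_iff[OF Qb] by eventually_elim auto
qed

end
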